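(* Let $\alpha\in(0,1)$, let $L$ be a slowly varying function, let $K(n)=L(n)/n^{1+\alpha}$ ($n\ge 1$) satisfy $\Sigma_K:=\sum_{n\ge 1}K(n)\le 1$, put $K(\infty)=1-\Sigma_K$ and $\beta_c=-\log \Sigma_K$, and let $\varepsilon\in\mathbf{R}$. Let $\mathbf{P}_{N,\beta}$ be the homogeneous pinning law built from the renewal process with inter-arrival law $K$, let $\tau_{(N)}=(\tau\cap[0,N])/N$, and let $(b_n)$, $(\tilde b_n)$, $\mathcal{A}_\alpha$, $L^{(\alpha)}_1$ be as defined in the context. Convergence in law $\Rightarrow$ is for random elements of the space $\mathcal{F}$ of closed subsets of $[0,1]$, as $N\to\infty$. (1) If $K(\infty)=0$ and, for each $N$, $\tau$ is distributed according to $\mathbf{P}_{N,\beta_c+\varepsilon/b_N}$, then $$\tau_{(N)}\Rightarrow \mathcal{B}_{\alpha,\varepsilon},$$ where $\mathcal{B}_{\alpha,\varepsilon}\subset[0,1]$ is the random closed set whose law is absolutely continuous with respect to the law of $\mathcal{A}_\alpha\cap[0,1]$ with Radon-Nikodym density $$\frac{\exp(\varepsilon L^{(\alpha)}_1)}{\mathbf{E}[\exp(\varepsilon L^{(\alpha)}_1)]}.$$ (2) If $K(\infty)>0$ and, for each $N$, $\tau$ is distributed according to $\mathbf{P}_{N,\beta_c+\varepsilon/\tilde b_N}$, then $$\tau_{(N)}\Rightarrow \tilde{\mathcal{B}}_{\alpha,\varepsilon},$$ where $\tilde{\mathcal{B}}_{\alpha,\varepsilon}\subset[0,1]$ is the random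 closed set whose law is absolutely continuous with respect to the law of $\mathcal{A}_\alpha\cap[0,1]$ with Radon-Nikodym density $$\frac{\exp(\varepsilon L^{(\alpha)}_1)\,\bigl(1-\max(\mathcal{A}_\alpha\cap[0,1])\bigr)^{\alpha}}{\mathbf{E}\bigl[\exp(\varepsilon L^{(\alpha)}_1)\,(1-\max(\mathcal{A}_\alpha\cap[0,1]))^{\alpha}\bigr]}.$$
   Context: **Renewal process.** A positive measurable function $L$ on $(0,\infty)$ is slowly varying if $L(cx)/L(x)\to 1$ as $x\to\infty$ for every $c>0$. Let $(l_i)_{i\ge1}$ be iid with values in $\{1,2,\dots\}\cup\{\infty\}$, $\mathbf{P}(l_1=n)=K(n)=L(n)/n^{1+\alpha}$ for $n\ge1$ and $\mathbf{P}(l_1=\infty)=K(\infty)=1-\Sigma_K$. Set $\tau_0=0$, $\tau_k=\sum_{i=1}^k l_i$, and identify $\tau$ with the set $\{\tau_0,\tau_1,\dots\}$. Write $\overline K(N)=\sum_{n>N}K(n)$ (sum over finite $n$). **Pinning law.** For $\beta\in\mathbf{R}$, $\frac{d\mathbf{P}_{N,\beta}}{d\mathbf{P}}(\tau)=\frac{1}{Z_{N,\beta}}\exp(\beta\,\mathcal{N}_N(\tau))$, where $\mathcal{N}_N(\tau)$ is the cardinality of $\tau\cap[0,N]$ and $Z_{N,\beta}=\mathbf{E}[\exp(\beta \mathcal{N}_N(\tau))]$. **Rescaled set and topology.** $\tau_{(N)}=(\tau\cap[0,N])/N\subset[0,1]$. $\mathcal{F}$ is the set of closed subsets of $[0,1]$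 with the Matheron topology; on non-empty sets this is the topology of the Hausdorff metric $\rho(F_1,F_2)=\max\{\sup_{t\in F_1}\inf_{s\in F_2}|t-s|,\ \sup_{t\in F_2}\inf_{s\in F_1}|t-s|\}$. **Stable subordinator, regenerative set, local time.** $(\sigma^{(\alpha)}_s)_{s\ge0}$ is the $\alpha$-stable subordinator: the non-decreasing Lévy process with $\mathbf{E}[e^{-\lambda\sigma^{(\alpha)}_s}]=e^{-s\lambda^\alpha}$ for $\lambda>0$. $\mathcal{A}_\alpha=\overline{\{\sigma^{(\alpha)}_s:\ s\ge0\}}$ (closure), and $L^{(\alpha)}_t=\inf\{s\ge0:\ \sigma^{(\alpha)}_s\ge t\}$. To say that a random closed set $\mathcal{B}\subset[0,1]$ has density $D$ (a nonnegative random variable defined from $\sigma^{(\alpha)}$ with $\mathbf{E}[D]=1$) with respect to the law of $\mathcal{A}_\alpha\cap[0,1]$ means $\mathbf{E}[F(\mathcal{B})]=\mathbf{E}[F(\mathcal{A}_\alpha\cap[0,1])\,D]$ for all bounded measurable $F:\mathcal{F}\to\mathbf{R}$. **Normalizing sequences.** When $K(\infty)=0$: $(a_n)$ is a positive sequence with $a_n\to\infty$ and $\frac{n\Gamma(1-\alpha)L(a_n)}{\alpha a_n^\alpha}\to1$, and $(b_n)$ is its asymptotic inverse, i.e. the positive sequence, unique up to asymptotic equivalence, with $a_{[b_n]}\sim b_{[a_n]}\sim n$; equivalently $b_n\sim(\Gamma(1-\alpha)\overline K(n))^{-1}$. ($[x]$ is the integer part; $u_n\sim v_n$ means $u_n/v_n\to1$.)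 When $K(\infty)>0$: let $\tilde K(n)=e^{\beta_c}K(n)=K(n)/\Sigma_K$; $(\tilde a_n)$ and $(\tilde b_n)$ are defined in the same way from $\tilde K$ (that is, with $L$ replaced by $L/\Sigma_K$), so $\tilde b_n\sim(\Gamma(1-\alpha)\sum_{j>n}\tilde K(j))^{-1}$. *)

theory Defs
  imports "HOL-Probability.Probability" "HOL-Library.Landau_Symbols" "HOL-Library.Extended_Nat"
begin

section \<open>Slowly varying functions and normalizing sequences\<close>

definition slowly_varying :: "(real \<Rightarrow> real) \<Rightarrow> bool" where
  "slowly_varying L \<longleftrightarrow>
     L \<in> borel_measurable (restrict_space borel {0<..}) \<and>
     (\<forall>x>0. L x > 0) \<and>
     (\<forall>c>0. ((\<lambda>x. L (c * x) / L x) \<longlongrightarrow> 1) at_top)"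

definition normalizing_seq :: "real \<Rightarrow> (real \<Rightarrow> real) \<Rightarrow> (nat \<Rightarrow> real) \<Rightarrow> bool" where
  "normalizing_seq \<alpha> L a \<longleftrightarrow>
     (\<forall>n\<ge>1. a n > 0) \<and> filterlim a at_top sequentially \<and>
     (\<lambda>n. real n * Gamma (1 - \<alpha>) * L (a n) / (\<alpha> * a n powr \<alpha>)) \<longlonglongrightarrow> 1"

text \<open>Truncation at \<open>0\<close> by \<open>nat\<close> is harmless: the sequences are positive from index \<open>1\<close> on.\<close>

definition asymptotic_inverse :: "(nat \<Rightarrow> real) \<Rightarrow> (nat \<Rightarrow> real) \<Rightarrow> bool" where
  "asymptotic_inverse a b \<longleftrightarrow>
     (\<forall>n\<ge>1. b n > 0) \<and>
     (\<lambda>n. a (nat \<lfloor>b n\<rfloor>)) \<sim>[sequentially] real \<and>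
     (\<lambda>n. b (nat \<lfloor>a n\<rfloor>)) \<sim>[sequentially] real"

section \<open>Renewal processes and the pinning law\<close>

text \<open>An inter-arrival kernel is a function on \<open>nat\<close> whose value at \<open>0\<close> is irrelevant.\<close>

definition kernel_mass :: "(nat \<Rightarrow> real) \<Rightarrow> real" where
  "kernel_mass K = (\<Sum>n. K (Suc n))"

definition critical_beta :: "(nat \<Rightarrow> real) \<Rightarrow> real" where
  "critical_beta K = - ln (kernel_mass K)"

text \<open>The inter-arrival times are \<open>l 1, l 2, \<dots>\<close>; \<open>l 0\<close> is not used.\<close>

definition renewal_increments ::
    "'a measure \<Rightarrow> (nat \<Rightarrow> 'a \<Rightarrow> enat) \<Rightarrow> (nat \<Rightarrow> real) \<Rightarrow> bool" where
  "renewal_increments P l K \<longleftrightarrow>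
     prob_space P \<and>
     prob_space.indep_vars P (\<lambda>_. count_space UNIV) l {1..} \<and>
     (\<forall>i\<ge>1. \<forall>\<omega>\<in>space P. l i \<omega> \<noteq> 0) \<and>
     (\<forall>i\<ge>1. \<forall>n\<ge>1. measure P {\<omega>\<in>space P. l i \<omega> = enat n} = K n) \<and>
     (\<forall>i\<ge>1. measure P {\<omega>\<in>space P. l i \<omega> = \<infinity>} = 1 - kernel_mass K)"

definition renewal_set :: "(nat \<Rightarrow> 'a \<Rightarrow> enat) \<Rightarrow> 'a \<Rightarrow> enat set" where
  "renewal_set l \<omega> = range (\<lambda>k. \<Sum>i=1..k. l i \<omega>)"

definition renewals_upto :: "nat \<Rightarrow> enat set \<Rightarrow> nat set" where
  "renewals_upto N T = {n. n \<le> N \<and> enat n \<in> T}"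

definition rescaled_set :: "nat \<Rightarrow> enat set \<Rightarrow> real set" where
  "rescaled_set N T = (\<lambda>n. real n / real N) ` renewals_upto N T"

definition partition_function ::
    "'a measure \<Rightarrow> ('a \<Rightarrow> enat set) \<Rightarrow> nat \<Rightarrow> real \<Rightarrow> real" where
  "partition_function P \<tau> N \<beta> =
     (\<integral>\<omega>. exp (\<beta> * real (card (renewals_upto N (\<tau> \<omega>)))) \<partial>P)"

definition pinning_law ::
    "'a measure \<Rightarrow> ('a \<Rightarrow> enat set) \<Rightarrow> nat \<Rightarrow> real \<Rightarrow> 'a measure" where
  "pinning_law P \<tau> N \<beta> = density P
     (\<lambda>\<omega>. ennreal (exp (\<beta> * real (card (renewals_upto N (\<tau> \<omega>)))) / partition_function P \<tau> N \<beta>))"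

section \<open>Random closed subsets of the unit interval\<close>

text \<open>The Matheron (hit-or-miss) topology. Intersecting with \<open>{0..1}\<close>, one gets the same sets
  from open and compact subsets of \<open>{0..1}\<close> as from open and compact sets of reals.\<close>

definition closed_unit_sets :: "real set set" where
  "closed_unit_sets = {F. closed F \<and> F \<subseteq> {0..1}}"

definition matheron :: "real set topology" where
  "matheron = topology_generated_by
     ({{F \<in> closed_unit_sets. F \<inter> G \<noteq> {}} | G. open G} \<union>
      {{F \<in> closed_unit_sets. F \<inter> C = {}} | C. compact C})"

lemma topspace_matheron: "topspace matheron = closed_unit_sets"
proof -
  have "closed_unit_sets \<in> {{F \<in> closed_unit_sets. F \<inter> C = {}} | C. compact C}"
    by (intro CollectI exI[of _ "{}"]) auto
  then show ?thesis
    unfolding matheron_def topology_generated_by_topspace by blast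
qed

definition borel_of_topology :: "'c topology \<Rightarrow> 'c measure" where
  "borel_of_topology T = sigma (topspace T) {U. openin T U}"

text \<open>Weak convergence of laws on a topological space, i.e. convergence in law of random elements
  with these laws.\<close>

definition weakly_converges :: "'c topology \<Rightarrow> (nat \<Rightarrow> 'c measure) \<Rightarrow> 'c measure \<Rightarrow> bool" where
  "weakly_converges T \<mu>s \<mu> \<longleftrightarrow>
     (\<forall>n. prob_space (\<mu>s n) \<and> sets (\<mu>s n) = sets (borel_of_topology T)) \<and>
     prob_space \<mu> \<and> sets \<mu> = sets (borel_of_topology T) \<and>
     (\<forall>f. continuous_map T euclideanreal f \<and> bounded (f ` topspace T) \<longrightarrow>
        (\<lambda>n. \<integral>F. f F \<partial>\<mu>s n) \<longlonglongrightarrow> (\<integral>F. f F \<partial>\<mu>))"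

text \<open>The law of \<open>rescaled_set N \<tau>\<close> when \<open>\<tau>\<close> is distributed according to the pinning law.\<close>

definition rescaled_pinning_law ::
    "'a measure \<Rightarrow> ('a \<Rightarrow> enat set) \<Rightarrow> nat \<Rightarrow> real \<Rightarrow> real set measure" where
  "rescaled_pinning_law P \<tau> N \<beta> =
     distr (pinning_law P \<tau> N \<beta>) (borel_of_topology matheron) (\<lambda>\<omega>. rescaled_set N (\<tau> \<omega>))"

text \<open>\<open>\<mu>\<close> is the law of a random closed set having density \<open>D\<close> with respect to the law of the
  random closed set \<open>A\<close>, where \<open>A\<close> and \<open>D\<close> live on the same probability space \<open>M\<close>.\<close>

definition law_with_density ::
    "'b measure \<Rightarrow> ('b \<Rightarrow> real set) \<Rightarrow> ('b \<Rightarrow> real) \<Rightarrow> real set measure \<Rightarrow> bool" where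
  "law_with_density M A D \<mu> \<longleftrightarrow>
     A \<in> measurable M (borel_of_topology matheron) \<and>
     D \<in> borel_measurable M \<and> (\<forall>\<omega>\<in>space M. D \<omega> \<ge> 0) \<and>
     integrable M D \<and> (\<integral>\<omega>. D \<omega> \<partial>M) = 1 \<and>
     prob_space \<mu> \<and> sets \<mu> = sets (borel_of_topology matheron) \<and>
     (\<forall>f\<in>borel_measurable (borel_of_topology matheron). bounded (f ` closed_unit_sets) \<longrightarrow>
        (\<integral>F. f F \<partial>\<mu>) = (\<integral>\<omega>. f (A \<omega>) * D \<omega> \<partial>M))"

section \<open>Stable subordinator, regenerative set, local time\<close>

text \<open>Processes are indexed by all reals, but only nonnegative times matter. Paths are required
  to be right-continuous with left limits, and to start at \<open>0\<close>, for every \<open>\<omega>\<close>; since the space is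
  not assumed complete, this makes functionals of the whole path measurable. Stochastic
  continuity follows from right-continuity and stationarity of the increments.\<close>

definition levy_process :: "'b measure \<Rightarrow> (real \<Rightarrow> 'b \<Rightarrow> real) \<Rightarrow> bool" where
  "levy_process M X \<longleftrightarrow>
     prob_space M \<and>
     (\<forall>s\<ge>0. X s \<in> borel_measurable M) \<and>
     (\<forall>\<omega>\<in>space M. X 0 \<omega> = 0) \<and>
     (\<forall>\<omega>\<in>space M. \<forall>s\<ge>0. continuous (at_right s) (\<lambda>u. X u \<omega>)) \<and>
     (\<forall>\<omega>\<in>space M. \<forall>s>0. \<exists>x. ((\<lambda>u. X u \<omega>) \<longlongrightarrow> x) (at_left s)) \<and>
     (\<forall>(t::nat \<Rightarrow> real) n. 0 \<le> t 0 \<and> mono t \<longrightarrow>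
        prob_space.indep_vars M (\<lambda>_. borel) (\<lambda>i \<omega>. X (t (Suc i)) \<omega> - X (t i) \<omega>) {..<n}) \<and>
     (\<forall>s\<ge>0. \<forall>h\<ge>0. distr M borel (\<lambda>\<omega>. X (s + h) \<omega> - X s \<omega>) = distr M borel (X h))"

definition stable_subordinator :: "real \<Rightarrow> 'b measure \<Rightarrow> (real \<Rightarrow> 'b \<Rightarrow> real) \<Rightarrow> bool" where
  "stable_subordinator \<alpha> M \<sigma> \<longleftrightarrow>
     levy_process M \<sigma> \<and>
     (\<forall>\<omega>\<in>space M. mono_on {0..} (\<lambda>s. \<sigma> s \<omega>)) \<and>
     (\<forall>s\<ge>0. \<forall>r>0. (\<integral>\<omega>. exp (- r * \<sigma> s \<omega>) \<partial>M) = exp (- s * r powr \<alpha>))"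

definition regenerative_set :: "(real \<Rightarrow> 'b \<Rightarrow> real) \<Rightarrow> 'b \<Rightarrow> real set" where
  "regenerative_set \<sigma> \<omega> = closure {\<sigma> s \<omega> | s. s \<ge> 0}"

definition local_time :: "(real \<Rightarrow> 'b \<Rightarrow> real) \<Rightarrow> real \<Rightarrow> 'b \<Rightarrow> real" where
  "local_time \<sigma> t \<omega> = Inf {s. s \<ge> 0 \<and> \<sigma> s \<omega> \<ge> t}"

text \<open>The maximum of the regenerative set in the unit interval. That set is compact and contains
  \<open>0\<close>, so its supremum is attained (\<open>Max\<close> is only meaningful for finite sets).\<close>

definition last_point :: "(real \<Rightarrow> 'b \<Rightarrow> real) \<Rightarrow> 'b \<Rightarrow> real" where
  "last_point \<sigma> \<omega> = Sup (regenerative_set \<sigma> \<omega> \<inter> {0..1})"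

end

(* Pinning reweights the renewal process by exp (\<beta> card). Passing to the critical kernel K / \<Sigma>_K turns this
   into a reweighting by exp (\<epsilon> card / b_N) times the ratio of the tails of K and K / \<Sigma>_K at the distance
   from the last renewal to N; by regular variation the latter converges uniformly.

   It remains to pass to the limit in E [f (trace) exp (\<epsilon> visits / b_n)] for random walks with iid
   positive steps whose Laplace transforms satisfy b_n (1 - lap_n r) \<longlonglongrightarrow> r^\<alpha>. The limit is shown to
   depend on the array of step laws only through \<alpha>: expectations of exp (sum of \<theta> over the visited points)
   solve Volterra equations whose kernels converge, and f of the trace is approximated by polynomials in
   such exponentials after a Poissonian sampling of the cells of a grid. Sampling the stable subordinator at times
   k/n gives another such array, for which the limit can be read off the path. *)

theory Submission imports Defs begin

section \<open>Random walks with positive steps\<close>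

definition pos :: "nat \<Rightarrow> (nat \<Rightarrow> real) \<Rightarrow> real" where
  "pos j \<omega> = (\<Sum>i<j. \<bar>\<omega> i\<bar>)"

definition seq_shift :: "nat \<Rightarrow> (nat \<Rightarrow> 'a) \<Rightarrow> nat \<Rightarrow> 'a" where
  "seq_shift j \<omega> = (\<lambda>i. \<omega> (i + j))"

definition visits :: "real \<Rightarrow> (nat \<Rightarrow> real) \<Rightarrow> nat" where
  "visits R \<omega> = card {j. pos j \<omega> \<le> R}"

lemma pos_0 [simp]: "pos 0 \<omega> = 0"
  by (simp add: pos_def)

lemma pos_nonneg [simp]: "0 \<le> pos j \<omega>"
  by (simp add: pos_def sum_nonneg)

lemma pos_mono: "i \<le> j \<Longrightarrow> pos i \<omega> \<le> pos j \<omega>"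
  unfolding pos_def by (intro sum_mono2) auto

lemma pos_add: "pos (i + j) \<omega> = pos j \<omega> + pos i (seq_shift j \<omega>)"
proof (induction i)
  case (Suc i)
  then show ?case by (simp add: pos_def seq_shift_def)
qed simp

lemma pos_comb_seq: "i \<le> j \<Longrightarrow> pos i (comb_seq j \<omega> \<omega>') = pos i \<omega>"
  unfolding pos_def by (intro sum.cong) (auto simp: comb_seq_less)

lemma seq_shift_comb_seq [simp]: "seq_shift j (comb_seq j \<omega> \<omega>') = \<omega>'"
  by (simp add: seq_shift_def comb_seq_add)

lemma visited_indices_eq:
  assumes "finite {j. pos j \<omega> \<le> R}"
  shows "{j. pos j \<omega> \<le> R} = {..<visits R \<omega>}"
proof -
  let ?J = "{j. pos j \<omega> \<le> R}"
  have down: "i \<in> ?J" if "j \<in> ?J" "i \<le> j" for i j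
    using that pos_mono[of i j \<omega>] by auto
  have "\<exists>n. ?J = {..<n}"
  proof (cases "?J = {}")
    case False
    then have "j \<in> ?J \<longleftrightarrow> j \<in> {..<Suc (Max ?J)}" for j
      using down[OF Max_in[OF assms False]] Max_ge[OF assms] by (metis lessThan_iff less_Suc_eq_le)
    then have "?J = {..<Suc (Max ?J)}"
      by blast
    then show ?thesis by blast
  qed auto
  then obtain n where n: "?J = {..<n}" by blast
  then show ?thesis by (simp add: visits_def)
qed

lemma sum_geometric_telescope: "(\<Sum>j<n. (exp c - 1) * exp (c * real j)) = exp (c * real n) - 1"
  by (induction n) (simp_all add: algebra_simps exp_add)

locale iid_steps = sequence_space \<mu> for \<mu> :: "real measure" +
  assumes sets_step [measurable_cong]: "sets \<mu> = sets borel"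
begin

definition lap :: "real \<Rightarrow> real" where
  "lap r = (\<integral>x. exp (- r * \<bar>x\<bar>) \<partial>\<mu>)"

lemma measurable_component [measurable]: "(\<lambda>\<omega>. \<omega> i) \<in> borel_measurable S"
proof -
  have "(\<lambda>\<omega>. \<omega> i) \<in> measurable S \<mu>" by measurable
  then show ?thesis by (simp add: measurable_cong_sets[OF refl sets_step])
qed

lemma measurable_pos [measurable]: "pos j \<in> borel_measurable S"
  unfolding pos_def[abs_def] by measurable

lemma measurable_seq_shift [measurable]: "seq_shift j \<in> measurable S S"
  unfolding seq_shift_def[abs_def] by (rule measurable_PiM_single') (auto simp: space_PiM)

lemma distr_seq_shift:
  assumes [measurable]: "X \<in> measurable S N"
    and X: "\<And>\<omega> \<omega>'. X (comb_seq j \<omega> \<omega>') = X \<omega>"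
  shows "distr S (N \<Otimes>\<^sub>M S) (\<lambda>\<omega>. (X \<omega>, seq_shift j \<omega>)) =
         distr (S \<Otimes>\<^sub>M S) (N \<Otimes>\<^sub>M S) (\<lambda>(\<omega>, \<omega>'). (X \<omega>, \<omega>'))"
proof -
  have "distr S (N \<Otimes>\<^sub>M S) (\<lambda>\<omega>. (X \<omega>, seq_shift j \<omega>)) =
      distr (distr (S \<Otimes>\<^sub>M S) S (\<lambda>(\<omega>, \<omega>'). comb_seq j \<omega> \<omega>')) (N \<Otimes>\<^sub>M S) (\<lambda>\<omega>. (X \<omega>, seq_shift j \<omega>))"
    by (simp add: PiM_comb_seq)
  also have "\<dots> = distr (S \<Otimes>\<^sub>M S) (N \<Otimes>\<^sub>M S) (\<lambda>(\<omega>, \<omega>'). (X \<omega>, \<omega>'))"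
    by (subst distr_distr) (auto intro!: distr_cong simp: X comp_def split_beta)
  finally show ?thesis .
qed

lemma nn_integral_seq_shift:
  assumes [measurable]: "X \<in> measurable S N" "G \<in> borel_measurable (N \<Otimes>\<^sub>M S)"
    and X: "\<And>\<omega> \<omega>'. X (comb_seq j \<omega> \<omega>') = X \<omega>"
  shows "(\<integral>\<^sup>+\<omega>. G (X \<omega>, seq_shift j \<omega>) \<partial>S) = (\<integral>\<^sup>+\<omega>. \<integral>\<^sup>+\<omega>'. G (X \<omega>, \<omega>') \<partial>S \<partial>S)"
proof -
  have "(\<integral>\<^sup>+\<omega>. G (X \<omega>, seq_shift j \<omega>) \<partial>S) = (\<integral>\<^sup>+z. G z \<partial>distr S (N \<Otimes>\<^sub>M S) (\<lambda>\<omega>. (X \<omega>, seq_shift j \<omega>)))"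
    by (subst nn_integral_distr) auto
  also have "\<dots> = (\<integral>\<^sup>+z. G (X (fst z), snd z) \<partial>(S \<Otimes>\<^sub>M S))"
    unfolding distr_seq_shift[OF assms(1) X] by (subst nn_integral_distr) (auto simp: split_beta)
  also have "\<dots> = (\<integral>\<^sup>+\<omega>. \<integral>\<^sup>+\<omega>'. G (X \<omega>, \<omega>') \<partial>S \<partial>S)"
    by (subst nn_integral_fst[symmetric]) auto
  finally show ?thesis .
qed

lemma integral_seq_shift:
  fixes G :: "_ \<Rightarrow> real"
  assumes [measurable]: "X \<in> measurable S N" "G \<in> borel_measurable (N \<Otimes>\<^sub>M S)"
    and X: "\<And>\<omega> \<omega>'. X (comb_seq j \<omega> \<omega>') = X \<omega>"
    and int: "integrable S h" and bound: "\<And>x \<omega>'. norm (G (x, \<omega>')) \<le> h \<omega>'"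
  shows "(\<integral>\<omega>. G (X \<omega>, seq_shift j \<omega>) \<partial>S) = (\<integral>\<omega>. \<integral>\<omega>'. G (X \<omega>, \<omega>') \<partial>S \<partial>S)"
    and "integrable S (\<lambda>\<omega>. G (X \<omega>, seq_shift j \<omega>))"
proof -
  interpret SS: pair_prob_space S S ..
  have bound': "\<bar>G (x, \<omega>')\<bar> \<le> \<bar>h \<omega>'\<bar>" for x \<omega>'
    using bound[of x \<omega>'] by auto
  have intG: "integrable S (\<lambda>\<omega>'. G (X \<omega>, \<omega>'))" if "\<omega> \<in> space S" for \<omega>
    by (rule Bochner_Integration.integrable_bound[OF int])
      (use bound' that in \<open>auto intro!: measurable_Pair2'\<close>)
  have "(\<integral>\<omega>'. norm (G (X \<omega>, \<omega>')) \<partial>S) \<le> (\<integral>\<omega>'. h \<omega>' \<partial>S)" if "\<omega> \<in> space S" for \<omega>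
    using intG[OF that] int bound by (intro integral_mono integrable_norm) auto
  then have int2: "integrable (S \<Otimes>\<^sub>M S) (\<lambda>z. G (X (fst z), snd z))"
    by (intro SS.Fubini_integrable) (auto intro!: P.integrable_const_bound[where B="\<integral>\<omega>'. h \<omega>' \<partial>S"] intG)
  have "(\<integral>\<omega>. G (X \<omega>, seq_shift j \<omega>) \<partial>S) = (\<integral>z. G z \<partial>distr S (N \<Otimes>\<^sub>M S) (\<lambda>\<omega>. (X \<omega>, seq_shift j \<omega>)))"
    by (subst integral_distr) auto
  also have "\<dots> = (\<integral>z. G (X (fst z), snd z) \<partial>(S \<Otimes>\<^sub>M S))"
    unfolding distr_seq_shift[OF assms(1) X] by (subst integral_distr) (auto simp: split_beta)
  also have "\<dots> = (\<integral>\<omega>. \<integral>\<omega>'. G (X \<omega>, \<omega>') \<partial>S \<partial>S)"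
    by (subst SS.integral_fst'[symmetric]) (use int2 in auto)
  finally show "(\<integral>\<omega>. G (X \<omega>, seq_shift j \<omega>) \<partial>S) = (\<integral>\<omega>. \<integral>\<omega>'. G (X \<omega>, \<omega>') \<partial>S \<partial>S)" .
  have "integrable (distr S (N \<Otimes>\<^sub>M S) (\<lambda>\<omega>. (X \<omega>, seq_shift j \<omega>))) G"
    unfolding distr_seq_shift[OF assms(1) X]
    by (subst integrable_distr_eq) (use int2 in \<open>auto simp: split_beta\<close>)
  then show "integrable S (\<lambda>\<omega>. G (X \<omega>, seq_shift j \<omega>))"
    by (subst (asm) integrable_distr_eq) auto
qed

lemma lap_nonneg [simp]: "0 \<le> lap r"
  unfolding lap_def by simp

lemma nn_integral_lap:
  assumes "0 \<le> r"
  shows "(\<integral>\<^sup>+x. ennreal (exp (- r * \<bar>x\<bar>)) \<partial>\<mu>) = ennreal (lap r)"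
proof -
  have "(\<lambda>x. exp (- (r * \<bar>x\<bar>))) \<in> borel_measurable \<mu>"
    by (subst measurable_cong_sets[OF sets_step refl]) measurable
  show ?thesis
    unfolding lap_def using assms \<open>_ \<in> _\<close>
    by (intro nn_integral_eq_integral M.integrable_const_bound[where B=1]) auto
qed

lemma nn_integral_exp_pos:
  assumes "0 \<le> r"
  shows "(\<integral>\<^sup>+\<omega>. ennreal (exp (- r * pos j \<omega>)) \<partial>S) = ennreal (lap r ^ j)"
proof (induction j)
  case 0
  then show ?case by (simp add: P.emeasure_space_1)
next
  case (Suc j)
  have "(\<integral>\<^sup>+\<omega>. ennreal (exp (- r * pos (Suc j) \<omega>)) \<partial>S) =
     (\<integral>\<^sup>+\<omega>. (\<lambda>(p, \<omega>'). ennreal (exp (- r * p)) * ennreal (exp (- r * \<bar>\<omega>' 0\<bar>))) (pos j \<omega>, seq_shift j \<omega>) \<partial>S)"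
    by (intro nn_integral_cong)
      (simp add: pos_def seq_shift_def algebra_simps mult_exp_exp flip: ennreal_mult)
  also have "\<dots> = (\<integral>\<^sup>+\<omega>. \<integral>\<^sup>+\<omega>'. ennreal (exp (- r * pos j \<omega>)) * ennreal (exp (- r * \<bar>\<omega>' 0\<bar>)) \<partial>S \<partial>S)"
    by (subst nn_integral_seq_shift[where N=borel]) (auto simp: pos_comb_seq)
  also have "\<dots> = (\<integral>\<^sup>+\<omega>. ennreal (exp (- r * pos j \<omega>)) \<partial>S) * (\<integral>\<^sup>+\<omega>'. ennreal (exp (- r * \<bar>\<omega>' 0\<bar>)) \<partial>S)"
    by (simp add: nn_integral_cmult nn_integral_multc)
  also have "(\<integral>\<^sup>+\<omega>'. ennreal (exp (- r * \<bar>\<omega>' 0\<bar>)) \<partial>S) = (\<integral>\<^sup>+x. ennreal (exp (- r * \<bar>x\<bar>)) \<partial>distr S \<mu> (\<lambda>\<omega>. \<omega> 0))"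
    by (subst nn_integral_distr) (auto simp: measurable_cong_sets[OF sets_step refl])
  also have "\<dots> = ennreal (lap r)"
    using PiM_component[of 0] nn_integral_lap[OF assms] by simp
  finally show ?case
    unfolding Suc.IH by (simp add: mult.commute flip: ennreal_mult)
qed

lemma integral_exp_pos:
  assumes "0 \<le> r"
  shows "integrable S (\<lambda>\<omega>. exp (- r * pos j \<omega>))" "(\<integral>\<omega>. exp (- r * pos j \<omega>) \<partial>S) = lap r ^ j"
proof -
  show "integrable S (\<lambda>\<omega>. exp (- r * pos j \<omega>))"
    using assms by (intro P.integrable_const_bound[where B=1]) auto
  then show "(\<integral>\<omega>. exp (- r * pos j \<omega>) \<partial>S) = lap r ^ j"
    using nn_integral_exp_pos[OF assms, of j]
    by (subst (asm) nn_integral_eq_integral) auto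
qed

lemma nn_integral_suminf_exp_pos:
  assumes "0 \<le> r" "0 \<le> q" "q * lap r < 1"
  shows "(\<integral>\<^sup>+\<omega>. (\<Sum>j. ennreal (q ^ j * exp (- r * pos j \<omega>))) \<partial>S) = ennreal (1 / (1 - q * lap r))"
proof -
  have *: "(\<integral>\<^sup>+\<omega>. ennreal (q ^ j) * ennreal (exp (- r * pos j \<omega>)) \<partial>S) = ennreal ((q * lap r) ^ j)" for j
    using assms nn_integral_exp_pos[OF assms(1), of j]
    by (subst nn_integral_cmult) (auto simp: power_mult_distrib ennreal_mult)
  have "(\<integral>\<^sup>+\<omega>. (\<Sum>j. ennreal (q ^ j * exp (- r * pos j \<omega>))) \<partial>S) =
      (\<Sum>j. \<integral>\<^sup>+\<omega>. ennreal (q ^ j) * ennreal (exp (- r * pos j \<omega>)) \<partial>S)"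
    using assms by (subst nn_integral_suminf) (auto simp: ennreal_mult)
  also have "\<dots> = (\<Sum>j. ennreal ((q * lap r) ^ j))"
    by (simp only: *)
  also have "\<dots> = ennreal (1 / (1 - q * lap r))"
    using assms geometric_sums[of "q * lap r"]
    by (subst suminf_ennreal2) (auto intro!: summable_geometric simp: sums_unique[symmetric] suminf_geometric)
  finally show ?thesis .
qed

lemma AE_finite_visits:
  assumes "0 < r" "lap r < 1"
  shows "AE \<omega> in S. \<forall>R. finite {j. pos j \<omega> \<le> R}"
proof -
  have "(\<integral>\<^sup>+\<omega>. (\<Sum>j. ennreal (exp (- r * pos j \<omega>))) \<partial>S) \<noteq> \<infinity>"
    using nn_integral_suminf_exp_pos[of r 1] assms(1) assms(2)
    by (simp only: mult_1 power_one zero_le_one less_imp_le[OF assms(1)] simp_thms infinity_ennreal_def ennreal_neq_top not_False_eq_True)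
  then have "AE \<omega> in S. (\<Sum>j. ennreal (exp (- r * pos j \<omega>))) \<noteq> \<infinity>"
    by (intro nn_integral_PInf_AE) auto
  then show ?thesis
  proof eventually_elim
    case (elim \<omega>)
    then have s: "summable (\<lambda>j. exp (- r * pos j \<omega>))"
      by (intro summable_suminf_not_top) auto
    show ?case
    proof
      fix R
      have "eventually (\<lambda>j. exp (- r * pos j \<omega>) < exp (- r * R)) sequentially"
        using summable_LIMSEQ_zero[OF s] by (rule order_tendstoD) simp
      then have "eventually (\<lambda>j. \<not> pos j \<omega> \<le> R) sequentially"
        using assms by (auto elim!: eventually_mono)
      then show "finite {j. pos j \<omega> \<le> R}"
        unfolding eventually_sequentially finite_nat_set_iff_bounded by (metis linorder_not_le mem_Collect_eq)
    qed
  qed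
qed

lemma measurable_visits [measurable]: "visits R \<in> measurable S (count_space UNIV)"
proof -
  have "{\<omega> \<in> space S. j \<in> {j. pos j \<omega> \<le> R}} \<in> sets S" for j
    unfolding mem_Collect_eq by measurable
  then have "(\<lambda>\<omega>. card {j. pos j \<omega> \<le> R}) \<in> measurable S (count_space UNIV)"
    by (rule measurable_card)
  then show ?thesis
    by (simp only: visits_def[abs_def])
qed

lemma nn_integral_exp_visits:
  assumes "0 \<le> r" "0 \<le> c" "exp c * lap r < 1"
  shows "(\<integral>\<^sup>+\<omega>. ennreal (exp (c * visits R \<omega>)) \<partial>S) \<le>
    ennreal (1 + exp (r * R) * (exp c - 1) / (1 - exp c * lap r))"
proof -
  let ?f = "\<lambda>\<omega>. (\<Sum>j. ennreal (exp c ^ j * exp (- r * pos j \<omega>)))"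
  let ?K = "exp (r * R) * (exp c - 1)"
  have K: "?K \<ge> 0" using assms by simp
  have "ennreal (exp (c * visits R \<omega>)) \<le> 1 + ennreal ?K * ?f \<omega>" for \<omega>
  proof (cases "finite {j. pos j \<omega> \<le> R}")
    case False
    then show ?thesis by (simp add: visits_def)
  next
    case True
    define n where "n = visits R \<omega>"
    have n: "pos j \<omega> \<le> R" if "j < n" for j
      using visited_indices_eq[OF True] that by (auto simp: n_def)
    have "exp (c * n) - 1 = (\<Sum>j<n. (exp c - 1) * exp (c * real j))"
      by (rule sum_geometric_telescope[symmetric])
    also have "\<dots> \<le> (\<Sum>j<n. ?K * (exp c ^ j * exp (- r * pos j \<omega>)))"
    proof (rule sum_mono)
      fix j assume "j \<in> {..<n}"
      then have "1 \<le> exp (r * R) * exp (- r * pos j \<omega>)"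
        using n[of j] assms by (simp flip: exp_add) (metis diff_ge_0_iff_ge mult_nonneg_nonneg right_diff_distrib)
      then have "(exp c - 1) * exp (c * real j) * 1 \<le> (exp c - 1) * exp (c * real j) * (exp (r * R) * exp (- r * pos j \<omega>))"
        using assms by (intro mult_left_mono) auto
      then show "(exp c - 1) * exp (c * real j) \<le> ?K * (exp c ^ j * exp (- r * pos j \<omega>))"
        by (simp add: exp_of_nat2_mult mult_ac)
    qed
    finally have "exp (c * n) \<le> 1 + ?K * (\<Sum>j<n. exp c ^ j * exp (- r * pos j \<omega>))"
      by (simp add: sum_distrib_left)
    then have "ennreal (exp (c * n)) \<le> ennreal (1 + ?K * (\<Sum>j<n. exp c ^ j * exp (- r * pos j \<omega>)))"
      by (rule ennreal_leI)
    also have "\<dots> = 1 + ennreal ?K * (\<Sum>j<n. ennreal (exp c ^ j * exp (- r * pos j \<omega>)))"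
      using K by (simp add: ennreal_plus ennreal_mult sum_nonneg sum_ennreal[symmetric] del: sum_ennreal)
    also have "\<dots> \<le> 1 + ennreal ?K * ?f \<omega>"
      by (intro add_mono mult_left_mono sum_le_suminf) auto
    finally show ?thesis by (simp add: n_def)
  qed
  then have "(\<integral>\<^sup>+\<omega>. ennreal (exp (c * visits R \<omega>)) \<partial>S) \<le> (\<integral>\<^sup>+\<omega>. 1 + ennreal ?K * ?f \<omega> \<partial>S)"
    by (intro nn_integral_mono)
  also have "\<dots> = 1 + ennreal ?K * (\<integral>\<^sup>+\<omega>. ?f \<omega> \<partial>S)"
    by (subst nn_integral_add, measurable, subst nn_integral_cmult, measurable) (simp add: P.emeasure_space_1)
  also have "(\<integral>\<^sup>+\<omega>. ?f \<omega> \<partial>S) = ennreal (1 / (1 - exp c * lap r))"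
    by (rule nn_integral_suminf_exp_pos) (use assms in auto)
  also have "ennreal ?K * ennreal (1 / (1 - exp c * lap r)) = ennreal (?K * (1 / (1 - exp c * lap r)))"
    by (rule ennreal_mult[symmetric]) (use assms K in auto)
  also have "1 + ennreal (?K * (1 / (1 - exp c * lap r))) = ennreal (1 + ?K * (1 / (1 - exp c * lap r)))"
    by (subst ennreal_plus) (use assms K in auto)
  also have "?K * (1 / (1 - exp c * lap r)) = ?K / (1 - exp c * lap r)"
    by simp
  finally show ?thesis .
qed

end

definition mass :: "real \<Rightarrow> real \<Rightarrow> (real \<Rightarrow> real) \<Rightarrow> (nat \<Rightarrow> real) \<Rightarrow> real" where
  "mass R b \<phi> \<omega> = (\<Sum>j<visits R \<omega>. \<phi> (pos j \<omega>)) / b"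

lemma abs_mass_le:
  assumes "\<And>y. \<bar>\<phi> y\<bar> \<le> C" "0 < b"
  shows "\<bar>mass R b \<phi> \<omega>\<bar> \<le> C / b * visits R \<omega>"
proof -
  have "\<bar>\<Sum>j<visits R \<omega>. \<phi> (pos j \<omega>)\<bar> \<le> (\<Sum>j<visits R \<omega>. C)"
    by (intro order_trans[OF sum_abs] sum_mono assms)
  then show ?thesis
    using assms(2) by (simp add: mass_def field_simps)
qed

lemma mass_eq_suminf:
  assumes "finite {j. pos j \<omega> \<le> R}" "\<And>y. y > R \<Longrightarrow> \<phi> y = 0"
  shows "mass R b \<phi> \<omega> = (\<Sum>j. \<phi> (pos j \<omega>)) / b" "summable (\<lambda>j. \<phi> (pos j \<omega>))"
proof -
  have z: "\<phi> (pos j \<omega>) = 0" if "j \<notin> {..<visits R \<omega>}" for j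
    using that visited_indices_eq[OF assms(1)] assms(2)[of "pos j \<omega>"] by (metis mem_Collect_eq not_le)
  show "mass R b \<phi> \<omega> = (\<Sum>j. \<phi> (pos j \<omega>)) / b"
    unfolding mass_def using suminf_finite[OF finite_lessThan z] by simp
  show "summable (\<lambda>j. \<phi> (pos j \<omega>))"
    by (rule summable_finite[OF finite_lessThan z])
qed

context iid_steps
begin

lemma measurable_mass [measurable]:
  assumes [measurable]: "(\<lambda>(x, y). \<phi> x y) \<in> borel_measurable (N \<Otimes>\<^sub>M borel)"
  shows "(\<lambda>(x, \<omega>). mass R b (\<phi> x) \<omega>) \<in> borel_measurable (N \<Otimes>\<^sub>M S)"
proof -
  have "(\<lambda>z. (\<lambda>k z. (\<Sum>j<k. \<phi> (fst z) (pos j (snd z))) / b) (visits R (snd z)) z) \<in> borel_measurable (N \<Otimes>\<^sub>M S)"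
    by (rule measurable_compose_countable) measurable
  then show ?thesis by (simp add: mass_def split_beta)
qed

lemma measurable_mass' [measurable]:
  assumes [measurable]: "\<phi> \<in> borel_measurable borel"
  shows "mass R b \<phi> \<in> borel_measurable S"
proof -
  have "(\<lambda>\<omega>. (\<lambda>k \<omega>. (\<Sum>j<k. \<phi> (pos j \<omega>)) / b) (visits R \<omega>) \<omega>) \<in> borel_measurable S"
    by (rule measurable_compose_countable) measurable
  then show ?thesis by (simp add: mass_def[abs_def])
qed

definition pot :: "real \<Rightarrow> (real \<Rightarrow> real) \<Rightarrow> real" where
  "pot b \<psi> = (\<Sum>j. \<integral>\<omega>. \<psi> (pos j \<omega>) \<partial>S) / b"

lemma integrable_pos:
  assumes [measurable]: "\<psi> \<in> borel_measurable borel" and "0 \<le> r"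
    and "\<And>y. 0 \<le> y \<Longrightarrow> \<bar>\<psi> y\<bar> \<le> c * exp (- r * y)"
  shows "integrable S (\<lambda>\<omega>. \<psi> (pos j \<omega>))"
    and "\<bar>\<integral>\<omega>. \<psi> (pos j \<omega>) \<partial>S\<bar> \<le> c * lap r ^ j"
proof -
  have i: "integrable S (\<lambda>\<omega>. c * exp (- r * pos j \<omega>))"
    using integral_exp_pos(1)[OF assms(2)] by (intro integrable_mult_right)
  show int: "integrable S (\<lambda>\<omega>. \<psi> (pos j \<omega>))"
    by (rule Bochner_Integration.integrable_bound[OF i])
      (use assms(3)[OF pos_nonneg] in \<open>auto intro!: AE_I2 order_trans[OF _ abs_ge_self]\<close>)
  have "\<bar>\<integral>\<omega>. \<psi> (pos j \<omega>) \<partial>S\<bar> \<le> (\<integral>\<omega>. \<bar>\<psi> (pos j \<omega>)\<bar> \<partial>S)"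
    by (rule integral_abs_bound)
  also have "\<dots> \<le> (\<integral>\<omega>. c * exp (- r * pos j \<omega>) \<partial>S)"
    using int i by (intro integral_mono integrable_abs) (use assms(3)[OF pos_nonneg] in auto)
  also have "\<dots> = c * lap r ^ j"
    using integral_exp_pos[OF assms(2), of j] by simp
  finally show "\<bar>\<integral>\<omega>. \<psi> (pos j \<omega>) \<partial>S\<bar> \<le> c * lap r ^ j" .
qed

lemma pot_bound:
  assumes [measurable]: "\<psi> \<in> borel_measurable borel" and r: "0 \<le> r" "lap r < 1" and b: "0 < b"
    and bnd: "\<And>y. 0 \<le> y \<Longrightarrow> \<bar>\<psi> y\<bar> \<le> c * exp (- r * y)"
  shows "summable (\<lambda>j. \<integral>\<omega>. \<psi> (pos j \<omega>) \<partial>S)"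
    and "\<bar>pot b \<psi>\<bar> \<le> c / (b * (1 - lap r))"
proof -
  note * = integrable_pos(2)[OF assms(1) r(1) bnd]
  have g: "(\<lambda>j. c * lap r ^ j) sums (c * (1 / (1 - lap r)))"
    using r by (intro sums_mult geometric_sums) auto
  have n: "summable (\<lambda>j. \<bar>\<integral>\<omega>. \<psi> (pos j \<omega>) \<partial>S\<bar>)"
    by (rule summable_comparison_test'[OF sums_summable[OF g], of 0]) (use * in auto)
  then show "summable (\<lambda>j. \<integral>\<omega>. \<psi> (pos j \<omega>) \<partial>S)"
    by (rule summable_rabs_cancel)
  have "\<bar>\<Sum>j. \<integral>\<omega>. \<psi> (pos j \<omega>) \<partial>S\<bar> \<le> (\<Sum>j. \<bar>\<integral>\<omega>. \<psi> (pos j \<omega>) \<partial>S\<bar>)"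
    by (rule summable_rabs[OF n])
  also have "\<dots> \<le> c * (1 / (1 - lap r))"
    using suminf_le[OF * n sums_summable[OF g]] sums_unique[OF g] by simp
  finally show "\<bar>pot b \<psi>\<bar> \<le> c / (b * (1 - lap r))"
    using b r divide_right_mono[of _ "c * (1 / (1 - lap r))" b] by (simp add: pot_def abs_divide mult.commute)
qed

lemma pot_add:
  assumes [measurable]: "\<psi> \<in> borel_measurable borel" "\<psi>' \<in> borel_measurable borel"
    and r: "0 \<le> r" "lap r < 1" "0 < b"
    and bnd: "\<And>y. 0 \<le> y \<Longrightarrow> \<bar>\<psi> y\<bar> \<le> c * exp (- r * y)" "\<And>y. 0 \<le> y \<Longrightarrow> \<bar>\<psi>' y\<bar> \<le> c' * exp (- r * y)"
  shows "pot b (\<lambda>y. \<psi> y + \<psi>' y) = pot b \<psi> + pot b \<psi>'"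
proof -
  have "(\<integral>\<omega>. \<psi> (pos j \<omega>) + \<psi>' (pos j \<omega>) \<partial>S) = (\<integral>\<omega>. \<psi> (pos j \<omega>) \<partial>S) + (\<integral>\<omega>. \<psi>' (pos j \<omega>) \<partial>S)" for j
    using integrable_pos(1)[OF assms(1) r(1) bnd(1)] integrable_pos(1)[OF assms(2) r(1) bnd(2)] by simp
  then show ?thesis
    unfolding pot_def
    using suminf_add[OF pot_bound(1)[OF assms(1) r bnd(1)] pot_bound(1)[OF assms(2) r bnd(2)]]
    by (metis (no_types, lifting) add_divide_distrib suminf_cong)
qed

lemma pot_exp_sum:
  assumes "\<And>i. i \<le> m \<Longrightarrow> lap (real i + 1) < 1"
  shows "(\<lambda>j. \<integral>\<omega>. (\<Sum>i\<le>m. c i * exp (- (real i + 1) * pos j \<omega>)) \<partial>S) sums (\<Sum>i\<le>(m::nat). c i * (1 / (1 - lap (real i + 1))))"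
proof -
  have "(\<integral>\<omega>. (\<Sum>i\<le>m. c i * exp (- (real i + 1) * pos j \<omega>)) \<partial>S) = (\<Sum>i\<le>m. c i * lap (real i + 1) ^ j)" for j
  proof (subst Bochner_Integration.integral_sum)
    show "integrable S (\<lambda>\<omega>. c i * exp (- (real i + 1) * pos j \<omega>))" for i
      by (intro integrable_mult_right integral_exp_pos(1)) simp
    show "(\<Sum>i\<le>m. \<integral>\<omega>. c i * exp (- (real i + 1) * pos j \<omega>) \<partial>S) = (\<Sum>i\<le>m. c i * lap (real i + 1) ^ j)"
      by (intro sum.cong refl) (subst integral_mult_right_zero, subst integral_exp_pos(2), auto)
  qed
  moreover have "(\<lambda>j. (\<Sum>i\<le>m. c i * lap (real i + 1) ^ j)) sums (\<Sum>i\<le>m. c i * (1 / (1 - lap (real i + 1))))"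
    using assms by (intro sums_sum sums_mult geometric_sums) auto
  ultimately show ?thesis by simp
qed

lemma pot_near_exp_sum:
  assumes [measurable]: "\<psi> \<in> borel_measurable borel" and b: "0 < b"
    and lap: "\<And>i. i \<le> m \<Longrightarrow> lap (real i + 1) < 1" and lap1: "lap 1 < 1"
    and bnd: "\<And>y. 0 \<le> y \<Longrightarrow> \<bar>\<psi> y - (\<Sum>i\<le>m. c i * exp (- (real i + 1) * y))\<bar> \<le> k * exp (- y)"
  shows "\<bar>pot b \<psi> - (\<Sum>i\<le>m. c i * (1 / (b * (1 - lap (real i + 1)))))\<bar> \<le> k * (1 / (b * (1 - lap 1)))"
proof -
  let ?e = "\<lambda>y. (\<Sum>i\<le>m. c i * exp (- (real i + 1) * y))"
  let ?d = "\<lambda>y. \<psi> y - ?e y"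
  have bd: "\<bar>?d y\<bar> \<le> k * exp (- 1 * y)" if "0 \<le> y" for y using bnd[OF that] by simp
  note D = pot_bound[OF _ zero_le_one lap1 b bd]
  have ie: "integrable S (\<lambda>\<omega>. ?e (pos j \<omega>))" for j
    by (intro Bochner_Integration.integrable_sum integrable_mult_right integral_exp_pos(1)) simp
  have "(\<integral>\<omega>. \<psi> (pos j \<omega>) \<partial>S) = (\<integral>\<omega>. ?d (pos j \<omega>) \<partial>S) + (\<integral>\<omega>. ?e (pos j \<omega>) \<partial>S)" for j
    using integrable_pos(1)[OF _ zero_le_one bd, of j] ie[of j]
    by (subst Bochner_Integration.integral_add[symmetric]) auto
  moreover have "(\<Sum>j. (\<integral>\<omega>. ?d (pos j \<omega>) \<partial>S) + (\<integral>\<omega>. ?e (pos j \<omega>) \<partial>S)) =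
     (\<Sum>j. (\<integral>\<omega>. ?d (pos j \<omega>) \<partial>S)) + (\<Sum>i\<le>m. c i * (1 / (1 - lap (real i + 1))))"
    using pot_exp_sum[OF lap, of m c] D(1)
    by (subst suminf_add[symmetric]) (auto simp: sums_iff)
  ultimately have "pot b \<psi> = pot b ?d + (\<Sum>i\<le>m. c i * (1 / (1 - lap (real i + 1)))) / b"
    by (simp add: pot_def add_divide_distrib)
  moreover have "(\<Sum>i\<le>m. c i * (1 / (1 - lap (real i + 1)))) / b = (\<Sum>i\<le>m. c i * (1 / (b * (1 - lap (real i + 1)))))"
    by (simp add: sum_divide_distrib mult.commute)
  ultimately show ?thesis
    using D(2) by simp
qed

end

definition stable_density :: "real \<Rightarrow> real \<Rightarrow> real" where
  "stable_density \<alpha> y = indicator {0<..} y * (y powr (\<alpha> - 1) / Gamma \<alpha>)"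

lemma measurable_stable_density [measurable]: "stable_density \<alpha> \<in> borel_measurable borel"
  unfolding stable_density_def[abs_def] by measurable

lemma stable_density_nonneg: "0 < \<alpha> \<Longrightarrow> 0 \<le> stable_density \<alpha> y"
  by (simp add: stable_density_def Gamma_real_pos less_imp_le)

lemma stable_density_laplace:
  assumes "0 < \<alpha>" "0 < r"
  shows "integrable lborel (\<lambda>y. stable_density \<alpha> y * exp (- r * y))"
    and "(\<integral>y. stable_density \<alpha> y * exp (- r * y) \<partial>lborel) = r powr (- \<alpha>)"
proof -
  have G: "((\<lambda>t. indicator {0<..} t * (t powr (\<alpha> - 1) / exp t)) has_integral Gamma \<alpha>) UNIV"
  proof -
    have "((\<lambda>t. t powr (\<alpha> - 1) / exp t) has_integral Gamma \<alpha>) {0..}"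
      by (rule Gamma_integral_real[OF assms(1)])
    then have "((\<lambda>t. t powr (\<alpha> - 1) / exp t) has_integral Gamma \<alpha>) {0<..}"
      by (subst (asm) has_integral_spike_set_eq[where T="{0<..}"])
        (auto intro: negligible_subset[of "{0}"] simp: negligible_sing)
    then show ?thesis
      by (subst (asm) has_integral_restrict_UNIV[symmetric], elim has_integral_eq[rotated]) auto
  qed
  have "((\<lambda>t. indicator {0<..} t * (t powr (\<alpha> - 1) / exp t)) has_integral Gamma \<alpha>) UNIV \<Longrightarrow>
    has_bochner_integral lborel (\<lambda>t. indicator {0<..} t * (t powr (\<alpha> - 1) / exp t)) (Gamma \<alpha>)"
    using Gamma_real_pos[OF assms(1)]
    by (intro has_bochner_integral_nn_integral) (auto intro!: nn_integral_has_integral_lborel)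
  then have H: "has_bochner_integral lborel (\<lambda>t. indicator {0<..} t * (t powr (\<alpha> - 1) / exp t)) (Gamma \<alpha>)"
    using G by blast
  have "has_bochner_integral lborel (\<lambda>y. indicator {0<..} (0 + r * y) * ((0 + r * y) powr (\<alpha> - 1) / exp (0 + r * y))) (Gamma \<alpha> /\<^sub>R \<bar>r\<bar>)"
    using lborel_has_bochner_integral_real_affine_iff[of r "\<lambda>t. indicator {0<..} t * (t powr (\<alpha> - 1) / exp t)" "Gamma \<alpha>" 0] assms H
    by auto
  then have "has_bochner_integral lborel (\<lambda>y. (r powr (1 - \<alpha>) / Gamma \<alpha>) * (indicator {0<..} (0 + r * y) * ((0 + r * y) powr (\<alpha> - 1) / exp (0 + r * y)))) ((r powr (1 - \<alpha>) / Gamma \<alpha>) * (Gamma \<alpha> /\<^sub>R \<bar>r\<bar>))"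
    by (rule has_bochner_integral_mult_right)
  moreover have "(r powr (1 - \<alpha>) / Gamma \<alpha>) * (indicator {0<..} (0 + r * y) * ((0 + r * y) powr (\<alpha> - 1) / exp (0 + r * y))) = stable_density \<alpha> y * exp (- r * y)" for y
  proof (cases "0 < y")
    case True
    have "r powr (1 - \<alpha>) * r powr (\<alpha> - 1) = 1"
      using assms by (simp flip: powr_add)
    then show ?thesis
      using True assms by (simp add: stable_density_def powr_mult exp_minus divide_inverse mult_ac)
  next
    case False
    then show ?thesis
      using assms by (simp add: stable_density_def zero_less_mult_iff)
  qed
  moreover have "(r powr (1 - \<alpha>) / Gamma \<alpha>) * (Gamma \<alpha> /\<^sub>R \<bar>r\<bar>) = r powr (- \<alpha>)"
  proof -
    have "Gamma \<alpha> \<noteq> 0" using Gamma_real_pos[OF assms(1)] by linarith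
    then show ?thesis using assms by (simp add: powr_diff powr_minus field_simps)
  qed
  ultimately have "has_bochner_integral lborel (\<lambda>y. stable_density \<alpha> y * exp (- r * y)) (r powr (- \<alpha>))"
    by simp
  then show "integrable lborel (\<lambda>y. stable_density \<alpha> y * exp (- r * y))"
    "(\<integral>y. stable_density \<alpha> y * exp (- r * y) \<partial>lborel) = r powr (- \<alpha>)"
    by (auto simp: has_bochner_integral_iff)
qed

definition stable_pot :: "real \<Rightarrow> (real \<Rightarrow> real) \<Rightarrow> real" where
  "stable_pot \<alpha> \<psi> = (\<integral>y. stable_density \<alpha> y * \<psi> y \<partial>lborel)"

lemma stable_pot_integrable:
  assumes "0 < \<alpha>" "0 < r" and [measurable]: "\<psi> \<in> borel_measurable borel"
    and bnd: "\<And>y. 0 \<le> y \<Longrightarrow> \<bar>\<psi> y\<bar> \<le> k * exp (- r * y)"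
  shows "integrable lborel (\<lambda>y. stable_density \<alpha> y * \<psi> y)" "\<bar>stable_pot \<alpha> \<psi>\<bar> \<le> k * r powr (- \<alpha>)"
proof -
  have i: "integrable lborel (\<lambda>y. k * (stable_density \<alpha> y * exp (- r * y)))"
    using stable_density_laplace(1)[OF assms(1,2)] by (rule integrable_mult_right)
  have le: "\<bar>stable_density \<alpha> y * \<psi> y\<bar> \<le> k * (stable_density \<alpha> y * exp (- r * y))" for y
  proof (cases "0 < y")
    case True
    then have "stable_density \<alpha> y * \<bar>\<psi> y\<bar> \<le> stable_density \<alpha> y * (k * exp (- r * y))"
      by (intro mult_left_mono bnd stable_density_nonneg assms) auto
    then show ?thesis using stable_density_nonneg[OF assms(1), of y] by (simp add: abs_mult mult_ac)
  qed (simp add: stable_density_def)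
  show i2: "integrable lborel (\<lambda>y. stable_density \<alpha> y * \<psi> y)"
    by (rule Bochner_Integration.integrable_bound[OF i]) (auto simp only: real_norm_def intro!: AE_I2 order_trans[OF le abs_ge_self], simp_all)
  have "\<bar>stable_pot \<alpha> \<psi>\<bar> \<le> (\<integral>y. \<bar>stable_density \<alpha> y * \<psi> y\<bar> \<partial>lborel)"
    unfolding stable_pot_def by (rule integral_abs_bound)
  also have "\<dots> \<le> (\<integral>y. k * (stable_density \<alpha> y * exp (- r * y)) \<partial>lborel)"
    using i i2 le by (intro integral_mono integrable_abs) auto
  also have "\<dots> = k * r powr (- \<alpha>)"
    using stable_density_laplace[OF assms(1,2)] by simp
  finally show "\<bar>stable_pot \<alpha> \<psi>\<bar> \<le> k * r powr (- \<alpha>)" .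
qed

lemma stable_pot_near_exp_sum:
  assumes "0 < \<alpha>" and [measurable]: "\<psi> \<in> borel_measurable borel"
    and bnd: "\<And>y. 0 \<le> y \<Longrightarrow> \<bar>\<psi> y - (\<Sum>i\<le>m. c i * exp (- (real i + 1) * y))\<bar> \<le> k * exp (- y)"
  shows "\<bar>stable_pot \<alpha> \<psi> - (\<Sum>i\<le>(m::nat). c i * (real i + 1) powr (- \<alpha>))\<bar> \<le> k"
proof -
  let ?e = "\<lambda>y. (\<Sum>i\<le>m. c i * exp (- (real i + 1) * y))"
  let ?d = "\<lambda>y. \<psi> y - ?e y"
  have bd: "\<bar>?d y\<bar> \<le> k * exp (- 1 * y)" if "0 \<le> y" for y using bnd[OF that] by simp
  note D = stable_pot_integrable[OF assms(1) zero_less_one _ bd]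
  have E: "has_bochner_integral lborel (\<lambda>y. \<Sum>i\<le>m. c i * (stable_density \<alpha> y * exp (- (real i + 1) * y))) (\<Sum>i\<le>m. c i * (real i + 1) powr (- \<alpha>))"
    by (intro has_bochner_integral_sum has_bochner_integral_mult_right)
      (use stable_density_laplace[OF assms(1), of "real _ + 1"] in \<open>simp add: has_bochner_integral_iff\<close>)
  then have E': "has_bochner_integral lborel (\<lambda>y. stable_density \<alpha> y * ?e y) (\<Sum>i\<le>m. c i * (real i + 1) powr (- \<alpha>))"
    by (simp add: sum_distrib_left mult_ac)
  have "has_bochner_integral lborel (\<lambda>y. stable_density \<alpha> y * ?d y + stable_density \<alpha> y * ?e y) (stable_pot \<alpha> ?d + (\<Sum>i\<le>m. c i * (real i + 1) powr (- \<alpha>)))"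
    using D(1) unfolding stable_pot_def
    by (intro has_bochner_integral_add E') (auto simp: has_bochner_integral_iff)
  then have "has_bochner_integral lborel (\<lambda>y. stable_density \<alpha> y * \<psi> y) (stable_pot \<alpha> ?d + (\<Sum>i\<le>m. c i * (real i + 1) powr (- \<alpha>)))"
    by (simp add: algebra_simps)
  then have "stable_pot \<alpha> \<psi> = stable_pot \<alpha> ?d + (\<Sum>i\<le>m. c i * (real i + 1) powr (- \<alpha>))"
    by (simp add: has_bochner_integral_iff stable_pot_def)
  then show ?thesis using D(2) by simp
qed

lemma exp_sum_approximation:
  fixes \<psi> :: "real \<Rightarrow> real"
  assumes cont: "continuous_on {0..} \<psi>" and supp: "\<And>y. R \<le> y \<Longrightarrow> \<psi> y = 0" and "0 \<le> R" "0 < e"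
  shows "\<exists>c (m::nat). \<forall>y\<ge>0. \<bar>\<psi> y - (\<Sum>i\<le>m. c i * exp (- (real i + 1) * y))\<bar> \<le> e * exp (- y)"
proof -
  define g where "g t = \<psi> (- ln (max t (exp (- R)))) / max t (exp (- R))" for t
  have "continuous_on {0..1} g"
    unfolding g_def
  proof (intro continuous_intros continuous_on_compose2[OF cont])
    show "(\<lambda>x. - ln (max x (exp (- R)))) ` {0..1} \<subseteq> {0..}"
      using assms by (auto intro!: ln_le_zero_iff[THEN iffD2] simp: less_max_iff_disj)
  qed (auto simp: max_def)
  then obtain p where p: "real_polynomial_function p" "\<And>t. t \<in> {0..1} \<Longrightarrow> \<bar>g t - p t\<bar> < e"
    using Stone_Weierstrass_real_polynomial_function[OF compact_Icc _ \<open>0 < e\<close>] by blast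
  then obtain c m where c: "p = (\<lambda>t. \<Sum>i\<le>(m::nat). c i * t ^ i)"
    unfolding real_polynomial_function_iff_sum by blast
  have "\<bar>\<psi> y - (\<Sum>i\<le>m. c i * exp (- (real i + 1) * y))\<bar> \<le> e * exp (- y)" if "0 \<le> y" for y
  proof -
    have g: "g (exp (- y)) * exp (- y) = \<psi> y"
      using supp[of y] supp[of R] assms by (cases "y \<le> R") (auto simp: g_def max_def)
    have "(\<Sum>i\<le>m. c i * exp (- (real i + 1) * y)) = p (exp (- y)) * exp (- y)"
      by (simp add: c sum_distrib_right exp_of_nat_mult[symmetric] mult.assoc mult_exp_exp distrib_right left_diff_distrib)
    then have "\<bar>\<psi> y - (\<Sum>i\<le>m. c i * exp (- (real i + 1) * y))\<bar> = \<bar>g (exp (- y)) - p (exp (- y))\<bar> * exp (- y)"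
      using g by (metis abs_exp_cancel abs_mult left_diff_distrib)
    also have "\<dots> \<le> e * exp (- y)"
      using p(2)[of "exp (- y)"] that by (intro mult_right_mono) auto
    finally show ?thesis .
  qed
  then show ?thesis by blast
qed

context iid_steps
begin

definition visit_moment :: "real \<Rightarrow> real \<Rightarrow> real" where
  "visit_moment R c = (\<integral>\<omega>. exp (c * visits R \<omega>) \<partial>S)"

lemma integrable_exp_visits:
  assumes "0 \<le> r" "0 \<le> c" "exp c * lap r < 1"
  shows "integrable S (\<lambda>\<omega>. exp (c * visits R \<omega>))"
    and "visit_moment R c \<le> 1 + exp (r * R) * (exp c - 1) / (1 - exp c * lap r)"
proof -
  note * = nn_integral_exp_visits[OF assms, of R]
  show i: "integrable S (\<lambda>\<omega>. exp (c * visits R \<omega>))"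
  proof (rule integrableI_nonneg)
    show "(\<lambda>\<omega>. exp (c * visits R \<omega>)) \<in> borel_measurable S"
      by (rule measurable_compose[OF measurable_visits]) simp
    show "(\<integral>\<^sup>+\<omega>. ennreal (exp (c * visits R \<omega>)) \<partial>S) < \<infinity>"
      by (rule le_less_trans[OF *]) simp
  qed simp
  have nn: "0 \<le> exp (r * R) * (exp c - 1) / (1 - exp c * lap r)"
    using assms by (intro divide_nonneg_nonneg mult_nonneg_nonneg) auto
  have "ennreal (visit_moment R c) = (\<integral>\<^sup>+\<omega>. ennreal (exp (c * visits R \<omega>)) \<partial>S)"
    unfolding visit_moment_def by (rule nn_integral_eq_integral[OF i, symmetric]) simp
  with * have "ennreal (visit_moment R c) \<le> ennreal (1 + exp (r * R) * (exp c - 1) / (1 - exp c * lap r))"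
    by (simp only:)
  then show "visit_moment R c \<le> 1 + exp (r * R) * (exp c - 1) / (1 - exp c * lap r)"
    by (subst (asm) ennreal_le_iff) (use nn in linarith)+
qed

definition fk :: "real \<Rightarrow> real \<Rightarrow> (real \<Rightarrow> real) \<Rightarrow> real \<Rightarrow> real" where
  "fk R b \<theta> x = (\<integral>\<omega>. exp (mass R b (\<lambda>y. \<theta> (x + y)) \<omega>) \<partial>S)"

lemma measurable_fk [measurable]:
  assumes [measurable]: "\<theta> \<in> borel_measurable borel"
  shows "fk R b \<theta> \<in> borel_measurable borel"
proof -
  have [measurable]: "(\<lambda>(x, \<omega>). mass R b (\<lambda>y. \<theta> (x + y)) \<omega>) \<in> borel_measurable (borel \<Otimes>\<^sub>M S)"
    by (rule measurable_mass) measurable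
  have "(\<lambda>x. \<integral>\<omega>. (\<lambda>z. exp ((\<lambda>(x, \<omega>). mass R b (\<lambda>y. \<theta> (x + y)) \<omega>) z)) (x, \<omega>) \<partial>S) \<in> borel_measurable borel"
    by (intro P.borel_measurable_lebesgue_integral) measurable
  then show ?thesis unfolding fk_def[abs_def] by simp
qed

context
  fixes R b C r :: real and \<theta> :: "real \<Rightarrow> real"
  assumes meas [measurable]: "\<theta> \<in> borel_measurable borel"
    and bnd: "\<And>y. \<bar>\<theta> y\<bar> \<le> C" and supp: "\<And>y. R \<le> y \<Longrightarrow> \<theta> y = 0" and R: "0 \<le> R" and b: "0 < b"
    and r: "0 < r" "exp (C / b) * lap r < 1"
begin

lemma C_nonneg: "0 \<le> C"
  using bnd[of 0] by linarith

lemma lap_less_1: "lap r < 1"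
proof -
  have "1 * lap r \<le> exp (C / b) * lap r"
    using C_nonneg b by (intro mult_right_mono) auto
  with r show ?thesis by simp
qed

lemma exp_mass_le: "exp (mass R b (\<lambda>y. \<theta> (x + y)) \<omega>) \<le> exp (C / b * visits R \<omega>)"
  using abs_mass_le[of "\<lambda>y. \<theta> (x + y)" C b R \<omega>] bnd b by auto

lemma integrable_exp_mass: "integrable S (\<lambda>\<omega>. exp (mass R b (\<lambda>y. \<theta> (x + y)) \<omega>))"
proof (rule Bochner_Integration.integrable_bound)
  show "integrable S (\<lambda>\<omega>. exp (C / b * visits R \<omega>))"
    using integrable_exp_visits(1)[of r "C / b" R] r b C_nonneg by simp
qed (use exp_mass_le in auto)

lemma fk_bounds: "0 \<le> fk R b \<theta> x" "fk R b \<theta> x \<le> visit_moment R (C / b)"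
proof -
  show "0 \<le> fk R b \<theta> x" unfolding fk_def by (rule Bochner_Integration.integral_nonneg) simp
  show "fk R b \<theta> x \<le> visit_moment R (C / b)"
    unfolding fk_def visit_moment_def
    by (intro integral_mono integrable_exp_mass exp_mass_le)
      (use integrable_exp_visits(1)[of r "C / b" R] r b C_nonneg in simp)
qed

lemma fk_beyond: "R \<le> x \<Longrightarrow> fk R b \<theta> x = 1"
  unfolding fk_def mass_def by (simp add: supp add_increasing2 P.prob_space)

text \<open>Telescoping the multiplicative functional over the visited points gives a Volterra equation,
  in which the law of the walk only enters through its potential.\<close>

lemma fk_volterra:
  assumes x: "0 \<le> x"
  shows "fk R b \<theta> x = 1 + pot b (\<lambda>y. b * (1 - exp (- \<theta> (x + y) / b)) * fk R b \<theta> (x + y))"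
proof -
  define a where "a p = \<theta> (x + p) / b" for p
  define G where "G = (\<lambda>(p, \<omega>). (1 - exp (- a p)) * exp (mass R b (\<lambda>y. \<theta> (x + p + y)) \<omega>))"
  define K where "K = 1 + exp (C / b)"
  define V where "V = visit_moment R (C / b)"
  have [measurable]: "a \<in> borel_measurable borel" unfolding a_def[abs_def] by measurable
  have [measurable]: "(\<lambda>(p, \<omega>). mass R b (\<lambda>y. \<theta> (x + p + y)) \<omega>) \<in> borel_measurable (borel \<Otimes>\<^sub>M S)"
    by (rule measurable_mass) measurable
  have [measurable]: "G \<in> borel_measurable (borel \<Otimes>\<^sub>M S)"
  proof -
    have "G = (\<lambda>z. (1 - exp (- a (fst z))) * exp ((\<lambda>(p, \<omega>). mass R b (\<lambda>y. \<theta> (x + p + y)) \<omega>) z))"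
      by (auto simp: G_def)
    then show ?thesis by simp
  qed
  have Kb: "\<bar>1 - exp (- a p)\<bar> \<le> K" for p
  proof -
    have "- a p \<le> C / b"
      using bnd[of "x + p"] b by (auto simp: a_def field_simps)
    then have "exp (- a p) \<le> exp (C / b)" by simp
    then show ?thesis using exp_gt_zero[of "- a p"] unfolding K_def by linarith
  qed
  have a0: "a p = 0" if "R < p" for p using supp[of "x + p"] x that by (simp add: a_def)
  have iV: "integrable S (\<lambda>\<omega>. K * exp (C / b * visits R \<omega>))"
    using integrable_exp_visits(1)[of r "C / b" R] r b C_nonneg by simp
  have G_bound: "norm (G (p, \<omega>)) \<le> K * exp (C / b * visits R \<omega>)" for p \<omega>
    unfolding G_def by (auto simp: abs_mult intro!: mult_mono Kb exp_mass_le[of "x + p", simplified]) (use Kb[of 0] in linarith)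
  have G_int: "(\<integral>\<omega>'. G (p, \<omega>') \<partial>S) = (1 - exp (- a p)) * fk R b \<theta> (x + p)"
    "(\<integral>\<omega>'. \<bar>G (p, \<omega>')\<bar> \<partial>S) = \<bar>1 - exp (- a p)\<bar> * fk R b \<theta> (x + p)" for p
    by (simp_all add: G_def fk_def abs_mult)
  note J = integral_seq_shift[where N=borel, OF measurable_pos _ _ iV]
  have J1: "(\<integral>\<omega>. G (pos j \<omega>, seq_shift j \<omega>) \<partial>S) = (\<integral>\<omega>. (1 - exp (- a (pos j \<omega>))) * fk R b \<theta> (x + pos j \<omega>) \<partial>S)" for j
    using J(1)[of G j j, OF _ _ G_bound] by (simp add: pos_comb_seq G_int)
  have J2: "integrable S (\<lambda>\<omega>. G (pos j \<omega>, seq_shift j \<omega>))" for j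
    using J(2)[of G j j, OF _ _ G_bound] by (simp add: pos_comb_seq)
  have J3: "(\<integral>\<omega>. \<bar>G (pos j \<omega>, seq_shift j \<omega>)\<bar> \<partial>S) = (\<integral>\<omega>. \<bar>1 - exp (- a (pos j \<omega>))\<bar> * fk R b \<theta> (x + pos j \<omega>) \<partial>S)" for j
    using J(1)[of "\<lambda>z. \<bar>G z\<bar>" j j] G_bound by (simp add: pos_comb_seq G_int)
  have abs_le: "\<bar>\<bar>1 - exp (- a y)\<bar> * fk R b \<theta> (x + y)\<bar> \<le> K * V * exp (r * R) * exp (- r * y)" if "0 \<le> y" for y
  proof (cases "R < y")
    case True
    have "0 \<le> V" using fk_bounds[of 0] by (simp add: V_def)
    moreover have "0 \<le> K" by (simp add: K_def add_nonneg_nonneg)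
    ultimately show ?thesis by (simp add: a0[OF True])
  next
    case False
    have "\<bar>1 - exp (- a y)\<bar> * fk R b \<theta> (x + y) \<le> K * V"
      unfolding V_def by (intro mult_mono Kb fk_bounds) (simp add: K_def add_nonneg_nonneg)
    also have "\<dots> \<le> K * V * exp (r * (R - y))"
    proof -
      have "0 \<le> K * V" using fk_bounds[of 0] by (simp add: K_def V_def add_nonneg_nonneg)
      moreover have "1 \<le> exp (r * (R - y))" using False r by simp
      ultimately show ?thesis using mult_left_mono[of 1 "exp (r * (R - y))" "K * V"] by simp
    qed
    finally show ?thesis
      using fk_bounds(1)[of "x + y"] by (simp add: abs_mult right_diff_distrib exp_diff exp_minus field_simps)
  qed
  have sum_abs: "summable (\<lambda>j. \<integral>\<omega>. \<bar>G (pos j \<omega>, seq_shift j \<omega>)\<bar> \<partial>S)"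
    unfolding J3
    by (rule pot_bound(1)[where r=r, OF _ _ lap_less_1 b abs_le]) (use r in auto)
  have AE: "AE \<omega> in S. summable (\<lambda>j. norm (G (pos j \<omega>, seq_shift j \<omega>))) \<and>
      (\<Sum>j. G (pos j \<omega>, seq_shift j \<omega>)) = exp (mass R b (\<lambda>y. \<theta> (x + y)) \<omega>) - 1"
    using AE_finite_visits[OF r(1) lap_less_1]
  proof eventually_elim
    case (elim \<omega>)
    define s where "s j = (\<Sum>i. a (pos (i + j) \<omega>))" for j
    obtain n where n: "{j. pos j \<omega> \<le> R} = {..<n}"
      using visited_indices_eq elim by blast
    have z: "a (pos j \<omega>) = 0" if "n \<le> j" for j
      using n a0[of "pos j \<omega>"] that by (metis lessThan_iff mem_Collect_eq not_le)
    have sm: "summable (\<lambda>i. a (pos (i + j) \<omega>))" for j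
      by (rule summable_finite[of "{..<n}"]) (auto intro: z)
    have mass_s: "mass R b (\<lambda>y. \<theta> (x + pos j \<omega> + y)) (seq_shift j \<omega>) = s j" for j
    proof -
      have "finite {i. pos i (seq_shift j \<omega>) \<le> R}"
      proof (rule finite_subset)
        show "finite ((\<lambda>i. i + j) -` {i. pos i \<omega> \<le> R + pos j \<omega>})"
          using elim by (intro finite_vimageI) (auto simp: inj_on_def)
        show "{i. pos i (seq_shift j \<omega>) \<le> R} \<subseteq> (\<lambda>i. i + j) -` {i. pos i \<omega> \<le> R + pos j \<omega>}"
          by (auto simp: pos_add)
      qed
      moreover have "\<theta> (x + pos j \<omega> + y) = 0" if "R < y" for y
        by (rule supp) (use that x pos_nonneg[of j \<omega>] in linarith)
      ultimately have "mass R b (\<lambda>y. \<theta> (x + pos j \<omega> + y)) (seq_shift j \<omega>) =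
          (\<Sum>i. \<theta> (x + pos j \<omega> + pos i (seq_shift j \<omega>))) / b"
        and "summable (\<lambda>i. \<theta> (x + pos j \<omega> + pos i (seq_shift j \<omega>)))"
        by (intro mass_eq_suminf; simp)+
      then show ?thesis
        by (simp add: s_def a_def pos_add add.assoc suminf_divide)
    qed
    have step: "s j = a (pos j \<omega>) + s (Suc j)" for j
      using suminf_split_head[OF sm[of j]] by (simp add: s_def)
    have G: "G (pos j \<omega>, seq_shift j \<omega>) = exp (s j) - exp (s (Suc j))" for j
      by (simp add: G_def mass_s) (simp add: step[of j] left_diff_distrib mult_exp_exp)
    have "s \<longlonglongrightarrow> 0"
      by (rule tendsto_eventually) (auto simp: eventually_sequentially s_def z intro!: exI[of _ n])
    then have "(\<lambda>j. exp (s j)) \<longlonglongrightarrow> exp 0"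
      by (intro tendsto_intros)
    from telescope_sums'[OF this] have "(\<lambda>j. G (pos j \<omega>, seq_shift j \<omega>)) sums (exp (s 0) - 1)"
      by (simp add: G)
    moreover have "mass R b (\<lambda>y. \<theta> (x + y)) \<omega> = s 0"
      using mass_s[of 0] by (simp add: seq_shift_def)
    moreover have "summable (\<lambda>j. norm (G (pos j \<omega>, seq_shift j \<omega>)))"
      by (rule summable_finite[of "{..<n}"]) (auto simp: G_def z)
    ultimately show ?case by (simp add: sums_iff)
  qed
  have "(\<lambda>j. \<integral>\<omega>. G (pos j \<omega>, seq_shift j \<omega>) \<partial>S) sums (\<integral>\<omega>. (\<Sum>j. G (pos j \<omega>, seq_shift j \<omega>)) \<partial>S)"
    by (rule sums_integral[OF J2]) (use AE sum_abs in \<open>auto elim!: eventually_mono\<close>)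
  also have "(\<integral>\<omega>. (\<Sum>j. G (pos j \<omega>, seq_shift j \<omega>)) \<partial>S) = (\<integral>\<omega>. exp (mass R b (\<lambda>y. \<theta> (x + y)) \<omega>) - 1 \<partial>S)"
  proof (rule integral_cong_AE)
    show "AE \<omega> in S. (\<Sum>j. G (pos j \<omega>, seq_shift j \<omega>)) = exp (mass R b (\<lambda>y. \<theta> (x + y)) \<omega>) - 1"
      using AE by (auto elim!: eventually_mono)
  qed measurable
  also have "\<dots> = fk R b \<theta> x - 1"
    using integrable_exp_mass by (simp add: fk_def P.prob_space)
  finally have "(\<lambda>j. \<integral>\<omega>. (1 - exp (- a (pos j \<omega>))) * fk R b \<theta> (x + pos j \<omega>) \<partial>S) sums (fk R b \<theta> x - 1)"
    by (simp add: J1)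
  then have "(\<lambda>j. b * (\<integral>\<omega>. (1 - exp (- a (pos j \<omega>))) * fk R b \<theta> (x + pos j \<omega>) \<partial>S)) sums (b * (fk R b \<theta> x - 1))"
    by (rule sums_mult)
  then have "(\<lambda>j. (\<integral>\<omega>. b * (1 - exp (- \<theta> (x + pos j \<omega>) / b)) * fk R b \<theta> (x + pos j \<omega>) \<partial>S)) sums (b * (fk R b \<theta> x - 1))"
    by (simp add: a_def mult.assoc)
  then show ?thesis
    using b by (simp add: pot_def sums_iff)
qed

end

end

section \<open>Limits of additive functionals\<close>

lemma scaled_exp_limit:
  fixes b :: "nat \<Rightarrow> real"
  assumes "filterlim b at_top sequentially" "\<And>n. 0 < b n"
  shows "(\<lambda>n. b n * (exp (C / b n) - 1)) \<longlonglongrightarrow> C"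
proof -
  have "((\<lambda>t. exp (C * t)) has_real_derivative C) (at 0)"
    by (auto intro!: derivative_eq_intros)
  then have d: "((\<lambda>h. (exp (C * h) - 1) / h) \<longlongrightarrow> C) (at 0)"
    by (simp add: DERIV_def)
  have "(\<lambda>n. 1 / b n) \<longlonglongrightarrow> 0"
    using assms(1) by (simp add: tendsto_inverse_0_at_top inverse_eq_divide[symmetric])
  then have "filterlim (\<lambda>n. 1 / b n) (at 0) sequentially"
    using assms(2) by (auto simp: filterlim_at less_imp_neq[symmetric] intro!: eventuallyI)
  from filterlim_compose[OF d this] show ?thesis
    by (simp add: mult.commute)
qed

lemma one_minus_exp_bound:
  fixes u :: real
  assumes "\<bar>u\<bar> \<le> 1"
  shows "\<bar>(1 - exp (- u)) - u\<bar> \<le> u\<^sup>2"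
proof -
  have "exp (- u) \<le> 1 - u + u\<^sup>2"
  proof (cases "0 \<le> u")
    case True
    have "1 \<le> (1 - u + u\<^sup>2) * (1 + u)"
      using True by (simp add: power2_eq_square algebra_simps)
    also have "\<dots> \<le> (1 - u + u\<^sup>2) * exp u"
    proof (rule mult_left_mono[OF exp_ge_add_one_self])
      have "0 \<le> (1 - u)\<^sup>2 + u" using True by simp
      then show "0 \<le> 1 - u + u\<^sup>2" by (simp add: power2_eq_square algebra_simps)
    qed
    finally show ?thesis by (simp add: exp_minus field_simps)
  next
    case False
    then show ?thesis using exp_bound[of "- u"] assms by simp
  qed
  moreover have "1 + (- u) \<le> exp (- u)" by (rule exp_ge_add_one_self)
  ultimately show ?thesis by simp
qed

lemma shifted_exp_sum:
  fixes \<psi> :: "real \<Rightarrow> real"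
  assumes "\<And>y. 0 \<le> y \<Longrightarrow> \<bar>\<psi> y - (\<Sum>i\<le>m. c i * exp (- (real i + 1) * y))\<bar> \<le> e * exp (- y)" "0 \<le> x" "0 \<le> y" "0 \<le> e"
  shows "\<bar>\<psi> (x + y) - (\<Sum>i\<le>m. (c i * exp (- (real i + 1) * x)) * exp (- (real i + 1) * y))\<bar> \<le> e * exp (- y)"
proof -
  have "(\<Sum>i\<le>m. (c i * exp (- (real i + 1) * x)) * exp (- (real i + 1) * y)) = (\<Sum>i\<le>m. c i * exp (- (real i + 1) * (x + y)))"
    by (simp add: mult.assoc mult_exp_exp distrib_left)
  moreover have "e * exp (- (x + y)) \<le> e * exp (- y)"
    using assms by (intro mult_left_mono) auto
  ultimately show ?thesis
    using assms(1)[of "x + y"] assms(2-) by linarith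
qed

lemma continuous_stable_pot:
  fixes \<psi> :: "real \<Rightarrow> real"
  assumes "0 < \<alpha>" and cont: "continuous_on UNIV \<psi>" and supp: "\<And>y. R \<le> y \<Longrightarrow> \<psi> y = 0" and "0 \<le> R"
  shows "continuous_on UNIV (\<lambda>x. stable_pot \<alpha> (\<lambda>y. \<psi> (max 0 x + y)))"
proof -
  have [measurable]: "\<psi> \<in> borel_measurable borel" by (rule borel_measurable_continuous_onI[OF cont])
  have "\<exists>g. continuous_on UNIV g \<and> (\<forall>x. \<bar>stable_pot \<alpha> (\<lambda>y. \<psi> (max 0 x + y)) - g x\<bar> \<le> 1 / (real n + 1))" for n :: nat
  proof -
    define e where "e = 1 / (real n + 1)"
    have e: "0 < e" by (simp add: e_def)
    obtain c and m :: nat where c: "\<And>y. 0 \<le> y \<Longrightarrow> \<bar>\<psi> y - (\<Sum>i\<le>m. c i * exp (- (real i + 1) * y))\<bar> \<le> e * exp (- y)"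
      using exp_sum_approximation[OF continuous_on_subset[OF cont] supp assms(4) e] by auto
    have "\<bar>stable_pot \<alpha> (\<lambda>y. \<psi> (max 0 x + y)) - (\<Sum>i\<le>m. (c i * exp (- (real i + 1) * max 0 x)) * (real i + 1) powr (- \<alpha>))\<bar> \<le> e" for x
      by (rule stable_pot_near_exp_sum[OF assms(1)], measurable, rule shifted_exp_sum[OF c]) (use e in auto)
    then show ?thesis
      by (intro exI[of _ "\<lambda>x. (\<Sum>i\<le>m. (c i * exp (- (real i + 1) * max 0 x)) * (real i + 1) powr (- \<alpha>))"])
        (auto simp: e_def[symmetric] intro!: continuous_intros)
  qed
  then obtain g where g: "\<And>n::nat. continuous_on UNIV (g n)"
      "\<And>n x. \<bar>stable_pot \<alpha> (\<lambda>y. \<psi> (max 0 x + y)) - g n x\<bar> \<le> 1 / (real n + 1)"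
    by metis
  have "uniform_limit UNIV g (\<lambda>x. stable_pot \<alpha> (\<lambda>y. \<psi> (max 0 x + y))) sequentially"
  proof (rule uniform_limitI)
    fix e :: real assume "0 < e"
    have "(\<lambda>n. 1 / (real n + 1)) \<longlonglongrightarrow> 0"
      using LIMSEQ_inverse_real_of_nat by (simp add: inverse_eq_divide add.commute)
    then have "\<forall>\<^sub>F n in sequentially. 1 / (real n + 1) < e"
      using \<open>0 < e\<close> by (rule order_tendstoD)
    then show "\<forall>\<^sub>F n in sequentially. \<forall>x\<in>UNIV. dist (g n x) (stable_pot \<alpha> (\<lambda>y. \<psi> (max 0 x + y))) < e"
      by eventually_elim (use g(2) in \<open>auto simp: dist_real_def abs_minus_commute[of "g _ _"] intro: le_less_trans\<close>)
  qed
  then show ?thesis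
    by (rule uniform_limit_theorem[rotated]) (use g in auto)
qed

primrec picard :: "real \<Rightarrow> (real \<Rightarrow> real) \<Rightarrow> nat \<Rightarrow> real \<Rightarrow> real" where
  "picard \<alpha> \<theta> 0 = (\<lambda>x. 1)"
| "picard \<alpha> \<theta> (Suc k) = (\<lambda>x. 1 + stable_pot \<alpha> (\<lambda>y. \<theta> (max 0 x + y) * picard \<alpha> \<theta> k (max 0 x + y)))"

lemma continuous_picard:
  assumes "0 < \<alpha>" "continuous_on UNIV \<theta>" "\<And>y. R \<le> y \<Longrightarrow> \<theta> y = 0" "0 \<le> R"
  shows "continuous_on UNIV (picard \<alpha> \<theta> k)"
proof (induction k)
  case (Suc k)
  have "continuous_on UNIV (\<lambda>x. stable_pot \<alpha> (\<lambda>y. (\<lambda>z. \<theta> z * picard \<alpha> \<theta> k z) (max 0 x + y)))"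
    by (rule continuous_stable_pot[where R=R]) (use assms Suc in \<open>auto intro!: continuous_intros\<close>)
  then show ?case by (simp add: continuous_on_add continuous_on_const)
qed simp

lemma picard_beyond:
  assumes "\<And>y. R \<le> y \<Longrightarrow> \<theta> y = 0" "0 \<le> R" "R \<le> x"
  shows "picard \<alpha> \<theta> k x = 1"
proof (cases k)
  case (Suc k')
  have "stable_density \<alpha> y * (\<theta> (max 0 x + y) * picard \<alpha> \<theta> k' (max 0 x + y)) = 0" for y
    using assms by (cases "0 < y") (auto simp: stable_density_def)
  then have "stable_pot \<alpha> (\<lambda>y. \<theta> (max 0 x + y) * picard \<alpha> \<theta> k' (max 0 x + y)) = 0"
    by (simp only: stable_pot_def Bochner_Integration.integral_zero)
  then show ?thesis by (simp add: Suc)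
qed simp

locale stable_array =
  fixes \<alpha> :: real and \<mu> :: "nat \<Rightarrow> real measure" and b :: "nat \<Rightarrow> real"
  assumes \<alpha>: "0 < \<alpha>" "\<alpha> < 1"
    and steps: "\<And>n. iid_steps (\<mu> n)"
    and b_pos: "\<And>n. 0 < b n"
    and b_top: "filterlim b at_top sequentially"
    and lap_conv: "\<And>r. 0 < r \<Longrightarrow> (\<lambda>n. b n * (1 - iid_steps.lap (\<mu> n) r)) \<longlonglongrightarrow> r powr \<alpha>"
begin

sublocale st: iid_steps "\<mu> n" for n
  by (rule steps)

lemma lap_eventually: "0 < r \<Longrightarrow> \<forall>\<^sub>F n in sequentially. st.lap n r < 1"
proof -
  assume r: "0 < r"
  have "\<forall>\<^sub>F n in sequentially. 0 < b n * (1 - st.lap n r)"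
    using order_tendstoD(1)[OF lap_conv[OF r], of 0] r by simp
  then show ?thesis
    by eventually_elim (metis b_pos diff_gt_0_iff_gt zero_less_mult_pos)
qed

lemma green_conv: "0 < r \<Longrightarrow> (\<lambda>n. 1 / (b n * (1 - st.lap n r))) \<longlonglongrightarrow> r powr (- \<alpha>)"
  unfolding powr_minus inverse_eq_divide by (intro tendsto_intros lap_conv) auto

lemma inverse_b: "(\<lambda>n. 1 / b n) \<longlonglongrightarrow> 0"
  using b_top by (simp add: tendsto_inverse_0_at_top inverse_eq_divide[symmetric])

lemma exp_lap_conv:
  assumes "0 < r"
  shows "(\<lambda>n. b n * (exp (C / b n) - 1)) \<longlonglongrightarrow> C"
    and "(\<lambda>n. b n * (1 - exp (C / b n) * st.lap n r)) \<longlonglongrightarrow> r powr \<alpha> - C"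
proof -
  show e: "(\<lambda>n. b n * (exp (C / b n) - 1)) \<longlonglongrightarrow> C" by (rule scaled_exp_limit[OF b_top b_pos])
  have "(\<lambda>n. 1 - (1 / b n) * (b n * (1 - st.lap n r))) \<longlonglongrightarrow> 1 - 0 * r powr \<alpha>"
    by (intro tendsto_intros inverse_b lap_conv assms)
  then have l: "(\<lambda>n. st.lap n r) \<longlonglongrightarrow> 1"
    using b_pos by (simp add: less_imp_neq[symmetric])
  have "(\<lambda>n. b n * (1 - st.lap n r) - b n * (exp (C / b n) - 1) * st.lap n r) \<longlonglongrightarrow> r powr \<alpha> - C * 1"
    by (intro tendsto_intros e l lap_conv assms)
  then show "(\<lambda>n. b n * (1 - exp (C / b n) * st.lap n r)) \<longlonglongrightarrow> r powr \<alpha> - C"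
    by (simp add: algebra_simps)
qed

lemma moments:
  assumes "0 \<le> C"
  obtains r V where "0 < r" "\<forall>\<^sub>F n in sequentially. exp (C / b n) * st.lap n r < 1 \<and> st.visit_moment n R (C / b n) \<le> V"
proof -
  define r where "r = (C + 1) powr (1 / \<alpha>)"
  have r: "0 < r" "r powr \<alpha> = C + 1" using assms \<alpha> by (auto simp: r_def powr_powr)
  have c: "(\<lambda>n. b n * (1 - exp (C / b n) * st.lap n r)) \<longlonglongrightarrow> 1"
    using exp_lap_conv(2)[OF r(1), of C] r by simp
  have "(\<lambda>n. 1 + exp (r * R) * ((b n * (exp (C / b n) - 1)) / (b n * (1 - exp (C / b n) * st.lap n r)))) \<longlonglongrightarrow> 1 + exp (r * R) * (C / 1)"
    by (intro tendsto_intros exp_lap_conv(1)[OF r(1)] c) simp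
  then have "\<forall>\<^sub>F n in sequentially. 1 + exp (r * R) * ((b n * (exp (C / b n) - 1)) / (b n * (1 - exp (C / b n) * st.lap n r))) < 2 + exp (r * R) * (C / 1)"
    by (rule order_tendstoD) simp
  moreover have "\<forall>\<^sub>F n in sequentially. 0 < b n * (1 - exp (C / b n) * st.lap n r)"
    by (rule order_tendstoD[OF c]) simp
  ultimately have "\<forall>\<^sub>F n in sequentially. exp (C / b n) * st.lap n r < 1 \<and> st.visit_moment n R (C / b n) \<le> 2 + exp (r * R) * C"
  proof eventually_elim
    case (elim n)
    then have 1: "exp (C / b n) * st.lap n r < 1" using b_pos[of n] by (simp add: zero_less_mult_iff)
    have "st.visit_moment n R (C / b n) \<le> 1 + exp (r * R) * (exp (C / b n) - 1) / (1 - exp (C / b n) * st.lap n r)"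
      by (rule st.integrable_exp_visits(2)) (use r assms b_pos[of n] 1 in auto)
    also have "\<dots> = 1 + exp (r * R) * ((b n * (exp (C / b n) - 1)) / (b n * (1 - exp (C / b n) * st.lap n r)))"
      using b_pos[of n] by simp
    finally show ?case using 1 elim(1) by simp
  qed
  with r(1) show ?thesis by (rule that)
qed

lemma pot_uniform:
  fixes \<psi> :: "real \<Rightarrow> real"
  assumes cont: "continuous_on UNIV \<psi>" and supp: "\<And>y. R \<le> y \<Longrightarrow> \<psi> y = 0" and "0 \<le> R" "0 < e"
  shows "\<forall>\<^sub>F n in sequentially. \<forall>x\<ge>0. \<bar>st.pot n (b n) (\<lambda>y. \<psi> (x + y)) - stable_pot \<alpha> (\<lambda>y. \<psi> (x + y))\<bar> \<le> e"
proof -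
  have [measurable]: "\<psi> \<in> borel_measurable borel" by (rule borel_measurable_continuous_onI[OF cont])
  define d where "d = e / 4"
  have d: "0 < d" using assms by (simp add: d_def)
  obtain c and m :: nat where c: "\<And>y. 0 \<le> y \<Longrightarrow> \<bar>\<psi> y - (\<Sum>i\<le>m. c i * exp (- (real i + 1) * y))\<bar> \<le> d * exp (- y)"
    using exp_sum_approximation[OF continuous_on_subset[OF cont] supp assms(3) d] by auto
  define g where "g n i = 1 / (b n * (1 - st.lap n (real i + 1)))" for n i
  have gc: "(\<lambda>n. g n i) \<longlonglongrightarrow> (real i + 1) powr (- \<alpha>)" for i
    unfolding g_def by (rule green_conv) simp
  have "(\<lambda>n. \<Sum>i\<le>m. \<bar>c i\<bar> * \<bar>g n i - (real i + 1) powr (- \<alpha>)\<bar>) \<longlonglongrightarrow> (\<Sum>i\<le>m. \<bar>c i\<bar> * \<bar>(real i + 1) powr (- \<alpha>) - (real i + 1) powr (- \<alpha>)\<bar>)"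
    by (intro tendsto_intros gc)
  then have 1: "\<forall>\<^sub>F n in sequentially. (\<Sum>i\<le>m. \<bar>c i\<bar> * \<bar>g n i - (real i + 1) powr (- \<alpha>)\<bar>) < d"
    using d by (auto dest: order_tendstoD(2))
  have 2: "\<forall>\<^sub>F n in sequentially. g n 0 < 2"
    using order_tendstoD(2)[OF gc[of 0], of 2] by simp
  have 3: "\<forall>\<^sub>F n in sequentially. \<forall>i\<in>{..m}. st.lap n (real i + 1) < 1"
    by (intro eventually_ball_finite ballI lap_eventually) auto
  from 1 2 3 show ?thesis
  proof eventually_elim
    case (elim n)
    show ?case
    proof (intro allI impI)
      fix x :: real assume x: "0 \<le> x"
      let ?c = "\<lambda>i. c i * exp (- (real i + 1) * x)"
      have "\<bar>st.pot n (b n) (\<lambda>y. \<psi> (x + y)) - (\<Sum>i\<le>m. ?c i * g n i)\<bar> \<le> d * g n 0"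
      proof -
        have "st.lap n 1 < 1" using elim(3)[rule_format, of 0] by simp
        then have "\<bar>st.pot n (b n) (\<lambda>y. \<psi> (x + y)) - (\<Sum>i\<le>m. ?c i * (1 / (b n * (1 - st.lap n (real i + 1)))))\<bar> \<le> d * (1 / (b n * (1 - st.lap n 1)))"
          by (intro st.pot_near_exp_sum shifted_exp_sum[OF c x]) (use b_pos elim(3) d in auto)
        then show ?thesis by (simp add: g_def)
      qed
      moreover have "d * g n 0 \<le> d * 2"
        using elim(2) d by (intro mult_left_mono) auto
      moreover have "\<bar>stable_pot \<alpha> (\<lambda>y. \<psi> (x + y)) - (\<Sum>i\<le>m. ?c i * (real i + 1) powr (- \<alpha>))\<bar> \<le> d"
        by (rule stable_pot_near_exp_sum[OF \<alpha>(1)], measurable, rule shifted_exp_sum[OF c x]) (use d in auto)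
      moreover have "\<bar>(\<Sum>i\<le>m. ?c i * g n i) - (\<Sum>i\<le>m. ?c i * (real i + 1) powr (- \<alpha>))\<bar> \<le> (\<Sum>i\<le>m. \<bar>c i\<bar> * \<bar>g n i - (real i + 1) powr (- \<alpha>)\<bar>)"
      proof -
        have "\<bar>(\<Sum>i\<le>m. ?c i * g n i) - (\<Sum>i\<le>m. ?c i * (real i + 1) powr (- \<alpha>))\<bar> \<le> (\<Sum>i\<le>m. \<bar>?c i * (g n i - (real i + 1) powr (- \<alpha>))\<bar>)"
          unfolding sum_subtractf[symmetric] right_diff_distrib[symmetric] by (rule sum_abs)
        also have "\<dots> \<le> (\<Sum>i\<le>m. \<bar>c i\<bar> * \<bar>g n i - (real i + 1) powr (- \<alpha>)\<bar>)"
        proof (rule sum_mono)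
          fix i
          have "exp (- (real i + 1) * x) \<le> 1" using x by (simp add: mult_nonpos_nonneg)
          then have "\<bar>c i\<bar> * exp (- (real i + 1) * x) * \<bar>g n i - (real i + 1) powr (- \<alpha>)\<bar> \<le> \<bar>c i\<bar> * 1 * \<bar>g n i - (real i + 1) powr (- \<alpha>)\<bar>"
            by (intro mult_right_mono mult_left_mono) auto
          then show "\<bar>?c i * (g n i - (real i + 1) powr (- \<alpha>))\<bar> \<le> \<bar>c i\<bar> * \<bar>g n i - (real i + 1) powr (- \<alpha>)\<bar>"
            by (simp only: abs_mult abs_exp_cancel mult_1_right)
        qed
        finally show ?thesis .
      qed
      ultimately show "\<bar>st.pot n (b n) (\<lambda>y. \<psi> (x + y)) - stable_pot \<alpha> (\<lambda>y. \<psi> (x + y))\<bar> \<le> e"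
        using elim(1) unfolding d_def by linarith
    qed
  qed
qed

lemma fk_near_picard:
  fixes \<theta> :: "real \<Rightarrow> real"
  assumes cont: "continuous_on UNIV \<theta>" and supp: "\<And>y. R \<le> y \<Longrightarrow> \<theta> y = 0" and R: "0 \<le> R"
    and bnd: "\<And>y. \<bar>\<theta> y\<bar> \<le> C"
  shows "\<exists>r M. 0 < r \<and> (\<forall>k. \<forall>e>0.
    \<forall>\<^sub>F n in sequentially. \<forall>x\<ge>0. \<bar>st.fk n R (b n) \<theta> x - picard \<alpha> \<theta> k x\<bar> * exp (r * x) \<le> M / 2 ^ k + e)"
proof -
  have C: "0 \<le> C" using bnd[of 0] by linarith
  have meas [measurable]: "\<theta> \<in> borel_measurable borel" by (rule borel_measurable_continuous_onI[OF cont])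
  obtain s V where s: "0 < s" and mom: "\<forall>\<^sub>F n in sequentially. exp (C / b n) * st.lap n s < 1 \<and> st.visit_moment n R (C / b n) \<le> V"
    by (rule moments[OF C])
  define r where "r = (2 * C + 1) powr (1 / \<alpha>)"
  have r: "0 < r" "r powr \<alpha> = 2 * C + 1" using C \<alpha> by (auto simp: r_def powr_powr)
  define u where "u n = 1 / (b n * (1 - st.lap n r))" for n
  have u_conv: "u \<longlonglongrightarrow> 1 / (2 * C + 1)"
    using green_conv[OF r(1)] r(2) by (simp add: u_def[abs_def] powr_minus inverse_eq_divide)
  have Cu: "\<forall>\<^sub>F n in sequentially. C * u n < 1 / 2"
    by (rule order_tendstoD(2)[OF tendsto_mult_left[OF u_conv]]) (use C in \<open>simp add: field_simps\<close>)
  define M where "M = (V + 1) * exp (r * R)"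
  have beyond: "st.fk n R (b n) \<theta> x - picard \<alpha> \<theta> k x = 0" if "R \<le> x" "exp (C / b n) * st.lap n s < 1" for n k x
    using st.fk_beyond[OF meas bnd supp R b_pos s that(2) that(1)] picard_beyond[OF supp R that(1)] by simp
  have "\<forall>\<^sub>F n in sequentially. \<forall>x\<ge>0. \<bar>st.fk n R (b n) \<theta> x - picard \<alpha> \<theta> k x\<bar> * exp (r * x) \<le> M / 2 ^ k + e" if "0 < e" for k e
    using that
  proof (induction k arbitrary: e)
    case 0
    from mom show ?case
    proof eventually_elim
      case (elim n)
      show ?case
      proof (intro allI impI)
        fix x :: real assume "0 \<le> x"
        note v = st.fk_bounds[OF meas bnd supp R b_pos s conjunct1[OF elim], where x=x]
        have V: "0 \<le> V" using v elim by fastforce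
        show "\<bar>st.fk n R (b n) \<theta> x - picard \<alpha> \<theta> 0 x\<bar> * exp (r * x) \<le> M / 2 ^ 0 + e"
        proof (cases "R \<le> x")
          case True
          then show ?thesis using beyond[OF True conjunct1[OF elim], of 0] V 0 by (simp add: M_def add_nonneg_nonneg)
        next
          case False
          have "\<bar>st.fk n R (b n) \<theta> x - picard \<alpha> \<theta> 0 x\<bar> * exp (r * x) \<le> (V + 1) * exp (r * R)"
            using v elim False r V by (intro mult_mono) auto
          then show ?thesis using 0 by (simp add: M_def)
        qed
      qed
    qed
  next
    case (Suc k)
    define \<psi> where "\<psi> z = \<theta> z * picard \<alpha> \<theta> k z" for z
    have \<psi>: "continuous_on UNIV \<psi>" "\<And>z. R \<le> z \<Longrightarrow> \<psi> z = 0"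
      using continuous_picard[OF \<alpha>(1) cont supp R, of k] cont supp
      by (auto simp: \<psi>_def[abs_def] intro!: continuous_intros)
    have [measurable]: "\<psi> \<in> borel_measurable borel" by (rule borel_measurable_continuous_onI[OF \<psi>(1)])
    obtain B where B: "\<And>z. z \<in> {0..R} \<Longrightarrow> \<bar>\<psi> z\<bar> \<le> B"
      using compact_imp_bounded[OF compact_continuous_image[OF continuous_on_subset[OF \<psi>(1)] compact_Icc], of 0 R]
      unfolding bounded_iff ball_simps real_norm_def by blast
    have B0: "0 \<le> B" using B[of 0] R by auto
    have \<psi>_exp: "\<bar>\<psi> z\<bar> \<le> B * exp (r * R) * exp (- r * z)" if "0 \<le> z" for z
    proof (cases "R \<le> z")
      case False
      then have "1 \<le> exp (r * R) * exp (- r * z)" using r by (simp add: mult_exp_exp)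
      then have "B * 1 \<le> B * (exp (r * R) * exp (- r * z))" using B0 by (intro mult_left_mono)
      then show ?thesis using B[of z] that False by simp
    qed (use \<psi>(2) B0 in simp)
    define d where "d = e / 4 / exp (r * R)"
    have d: "0 < d" using Suc.prems by (simp add: d_def)
    have small: "\<forall>\<^sub>F n in sequentially. (C\<^sup>2 * V * exp (r * R)) * (1 / b n) * u n < e / 4"
    proof (rule order_tendstoD)
      show "(\<lambda>n. (C\<^sup>2 * V * exp (r * R)) * (1 / b n) * u n) \<longlonglongrightarrow> (C\<^sup>2 * V * exp (r * R)) * 0 * (1 / (2 * C + 1))"
        by (intro tendsto_intros inverse_b u_conv)
    qed (use Suc.prems in simp)
    have bC: "\<forall>\<^sub>F n in sequentially. C \<le> b n"
      using b_top by (simp add: filterlim_at_top)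
    have IH: "\<forall>\<^sub>F n in sequentially. \<forall>x\<ge>0. \<bar>st.fk n R (b n) \<theta> x - picard \<alpha> \<theta> k x\<bar> * exp (r * x) \<le> M / 2 ^ k + e / 2"
      by (rule Suc.IH) (use Suc.prems in simp)
    have PU: "\<forall>\<^sub>F n in sequentially. \<forall>x\<ge>0. \<bar>st.pot n (b n) (\<lambda>y. \<psi> (x + y)) - stable_pot \<alpha> (\<lambda>y. \<psi> (x + y))\<bar> \<le> d"
      by (rule pot_uniform[OF \<psi>(1) _ R d]) (rule \<psi>(2))
    from IH mom small bC Cu lap_eventually[OF r(1)] PU
    show ?case
    proof eventually_elim
      case (elim n)
      let ?v = "st.fk n R (b n) \<theta>" and ?p = "picard \<alpha> \<theta> k"
      note v = st.fk_bounds[OF meas bnd supp R b_pos s conjunct1[OF elim(2)]]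
      have V: "?v x \<le> V" for x using v(2)[of x] elim(2) by simp
      have V0: "0 \<le> V" using v(1)[of 0] V[of 0] by simp
      define \<phi> where "\<phi> z = b n * (1 - exp (- \<theta> z / b n))" for z
      have [measurable]: "\<phi> \<in> borel_measurable borel" unfolding \<phi>_def[abs_def] by measurable
      have \<phi>: "\<bar>\<phi> z - \<theta> z\<bar> \<le> C\<^sup>2 / b n" for z
      proof -
        have "\<bar>\<theta> z / b n\<bar> \<le> 1" using bnd[of z] elim(4) b_pos[of n] by simp
        from one_minus_exp_bound[OF this] have "b n * \<bar>1 - exp (- \<theta> z / b n) - \<theta> z / b n\<bar> \<le> b n * (\<theta> z / b n)\<^sup>2"
          using b_pos[of n] by (intro mult_left_mono) auto
        moreover have "b n * \<bar>1 - exp (- \<theta> z / b n) - \<theta> z / b n\<bar> = \<bar>\<phi> z - \<theta> z\<bar>"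
        proof -
          have "\<phi> z - \<theta> z = b n * (1 - exp (- \<theta> z / b n) - \<theta> z / b n)"
            using b_pos[of n] by (simp add: \<phi>_def right_diff_distrib)
          then show ?thesis using b_pos[of n] by (simp add: abs_mult)
        qed
        moreover have "b n * (\<theta> z / b n)\<^sup>2 \<le> C\<^sup>2 / b n"
          using b_pos[of n] power_mono[OF bnd[of z], of 2] by (simp add: power2_eq_square divide_right_mono)
        ultimately show ?thesis by simp
      qed
      define D where "D z = \<phi> z * ?v z - \<psi> z" for z
      have [measurable]: "D \<in> borel_measurable borel" unfolding D_def[abs_def] by measurable
      define k' where "k' = C\<^sup>2 * V * exp (r * R) * (1 / b n) + C * (M / 2 ^ k + e / 2)"
      have D_exp: "\<bar>D z\<bar> \<le> k' * exp (- r * z)" if z: "0 \<le> z" for z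
      proof (cases "R \<le> z")
        case True
        have "0 \<le> M" using V0 by (simp add: M_def)
        then have "0 \<le> k'" using V0 C b_pos[of n] Suc.prems by (simp add: k'_def less_imp_le)
        then show ?thesis using supp[OF True] by (simp add: D_def \<phi>_def \<psi>_def)
      next
        case False
        have "D z = (\<phi> z - \<theta> z) * ?v z + \<theta> z * (?v z - ?p z)"
          by (simp add: D_def \<psi>_def algebra_simps)
        also have "\<bar>\<dots>\<bar> \<le> \<bar>\<phi> z - \<theta> z\<bar> * ?v z + \<bar>\<theta> z\<bar> * \<bar>?v z - ?p z\<bar>"
          using v(1)[of z] by (intro order_trans[OF abs_triangle_ineq]) (simp add: abs_mult)
        also have "\<dots> \<le> C\<^sup>2 / b n * V + C * \<bar>?v z - ?p z\<bar>"
          using V[of z] v(1)[of z] C b_pos[of n] by (intro add_mono mult_mono \<phi> bnd) auto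
        finally have "\<bar>D z\<bar> * exp (r * z) \<le> (C\<^sup>2 / b n * V + C * \<bar>?v z - ?p z\<bar>) * exp (r * z)"
          by (intro mult_right_mono) auto
        also have "\<dots> = C\<^sup>2 / b n * V * exp (r * z) + C * (\<bar>?v z - ?p z\<bar> * exp (r * z))"
          by (simp add: algebra_simps)
        also have "\<dots> \<le> C\<^sup>2 / b n * V * exp (r * R) + C * (M / 2 ^ k + e / 2)"
          using V0 False r b_pos[of n] C z elim(1) by (intro add_mono mult_left_mono) auto
        finally have "\<bar>D z\<bar> * exp (r * z) \<le> k'" by (simp add: k'_def)
        then have "\<bar>D z\<bar> * exp (r * z) * exp (- r * z) \<le> k' * exp (- r * z)" by (intro mult_right_mono) auto
        then show ?thesis by (simp add: mult.assoc mult_exp_exp)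
      qed
      show ?case
      proof (intro allI impI)
        fix x :: real assume x: "0 \<le> x"
        show "\<bar>?v x - picard \<alpha> \<theta> (Suc k) x\<bar> * exp (r * x) \<le> M / 2 ^ Suc k + e"
        proof (cases "R \<le> x")
          case True
          have "0 \<le> M" using V0 by (simp add: M_def)
          then show ?thesis using beyond[OF True conjunct1[OF elim(2)], of "Suc k"] Suc.prems
            by (simp del: picard.simps add: add_nonneg_nonneg)
        next
          case False
          have D_exp': "\<bar>D (x + y)\<bar> \<le> (k' * exp (- r * x)) * exp (- r * y)" if "0 \<le> y" for y
            using D_exp[of "x + y"] x that by (simp add: mult.assoc mult_exp_exp distrib_left)
          have \<psi>_exp': "\<bar>\<psi> (x + y)\<bar> \<le> (B * exp (r * R)) * exp (- r * y)" if "0 \<le> y" for y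
          proof -
            have "B * exp (r * R) * exp (- r * (x + y)) \<le> B * exp (r * R) * exp (- r * y)"
              using B0 r x by (intro mult_left_mono) auto
            then show ?thesis using \<psi>_exp[of "x + y"] x that by simp
          qed
          have "?v x = 1 + st.pot n (b n) (\<lambda>y. \<phi> (x + y) * ?v (x + y))"
            unfolding \<phi>_def by (rule st.fk_volterra[OF meas bnd supp R b_pos s conjunct1[OF elim(2)] x])
          also have "(\<lambda>y. \<phi> (x + y) * ?v (x + y)) = (\<lambda>y. D (x + y) + \<psi> (x + y))"
            by (simp add: D_def)
          also have "st.pot n (b n) \<dots> = st.pot n (b n) (\<lambda>y. D (x + y)) + st.pot n (b n) (\<lambda>y. \<psi> (x + y))"
            by (rule st.pot_add[where r=r, OF _ _ _ elim(6) b_pos D_exp' \<psi>_exp']) (use r in auto)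
          finally have eq: "?v x - picard \<alpha> \<theta> (Suc k) x = st.pot n (b n) (\<lambda>y. D (x + y)) + (st.pot n (b n) (\<lambda>y. \<psi> (x + y)) - stable_pot \<alpha> (\<lambda>y. \<psi> (x + y)))"
            using x by (simp add: \<psi>_def max_absorb2)
          have "\<bar>st.pot n (b n) (\<lambda>y. D (x + y))\<bar> \<le> k' * exp (- r * x) / (b n * (1 - st.lap n r))"
            by (rule st.pot_bound(2)[OF _ _ elim(6) b_pos D_exp']) (use r in auto)
          then have 1: "\<bar>st.pot n (b n) (\<lambda>y. D (x + y))\<bar> \<le> k' * u n * exp (- r * x)"
            by (simp add: u_def)
          have 2: "\<bar>st.pot n (b n) (\<lambda>y. \<psi> (x + y)) - stable_pot \<alpha> (\<lambda>y. \<psi> (x + y))\<bar> \<le> d"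
            using elim(7) x by blast
          have "\<bar>?v x - picard \<alpha> \<theta> (Suc k) x\<bar> * exp (r * x) \<le> (k' * u n * exp (- r * x) + d) * exp (r * x)"
            unfolding eq using 1 2 by (intro mult_right_mono) auto
          also have "\<dots> = k' * u n + d * exp (r * x)"
            by (simp add: distrib_right mult.assoc mult_exp_exp)
          also have "d * exp (r * x) \<le> d * exp (r * R)"
            using False r d by (intro mult_left_mono) auto
          also have "d * exp (r * R) = e / 4" by (simp add: d_def)
          also have "k' * u n \<le> e / 4 + (M / 2 ^ k + e / 2) / 2"
          proof -
            have le: "(C * u n) * (M / 2 ^ k + e / 2) \<le> 1 / 2 * (M / 2 ^ k + e / 2)"
              using elim(5) V0 Suc.prems by (intro mult_right_mono) (auto simp: M_def)
            have eq: "k' * u n = (C\<^sup>2 * V * exp (r * R)) * (1 / b n) * u n + (C * u n) * (M / 2 ^ k + e / 2)"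
              unfolding k'_def distrib_right[where c="u n"] by (simp only: mult_ac)
            have "Y \<le> e / 4 + X / 2" if "Y = A + B" "B \<le> 1 / 2 * X" "A < e / 4" for A B X Y :: real
              using that by linarith
            from this[OF eq le elim(3)] show ?thesis .
          qed
          also have "e / 4 + (M / 2 ^ k + e / 2) / 2 + e / 4 \<le> M / 2 ^ Suc k + e"
            using Suc.prems by (simp add: add_divide_distrib)
          finally show ?thesis by simp
        qed
      qed
    qed
  qed
  with r(1) show ?thesis by blast
qed

end

lemma fk_universal:
  assumes A: "stable_array \<alpha> \<mu> b" and A': "stable_array \<alpha> \<mu>' b'"
    and cont: "continuous_on UNIV \<theta>" and supp: "\<And>y. R \<le> y \<Longrightarrow> \<theta> y = 0" and R: "0 \<le> R"
    and bnd: "\<And>y. \<bar>\<theta> y\<bar> \<le> C"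
  shows "(\<lambda>n. iid_steps.fk (\<mu> n) R (b n) \<theta> 0 - iid_steps.fk (\<mu>' n) R (b' n) \<theta> 0) \<longlonglongrightarrow> 0"
proof -
  interpret A: stable_array \<alpha> \<mu> b by fact
  interpret A': stable_array \<alpha> \<mu>' b' by fact
  obtain r M where "0 < r" and M: "\<And>k e. 0 < e \<Longrightarrow>
    \<forall>\<^sub>F n in sequentially. \<forall>x\<ge>0. \<bar>A.st.fk n R (b n) \<theta> x - picard \<alpha> \<theta> k x\<bar> * exp (r * x) \<le> M / 2 ^ k + e"
    using A.fk_near_picard[OF cont supp R bnd] by blast
  obtain r' M' where "0 < r'" and M': "\<And>k e. 0 < e \<Longrightarrow>
    \<forall>\<^sub>F n in sequentially. \<forall>x\<ge>0. \<bar>A'.st.fk n R (b' n) \<theta> x - picard \<alpha> \<theta> k x\<bar> * exp (r' * x) \<le> M' / 2 ^ k + e"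
    using A'.fk_near_picard[OF cont supp R bnd] by blast
  show ?thesis
  proof (rule tendstoI)
    fix e :: real assume e: "0 < e"
    have "(\<lambda>k. (M + M') * (1 / 2) ^ k) \<longlonglongrightarrow> (M + M') * 0"
      by (intro tendsto_mult tendsto_const LIMSEQ_power_zero) simp
    then have "\<forall>\<^sub>F k in sequentially. (M + M') * (1 / 2) ^ k < e / 2"
      using order_tendstoD(2)[of _ "(M + M') * 0" _ "e / 2"] e by simp
    then obtain k where k: "(M + M') * (1 / 2) ^ k < e / 2"
      by (auto dest: eventually_happens)
    have e': "0 < e / 4" using e by simp
    from M[OF e', of k] M'[OF e', of k]
    show "\<forall>\<^sub>F n in sequentially. dist (A.st.fk n R (b n) \<theta> 0 - A'.st.fk n R (b' n) \<theta> 0) 0 < e"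
    proof eventually_elim
      case (elim n)
      have "\<bar>A.st.fk n R (b n) \<theta> 0 - picard \<alpha> \<theta> k 0\<bar> \<le> M / 2 ^ k + e / 4"
        "\<bar>A'.st.fk n R (b' n) \<theta> 0 - picard \<alpha> \<theta> k 0\<bar> \<le> M' / 2 ^ k + e / 4"
        using elim[THEN spec, of 0] by auto
      moreover have "M / 2 ^ k + M' / 2 ^ k < e / 2"
        using k by (simp add: power_one_over field_simps)
      ultimately show ?case by (auto simp: dist_real_def)
    qed
  qed
qed

definition first_visit :: "real set \<Rightarrow> nat \<Rightarrow> (nat \<Rightarrow> real) \<Rightarrow> bool" where
  "first_visit C j \<omega> \<longleftrightarrow> pos j \<omega> \<in> C \<and> (\<forall>i<j. pos i \<omega> \<notin> C)"

lemma first_visit_exists: "(\<exists>j. first_visit C j \<omega>) \<longleftrightarrow> (\<exists>j. pos j \<omega> \<in> C)"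
  unfolding first_visit_def using exists_least_iff[of "\<lambda>j. pos j \<omega> \<in> C"] by blast

lemma first_visit_unique: "first_visit C i \<omega> \<Longrightarrow> first_visit C j \<omega> \<Longrightarrow> i = j"
  unfolding first_visit_def by (metis linorder_neqE_nat)

lemma suminf_first_visit:
  "(\<Sum>j. indicator {\<omega>. first_visit C j \<omega>} \<omega> * f j) = (if first_visit C k \<omega> then f k else (0::ennreal))"
  if "\<And>j. first_visit C j \<omega> \<Longrightarrow> j = k"
proof -
  have "(\<Sum>j. indicator {\<omega>. first_visit C j \<omega>} \<omega> * f j) = (\<Sum>j\<in>{k}. indicator {\<omega>. first_visit C j \<omega>} \<omega> * f j)"
    by (rule suminf_finite) (use that in \<open>auto simp: indicator_def\<close>)
  also have "\<dots> = indicator {\<omega>. first_visit C k \<omega>} \<omega> * f k"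
    by (rule trans[OF sum.insert]) auto
  finally show ?thesis by (simp add: indicator_def)
qed

context iid_steps
begin

lemma measurable_first_visit [measurable]:
  assumes [measurable]: "C \<in> sets borel"
  shows "Measurable.pred S (first_visit C j)"
  unfolding first_visit_def[abs_def] by measurable

lemma nn_integral_first_visit:
  assumes [measurable]: "C \<in> sets borel" "G \<in> borel_measurable S"
  shows "(\<integral>\<^sup>+\<omega>. (\<Sum>j. indicator {\<omega>. first_visit C j \<omega>} \<omega> * G (seq_shift j \<omega>)) \<partial>S) =
    emeasure S {\<omega>\<in>space S. \<exists>j. pos j \<omega> \<in> C} * (\<integral>\<^sup>+\<omega>. G \<omega> \<partial>S)"
proof -
  have "(\<integral>\<^sup>+\<omega>. indicator {\<omega>. first_visit C j \<omega>} \<omega> * G (seq_shift j \<omega>) \<partial>S) =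
      (\<integral>\<^sup>+\<omega>. indicator {\<omega>. first_visit C j \<omega>} \<omega> \<partial>S) * (\<integral>\<^sup>+\<omega>. G \<omega> \<partial>S)" for j
  proof -
    let ?X = "\<lambda>\<omega>. indicator {\<omega>. first_visit C j \<omega>} \<omega> :: ennreal"
    have [measurable]: "?X \<in> borel_measurable S"
      by (rule borel_measurable_indicator') simp
    have "(\<integral>\<^sup>+\<omega>. (\<lambda>(x, \<omega>'). x * G \<omega>') (?X \<omega>, seq_shift j \<omega>) \<partial>S) =
      (\<integral>\<^sup>+\<omega>. \<integral>\<^sup>+\<omega>'. (\<lambda>(x, \<omega>'). x * G \<omega>') (?X \<omega>, \<omega>') \<partial>S \<partial>S)"
      by (rule nn_integral_seq_shift[where N=borel])
        (auto simp: first_visit_def pos_comb_seq indicator_def)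
    then show ?thesis
      by (simp add: nn_integral_cmult nn_integral_multc)
  qed
  then have "(\<integral>\<^sup>+\<omega>. (\<Sum>j. indicator {\<omega>. first_visit C j \<omega>} \<omega> * G (seq_shift j \<omega>)) \<partial>S) =
      (\<Sum>j. (\<integral>\<^sup>+\<omega>. indicator {\<omega>. first_visit C j \<omega>} \<omega> \<partial>S) * (\<integral>\<^sup>+\<omega>. G \<omega> \<partial>S))"
    by (subst nn_integral_suminf) auto
  also have "\<dots> = (\<Sum>j. \<integral>\<^sup>+\<omega>. indicator {\<omega>. first_visit C j \<omega>} \<omega> \<partial>S) * (\<integral>\<^sup>+\<omega>. G \<omega> \<partial>S)"
    by (rule ennreal_suminf_multc)
  also have "(\<Sum>j. \<integral>\<^sup>+\<omega>. indicator {\<omega>. first_visit C j \<omega>} \<omega> \<partial>S) = (\<integral>\<^sup>+\<omega>. (\<Sum>j. indicator {\<omega>. first_visit C j \<omega>} \<omega>) \<partial>S)"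
    by (subst nn_integral_suminf) auto
  also have "\<dots> = (\<integral>\<^sup>+\<omega>. indicator {\<omega>\<in>space S. \<exists>j. pos j \<omega> \<in> C} \<omega> \<partial>S)"
  proof (rule nn_integral_cong)
    fix \<omega> assume "\<omega> \<in> space S"
    show "(\<Sum>j. indicator {\<omega>. first_visit C j \<omega>} \<omega>) = (indicator {\<omega>\<in>space S. \<exists>j. pos j \<omega> \<in> C} \<omega> :: ennreal)"
    proof (cases "\<exists>j. first_visit C j \<omega>")
      case True
      then obtain k where k: "first_visit C k \<omega>" by blast
      have "(\<Sum>j. indicator {\<omega>. first_visit C j \<omega>} \<omega>) = (\<Sum>j. indicator {\<omega>. first_visit C j \<omega>} \<omega> * (1::ennreal))"
        by simp
      also have "\<dots> = 1"
        by (rule trans[OF suminf_first_visit[of C \<omega> k "\<lambda>_. 1", OF first_visit_unique[OF _ k]] if_P[OF k]])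
      finally have one: "(\<Sum>j. indicator {\<omega>. first_visit C j \<omega>} \<omega>) = (1::ennreal)" .
      have "\<omega> \<in> {\<omega>\<in>space S. \<exists>j. pos j \<omega> \<in> C}"
        using True \<open>\<omega> \<in> space S\<close> unfolding first_visit_exists by simp
      then show ?thesis unfolding one by (simp only: indicator_simps)
    next
      case False
      then have "\<omega> \<notin> {\<omega>\<in>space S. \<exists>j. pos j \<omega> \<in> C}" "\<And>j. \<omega> \<notin> {\<omega>. first_visit C j \<omega>}"
        unfolding first_visit_exists[symmetric] by auto
      then have "(\<Sum>j. indicator {\<omega>. first_visit C j \<omega>} \<omega>) = (\<Sum>j. (0::ennreal))"
        by - (rule suminf_cong, rule indicator_simps(2), blast)
      moreover have "(indicator {\<omega>\<in>space S. \<exists>j. pos j \<omega> \<in> C} \<omega> :: ennreal) = 0"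
        by (rule indicator_simps(2)) fact
      ultimately show ?thesis by (simp only: suminf_zero)
    qed
  qed
  also have "\<dots> = emeasure S {\<omega>\<in>space S. \<exists>j. pos j \<omega> \<in> C}"
    by (rule nn_integral_indicator) measurable
  finally show ?thesis .
qed

lemma prob_sparse_after_first_visit:
  assumes [measurable]: "C \<in> sets borel"
  shows "P.prob {\<omega>\<in>space S. \<exists>j. first_visit C j \<omega> \<and> real (visits h (seq_shift j \<omega>)) < q}
    \<le> P.prob {\<omega>\<in>space S. real (visits h \<omega>) < q}"
proof -
  let ?D = "{\<omega>\<in>space S. real (visits h \<omega>) < q}"
  have [measurable]: "(\<lambda>\<omega>. real (visits h \<omega>)) \<in> borel_measurable S"
    by (rule measurable_compose[OF measurable_visits]) simp
  have [measurable]: "?D \<in> sets S" by measurable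
  let ?E = "{\<omega>\<in>space S. \<exists>j. first_visit C j \<omega> \<and> real (visits h (seq_shift j \<omega>)) < q}"
  have [measurable]: "(\<lambda>\<omega>. real (visits h (seq_shift j \<omega>))) \<in> borel_measurable S" for j
    by (rule measurable_compose[OF measurable_seq_shift]) simp
  have [measurable]: "?E \<in> sets S" by measurable
  have "emeasure S ?E = (\<integral>\<^sup>+\<omega>. indicator ?E \<omega> \<partial>S)"
    by simp
  also have "\<dots> \<le> (\<integral>\<^sup>+\<omega>. (\<Sum>j. indicator {\<omega>. first_visit C j \<omega>} \<omega> * indicator ?D (seq_shift j \<omega>)) \<partial>S)"
  proof (rule nn_integral_mono)
    fix \<omega> assume \<omega>: "\<omega> \<in> space S"
    show "indicator ?E \<omega> \<le> (\<Sum>j. indicator {\<omega>. first_visit C j \<omega>} \<omega> * indicator ?D (seq_shift j \<omega>) :: ennreal)"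
    proof (cases "\<omega> \<in> ?E")
      case True
      then obtain k where k: "first_visit C k \<omega>" "real (visits h (seq_shift k \<omega>)) < q" by blast
      have "seq_shift k \<omega> \<in> space S" using measurable_space[OF measurable_seq_shift \<omega>] .
      have "(\<Sum>j. indicator {\<omega>. first_visit C j \<omega>} \<omega> * indicator ?D (seq_shift j \<omega>)) =
          (if first_visit C k \<omega> then indicator ?D (seq_shift k \<omega>) else (0::ennreal))"
        by (rule suminf_first_visit) (rule first_visit_unique[OF _ k(1)])
      also have "\<dots> = 1" using k \<open>seq_shift k \<omega> \<in> space S\<close> by simp
      finally have one: "(\<Sum>j. indicator {\<omega>. first_visit C j \<omega>} \<omega> * indicator ?D (seq_shift j \<omega>)) = (1::ennreal)" .
      show ?thesis unfolding one by (simp add: indicator_def)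
    qed simp
  qed
  also have "\<dots> = emeasure S {\<omega>\<in>space S. \<exists>j. pos j \<omega> \<in> C} * (\<integral>\<^sup>+\<omega>. indicator ?D \<omega> \<partial>S)"
    by (rule nn_integral_first_visit) auto
  also have "\<dots> \<le> 1 * emeasure S ?D"
    by (intro mult_mono P.emeasure_le_1) auto
  finally show ?thesis
    by (simp add: P.emeasure_eq_measure)
qed

lemma nn_integral_pot:
  assumes [measurable]: "\<psi> \<in> borel_measurable borel" and r: "0 \<le> r" "lap r < 1" and b: "0 < b"
    and nonneg: "\<And>y. 0 \<le> \<psi> y" and bnd: "\<And>y. 0 \<le> y \<Longrightarrow> \<bar>\<psi> y\<bar> \<le> c * exp (- r * y)"
  shows "(\<integral>\<^sup>+\<omega>. (\<Sum>j. ennreal (\<psi> (pos j \<omega>))) \<partial>S) = ennreal (b * pot b \<psi>)"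
proof -
  have "(\<integral>\<^sup>+\<omega>. (\<Sum>j. ennreal (\<psi> (pos j \<omega>))) \<partial>S) = (\<Sum>j. \<integral>\<^sup>+\<omega>. ennreal (\<psi> (pos j \<omega>)) \<partial>S)"
    by (rule nn_integral_suminf) measurable
  also have "\<dots> = (\<Sum>j. ennreal (\<integral>\<omega>. \<psi> (pos j \<omega>) \<partial>S))"
    by (intro suminf_cong nn_integral_eq_integral integrable_pos(1)[OF assms(1) r(1) bnd]) (auto simp: nonneg)
  also have "\<dots> = ennreal (\<Sum>j. \<integral>\<omega>. \<psi> (pos j \<omega>) \<partial>S)"
    by (rule suminf_ennreal2) (auto simp: nonneg intro!: Bochner_Integration.integral_nonneg pot_bound(1)[OF assms(1) r b bnd])
  also have "(\<Sum>j. \<integral>\<omega>. \<psi> (pos j \<omega>) \<partial>S) = b * pot b \<psi>"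
    unfolding pot_def using b by (metis less_irrefl nonzero_mult_div_cancel_left times_divide_eq_right)
  finally show ?thesis .
qed

text \<open>Renewal at the first visit to \<open>{a..c}\<close>: each visit there is followed by the points of a fresh
  walk, and those at distance at most \<open>h\<close> land in \<open>{a..c + h}\<close>.\<close>

lemma prob_hit_mult_pot_le:
  assumes [measurable]: "f \<in> borel_measurable borel" "g \<in> borel_measurable borel"
    and r: "0 \<le> r" "lap r < 1" and b: "0 < b"
    and f: "\<And>y. 0 \<le> f y" "\<And>y. a \<le> y \<Longrightarrow> y \<le> c + h \<Longrightarrow> 1 \<le> f y" "\<And>y. 0 \<le> y \<Longrightarrow> \<bar>f y\<bar> \<le> kf * exp (- r * y)"
    and g: "\<And>y. 0 \<le> g y" "\<And>y. g y \<le> 1" "\<And>y. h < y \<Longrightarrow> g y = 0" "\<And>y. 0 \<le> y \<Longrightarrow> \<bar>g y\<bar> \<le> kg * exp (- r * y)"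
  shows "P.prob {\<omega>\<in>space S. \<exists>j. pos j \<omega> \<in> {a..c}} * pot b g \<le> pot b f"
proof -
  let ?G = "\<lambda>\<omega>. (\<Sum>i. ennreal (g (pos i \<omega>)))"
  have pnn: "0 \<le> pot b f" "0 \<le> pot b g"
    unfolding pot_def using b f(1) g(1) pot_bound(1)[OF assms(1) r b f(3)] pot_bound(1)[OF assms(2) r b g(4)]
    by (auto intro!: divide_nonneg_pos suminf_nonneg Bochner_Integration.integral_nonneg)
  have "emeasure S {\<omega>\<in>space S. \<exists>j. pos j \<omega> \<in> {a..c}} * (\<integral>\<^sup>+\<omega>. ?G \<omega> \<partial>S) =
      (\<integral>\<^sup>+\<omega>. (\<Sum>j. indicator {\<omega>. first_visit {a..c} j \<omega>} \<omega> * ?G (seq_shift j \<omega>)) \<partial>S)"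
    by (rule nn_integral_first_visit[symmetric]) measurable
  also have "\<dots> \<le> (\<integral>\<^sup>+\<omega>. (\<Sum>i. ennreal (f (pos i \<omega>))) \<partial>S)"
  proof (rule nn_integral_mono)
    fix \<omega> assume "\<omega> \<in> space S"
    show "(\<Sum>j. indicator {\<omega>. first_visit {a..c} j \<omega>} \<omega> * ?G (seq_shift j \<omega>)) \<le> (\<Sum>i. ennreal (f (pos i \<omega>)))"
    proof (cases "\<exists>j. first_visit {a..c} j \<omega>")
      case False
      then show ?thesis by simp
    next
      case True
      then obtain k where k: "first_visit {a..c} k \<omega>" by blast
      have p: "a \<le> pos k \<omega>" "pos k \<omega> \<le> c" using k by (auto simp: first_visit_def)
      have "(\<Sum>j. indicator {\<omega>. first_visit {a..c} j \<omega>} \<omega> * ?G (seq_shift j \<omega>)) = ?G (seq_shift k \<omega>)"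
        by (rule trans[OF suminf_first_visit[of "{a..c}" \<omega> k "\<lambda>j. ?G (seq_shift j \<omega>)", OF first_visit_unique[OF _ k]] if_P[OF k]])
      also have "\<dots> \<le> (\<Sum>i. ennreal (f (pos (i + k) \<omega>)))"
      proof (intro suminf_le summableI ennreal_leI)
        fix i
        show "g (pos i (seq_shift k \<omega>)) \<le> f (pos (i + k) \<omega>)"
        proof (cases "h < pos i (seq_shift k \<omega>)")
          case True
          then show ?thesis using g(3) f(1) by simp
        next
          case False
          then have "1 \<le> f (pos (i + k) \<omega>)"
            using p by (intro f(2)) (auto simp: pos_add add_increasing2)
          then show ?thesis using g(2) order_trans by blast
        qed
      qed
      also have "\<dots> \<le> (\<Sum>i. ennreal (f (pos i \<omega>)))"
        using suminf_offset[OF summableI, of "\<lambda>i. ennreal (f (pos i \<omega>))" k] by simp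
      finally show ?thesis .
    qed
  qed
  finally have "ennreal (P.prob {\<omega>\<in>space S. \<exists>j. pos j \<omega> \<in> {a..c}}) * ennreal (b * pot b g) \<le> ennreal (b * pot b f)"
    using nn_integral_pot[OF assms(1) r b f(1) f(3)] nn_integral_pot[OF assms(2) r b g(1) g(4)]
    by (simp add: P.emeasure_eq_measure)
  then have "P.prob {\<omega>\<in>space S. \<exists>j. pos j \<omega> \<in> {a..c}} * (b * pot b g) \<le> b * pot b f"
    using pnn b by (simp add: ennreal_mult[symmetric] ennreal_le_iff)
  then show ?thesis using b by (simp add: mult.left_commute)
qed

lemma prob_few_visits:
  assumes "0 < h" "0 < s" "lap s < 1"
  shows "P.prob {\<omega>\<in>space S. real (visits h \<omega>) < q} \<le> 2 * max 0 q * (1 - lap (1 / h))"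
proof -
  let ?k = "nat \<lfloor>q\<rfloor>"
  have [measurable]: "(\<lambda>\<omega>. real (visits h \<omega>)) \<in> borel_measurable S"
    by (rule measurable_compose[OF measurable_visits]) simp
  have l1: "lap (1 / h) \<le> 1"
  proof -
    have "lap (1 / h) = (\<integral>\<omega>. exp (- (1 / h) * pos 1 \<omega>) \<partial>S)"
      using integral_exp_pos(2)[of "1 / h" 1] assms by simp
    also have "\<dots> \<le> (\<integral>\<omega>. 1 \<partial>S)"
      using assms integral_exp_pos(1)[of "1 / h" 1] by (intro integral_mono) auto
    finally show ?thesis by (simp add: P.prob_space)
  qed
  have i: "integrable S (\<lambda>\<omega>. 2 * (1 - exp (- (1 / h) * pos ?k \<omega>)))"
    using integral_exp_pos(1)[of "1 / h" ?k] assms by simp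
  have "P.prob {\<omega>\<in>space S. real (visits h \<omega>) < q} = (\<integral>\<omega>. indicator {\<omega>\<in>space S. real (visits h \<omega>) < q} \<omega> \<partial>S)"
    by simp
  also have "\<dots> \<le> (\<integral>\<omega>. 2 * (1 - exp (- (1 / h) * pos ?k \<omega>)) \<partial>S)"
  proof (rule integral_mono_AE[OF _ i])
    show "integrable S (indicator {\<omega>\<in>space S. real (visits h \<omega>) < q} :: _ \<Rightarrow> real)"
      by (rule integrable_real_indicator) (auto simp: less_top[symmetric])
    show "AE \<omega> in S. indicator {\<omega>\<in>space S. real (visits h \<omega>) < q} \<omega> \<le> 2 * (1 - exp (- (1 / h) * pos ?k \<omega>))"
      using AE_finite_visits[OF assms(2,3)]
    proof eventually_elim
      case (elim \<omega>)
      show ?case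
      proof (cases "real (visits h \<omega>) < q")
        case False
        then show ?thesis using assms by simp
      next
        case True
        then have "visits h \<omega> \<le> ?k" by linarith
        then have "?k \<notin> {..<visits h \<omega>}" by simp
        then have "h < pos ?k \<omega>"
          using visited_indices_eq[of \<omega> h] elim by (metis mem_Collect_eq not_le)
        then have "exp (- (1 / h) * pos ?k \<omega>) \<le> exp (- 1)"
          using assms by (simp add: field_simps)
        moreover have "exp (- 1) \<le> 1 / (2::real)"
          using exp_ge_add_one_self[of 1] by (simp add: exp_minus field_simps)
        ultimately have "exp (- (1 / h) * pos ?k \<omega>) \<le> 1 / 2" by (rule order_trans)
        then have "1 \<le> 2 * (1 - exp (- (1 / h) * pos ?k \<omega>))" by simp
        then show ?thesis by (rule order_trans[OF indicator_le_1])
      qed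
    qed
  qed
  also have "\<dots> = 2 * (1 - lap (1 / h) ^ ?k)"
    using integral_exp_pos[of "1 / h" ?k] assms by (simp add: P.prob_space)
  also have "\<dots> \<le> 2 * (?k * (1 - lap (1 / h)))"
  proof -
    have "1 + real ?k * (lap (1 / h) - 1) \<le> (1 + (lap (1 / h) - 1)) ^ ?k"
      by (rule Bernoulli_inequality) simp
    then show ?thesis by (simp add: algebra_simps)
  qed
  also have "\<dots> \<le> 2 * (max 0 q * (1 - lap (1 / h)))"
  proof -
    have "real ?k \<le> max 0 q" by linarith
    then show ?thesis using l1 by (intro mult_left_mono mult_right_mono) auto
  qed
  finally show ?thesis by simp
qed

end

context stable_array
begin

lemma prob_few_visits_eventually:
  assumes "0 < h" "0 < e"
  obtains q where "0 < q" "\<forall>\<^sub>F n in sequentially. st.P.prob n {\<omega>\<in>space (Pi\<^sub>M UNIV (\<lambda>_. \<mu> n)). real (visits h \<omega>) < q * b n} \<le> e"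
proof -
  define l where "l = (1 / h) powr \<alpha>"
  have l: "0 < l" using assms by (simp add: l_def)
  define q where "q = e / (4 * l)"
  have q: "0 < q" using assms l by (simp add: q_def)
  have "\<forall>\<^sub>F n in sequentially. b n * (1 - st.lap n (1 / h)) < 2 * l"
    by (rule order_tendstoD(2)[OF lap_conv]) (use assms l in \<open>auto simp: l_def\<close>)
  with lap_eventually[OF zero_less_one]
  have "\<forall>\<^sub>F n in sequentially. st.P.prob n {\<omega>\<in>space (Pi\<^sub>M UNIV (\<lambda>_. \<mu> n)). real (visits h \<omega>) < q * b n} \<le> e"
  proof eventually_elim
    case (elim n)
    have "st.P.prob n {\<omega>\<in>space (Pi\<^sub>M UNIV (\<lambda>_. \<mu> n)). real (visits h \<omega>) < q * b n} \<le> 2 * max 0 (q * b n) * (1 - st.lap n (1 / h))"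
      by (rule st.prob_few_visits[OF assms(1) zero_less_one elim(1)])
    also have "\<dots> = 2 * q * (b n * (1 - st.lap n (1 / h)))"
      using q b_pos[of n] by (simp add: max_def not_le)
    also have "\<dots> \<le> 2 * q * (2 * l)"
      using elim(2) q by (intro mult_left_mono) auto
    also have "\<dots> = e" using l by (simp add: q_def)
    finally show ?case .
  qed
  with q show ?thesis by (rule that)
qed

end

definition trapezoid :: "real \<Rightarrow> real \<Rightarrow> real \<Rightarrow> real \<Rightarrow> real" where
  "trapezoid u v d y = max 0 (min 1 (min ((y - u) / d + 1) ((v - y) / d + 1)))"

lemma trapezoid:
  assumes "0 < d"
  shows "continuous_on UNIV (trapezoid u v d)" "0 \<le> trapezoid u v d y" "trapezoid u v d y \<le> 1"
    "u \<le> y \<Longrightarrow> y \<le> v \<Longrightarrow> trapezoid u v d y = 1"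
    "y \<le> u - d \<Longrightarrow> trapezoid u v d y = 0" "v + d \<le> y \<Longrightarrow> trapezoid u v d y = 0"
proof -
  show "continuous_on UNIV (trapezoid u v d)"
    unfolding trapezoid_def[abs_def] using assms by (intro continuous_intros) auto
  show "0 \<le> trapezoid u v d y" "trapezoid u v d y \<le> 1" by (auto simp: trapezoid_def)
  show "trapezoid u v d y = 1" if "u \<le> y" "y \<le> v" using that assms by (simp add: trapezoid_def)
  show "trapezoid u v d y = 0" if "y \<le> u - d"
  proof -
    have "(y - u) / d + 1 \<le> 0" using that assms by (simp add: field_simps)
    then show ?thesis by (simp add: trapezoid_def)
  qed
  show "trapezoid u v d y = 0" if "v + d \<le> y"
  proof -
    have "(v - y) / d + 1 \<le> 0" using that assms by (simp add: field_simps)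
    then show ?thesis by (simp add: trapezoid_def)
  qed
qed

lemma stable_pot_interval_le:
  assumes "0 < \<alpha>" "\<alpha> < 1" "1 / 2 \<le> u" "u \<le> v" "\<And>y. 0 \<le> f y" "\<And>y. f y \<le> 1"
    "\<And>y. y < u \<Longrightarrow> f y = 0" "\<And>y. v < y \<Longrightarrow> f y = 0" and [measurable]: "f \<in> borel_measurable borel"
  shows "stable_pot \<alpha> f \<le> 2 / Gamma \<alpha> * (v - u)"
proof -
  have G: "0 < Gamma \<alpha>" using Gamma_real_pos[OF assms(1)] .
  have i: "integrable lborel (\<lambda>y. 2 / Gamma \<alpha> * indicator {u..v} y :: real)"
    by (intro integrable_mult_right integrable_real_indicator) (use assms(4) in auto)
  have le: "stable_density \<alpha> y * f y \<le> 2 / Gamma \<alpha> * indicator {u..v} y" for y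
  proof (cases "y \<in> {u..v}")
    case True
    have "y powr (\<alpha> - 1) \<le> (1 / 2) powr (\<alpha> - 1)"
      using assms True by (intro powr_mono2') auto
    also have "\<dots> = 2 powr (1 - \<alpha>)"
      by (simp add: powr_divide powr_diff powr_minus)
    also have "\<dots> \<le> 2 powr 1"
      using assms by (intro powr_mono) auto
    finally have "y powr (\<alpha> - 1) * f y \<le> 2 * 1"
      using assms by (intro mult_mono) auto
    then show ?thesis
      using True assms G by (simp add: stable_density_def divide_right_mono)
  next
    case False
    then show ?thesis using assms(7)[of y] assms(8)[of y] by (auto simp: not_le)
  qed
  have nn: "0 \<le> stable_density \<alpha> y * f y" for y
    using stable_density_nonneg[OF assms(1), of y] assms(5)[of y] by simp
  have "stable_pot \<alpha> f \<le> (\<integral>y. 2 / Gamma \<alpha> * indicator {u..v} y \<partial>lborel)"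
    unfolding stable_pot_def
  proof (rule integral_mono[OF _ i le])
    show "integrable lborel (\<lambda>y. stable_density \<alpha> y * f y)"
      by (rule Bochner_Integration.integrable_bound[OF i])
        (measurable, intro AE_I2, use le nn in \<open>simp only: real_norm_def abs_of_nonneg[OF nn] order_trans[OF le abs_ge_self]\<close>)
  qed
  also have "\<dots> = 2 / Gamma \<alpha> * (v - u)"
    using assms by simp
  finally show ?thesis .
qed

lemma stable_pot_initial_ge:
  assumes "0 < \<alpha>" "\<alpha> < 1" "0 < u" "\<And>y. 0 \<le> f y" "\<And>y. f y \<le> 1"
    "\<And>y. 0 \<le> y \<Longrightarrow> y \<le> u \<Longrightarrow> f y = 1" "\<And>y. v < y \<Longrightarrow> f y = 0" "0 \<le> v" and [measurable]: "f \<in> borel_measurable borel"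
  shows "u powr \<alpha> / Gamma \<alpha> \<le> stable_pot \<alpha> f"
proof -
  have G: "0 < Gamma \<alpha>" using Gamma_real_pos[OF assms(1)] .
  have i: "integrable lborel (\<lambda>y. u powr (\<alpha> - 1) / Gamma \<alpha> * indicator {0<..u} y :: real)"
    by (intro integrable_mult_right integrable_real_indicator) (use assms(3) in auto)
  have le: "u powr (\<alpha> - 1) / Gamma \<alpha> * indicator {0<..u} y \<le> stable_density \<alpha> y * f y" for y
  proof (cases "y \<in> {0<..u}")
    case True
    have "u powr (\<alpha> - 1) \<le> y powr (\<alpha> - 1)"
      using assms True by (intro powr_mono2') auto
    then show ?thesis
      using True assms G by (simp add: stable_density_def divide_right_mono)
  next
    case False
    then show ?thesis using stable_density_nonneg[OF assms(1), of y] assms(4)[of y] by simp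
  qed
  have "\<bar>f y\<bar> \<le> exp v * exp (- 1 * y)" if "0 \<le> y" for y
    using assms(4,5,7)[of y] that by (cases "v < y") (auto simp: mult_exp_exp intro: order_trans[of _ 1])
  then have i2: "integrable lborel (\<lambda>y. stable_density \<alpha> y * f y)"
    by (rule stable_pot_integrable(1)[OF assms(1) zero_less_one assms(9)])
  have "u powr \<alpha> / Gamma \<alpha> = (\<integral>y. u powr (\<alpha> - 1) / Gamma \<alpha> * indicator {0<..u} y \<partial>lborel)"
    using assms by (simp add: powr_mult_base[symmetric] powr_diff)
  also have "\<dots> \<le> stable_pot \<alpha> f"
    unfolding stable_pot_def by (rule integral_mono[OF i i2 le])
  finally show ?thesis .
qed

context stable_array
begin

lemma prob_hit_near_one:
  assumes "0 < e"
  obtains d where "0 < d" "\<forall>\<^sub>F n in sequentially. st.P.prob n {\<omega>\<in>space (Pi\<^sub>M UNIV (\<lambda>_. \<mu> n)). \<exists>j. pos j \<omega> \<in> {1 - d..1 + d}} \<le> e"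
proof -
  define d where "d = min (1 / 16) ((e / 32) powr (1 / (1 - \<alpha>)))"
  have d0: "0 < d" "d < 1 / 8" using assms by (auto simp: d_def)
  have "d powr (1 - \<alpha>) \<le> ((e / 32) powr (1 / (1 - \<alpha>))) powr (1 - \<alpha>)"
    using d0 \<alpha> by (intro powr_mono2) (auto simp: d_def)
  also have "\<dots> = e / 32" using \<alpha> assms by (simp add: powr_powr)
  finally have d: "16 * d powr (1 - \<alpha>) < e" "d < 1 / 8" "0 < d" using d0 assms by auto
  define f where "f = trapezoid (1 - d) (1 + 3 * d) d"
  define g where "g = trapezoid 0 d d"
  note F = trapezoid[OF d(3), where u="1 - d" and v="1 + 3 * d", folded f_def]
  note Gt = trapezoid[OF d(3), where u=0 and v=d, folded g_def]
  have [measurable]: "f \<in> borel_measurable borel" "g \<in> borel_measurable borel"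
    using F(1) Gt(1) by (auto intro: borel_measurable_continuous_onI)
  have G: "0 < Gamma \<alpha>" using Gamma_real_pos[OF \<alpha>(1)] .
  have fe: "\<bar>f y\<bar> \<le> exp 2 * exp (- 1 * y)" if "0 \<le> y" for y
    using F(2,3)[of y] F(6)[of y] d by (cases "2 < y") (auto simp: mult_exp_exp intro: order_trans[of _ 1])
  have ge: "\<bar>g y\<bar> \<le> exp 2 * exp (- 1 * y)" if "0 \<le> y" for y
    using Gt(2,3)[of y] Gt(6)[of y] d by (cases "2 < y") (auto simp: mult_exp_exp intro: order_trans[of _ 1])
  have f_le: "stable_pot \<alpha> f \<le> 2 / Gamma \<alpha> * (6 * d)"
    using stable_pot_interval_le[OF \<alpha>, of "1 - 2 * d" "1 + 4 * d" f] F d by auto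
  have g_ge: "d powr \<alpha> / Gamma \<alpha> \<le> stable_pot \<alpha> g"
    using stable_pot_initial_ge[OF \<alpha>, of d g "2 * d"] Gt d by auto
  have conv: "(\<lambda>n. st.pot n (b n) \<psi>) \<longlonglongrightarrow> stable_pot \<alpha> \<psi>" if "continuous_on UNIV \<psi>" "\<And>y. 2 \<le> y \<Longrightarrow> \<psi> y = 0" for \<psi>
  proof (rule tendstoI)
    fix e :: real assume "0 < e"
    then have "\<forall>\<^sub>F n in sequentially. \<forall>x\<ge>0. \<bar>st.pot n (b n) (\<lambda>y. \<psi> (x + y)) - stable_pot \<alpha> (\<lambda>y. \<psi> (x + y))\<bar> \<le> e / 2"
      by (intro pot_uniform[where R=2] that) auto
    then show "\<forall>\<^sub>F n in sequentially. dist (st.pot n (b n) \<psi>) (stable_pot \<alpha> \<psi>) < e"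
    proof eventually_elim
      case (elim n)
      from elim[rule_format, of 0] show ?case using \<open>0 < e\<close> by (simp add: dist_real_def)
    qed
  qed
  have "0 < d powr \<alpha> / Gamma \<alpha>" using d G by simp
  then have gpos: "0 < stable_pot \<alpha> g" using g_ge by linarith
  have "(\<lambda>n. st.pot n (b n) f / st.pot n (b n) g) \<longlonglongrightarrow> stable_pot \<alpha> f / stable_pot \<alpha> g"
    using gpos F(6) Gt(6) d by (intro tendsto_divide conv F(1) Gt(1)) auto
  moreover have "stable_pot \<alpha> f / stable_pot \<alpha> g < e"
  proof -
    have "stable_pot \<alpha> f / stable_pot \<alpha> g \<le> (2 / Gamma \<alpha> * (6 * d)) / (d powr \<alpha> / Gamma \<alpha>)"
      using f_le g_ge gpos d G by (intro frac_le) auto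
    also have "\<dots> = 12 * d powr (1 - \<alpha>)"
      using d G by (simp add: powr_diff)
    also have "\<dots> \<le> 16 * d powr (1 - \<alpha>)" by simp
    finally show ?thesis using d(1) by linarith
  qed
  ultimately have "\<forall>\<^sub>F n in sequentially. st.pot n (b n) f / st.pot n (b n) g < e"
    by (rule order_tendstoD(2))
  moreover have "\<forall>\<^sub>F n in sequentially. 0 < st.pot n (b n) g"
    by (rule order_tendstoD(1)[OF conv gpos]) (use Gt d in auto)
  ultimately have "\<forall>\<^sub>F n in sequentially. st.P.prob n {\<omega>\<in>space (Pi\<^sub>M UNIV (\<lambda>_. \<mu> n)). \<exists>j. pos j \<omega> \<in> {1 - d..1 + d}} \<le> e"
    using lap_eventually[OF zero_less_one]
  proof eventually_elim
    case (elim n)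
    have "st.P.prob n {\<omega>\<in>space (Pi\<^sub>M UNIV (\<lambda>_. \<mu> n)). \<exists>j. pos j \<omega> \<in> {1 - d..1 + d}} * st.pot n (b n) g \<le> st.pot n (b n) f"
      by (rule st.prob_hit_mult_pot_le[where h="2 * d" and r=1 and kf="exp 2" and kg="exp 2"])
        (use F Gt fe ge d elim(3) b_pos in auto)
    then have "st.P.prob n {\<omega>\<in>space (Pi\<^sub>M UNIV (\<lambda>_. \<mu> n)). \<exists>j. pos j \<omega> \<in> {1 - d..1 + d}} \<le> st.pot n (b n) f / st.pot n (b n) g"
      using elim(2) by (simp add: field_simps)
    with elim(1) show ?case by linarith
  qed
  with d(3) show ?thesis by (rule that)
qed

end

section \<open>The Matheron topology\<close>

definition close_sets :: "real \<Rightarrow> real set \<Rightarrow> real set \<Rightarrow> bool" where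
  "close_sets d F G \<longleftrightarrow> (\<forall>x\<in>F. \<exists>y\<in>G. \<bar>x - y\<bar> \<le> d) \<and> (\<forall>y\<in>G. \<exists>x\<in>F. \<bar>x - y\<bar> \<le> d)"

lemma matheron_induct [consumes 1, case_names Empty Int UN Hit Miss]:
  assumes "openin matheron U"
    and "P {}" "\<And>U V. P U \<Longrightarrow> P V \<Longrightarrow> P (U \<inter> V)" "\<And>K. (\<And>U. U \<in> K \<Longrightarrow> P U) \<Longrightarrow> P (\<Union>K)"
    and "\<And>G. open G \<Longrightarrow> P {F \<in> closed_unit_sets. F \<inter> G \<noteq> {}}"
    and "\<And>C. compact C \<Longrightarrow> P {F \<in> closed_unit_sets. F \<inter> C = {}}"
  shows "P U"
proof -
  have "generate_topology_on ({{F \<in> closed_unit_sets. F \<inter> G \<noteq> {}} | G. open G} \<union>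
      {{F \<in> closed_unit_sets. F \<inter> C = {}} | C. compact C}) U"
    using assms(1) unfolding matheron_def by (rule openin_topology_generated_by)
  then show ?thesis
    by induction (use assms(2-) in auto)
qed

lemma openin_matheron_hit: "open G \<Longrightarrow> openin matheron {F \<in> closed_unit_sets. F \<inter> G \<noteq> {}}"
  unfolding matheron_def by (rule topology_generated_by_Basis) blast

lemma openin_matheron_miss: "compact C \<Longrightarrow> openin matheron {F \<in> closed_unit_sets. F \<inter> C = {}}"
  unfolding matheron_def by (rule topology_generated_by_Basis) blast

lemma subbase_topology_eq:
  "topology (arbitrary union_of (finite intersection_of (\<lambda>x. x \<in> \<B>) relative_to \<Union>\<B>)) = topology_generated_by \<B>"
  unfolding topology_eq
proof (intro allI iffI)
  fix U
  assume "openin (topology (arbitrary union_of (finite intersection_of (\<lambda>x. x \<in> \<B>) relative_to \<Union>\<B>))) U"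
  then have "(arbitrary union_of (finite intersection_of (\<lambda>x. x \<in> \<B>) relative_to \<Union>\<B>)) U"
    by (simp add: openin_subbase)
  then obtain K where U: "U = \<Union>K" and K: "\<And>k. k \<in> K \<Longrightarrow> (finite intersection_of (\<lambda>x. x \<in> \<B>) relative_to \<Union>\<B>) k"
    by (auto simp: union_of_def)
  have "openin (topology_generated_by \<B>) k" if "k \<in> K" for k
  proof -
    note k = K[OF that]
    obtain \<F> where \<F>: "finite \<F>" "\<F> \<subseteq> \<B>" "k = \<Union>\<B> \<inter> \<Inter>\<F>"
      using k by (auto simp: relative_to_def intersection_of_def)
    have "openin (topology_generated_by \<B>) (topspace (topology_generated_by \<B>) \<inter> \<Inter>\<F>)"
      using \<F> by (intro openin_Int_Inter) (auto intro: topology_generated_by_Basis)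
    then show ?thesis using \<F>(3) by simp
  qed
  then show "openin (topology_generated_by \<B>) U" unfolding U by blast
next
  fix U
  assume "openin (topology_generated_by \<B>) U"
  then have gen: "generate_topology_on \<B> U" by (rule openin_topology_generated_by)
  have "(arbitrary union_of (finite intersection_of (\<lambda>x. x \<in> \<B>) relative_to \<Union>\<B>)) s" if "s \<in> \<B>" for s
  proof -
    have "(finite intersection_of (\<lambda>x. x \<in> \<B>) relative_to \<Union>\<B>) s"
      unfolding relative_to_def intersection_of_def
      by (rule exI[of _ s], rule conjI, rule exI[of _ "{s}"]) (use that in auto)
    then show ?thesis by (rule arbitrary_union_of_inc)
  qed
  then show "openin (topology (arbitrary union_of (finite intersection_of (\<lambda>x. x \<in> \<B>) relative_to \<Union>\<B>))) U"
    unfolding openin_subbase using generate_topology_on_coarsest[OF istopology_subbase _ gen] by blast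
qed

lemma compact_space_matheron: "compact_space matheron"
proof (rule Alexander_subbase)
  let ?hit = "\<lambda>G. {F \<in> closed_unit_sets. F \<inter> G \<noteq> {}}" and ?miss = "\<lambda>C. {F \<in> closed_unit_sets. F \<inter> C = {}}"
  let ?B = "{?hit G | G. open G} \<union> {?miss C | C. compact C}"
  show "topology (arbitrary union_of (finite intersection_of (\<lambda>x. x \<in> ?B) relative_to \<Union>?B)) = matheron"
    unfolding subbase_topology_eq matheron_def ..
  fix \<C> assume \<C>: "\<C> \<subseteq> ?B" "\<Union>\<C> = topspace matheron"
  define \<G> where "\<G> = {G. open G \<and> ?hit G \<in> \<C>}"
  define F where "F = {0..1} - \<Union>\<G>"
  have og: "open (\<Union>\<G>)" by (auto simp: \<G>_def)
  have F: "F \<in> closed_unit_sets"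
    unfolding closed_unit_sets_def F_def using og by (auto intro: closed_Diff)
  then obtain S where S: "S \<in> \<C>" "F \<in> S" using \<C>(2) by (auto simp: topspace_matheron)
  have "S \<noteq> ?hit G" if "open G" for G
  proof
    assume eq: "S = ?hit G"
    then have "G \<in> \<G>" using S that by (auto simp: \<G>_def)
    then show False using S(2) eq by (auto simp: F_def)
  qed
  then have "S \<notin> {?hit G | G. open G}" by blast
  moreover have "S \<in> ?B" using \<C>(1) S(1) by (rule subsetD)
  ultimately have "S \<in> {?miss C | C. compact C}" by (simp only: Un_iff simp_thms)
  then obtain C where C: "compact C" "S = ?miss C" by blast
  have "compact (C \<inter> {0..1})" using C by (intro compact_Int) auto
  moreover have "C \<inter> {0..1} \<subseteq> \<Union>\<G>" using S(2) C by (auto simp: F_def)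
  moreover have "\<forall>G\<in>\<G>. open G" by (auto simp: \<G>_def)
  ultimately obtain \<G>' where \<G>': "\<G>' \<subseteq> \<G>" "finite \<G>'" "C \<inter> {0..1} \<subseteq> \<Union>\<G>'"
    by (metis compactE)
  have "closed_unit_sets \<subseteq> \<Union>(insert S (?hit ` \<G>'))"
  proof
    fix H assume H: "H \<in> closed_unit_sets"
    show "H \<in> \<Union>(insert S (?hit ` \<G>'))"
    proof (cases "H \<inter> C = {}")
      case True
      then show ?thesis using H C by auto
    next
      case False
      then obtain x where x: "x \<in> H" "x \<in> C" by blast
      then have "x \<in> {0..1}" using H by (auto simp: closed_unit_sets_def)
      then obtain G where "G \<in> \<G>'" "x \<in> G" using \<G>'(3) x by blast
      then show ?thesis using H x by blast
    qed
  qed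
  moreover have "insert S (?hit ` \<G>') \<subseteq> \<C>" using S(1) \<G>'(1) by (auto simp: \<G>_def)
  ultimately show "\<exists>\<C>'. finite \<C>' \<and> \<C>' \<subseteq> \<C> \<and> \<Union>\<C>' = topspace matheron"
    using \<G>'(2) \<C>(2) unfolding topspace_matheron by (intro exI[of _ "insert S (?hit ` \<G>')"]) blast
qed

lemma matheron_nbhd_close:
  assumes "openin matheron U" "F0 \<in> U"
  shows "\<exists>V d. openin matheron V \<and> F0 \<in> V \<and> 0 < d \<and> (\<forall>F\<in>V. \<forall>G\<in>closed_unit_sets. close_sets d F G \<longrightarrow> G \<in> U)"
  using assms
proof (induction arbitrary: F0 rule: matheron_induct)
  case (Int U1 U2)
  obtain V1 d1 where 1: "openin matheron V1" "F0 \<in> V1" "0 < d1" "\<And>F G. F \<in> V1 \<Longrightarrow> G \<in> closed_unit_sets \<Longrightarrow> close_sets d1 F G \<Longrightarrow> G \<in> U1"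
    using Int.IH(1)[of F0] Int.prems by blast
  obtain V2 d2 where 2: "openin matheron V2" "F0 \<in> V2" "0 < d2" "\<And>F G. F \<in> V2 \<Longrightarrow> G \<in> closed_unit_sets \<Longrightarrow> close_sets d2 F G \<Longrightarrow> G \<in> U2"
    using Int.IH(2)[of F0] Int.prems by blast
  have mono: "close_sets (min d1 d2) F G \<Longrightarrow> close_sets d1 F G \<and> close_sets d2 F G" for F G
    unfolding close_sets_def by (meson min.boundedE)
  show ?case
    using 1 2 mono by (intro exI[of _ "V1 \<inter> V2"] exI[of _ "min d1 d2"]) (auto intro: openin_Int)
next
  case (UN K)
  then obtain U where U: "U \<in> K" "F0 \<in> U" by blast
  from UN.IH[OF this] show ?case using U(1) by (meson UnionI)
next
  case (Hit G)
  then obtain x where x: "x \<in> F0" "x \<in> G" "F0 \<in> closed_unit_sets" by blast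
  then obtain e where e: "0 < e" "ball x e \<subseteq> G" using Hit open_contains_ball by metis
  have "G' \<inter> G \<noteq> {}" if hitF: "F \<inter> ball x (e / 2) \<noteq> {}" and cl: "close_sets (e / 3) F G'" for F G'
  proof -
    obtain z where "z \<in> F" "z \<in> ball x (e / 2)" using hitF by blast
    then have z: "z \<in> F" "dist x z < e / 2" by simp_all
    then obtain y where y: "y \<in> G'" "\<bar>z - y\<bar> \<le> e / 3" using cl by (auto simp: close_sets_def)
    then have "dist x y < e" using z e(1) unfolding dist_real_def by linarith
    then show ?thesis using e y by auto
  qed
  moreover have "F0 \<inter> ball x (e / 2) \<noteq> {}" using x e by auto
  ultimately show ?case
    using e x by (intro exI[of _ "{F \<in> closed_unit_sets. F \<inter> ball x (e / 2) \<noteq> {}}"] exI[of _ "e / 3"])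
      (auto intro: openin_matheron_hit)
next
  case (Miss C)
  then have F0: "F0 \<in> closed_unit_sets" "closed F0" "F0 \<inter> C = {}" by (auto simp: closed_unit_sets_def)
  obtain e where e: "0 < e" "\<And>x y. x \<in> C \<Longrightarrow> y \<in> F0 \<Longrightarrow> e \<le> dist x y"
    using separate_compact_closed[OF Miss(1) F0(2)] F0(3) by blast
  define D where "D = {x + y | x y. x \<in> C \<and> y \<in> cball 0 (e / 2)}"
  have "compact D" unfolding D_def using Miss(1) by (intro compact_sums compact_cball)
  have "G' \<inter> C = {}" if FD: "F \<inter> D = {}" and cl: "close_sets (e / 2) F G'" for F G'
  proof (rule ccontr)
    assume "G' \<inter> C \<noteq> {}"
    then obtain y where y: "y \<in> G'" "y \<in> C" by blast
    then obtain x where x: "x \<in> F" "\<bar>x - y\<bar> \<le> e / 2" using cl by (auto simp: close_sets_def)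
    then have "x = y + (x - y)" "x - y \<in> cball 0 (e / 2)" by auto
    then have "x \<in> D" unfolding D_def using y by blast
    then show False using x FD by blast
  qed
  moreover have "F0 \<inter> D = {}"
  proof (rule ccontr)
    assume "F0 \<inter> D \<noteq> {}"
    then obtain x y where "x + y \<in> F0" "x \<in> C" "\<bar>y\<bar> \<le> e / 2" by (auto simp: D_def)
    then show False using e(2)[of x "x + y"] e(1) by (simp add: dist_real_def)
  qed
  ultimately show ?case
    using e F0 \<open>compact D\<close> by (intro exI[of _ "{F \<in> closed_unit_sets. F \<inter> D = {}}"] exI[of _ "e / 2"])
      (auto intro: openin_matheron_miss)
next
  case Empty
  then show ?case by simp
qed

lemma matheron_uniformly_continuous:
  assumes f: "continuous_map matheron euclideanreal f" and e: "0 < e"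
  shows "\<exists>d>0. \<forall>F\<in>closed_unit_sets. \<forall>G\<in>closed_unit_sets. close_sets d F G \<longrightarrow> \<bar>f F - f G\<bar> < e"
proof -
  have "\<exists>V d. openin matheron V \<and> F0 \<in> V \<and> 0 < d \<and> (\<forall>F\<in>V. \<forall>G\<in>closed_unit_sets. close_sets d F G \<longrightarrow> \<bar>f F - f G\<bar> < e)"
    if F0: "F0 \<in> closed_unit_sets" for F0
  proof -
    let ?U = "{F \<in> topspace matheron. f F \<in> ball (f F0) (e / 2)}"
    have U: "openin matheron ?U" using f by (rule openin_continuous_map_preimage) auto
    have "F0 \<in> ?U" using F0 e by (auto simp: topspace_matheron)
    from matheron_nbhd_close[OF U this] obtain V d where V: "openin matheron V" "F0 \<in> V" "0 < d"
      "\<And>F G. F \<in> V \<Longrightarrow> G \<in> closed_unit_sets \<Longrightarrow> close_sets d F G \<Longrightarrow> G \<in> ?U" by blast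
    have "\<bar>f F - f G\<bar> < e" if "F \<in> V \<inter> ?U" "G \<in> closed_unit_sets" "close_sets d F G" for F G
    proof -
      have "G \<in> ?U" using V(4) that by blast
      then have "\<bar>f F0 - f G\<bar> < e / 2" "\<bar>f F0 - f F\<bar> < e / 2" using that(1) by (auto simp: dist_real_def)
      then show ?thesis by linarith
    qed
    then show ?thesis using V U \<open>F0 \<in> ?U\<close> by (intro exI[of _ "V \<inter> ?U"] exI[of _ d]) (auto intro: openin_Int)
  qed
  then obtain V d where V: "\<And>F. F \<in> closed_unit_sets \<Longrightarrow> openin matheron (V F) \<and> F \<in> V F \<and> 0 < d F \<and>
      (\<forall>F'\<in>V F. \<forall>G\<in>closed_unit_sets. close_sets (d F) F' G \<longrightarrow> \<bar>f F' - f G\<bar> < e)"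
    by metis
  have "compactin matheron closed_unit_sets" using compact_space_matheron by (simp add: compact_space_def topspace_matheron)
  moreover have "closed_unit_sets \<subseteq> \<Union>(V ` closed_unit_sets)" using V by blast
  ultimately obtain \<F> where \<F>: "finite \<F>" "\<F> \<subseteq> V ` closed_unit_sets" "closed_unit_sets \<subseteq> \<Union>\<F>"
    using V unfolding compactin_def by (metis (mono_tags, lifting) image_iff)
  then obtain A where A: "finite A" "A \<subseteq> closed_unit_sets" "\<F> = V ` A" by (metis finite_subset_image)
  define d0 where "d0 = Min (insert 1 (d ` A))"
  have d0: "0 < d0" using A V by (auto simp: d0_def)
  have "\<bar>f F - f G\<bar> < e" if FG: "F \<in> closed_unit_sets" "G \<in> closed_unit_sets" "close_sets d0 F G" for F G
  proof -
    obtain F0 where F0: "F0 \<in> A" "F \<in> V F0" using \<F>(3) FG A by blast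
    have "d0 \<le> d F0" using A F0 by (auto simp: d0_def)
    then have "close_sets (d F0) F G" using FG(3) by (force simp: close_sets_def)
    then show ?thesis using V[of F0] F0 A FG by blast
  qed
  with d0 show ?thesis by blast
qed

lemma matheron_tendsto:
  assumes f: "continuous_map matheron euclideanreal f"
    and A: "A \<in> closed_unit_sets" and F: "\<And>n. F n \<in> closed_unit_sets"
    and hit: "\<And>G. open G \<Longrightarrow> A \<inter> G \<noteq> {} \<Longrightarrow> \<forall>\<^sub>F n in sequentially. F n \<inter> G \<noteq> {}"
    and miss: "\<And>C. compact C \<Longrightarrow> A \<inter> C = {} \<Longrightarrow> \<forall>\<^sub>F n in sequentially. F n \<inter> C = {}"
  shows "(\<lambda>n. f (F n)) \<longlonglongrightarrow> f A"
proof -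
  have "\<forall>\<^sub>F n in sequentially. F n \<in> U" if "openin matheron U" "A \<in> U" for U
    using that
  proof (induction rule: matheron_induct)
    case (UN K)
    then obtain U where U: "U \<in> K" "A \<in> U" by blast
    from UN.IH[OF this] show ?case by eventually_elim (use U in blast)
  qed (auto simp: F intro: hit miss eventually_conj)
  then have "limitin matheron F A sequentially"
    using A by (simp add: limitin_def topspace_matheron)
  from continuous_map_limit[OF f this] show ?thesis by (simp add: comp_def)
qed

lemma space_borel_of_topology [simp]: "space (borel_of_topology T) = topspace T"
  by (simp add: borel_of_topology_def space_measure_of_conv)

lemma sets_borel_of_topology: "sets (borel_of_topology T) = sigma_sets (topspace T) {U. openin T U}"
  unfolding borel_of_topology_def by (rule sets_measure_of) (auto dest: openin_subset)

lemma measurable_continuous_map: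
  fixes f :: "'a \<Rightarrow> real"
  assumes "continuous_map T euclideanreal f"
  shows "f \<in> borel_measurable (borel_of_topology T)"
proof (rule borel_measurableI)
  fix S :: "real set" assume "open S"
  then have "openin T {x \<in> topspace T. f x \<in> S}"
    using assms by (intro openin_continuous_map_preimage) auto
  moreover have "f -` S \<inter> topspace T = {x \<in> topspace T. f x \<in> S}" by auto
  ultimately show "f -` S \<inter> space (borel_of_topology T) \<in> sets (borel_of_topology T)"
    by (simp add: sets_borel_of_topology)
qed

definition matheron_base :: "(rat \<times> rat) list \<times> (rat \<times> rat) list \<Rightarrow> real set set" where
  "matheron_base pq = {F \<in> closed_unit_sets.
     (\<forall>(a, b)\<in>set (fst pq). F \<inter> {of_rat a<..<of_rat b} \<noteq> {}) \<and> (\<forall>(a, b)\<in>set (snd pq). F \<inter> {of_rat a..of_rat b} = {})}"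

lemma matheron_base:
  assumes "openin matheron U" "F0 \<in> U"
  shows "\<exists>pq. F0 \<in> matheron_base pq \<and> matheron_base pq \<subseteq> U"
  using assms
proof (induction rule: matheron_induct)
  case (Int U V)
  obtain p1 q1 p2 q2 where "F0 \<in> matheron_base (p1, q1)" "matheron_base (p1, q1) \<subseteq> U"
    "F0 \<in> matheron_base (p2, q2)" "matheron_base (p2, q2) \<subseteq> V"
    using Int.IH Int.prems by (metis IntE surj_pair)
  moreover have "matheron_base (p1 @ p2, q1 @ q2) = matheron_base (p1, q1) \<inter> matheron_base (p2, q2)"
    unfolding matheron_base_def fst_conv snd_conv set_append ball_Un by blast
  ultimately show ?case by (intro exI[of _ "(p1 @ p2, q1 @ q2)"]) auto
next
  case (UN K)
  then obtain U where U: "U \<in> K" "F0 \<in> U" by blast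
  from UN.IH[OF this] show ?case using U(1) by (meson Union_upper order_trans)
next
  case (Hit G)
  then obtain x where x: "x \<in> F0" "x \<in> G" "F0 \<in> closed_unit_sets" by blast
  then obtain e where e: "0 < e" "ball x e \<subseteq> G" using Hit open_contains_ball by metis
  obtain a b where ab: "x - e < of_rat a" "of_rat a < x" "x < of_rat b" "of_rat b < x + e"
    using of_rat_dense[of "x - e" x] of_rat_dense[of x "x + e"] e by auto
  have "{of_rat a<..<of_rat b} \<subseteq> G"
    using ab by (intro order_trans[OF _ e(2)]) (auto simp: dist_real_def)
  then show ?case
    using x ab by (intro exI[of _ "([(a, b)], [])"]) (auto simp: matheron_base_def)
next
  case (Miss C)
  then have F0: "F0 \<in> closed_unit_sets" "closed F0" "F0 \<inter> C = {}" by (auto simp: closed_unit_sets_def)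
  obtain e where e: "0 < e" "\<And>x y. x \<in> C \<Longrightarrow> y \<in> F0 \<Longrightarrow> e \<le> dist x y"
    using separate_compact_closed[OF Miss(1) F0(2)] F0(3) by blast
  have "\<exists>a b. x - e < of_rat a \<and> of_rat a < x \<and> x < of_rat b \<and> of_rat b < x + e" for x
    using of_rat_dense[of "x - e" x] of_rat_dense[of x "x + e"] e(1) by auto
  then obtain a b where ab: "\<And>x. x - e < of_rat (a x) \<and> of_rat (a x) < x \<and> x < of_rat (b x) \<and> of_rat (b x) < x + e"
    by metis
  obtain C' where C': "C' \<subseteq> C" "finite C'" "C \<subseteq> (\<Union>x\<in>C'. {of_rat (a x)<..<of_rat (b x)})"
    by (rule compactE_image[OF Miss(1), of C "\<lambda>x. {of_rat (a x)<..<of_rat (b x)}"]) (use ab in force)+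
  obtain xs where xs: "set xs = C'" using C'(2) finite_list by blast
  let ?q = "map (\<lambda>x. (a x, b x)) xs"
  have "F0 \<inter> {of_rat (a x)..of_rat (b x)} = {}" if "x \<in> C'" for x
  proof (rule ccontr)
    assume "F0 \<inter> {of_rat (a x)..of_rat (b x)} \<noteq> {}"
    then obtain y where "y \<in> F0" "of_rat (a x) \<le> y" "y \<le> of_rat (b x)" by auto
    then show False using e(2)[of x y] ab[of x] that C'(1) by (auto simp: dist_real_def abs_if split: if_splits)
  qed
  then have "F0 \<in> matheron_base ([], ?q)" using F0(1) by (auto simp: matheron_base_def xs)
  moreover have "matheron_base ([], ?q) \<subseteq> {F \<in> closed_unit_sets. F \<inter> C = {}}"
  proof
    fix F assume F: "F \<in> matheron_base ([], ?q)"
    have "x \<notin> C" if "x \<in> F" for x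
    proof
      assume "x \<in> C"
      then obtain z where z: "z \<in> C'" "x \<in> {of_rat (a z)<..<of_rat (b z)}" using C'(3) by blast
      then have "F \<inter> {of_rat (a z)..of_rat (b z)} = {}" using F by (auto simp: matheron_base_def xs)
      then show False using z that by auto
    qed
    then show "F \<in> {F \<in> closed_unit_sets. F \<inter> C = {}}" using F by (auto simp: matheron_base_def)
  qed
  ultimately show ?case by blast
next
  case Empty
  then show ?case by simp
qed

lemma measurable_matheronI:
  assumes X: "\<And>\<omega>. \<omega> \<in> space M \<Longrightarrow> X \<omega> \<in> closed_unit_sets"
    and meas: "\<And>a b. {\<omega>\<in>space M. X \<omega> \<inter> {a..b} \<noteq> {}} \<in> sets M"
  shows "X \<in> measurable M (borel_of_topology matheron)"
  unfolding borel_of_topology_def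
proof (rule measurable_measure_of)
  show "{U. openin matheron U} \<subseteq> Pow (topspace matheron)" by (auto dest: openin_subset)
  show "X \<in> space M \<rightarrow> topspace matheron" using X by (auto simp: topspace_matheron)
  fix U assume "U \<in> {U. openin matheron U}"
  then have U: "openin matheron U" by simp
  have hit: "{\<omega>\<in>space M. X \<omega> \<inter> {a<..<b} \<noteq> {}} \<in> sets M" for a b :: real
  proof -
    have "{a<..<b} = (\<Union>n::nat. {a + 1 / Suc n..b - 1 / Suc n})"
    proof (intro equalityI subsetI)
      fix x assume x: "x \<in> {a<..<b}"
      then obtain n where "inverse (real (Suc n)) < min (x - a) (b - x)" using reals_Archimedean[of "min (x - a) (b - x)"] by auto
      then have "x \<in> {a + 1 / Suc n..b - 1 / Suc n}" by (simp add: inverse_eq_divide)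
      then show "x \<in> (\<Union>n::nat. {a + 1 / Suc n..b - 1 / Suc n})" by blast
    next
      fix x assume "x \<in> (\<Union>n::nat. {a + 1 / Suc n..b - 1 / Suc n})"
      then obtain n :: nat where "a + 1 / Suc n \<le> x" "x \<le> b - 1 / Suc n" by auto
      moreover have "0 < 1 / real (Suc n)" by simp
      ultimately have "a < x" "x < b" by linarith+
      then show "x \<in> {a<..<b}" by simp
    qed
    then have "{\<omega>\<in>space M. X \<omega> \<inter> {a<..<b} \<noteq> {}} = (\<Union>n::nat. {\<omega>\<in>space M. X \<omega> \<inter> {a + 1 / Suc n..b - 1 / Suc n} \<noteq> {}})"
      by blast
    then show ?thesis using meas by auto
  qed
  have base: "{\<omega>\<in>space M. X \<omega> \<in> matheron_base pq} \<in> sets M" for pq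
  proof -
    have "{\<omega>\<in>space M. X \<omega> \<in> matheron_base pq} =
       {\<omega>\<in>space M. (\<forall>ab\<in>set (fst pq). X \<omega> \<inter> {of_rat (fst ab)<..<of_rat (snd ab)} \<noteq> {}) \<and>
         (\<forall>ab\<in>set (snd pq). \<not> X \<omega> \<inter> {of_rat (fst ab)..of_rat (snd ab)} \<noteq> {})}"
      using X unfolding matheron_base_def split_beta by blast
    also have "\<dots> \<in> sets M"
      by (intro sets.sets_Collect_conj sets.sets_Collect_finite_All sets.sets_Collect_neg hit meas) auto
    finally show ?thesis .
  qed
  have "X -` U \<inter> space M = (\<Union>pq\<in>{pq. matheron_base pq \<subseteq> U}. {\<omega>\<in>space M. X \<omega> \<in> matheron_base pq})"
    using matheron_base[OF U] by blast
  also have "\<dots> \<in> sets M"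
    by (rule sets.countable_UN'') (use base in auto)
  finally show "X -` U \<inter> space M \<in> sets M" .
qed

lemma closure_Int_unit_in_closed_unit_sets: "closure A \<inter> {0..1} \<in> closed_unit_sets"
  by (auto simp: closed_unit_sets_def)

lemma measurable_closure_Int_unit:
  fixes Y :: "'i::countable \<Rightarrow> 'a \<Rightarrow> real"
  assumes [measurable]: "\<And>i. Y i \<in> borel_measurable M"
  shows "(\<lambda>\<omega>. closure (range (\<lambda>i. Y i \<omega>)) \<inter> {0..1}) \<in> measurable M (borel_of_topology matheron)"
proof (rule measurable_matheronI[OF closure_Int_unit_in_closed_unit_sets])
  fix a b :: real
  define u v where "u = max a 0" and "v = min b 1"
  have "closure R \<inter> {0..1} \<inter> {a..b} \<noteq> {} \<longleftrightarrow> u \<le> v \<and> (\<forall>n::nat. \<exists>y\<in>R. u - 1 / Suc n < y \<and> y < v + 1 / Suc n)" for R :: "real set"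
  proof -
    have I: "{0..1} \<inter> {a..b} = {u..v}" by (auto simp: u_def v_def)
    show ?thesis
    proof (intro iffI conjI allI)
      assume ne: "closure R \<inter> {0..1} \<inter> {a..b} \<noteq> {}"
      then obtain x where "x \<in> closure R" "x \<in> {0..1} \<inter> {a..b}" by blast
      then have x: "x \<in> closure R" "u \<le> x" "x \<le> v" unfolding I by auto
      show "u \<le> v" using x by simp
      fix n :: nat
      have "0 < 1 / real (Suc n)" by simp
      then obtain y where "y \<in> R" "dist y x < 1 / Suc n" using x(1) unfolding closure_approachable by blast
      then show "\<exists>y\<in>R. u - 1 / Suc n < y \<and> y < v + 1 / Suc n" using x by (intro bexI[of _ y]) (auto simp: dist_real_def)
    next
      assume *: "u \<le> v \<and> (\<forall>n::nat. \<exists>y\<in>R. u - 1 / Suc n < y \<and> y < v + 1 / Suc n)"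
      show "closure R \<inter> {0..1} \<inter> {a..b} \<noteq> {}"
      proof (rule ccontr)
        assume "\<not> closure R \<inter> {0..1} \<inter> {a..b} \<noteq> {}"
        then have "{u..v} \<inter> closure R = {}" using I by blast
        then obtain d where d: "0 < d" "\<And>x y. x \<in> {u..v} \<Longrightarrow> y \<in> closure R \<Longrightarrow> d \<le> dist x y"
          using separate_compact_closed[of "{u..v}" "closure R"] by auto
        obtain n where n: "inverse (real (Suc n)) < d" using reals_Archimedean[OF d(1)] by auto
        obtain y where y: "y \<in> R" "u - 1 / Suc n < y" "y < v + 1 / Suc n" using * by blast
        have "max u (min y v) \<in> {u..v}" using * by auto
        from d(2)[OF this closure_subset[THEN subsetD, OF y(1)]] show False
          using y n * d(1) by (auto simp: dist_real_def inverse_eq_divide max_def min_def split: if_splits)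
      qed
    qed
  qed
  then have "{\<omega>\<in>space M. closure (range (\<lambda>i. Y i \<omega>)) \<inter> {0..1} \<inter> {a..b} \<noteq> {}} =
      {\<omega>\<in>space M. u \<le> v \<and> (\<forall>n::nat. \<exists>i. u - 1 / Suc n < Y i \<omega> \<and> Y i \<omega> < v + 1 / Suc n)}"
    by auto
  also have "\<dots> \<in> sets M" by measurable
  finally show "{\<omega>\<in>space M. closure (range (\<lambda>i. Y i \<omega>)) \<inter> {0..1} \<inter> {a..b} \<noteq> {}} \<in> sets M" .
qed

section \<open>Approximation of functionals of the trace\<close>

lemma closure_range_pos:
  assumes "finite {j. pos j \<omega> \<le> R}" "1 < R"
  shows "closure (range (\<lambda>j. pos j \<omega>)) \<inter> {0..1} = range (\<lambda>j. pos j \<omega>) \<inter> {0..1}"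
proof -
  let ?A = "(\<lambda>j. pos j \<omega>) ` {j. pos j \<omega> \<le> R}" and ?B = "range (\<lambda>j. pos j \<omega>) \<inter> {R..}"
  have "range (\<lambda>j. pos j \<omega>) \<subseteq> ?A \<union> ?B" by auto
  then have "closure (range (\<lambda>j. pos j \<omega>)) \<subseteq> ?A \<union> {R..}"
    by (intro closure_minimal closed_Un[OF finite_imp_closed closed_atLeast]) (use assms in auto)
  then show ?thesis using assms(2) closure_subset[of "range (\<lambda>j. pos j \<omega>)"] by auto
qed

definition walk_trace :: "(nat \<Rightarrow> real) \<Rightarrow> real set" where
  "walk_trace \<omega> = closure (range (\<lambda>j. pos j \<omega>)) \<inter> {0..1}"

lemma walk_trace_closed: "walk_trace \<omega> \<in> closed_unit_sets"
  unfolding walk_trace_def by (rule closure_Int_unit_in_closed_unit_sets)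

definition cell_bump :: "nat \<Rightarrow> nat \<Rightarrow> real \<Rightarrow> real" where
  "cell_bump n i = trapezoid (real i / n) ((real i + 2) / n) (1 / n)"

definition cutoff :: "nat \<Rightarrow> real \<Rightarrow> real" where
  "cutoff n = trapezoid 0 (1 - 3 / n) (1 / n)"

definition grid_points :: "nat \<Rightarrow> nat set \<Rightarrow> real set" where
  "grid_points n I = (\<lambda>i. real i / n) ` I"

definition soft_weight :: "nat \<Rightarrow> (nat \<Rightarrow> real) \<Rightarrow> nat set \<Rightarrow> real" where
  "soft_weight n a I = (\<Prod>i\<in>I. 1 - a i) * (\<Prod>i\<in>{..<n} - I. a i)"

lemma sum_soft_weight: "(\<Sum>I\<in>Pow {..<n}. soft_weight n a I) = 1"
  using prod_add[of "{..<n}" "\<lambda>i. 1 - a i" a] by (simp add: soft_weight_def)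

lemma soft_weight_nonneg:
  assumes "\<And>i. 0 \<le> a i" "\<And>i. a i \<le> 1"
  shows "0 \<le> soft_weight n a I"
  unfolding soft_weight_def using assms by (intro mult_nonneg_nonneg prod_nonneg) auto

lemma soft_weight_le:
  assumes "\<And>i. 0 \<le> a i" "\<And>i. a i \<le> 1" "i < n" "i \<notin> I"
  shows "soft_weight n a I \<le> a i"
proof -
  have "(\<Prod>i\<in>{..<n} - I. a i) = a i * (\<Prod>i\<in>{..<n} - I - {i}. a i)"
    using assms by (intro prod.remove) auto
  moreover have "(\<Prod>i\<in>{..<n} - I - {i}. a i) \<le> 1" "0 \<le> (\<Prod>i\<in>{..<n} - I - {i}. a i)"
    using assms by (auto intro!: prod_le_1 prod_nonneg)
  moreover have "(\<Prod>i\<in>I. 1 - a i) \<le> 1" "0 \<le> (\<Prod>i\<in>I. 1 - a i)"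
    using assms by (auto intro!: prod_le_1 prod_nonneg)
  ultimately have "soft_weight n a I \<le> 1 * (a i * 1)"
    unfolding soft_weight_def using assms by (intro mult_mono) (auto intro: mult_left_le)
  then show ?thesis by simp
qed

lemma soft_weight_zero:
  assumes "finite I" "i \<in> I" "a i = 1"
  shows "soft_weight n a I = 0"
  using assms by (auto simp: soft_weight_def)

lemma soft_weight_expand:
  assumes "I \<subseteq> {..<n}"
  shows "soft_weight n a I = (\<Sum>X\<in>Pow I. (- 1) ^ card X * (\<Prod>i\<in>X \<union> ({..<n} - I). a i))"
proof -
  have fin: "finite I" using assms finite_subset by blast
  have "(\<Prod>i\<in>I. 1 - a i) = (\<Prod>i\<in>I. - a i + 1)" by simp
  also have "\<dots> = (\<Sum>X\<in>Pow I. (\<Prod>i\<in>X. - a i) * (\<Prod>i\<in>I - X. 1))" by (rule prod_add[OF fin])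
  also have "\<dots> = (\<Sum>X\<in>Pow I. (- 1) ^ card X * (\<Prod>i\<in>X. a i))" by (simp add: prod_uminus)
  finally have "soft_weight n a I = (\<Sum>X\<in>Pow I. (- 1) ^ card X * (\<Prod>i\<in>X. a i) * (\<Prod>i\<in>{..<n} - I. a i))"
    by (simp add: soft_weight_def sum_distrib_right)
  also have "\<dots> = (\<Sum>X\<in>Pow I. (- 1) ^ card X * (\<Prod>i\<in>X \<union> ({..<n} - I). a i))"
  proof (intro sum.cong refl)
    fix X assume "X \<in> Pow I"
    then have "finite X" "X \<inter> ({..<n} - I) = {}" using fin finite_subset by auto
    then have "(\<Prod>i\<in>X \<union> ({..<n} - I). a i) = (\<Prod>i\<in>X. a i) * (\<Prod>i\<in>{..<n} - I. a i)"
      by (intro prod.union_disjoint) auto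
    then show "(- 1) ^ card X * (\<Prod>i\<in>X. a i) * (\<Prod>i\<in>{..<n} - I. a i) = (- 1) ^ card X * (\<Prod>i\<in>X \<union> ({..<n} - I). a i)"
      by simp
  qed
  finally show ?thesis .
qed

text \<open>Conditionally on the walk, a Poissonian sampling of the cells: cell \<open>i\<close> is kept with probability
  \<open>1 - exp (- k m)\<close>, where \<open>m\<close> is the mass of the walk around the cell. This makes the functional of the
  trace a finite linear combination of exponentials of masses.\<close>

definition soft_value :: "(real set \<Rightarrow> real) \<Rightarrow> nat \<Rightarrow> real \<Rightarrow> real \<Rightarrow> (nat \<Rightarrow> real) \<Rightarrow> real" where
  "soft_value f n k b \<omega> = (\<Sum>I\<in>Pow {..<n}. f (grid_points n I) * soft_weight n (\<lambda>i. exp (- k * mass 2 b (cell_bump n i) \<omega>)) I)"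

lemma grid_points_closed: "0 < n \<Longrightarrow> I \<subseteq> {..<n} \<Longrightarrow> grid_points n I \<in> closed_unit_sets"
  unfolding closed_unit_sets_def grid_points_def
  by (auto intro!: finite_imp_closed finite_imageI intro: finite_subset)

lemma mass_nonneg: "(\<And>y. 0 \<le> \<phi> y) \<Longrightarrow> 0 < b \<Longrightarrow> 0 \<le> mass R b \<phi> \<omega>"
  unfolding mass_def by (intro divide_nonneg_pos sum_nonneg) auto

lemma cell_bump:
  assumes "0 < n"
  shows "continuous_on UNIV (cell_bump n i)" "0 \<le> cell_bump n i y" "cell_bump n i y \<le> 1"
    "real i / n \<le> y \<Longrightarrow> y \<le> (real i + 2) / n \<Longrightarrow> cell_bump n i y = 1"
    "cell_bump n i y \<noteq> 0 \<Longrightarrow> (real i - 1) / n < y \<and> y < (real i + 3) / n"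
proof -
  have d: "0 < 1 / real n" using assms by simp
  note T = trapezoid[OF d, where u="real i / n" and v="(real i + 2) / n", folded cell_bump_def]
  show "continuous_on UNIV (cell_bump n i)" "0 \<le> cell_bump n i y" "cell_bump n i y \<le> 1"
    "real i / n \<le> y \<Longrightarrow> y \<le> (real i + 2) / n \<Longrightarrow> cell_bump n i y = 1"
    using T(1-4) by auto
  have "real i / n - 1 / n = (real i - 1) / n" "(real i + 2) / n + 1 / n = (real i + 3) / n"
    by (simp_all add: diff_divide_distrib add_divide_distrib)
  then show "cell_bump n i y \<noteq> 0 \<Longrightarrow> (real i - 1) / n < y \<and> y < (real i + 3) / n"
    using T(5)[of y] T(6)[of y] by force
qed

lemma soft_value_near:
  assumes b: "0 < b" and n: "3 < n" and k: "0 \<le> k" and q: "0 < q" and B: "\<And>F. F \<in> closed_unit_sets \<Longrightarrow> \<bar>f F\<bar> \<le> B"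
    and unif: "\<And>F G. F \<in> closed_unit_sets \<Longrightarrow> G \<in> closed_unit_sets \<Longrightarrow> close_sets (3 / n) F G \<Longrightarrow> \<bar>f F - f G\<bar> < e"
    and fin: "finite {j. pos j \<omega> \<le> 2}"
    and good: "\<And>i j. i < n \<Longrightarrow> pos j \<omega> \<in> {real i / n..(real i + 1) / n} \<Longrightarrow> q \<le> mass 2 b (cell_bump n i) \<omega>"
    and gap: "\<And>j. pos j \<omega> \<notin> {1 - 3 / n..1 + 3 / n}"
  shows "\<bar>f (walk_trace \<omega>) - soft_value f n k b \<omega>\<bar> \<le> e + 2 * B * 2 ^ n * exp (- k * q)"
proof -
  define a where "a i = exp (- k * mass 2 b (cell_bump n i) \<omega>)" for i
  have n0: "0 < n" using n by simp
  have a: "0 \<le> a i" "a i \<le> 1" for i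
    using k mass_nonneg[OF cell_bump(2)[OF n0] b] by (auto simp: a_def)
  have tr: "walk_trace \<omega> = range (\<lambda>j. pos j \<omega>) \<inter> {0..1}"
    unfolding walk_trace_def by (rule closure_range_pos[OF fin]) simp
  have B0: "0 \<le> B" using B[OF walk_trace_closed[of \<omega>]] by linarith
  let ?W = "\<lambda>I. soft_weight n a I"
  have "close_sets (3 / n) (walk_trace \<omega>) (walk_trace \<omega>)"
    unfolding close_sets_def by (metis abs_zero diff_self divide_nonneg_nonneg of_nat_0_le_iff zero_le_numeral)
  then have e: "0 < e" using unif[OF walk_trace_closed[of \<omega>] walk_trace_closed[of \<omega>]] by simp
  have piece: "\<bar>f (walk_trace \<omega>) - f (grid_points n I)\<bar> * ?W I \<le> e * ?W I + 2 * B * exp (- k * q)" if I: "I \<in> Pow {..<n}" for I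
  proof -
    have gI: "grid_points n I \<in> closed_unit_sets" using grid_points_closed[OF n0] I by auto
    have W: "0 \<le> ?W I" using soft_weight_nonneg[OF a] .
    consider (zero) "?W I = 0" | (miss) i j where "i < n" "i \<notin> I" "pos j \<omega> \<in> {real i / n..(real i + 1) / n}"
      | (good) "?W I \<noteq> 0" "\<And>i j. i < n \<Longrightarrow> pos j \<omega> \<in> {real i / n..(real i + 1) / n} \<Longrightarrow> i \<in> I"
      by blast
    then show ?thesis
    proof cases
      case zero
      then show ?thesis using B0 by simp
    next
      case miss
      have "?W I \<le> a i" by (rule soft_weight_le[OF a miss(1,2)])
      also have "\<dots> \<le> exp (- k * q)"
        using good[OF miss(1,3)] k by (auto simp: a_def intro: mult_left_mono)
      finally have "\<bar>f (walk_trace \<omega>) - f (grid_points n I)\<bar> * ?W I \<le> (2 * B) * exp (- k * q)"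
        using B[OF walk_trace_closed[of \<omega>]] B[OF gI] W by (intro mult_mono) auto
      moreover have "0 \<le> e * ?W I" using e W by simp
      ultimately show ?thesis by linarith
    next
      case good
      have "close_sets (3 / n) (walk_trace \<omega>) (grid_points n I)"
        unfolding close_sets_def
      proof (intro conjI ballI)
        fix x assume "x \<in> walk_trace \<omega>"
        then obtain j where x: "x = pos j \<omega>" "0 \<le> x" "x \<le> 1" unfolding tr by auto
        have x1: "x < 1"
        proof (rule ccontr)
          assume "\<not> x < 1"
          then have "x = 1" using x by simp
          then show False using gap[of j] x by auto
        qed
        define i where "i = nat \<lfloor>x * n\<rfloor>"
        have i: "real i \<le> x * n" "x * n < real i + 1" using x n unfolding i_def by (auto simp: of_nat_nat)
        have "x * real n < 1 * real n" using x1 n0 by (intro mult_strict_right_mono) auto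
        then have "i < n" using i(1) by linarith
        moreover have "x \<in> {real i / n..(real i + 1) / n}" using i n0 by (auto simp: field_simps)
        ultimately have "i \<in> I" using good(2) x(1) by blast
        then have "real i / n \<in> grid_points n I" by (auto simp: grid_points_def)
        moreover have "\<bar>x - real i / n\<bar> \<le> 3 / n"
        proof -
          have "x - real i / n = (x * n - real i) / n" using n0 by (simp add: diff_divide_distrib)
          moreover have "0 \<le> (x * n - real i) / n" "(x * n - real i) / n \<le> 3 / n"
            using i n0 by (auto intro!: divide_right_mono divide_nonneg_pos)
          ultimately show ?thesis by simp
        qed
        ultimately show "\<exists>y\<in>grid_points n I. \<bar>x - y\<bar> \<le> 3 / n" by blast
      next
        fix y assume "y \<in> grid_points n I"
        then obtain i where i: "i \<in> I" "y = real i / n" by (auto simp: grid_points_def)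
        have "i < n" using I i by auto
        have "a i \<noteq> 1"
          using soft_weight_zero[of I i a n] good(1) i(1) I finite_subset[of I "{..<n}"] by auto
        then have "mass 2 b (cell_bump n i) \<omega> \<noteq> 0" by (auto simp: a_def)
        then have "(\<Sum>j<visits 2 \<omega>. cell_bump n i (pos j \<omega>)) \<noteq> 0" by (auto simp: mass_def)
        then obtain j where j: "cell_bump n i (pos j \<omega>) \<noteq> 0" by (meson sum.not_neutral_contains_not_neutral)
        from cell_bump(5)[OF n0 this] have c: "(real i - 1) / n < pos j \<omega>" "pos j \<omega> < (real i + 3) / n" by auto
        have "(real i + 3) / n \<le> 1 + 3 / n" using \<open>i < n\<close> n0 by (simp add: field_simps)
        then have "pos j \<omega> < 1 - 3 / n" using gap[of j] c(2) by auto
        then have "pos j \<omega> \<in> walk_trace \<omega>" unfolding tr using n0 by (auto simp: field_simps intro: order_trans[of _ "1 - 3 / n"])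
        moreover have "\<bar>pos j \<omega> - y\<bar> \<le> 3 / n"
        proof -
          have aux: "\<bar>p - w\<bar> \<le> 3 * u" if "w - u < p" "p < w + 3 * u" "0 \<le> u" for p w u :: real
            using that by linarith
          show ?thesis
            using aux[of "real i / n" "1 / n" "pos j \<omega>"] c by (simp add: i(2) diff_divide_distrib add_divide_distrib)
        qed
        ultimately show "\<exists>x\<in>walk_trace \<omega>. \<bar>x - y\<bar> \<le> 3 / n" by blast
      qed
      from unif[OF walk_trace_closed gI this]
      have "\<bar>f (walk_trace \<omega>) - f (grid_points n I)\<bar> * ?W I \<le> e * ?W I" using W by (intro mult_right_mono) auto
      moreover have "0 \<le> 2 * B * exp (- k * q)" using B0 by simp
      ultimately show ?thesis by linarith
    qed
  qed
  have "f (walk_trace \<omega>) - soft_value f n k b \<omega> = (\<Sum>I\<in>Pow {..<n}. f (walk_trace \<omega>) * ?W I) - (\<Sum>I\<in>Pow {..<n}. f (grid_points n I) * ?W I)"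
    unfolding soft_value_def a_def[symmetric] sum_distrib_left[symmetric] by (simp add: sum_soft_weight)
  also have "\<dots> = (\<Sum>I\<in>Pow {..<n}. (f (walk_trace \<omega>) - f (grid_points n I)) * ?W I)"
    by (simp add: sum_subtractf left_diff_distrib)
  finally have "\<bar>f (walk_trace \<omega>) - soft_value f n k b \<omega>\<bar> \<le> (\<Sum>I\<in>Pow {..<n}. \<bar>(f (walk_trace \<omega>) - f (grid_points n I)) * ?W I\<bar>)"
    by (simp only: sum_abs)
  also have "\<dots> = (\<Sum>I\<in>Pow {..<n}. \<bar>f (walk_trace \<omega>) - f (grid_points n I)\<bar> * ?W I)"
    using soft_weight_nonneg[OF a] by (simp add: abs_mult)
  also have "\<dots> \<le> (\<Sum>I\<in>Pow {..<n}. e * ?W I + 2 * B * exp (- k * q))"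
    by (intro sum_mono piece)
  also have "\<dots> = e + 2 * B * 2 ^ n * exp (- k * q)"
    by (simp add: sum.distrib sum_distrib_left[symmetric] sum_soft_weight card_Pow)
  finally show ?thesis .
qed

lemma soft_value_bounded:
  assumes b: "0 < b" and n: "0 < n" and k: "0 \<le> k" and B: "\<And>F. F \<in> closed_unit_sets \<Longrightarrow> \<bar>f F\<bar> \<le> B"
  shows "\<bar>soft_value f n k b \<omega>\<bar> \<le> B"
proof -
  define a where "a i = exp (- k * mass 2 b (cell_bump n i) \<omega>)" for i
  have a: "0 \<le> a i" "a i \<le> 1" for i
    using k mass_nonneg[OF cell_bump(2)[OF n] b] by (auto simp: a_def)
  have "\<bar>soft_value f n k b \<omega>\<bar> \<le> (\<Sum>I\<in>Pow {..<n}. \<bar>f (grid_points n I) * soft_weight n a I\<bar>)"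
    unfolding soft_value_def a_def[symmetric] by (rule sum_abs)
  also have "\<dots> \<le> (\<Sum>I\<in>Pow {..<n}. B * soft_weight n a I)"
    using soft_weight_nonneg[OF a] grid_points_closed[OF n] by (intro sum_mono) (auto simp: abs_mult intro!: mult_right_mono B)
  also have "\<dots> = B" by (simp add: sum_distrib_left[symmetric] sum_soft_weight)
  finally show ?thesis .
qed

definition soft_exponent :: "nat \<Rightarrow> real \<Rightarrow> real \<Rightarrow> nat set \<Rightarrow> real \<Rightarrow> real" where
  "soft_exponent n k \<epsilon> J y = \<epsilon> * cutoff n y - k * (\<Sum>i\<in>J. cell_bump n i y)"

lemma mass_soft_exponent:
  "mass R b (soft_exponent n k \<epsilon> J) \<omega> = \<epsilon> * mass R b (cutoff n) \<omega> - k * (\<Sum>i\<in>J. mass R b (cell_bump n i) \<omega>)"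
proof -
  have "(\<Sum>j<visits R \<omega>. \<Sum>i\<in>J. cell_bump n i (pos j \<omega>)) = (\<Sum>i\<in>J. \<Sum>j<visits R \<omega>. cell_bump n i (pos j \<omega>))"
    by (rule sum.swap)
  then show ?thesis
    by (simp add: mass_def soft_exponent_def sum_subtractf sum_distrib_left[symmetric] diff_divide_distrib sum_divide_distrib[symmetric])
qed

lemma soft_value_expand:
  "soft_value f n k b \<omega> * exp (\<epsilon> * mass 2 b (cutoff n) \<omega>) =
    (\<Sum>I\<in>Pow {..<n}. \<Sum>X\<in>Pow I. f (grid_points n I) * (- 1) ^ card X * exp (mass 2 b (soft_exponent n k \<epsilon> (X \<union> ({..<n} - I))) \<omega>))"
proof -
  have e: "(\<Prod>i\<in>J. exp (- k * mass 2 b (cell_bump n i) \<omega>)) * exp (\<epsilon> * mass 2 b (cutoff n) \<omega>) = exp (mass 2 b (soft_exponent n k \<epsilon> J) \<omega>)"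
    if "finite J" for J
    using that by (simp add: mass_soft_exponent exp_sum[symmetric] mult_exp_exp sum_negf sum_distrib_left)
  show ?thesis
    unfolding soft_value_def sum_distrib_right
  proof (intro sum.cong refl)
    fix I assume I: "I \<in> Pow {..<n}"
    let ?a = "\<lambda>i. exp (- k * mass 2 b (cell_bump n i) \<omega>)"
    have "f (grid_points n I) * soft_weight n ?a I * exp (\<epsilon> * mass 2 b (cutoff n) \<omega>) =
        (\<Sum>X\<in>Pow I. f (grid_points n I) * (- 1) ^ card X * ((\<Prod>i\<in>X \<union> ({..<n} - I). ?a i) * exp (\<epsilon> * mass 2 b (cutoff n) \<omega>)))"
      using I by (subst soft_weight_expand) (auto simp: sum_distrib_left sum_distrib_right mult.assoc)
    also have "\<dots> = (\<Sum>X\<in>Pow I. f (grid_points n I) * (- 1) ^ card X * exp (mass 2 b (soft_exponent n k \<epsilon> (X \<union> ({..<n} - I))) \<omega>))"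
    proof (intro sum.cong refl)
      fix X assume "X \<in> Pow I"
      then have "finite (X \<union> ({..<n} - I))" using I by (auto intro: finite_subset)
      then show "f (grid_points n I) * (- 1) ^ card X * ((\<Prod>i\<in>X \<union> ({..<n} - I). ?a i) * exp (\<epsilon> * mass 2 b (cutoff n) \<omega>)) =
        f (grid_points n I) * (- 1) ^ card X * exp (mass 2 b (soft_exponent n k \<epsilon> (X \<union> ({..<n} - I))) \<omega>)"
        by (simp only: e)
    qed
    finally show "f (grid_points n I) * soft_weight n ?a I * exp (\<epsilon> * mass 2 b (cutoff n) \<omega>) =
      (\<Sum>X\<in>Pow I. f (grid_points n I) * (- 1) ^ card X * exp (mass 2 b (soft_exponent n k \<epsilon> (X \<union> ({..<n} - I))) \<omega>))" .
  qed
qed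

lemma soft_exponent:
  assumes n: "3 < n" and k: "0 \<le> k" and J: "J \<subseteq> {..<n}"
  shows "continuous_on UNIV (soft_exponent n k \<epsilon> J)" "2 \<le> y \<Longrightarrow> soft_exponent n k \<epsilon> J y = 0"
    "\<bar>soft_exponent n k \<epsilon> J y\<bar> \<le> \<bar>\<epsilon>\<bar> + k * n"
proof -
  have n0: "0 < n" "0 < 1 / real n" using n by auto
  note T = trapezoid[OF n0(2), where u=0 and v="1 - 3 / n", folded cutoff_def]
  show "continuous_on UNIV (soft_exponent n k \<epsilon> J)"
    unfolding soft_exponent_def[abs_def] by (intro continuous_intros T(1) cell_bump(1) n0)
  show "soft_exponent n k \<epsilon> J y = 0" if y: "2 \<le> y"
  proof -
    have "cell_bump n i y = 0" if "i \<in> J" for i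
    proof (rule ccontr)
      assume "cell_bump n i y \<noteq> 0"
      from cell_bump(5)[OF n0(1) this] have "y < (real i + 3) / n" by blast
      moreover have "real i + 3 \<le> 2 * n" using that J n by auto
      then have "(real i + 3) / n \<le> 2" using n0 by (simp add: field_simps)
      ultimately show False using y by linarith
    qed
    moreover have "cutoff n y = 0"
    proof (rule T(6))
      have "1 - 3 / real n + 1 / real n \<le> 1" by (simp add: divide_right_mono)
      then show "1 - 3 / real n + 1 / real n \<le> y" using y by linarith
    qed
    ultimately show ?thesis by (simp add: soft_exponent_def)
  qed
  have "0 \<le> (\<Sum>i\<in>J. cell_bump n i y)" by (intro sum_nonneg cell_bump n0)
  moreover have "(\<Sum>i\<in>J. cell_bump n i y) \<le> n"
  proof -
    have "(\<Sum>i\<in>J. cell_bump n i y) \<le> (\<Sum>i\<in>J. 1)" by (intro sum_mono cell_bump n0)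
    also have "\<dots> \<le> n" using card_mono[OF _ J] by simp
    finally show ?thesis .
  qed
  ultimately have "\<bar>k * (\<Sum>i\<in>J. cell_bump n i y)\<bar> \<le> k * n" using k by (simp add: abs_mult mult_left_mono)
  moreover have "\<bar>\<epsilon> * cutoff n y\<bar> \<le> \<bar>\<epsilon>\<bar>" using T(2,3)[of y] by (simp add: abs_mult mult_left_le)
  ultimately show "\<bar>soft_exponent n k \<epsilon> J y\<bar> \<le> \<bar>\<epsilon>\<bar> + k * n" unfolding soft_exponent_def by linarith
qed

context iid_steps
begin

lemma measurable_walk_trace [measurable]: "walk_trace \<in> measurable S (borel_of_topology matheron)"
  unfolding walk_trace_def[abs_def] by (rule measurable_closure_Int_unit) measurable

lemma measurable_visits_real [measurable]: "(\<lambda>\<omega>. real (visits R \<omega>)) \<in> borel_measurable S"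
  by (rule measurable_compose[OF measurable_visits]) simp

definition weighted_trace :: "real \<Rightarrow> real \<Rightarrow> (real set \<Rightarrow> real) \<Rightarrow> real" where
  "weighted_trace b \<epsilon> f = (\<integral>\<omega>. f (walk_trace \<omega>) * exp (\<epsilon> * (visits 1 \<omega> / b)) \<partial>S)"

definition soft_trace :: "real \<Rightarrow> real \<Rightarrow> (real set \<Rightarrow> real) \<Rightarrow> nat \<Rightarrow> real \<Rightarrow> real" where
  "soft_trace b \<epsilon> f n k = (\<Sum>I\<in>Pow {..<n}. \<Sum>X\<in>Pow I.
     f (grid_points n I) * (- 1) ^ card X * fk 2 b (soft_exponent n k \<epsilon> (X \<union> ({..<n} - I))) 0)"

definition bad_set :: "real \<Rightarrow> real \<Rightarrow> nat \<Rightarrow> (nat \<Rightarrow> real) set" where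
  "bad_set b q n = {\<omega>\<in>space S. \<exists>j. pos j \<omega> \<in> {1 - 3 / n..1 + 3 / n}} \<union>
     (\<Union>i<n. {\<omega>\<in>space S. \<exists>j. first_visit {real i / n..(real i + 1) / n} j \<omega> \<and> real (visits (1 / n) (seq_shift j \<omega>)) < q * b})"

lemma sets_bad_set [measurable]: "bad_set b q n \<in> sets S"
proof -
  have [measurable]: "(\<lambda>\<omega>. real (visits h (seq_shift j \<omega>))) \<in> borel_measurable S" for j h
    by (rule measurable_compose[OF measurable_seq_shift]) simp
  have [measurable]: "Measurable.pred S (first_visit {real i / n..(real i + 1) / n} j)" for i j
    by (rule measurable_first_visit) simp
  show ?thesis unfolding bad_set_def by (intro sets.Un sets.finite_UN) measurable
qed

lemma prob_bad_set:
  "P.prob (bad_set b q n) \<le> P.prob {\<omega>\<in>space S. \<exists>j. pos j \<omega> \<in> {1 - 3 / n..1 + 3 / n}} +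
     n * P.prob {\<omega>\<in>space S. real (visits (1 / n) \<omega>) < q * b}"
proof -
  have [measurable]: "(\<lambda>\<omega>. real (visits h (seq_shift j \<omega>))) \<in> borel_measurable S" for j h
    by (rule measurable_compose[OF measurable_seq_shift]) simp
  have [measurable]: "Measurable.pred S (first_visit {real i / n..(real i + 1) / n} j)" for i j
    by (rule measurable_first_visit) simp
  let ?E = "\<lambda>i. {\<omega>\<in>space S. \<exists>j. first_visit {real i / n..(real i + 1) / n} j \<omega> \<and> real (visits (1 / n) (seq_shift j \<omega>)) < q * b}"
  have E: "?E i \<in> sets S" for i by measurable
  have "P.prob (\<Union>i<n. ?E i) \<le> (\<Sum>i<n. P.prob (?E i))"
    by (rule P.finite_measure_subadditive_finite) (use E in auto)
  also have "\<dots> \<le> (\<Sum>i<n. P.prob {\<omega>\<in>space S. real (visits (1 / n) \<omega>) < q * b})"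
    by (intro sum_mono prob_sparse_after_first_visit) simp
  finally have 1: "P.prob (\<Union>i<n. ?E i) \<le> n * P.prob {\<omega>\<in>space S. real (visits (1 / n) \<omega>) < q * b}" by simp
  have "P.prob (bad_set b q n) \<le> P.prob {\<omega>\<in>space S. \<exists>j. pos j \<omega> \<in> {1 - 3 / n..1 + 3 / n}} + P.prob (\<Union>i<n. ?E i)"
    unfolding bad_set_def by (rule measure_Un_le) (use E in \<open>auto intro!: sets.finite_UN\<close>)
  with 1 show ?thesis by linarith
qed

lemma good_of_not_bad:
  assumes b: "0 < b" and n: "3 < n" and \<omega>: "\<omega> \<in> space S" "\<omega> \<notin> bad_set b q n" and fin: "\<And>R. finite {j. pos j \<omega> \<le> R}"
  shows "pos j \<omega> \<notin> {1 - 3 / n..1 + 3 / n}"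
    and "i < n \<Longrightarrow> pos j \<omega> \<in> {real i / n..(real i + 1) / n} \<Longrightarrow> q \<le> mass 2 b (cell_bump n i) \<omega>"
proof -
  show "pos j \<omega> \<notin> {1 - 3 / n..1 + 3 / n}" using \<omega> by (auto simp: bad_set_def)
  assume i: "i < n" "pos j \<omega> \<in> {real i / n..(real i + 1) / n}"
  have n0: "0 < n" using n by simp
  obtain m where m: "first_visit {real i / n..(real i + 1) / n} m \<omega>"
    using i(2) first_visit_exists[of "{real i / n..(real i + 1) / n}" \<omega>] by blast
  let ?v = "visits (1 / n) (seq_shift m \<omega>)"
  have v: "q * b \<le> real ?v"
  proof (rule ccontr)
    assume "\<not> q * b \<le> real ?v"
    then have "\<omega> \<in> bad_set b q n" using m i(1) \<omega>(1) unfolding bad_set_def by (auto simp: not_le)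
    then show False using \<omega>(2) by simp
  qed
  have fs: "finite {l. pos l (seq_shift m \<omega>) \<le> 1 / n}"
  proof (rule finite_subset)
    show "finite ((\<lambda>l. l + m) -` {l. pos l \<omega> \<le> 1 / n + pos m \<omega>})"
      using fin by (intro finite_vimageI) (auto simp: inj_on_def)
    show "{l. pos l (seq_shift m \<omega>) \<le> 1 / n} \<subseteq> (\<lambda>l. l + m) -` {l. pos l \<omega> \<le> 1 / n + pos m \<omega>}"
      by (auto simp: pos_add)
  qed
  have pm: "real i / n \<le> pos m \<omega>" "pos m \<omega> \<le> (real i + 1) / n" using m by (auto simp: first_visit_def)
  have in_cell: "cell_bump n i (pos (l + m) \<omega>) = 1 \<and> l + m < visits 2 \<omega>" if l: "l < ?v" for l
  proof -
    have "l \<in> {l. pos l (seq_shift m \<omega>) \<le> 1 / n}" using l unfolding visited_indices_eq[OF fs] by simp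
    then have p: "pos (l + m) \<omega> \<le> pos m \<omega> + 1 / n" "pos m \<omega> \<le> pos (l + m) \<omega>" by (auto simp: pos_add)
    have s: "(real i + 1) / n + 1 / n = (real i + 2) / n" by (simp add: add_divide_distrib)
    have le: "pos (l + m) \<omega> \<le> (real i + 2) / n" using p pm s by linarith
    have "(real i + 2) / n \<le> 2" using i(1) n by (simp add: field_simps)
    then have "l + m \<in> {j. pos j \<omega> \<le> 2}" using le by simp
    then have "l + m < visits 2 \<omega>" unfolding visited_indices_eq[OF fin] by simp
    moreover have "cell_bump n i (pos (l + m) \<omega>) = 1" using le p pm by (intro cell_bump(4)[OF n0]) auto
    ultimately show ?thesis by blast
  qed
  have "real ?v = (\<Sum>l<?v. cell_bump n i (pos (l + m) \<omega>))" using in_cell by simp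
  also have "\<dots> = (\<Sum>j\<in>(\<lambda>l. l + m) ` {..<?v}. cell_bump n i (pos j \<omega>))"
    by (subst sum.reindex) (auto simp: inj_on_def)
  also have "\<dots> \<le> (\<Sum>j<visits 2 \<omega>. cell_bump n i (pos j \<omega>))"
    using in_cell by (intro sum_mono2) (auto intro!: cell_bump(2)[OF n0])
  finally have "q * b \<le> (\<Sum>j<visits 2 \<omega>. cell_bump n i (pos j \<omega>))" using v by linarith
  then show "q \<le> mass 2 b (cell_bump n i) \<omega>" using b by (simp add: mass_def field_simps)
qed

lemma soft_trace_near:
  assumes b: "0 < b" and n: "3 < n" and k: "0 \<le> k" and q: "0 < q"
    and f: "continuous_map matheron euclideanreal f" and B: "\<And>F. F \<in> closed_unit_sets \<Longrightarrow> \<bar>f F\<bar> \<le> B"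
    and unif: "\<And>F G. F \<in> closed_unit_sets \<Longrightarrow> G \<in> closed_unit_sets \<Longrightarrow> close_sets (3 / n) F G \<Longrightarrow> \<bar>f F - f G\<bar> < e"
    and r: "0 < r" "exp (2 * \<bar>\<epsilon>\<bar> / b) * lap r < 1"
    and r': "0 < r'" "exp ((\<bar>\<epsilon>\<bar> + k * n) / b) * lap r' < 1"
    and V: "visit_moment 2 (2 * \<bar>\<epsilon>\<bar> / b) \<le> V" and T: "0 < T"
  shows "\<bar>weighted_trace b \<epsilon> f - soft_trace b \<epsilon> f n k\<bar> \<le>
     V * (e + 2 * B * 2 ^ n * exp (- k * q) + 2 * B / T) + 2 * B * T * P.prob (bad_set b q n)"
proof -
  let ?E = "\<lambda>\<omega>. exp (2 * \<bar>\<epsilon>\<bar> / b * visits 2 \<omega>)"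
  let ?soft = "\<lambda>\<omega>. soft_value f n k b \<omega> * exp (\<epsilon> * mass 2 b (cutoff n) \<omega>)"
  let ?tr = "\<lambda>\<omega>. f (walk_trace \<omega>) * exp (\<epsilon> * (visits 1 \<omega> / b))"
  have n0: "0 < n" "0 < 1 / real n" using n by auto
  note Tc = trapezoid[OF n0(2), where u=0 and v="1 - 3 / n", folded cutoff_def]
  have B0: "0 \<le> B" using B[OF walk_trace_closed[of undefined]] by linarith
  have [measurable]: "f \<in> borel_measurable (borel_of_topology matheron)" by (rule measurable_continuous_map[OF f])
  have intE: "integrable S ?E"
    by (rule integrable_exp_visits(1)) (use r b in auto)
  have lap1: "lap r < 1"
  proof -
    have "1 * lap r \<le> exp (2 * \<bar>\<epsilon>\<bar> / b) * lap r" using b by (intro mult_right_mono) auto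
    with r show ?thesis by simp
  qed
  have sum_int: "integrable S (\<lambda>\<omega>. exp (mass 2 b (soft_exponent n k \<epsilon> (X \<union> ({..<n} - I))) \<omega>))" if "I \<in> Pow {..<n}" "X \<in> Pow I" for I X
  proof -
    have J: "X \<union> ({..<n} - I) \<subseteq> {..<n}" using that by auto
    note se = soft_exponent[OF n k J, where \<epsilon>=\<epsilon>]
    show ?thesis
      using integrable_exp_mass[OF borel_measurable_continuous_onI[OF se(1)] se(3) se(2) _ b r', of 2 0] by simp
  qed
  have soft_eq: "?soft = (\<lambda>\<omega>. \<Sum>I\<in>Pow {..<n}. \<Sum>X\<in>Pow I. f (grid_points n I) * (- 1) ^ card X * exp (mass 2 b (soft_exponent n k \<epsilon> (X \<union> ({..<n} - I))) \<omega>))"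
    by (rule ext) (rule soft_value_expand)
  have int_soft: "integrable S ?soft"
    unfolding soft_eq by (intro Bochner_Integration.integrable_sum integrable_mult_right sum_int)
  have soft: "(\<integral>\<omega>. ?soft \<omega> \<partial>S) = soft_trace b \<epsilon> f n k"
    unfolding soft_eq soft_trace_def
    by (subst Bochner_Integration.integral_sum, intro Bochner_Integration.integrable_sum integrable_mult_right sum_int, assumption, assumption,
        intro sum.cong refl, subst Bochner_Integration.integral_sum, intro integrable_mult_right sum_int, assumption, assumption)
      (simp add: fk_def)
  have mono12: "visits 1 \<omega> \<le> visits 2 \<omega>" if "finite {j. pos j \<omega> \<le> 2}" for \<omega>
    unfolding visits_def by (rule card_mono[OF that]) auto
  have tr_le: "\<bar>?tr \<omega>\<bar> \<le> B * exp (\<bar>\<epsilon>\<bar> / b * visits 2 \<omega>)" if "finite {j. pos j \<omega> \<le> 2}" for \<omega>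
  proof -
    have "\<epsilon> * (visits 1 \<omega> / b) \<le> \<bar>\<epsilon>\<bar> * (visits 2 \<omega> / b)"
      using mono12[OF that] b by (intro mult_mono divide_right_mono) auto
    then show ?thesis using B[OF walk_trace_closed[of \<omega>]] B0 by (auto simp: abs_mult intro!: mult_mono)
  qed
  have soft_le: "\<bar>?soft \<omega>\<bar> \<le> B * exp (\<bar>\<epsilon>\<bar> / b * visits 2 \<omega>)" for \<omega>
  proof -
    have "\<bar>mass 2 b (cutoff n) \<omega>\<bar> \<le> 1 / b * visits 2 \<omega>"
      by (rule abs_mass_le) (use Tc(2,3) b in auto)
    then have "\<bar>\<epsilon>\<bar> * \<bar>mass 2 b (cutoff n) \<omega>\<bar> \<le> \<bar>\<epsilon>\<bar> * (1 / b * visits 2 \<omega>)"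
      by (rule mult_left_mono) simp
    then have le: "\<epsilon> * mass 2 b (cutoff n) \<omega> \<le> \<bar>\<epsilon>\<bar> / b * visits 2 \<omega>"
      using abs_ge_self[of "\<epsilon> * mass 2 b (cutoff n) \<omega>"] by (simp add: abs_mult)
    have "\<bar>?soft \<omega>\<bar> = \<bar>soft_value f n k b \<omega>\<bar> * exp (\<epsilon> * mass 2 b (cutoff n) \<omega>)"
      by (simp only: abs_mult abs_exp_cancel)
    also have "\<dots> \<le> B * exp (\<bar>\<epsilon>\<bar> / b * visits 2 \<omega>)"
      using le by (intro mult_mono soft_value_bounded[OF b n0(1) k B] B0) simp_all
    finally show ?thesis .
  qed
  have E1: "exp (\<bar>\<epsilon>\<bar> / b * visits 2 \<omega>) \<le> ?E \<omega>" for \<omega>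
    using b by (simp add: divide_right_mono mult_right_mono)
  have ET: "exp (\<bar>\<epsilon>\<bar> / b * visits 2 \<omega>) \<le> T + ?E \<omega> / T" for \<omega>
  proof -
    define x where "x = exp (\<bar>\<epsilon>\<bar> / b * visits 2 \<omega>)"
    have x: "0 \<le> x" by (simp add: x_def)
    have xx: "?E \<omega> = x * x" by (simp add: x_def mult_exp_exp)
    have "x \<le> T + x * x / T"
    proof (cases "x \<le> T")
      case True
      then show ?thesis using x T by (simp add: add_increasing2)
    next
      case False
      then have "x * T \<le> x * x" using x by (intro mult_left_mono) auto
      then have "x \<le> x * x / T" using T by (simp add: field_simps)
      then show ?thesis using T by linarith
    qed
    then show ?thesis unfolding xx by (simp only: x_def)
  qed
  have cut: "mass 2 b (cutoff n) \<omega> = visits 1 \<omega> / b" if fin: "finite {j. pos j \<omega> \<le> 2}" and gap: "\<And>j. pos j \<omega> \<notin> {1 - 3 / n..1 + 3 / n}" for \<omega>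
  proof -
    have fin1: "finite {j. pos j \<omega> \<le> 1}" by (rule finite_subset[OF _ fin]) auto
    have c: "cutoff n (pos j \<omega>) = (if j < visits 1 \<omega> then 1 else 0)" for j
    proof (cases "j < visits 1 \<omega>")
      case True
      then have "j \<in> {j. pos j \<omega> \<le> 1}" unfolding visited_indices_eq[OF fin1] by simp
      then have "pos j \<omega> < 1 - 3 / n" using gap[of j] n0 by (auto simp: not_le add_increasing2)
      then show ?thesis using True by (simp add: Tc(4))
    next
      case False
      then have "j \<notin> {j. pos j \<omega> \<le> 1}" unfolding visited_indices_eq[OF fin1] by simp
      then have "1 \<le> pos j \<omega>" by simp
      moreover have "1 - 3 / real n + 1 / real n \<le> 1" by (simp add: divide_right_mono)
      ultimately have "1 - 3 / real n + 1 / real n \<le> pos j \<omega>" by (rule order_trans[rotated])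
      from Tc(6)[OF this] False show ?thesis by simp
    qed
    have "(\<Sum>j<visits 2 \<omega>. cutoff n (pos j \<omega>)) = (\<Sum>j\<in>{..<visits 2 \<omega>} \<inter> {..<visits 1 \<omega>}. 1)"
      unfolding c by (subst sum.inter_restrict) auto
    also have "{..<visits 2 \<omega>} \<inter> {..<visits 1 \<omega>} = {..<visits 1 \<omega>}" using mono12[OF fin] by auto
    finally show ?thesis by (simp add: mass_def)
  qed
  let ?c = "e + 2 * B * 2 ^ n * exp (- k * q)"
  have e0: "0 < e"
  proof -
    have "close_sets (3 / n) {} {}" "{} \<in> closed_unit_sets" by (auto simp: close_sets_def closed_unit_sets_def)
    then show ?thesis using unif[of "{}" "{}"] by simp
  qed
  have c0: "0 \<le> ?c" using e0 B0 by simp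
  have AE: "AE \<omega> in S. \<bar>?tr \<omega> - ?soft \<omega>\<bar> \<le> ?E \<omega> * (?c + 2 * B / T) + 2 * B * T * indicator (bad_set b q n) \<omega> \<and> \<bar>?tr \<omega>\<bar> \<le> B * ?E \<omega>"
    using AE_finite_visits[OF r(1) lap1] AE_space
  proof eventually_elim
    case (elim \<omega>)
    then have fin: "finite {j. pos j \<omega> \<le> R}" for R by blast
    have "\<bar>?tr \<omega>\<bar> \<le> B * ?E \<omega>"
      using tr_le[OF fin] mult_left_mono[OF E1 B0, of \<omega>] by linarith
    moreover have "\<bar>?tr \<omega> - ?soft \<omega>\<bar> \<le> ?E \<omega> * (?c + 2 * B / T) + 2 * B * T * indicator (bad_set b q n) \<omega>"
    proof (cases "\<omega> \<in> bad_set b q n")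
      case True
      have "\<bar>?tr \<omega> - ?soft \<omega>\<bar> \<le> 2 * B * exp (\<bar>\<epsilon>\<bar> / b * visits 2 \<omega>)"
        using tr_le[OF fin] soft_le[of \<omega>] by linarith
      also have "\<dots> \<le> 2 * B * (T + ?E \<omega> / T)"
        using B0 by (intro mult_left_mono ET) auto
      also have "\<dots> = ?E \<omega> * (2 * B / T) + 2 * B * T" using T by (simp add: field_simps)
      also have "\<dots> \<le> ?E \<omega> * (?c + 2 * B / T) + 2 * B * T"
        using c0 by (intro add_right_mono mult_left_mono) auto
      finally show ?thesis using True by simp
    next
      case False
      note good = good_of_not_bad[OF b n elim(2) False fin]
      have "?tr \<omega> - ?soft \<omega> = (f (walk_trace \<omega>) - soft_value f n k b \<omega>) * exp (\<epsilon> * (visits 1 \<omega> / b))"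
        unfolding cut[OF fin good(1)] by (simp only: left_diff_distrib)
      also have "\<bar>\<dots>\<bar> = \<bar>f (walk_trace \<omega>) - soft_value f n k b \<omega>\<bar> * exp (\<epsilon> * (visits 1 \<omega> / b))"
        by (simp only: abs_mult abs_exp_cancel)
      also have "\<dots> \<le> ?c * ?E \<omega>"
      proof (rule mult_mono)
        show "\<bar>f (walk_trace \<omega>) - soft_value f n k b \<omega>\<bar> \<le> ?c"
          by (rule soft_value_near[OF b n k q B unif fin good(2) good(1)])
        have "\<epsilon> * (visits 1 \<omega> / b) \<le> \<bar>\<epsilon>\<bar> * (visits 2 \<omega> / b)"
          using mono12[OF fin] b by (intro mult_mono divide_right_mono) auto
        then have "exp (\<epsilon> * (visits 1 \<omega> / b)) \<le> exp (\<bar>\<epsilon>\<bar> / b * visits 2 \<omega>)" by simp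
        from order_trans[OF this E1] show "exp (\<epsilon> * (visits 1 \<omega> / b)) \<le> ?E \<omega>" .
      qed (use c0 in auto)
      also have "\<dots> \<le> ?E \<omega> * (?c + 2 * B / T)"
      proof -
        have "?c * ?E \<omega> = ?E \<omega> * ?c" by (rule mult.commute)
        also have "\<dots> \<le> ?E \<omega> * (?c + 2 * B / T)" using B0 T by (intro mult_left_mono) auto
        finally show ?thesis .
      qed
      finally show ?thesis using False by simp
    qed
    ultimately show ?case by blast
  qed
  have int_tr: "integrable S ?tr"
  proof (rule Bochner_Integration.integrable_bound)
    show "integrable S (\<lambda>\<omega>. B * ?E \<omega>)" using intE by (rule integrable_mult_right)
    show "AE \<omega> in S. norm (?tr \<omega>) \<le> norm (B * ?E \<omega>)"
      using AE by eventually_elim (auto intro: order_trans[OF _ abs_ge_self])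
  qed measurable
  have int_rhs: "integrable S (\<lambda>\<omega>. ?E \<omega> * (?c + 2 * B / T) + 2 * B * T * indicator (bad_set b q n) \<omega>)"
    by (intro Bochner_Integration.integrable_add integrable_mult_left integrable_mult_right intE integrable_real_indicator sets_bad_set)
      (auto simp: less_top[symmetric])
  have "\<bar>weighted_trace b \<epsilon> f - soft_trace b \<epsilon> f n k\<bar> = \<bar>\<integral>\<omega>. ?tr \<omega> - ?soft \<omega> \<partial>S\<bar>"
    unfolding weighted_trace_def soft[symmetric] by (subst Bochner_Integration.integral_diff[OF int_tr int_soft]) (rule refl)
  also have "\<dots> \<le> (\<integral>\<omega>. \<bar>?tr \<omega> - ?soft \<omega>\<bar> \<partial>S)" by (rule integral_abs_bound)
  also have "\<dots> \<le> (\<integral>\<omega>. ?E \<omega> * (?c + 2 * B / T) + 2 * B * T * indicator (bad_set b q n) \<omega> \<partial>S)"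
    by (rule integral_mono_AE[OF integrable_abs[OF Bochner_Integration.integrable_diff[OF int_tr int_soft]] int_rhs])
      (use AE in eventually_elim, blast)
  also have "\<dots> = visit_moment 2 (2 * \<bar>\<epsilon>\<bar> / b) * (?c + 2 * B / T) + 2 * B * T * P.prob (bad_set b q n)"
  proof -
    have 1: "integrable S (\<lambda>\<omega>. ?E \<omega> * (?c + 2 * B / T))" using intE by (rule integrable_mult_left)
    have 2: "integrable S (\<lambda>\<omega>. 2 * B * T * indicator (bad_set b q n) \<omega>)"
      by (intro integrable_mult_right integrable_real_indicator sets_bad_set) (auto simp: less_top[symmetric])
    have 3: "(\<integral>\<omega>. ?E \<omega> * (?c + 2 * B / T) \<partial>S) = visit_moment 2 (2 * \<bar>\<epsilon>\<bar> / b) * (?c + 2 * B / T)"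
      unfolding visit_moment_def by (rule integral_mult_left_zero)
    have 4: "(\<integral>\<omega>. 2 * B * T * indicator (bad_set b q n) \<omega> \<partial>S) = 2 * B * T * P.prob (bad_set b q n)"
      by (subst integral_mult_right_zero) simp
    show ?thesis unfolding Bochner_Integration.integral_add[OF 1 2] 3 4 ..
  qed
  also have "\<dots> \<le> V * (?c + 2 * B / T) + 2 * B * T * P.prob (bad_set b q n)"
    using V c0 B0 T by (intro add_right_mono mult_right_mono) auto
  finally show ?thesis .
qed
end


lemma close_sets_mono: "close_sets d F G \<Longrightarrow> d \<le> d' \<Longrightarrow> close_sets d' F G"
  unfolding close_sets_def by (meson order_trans)

context stable_array
begin

lemma soft_trace_approximates:
  assumes f: "continuous_map matheron euclideanreal f" and B: "\<And>F. F \<in> closed_unit_sets \<Longrightarrow> \<bar>f F\<bar> \<le> B" and e: "0 < e"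
  shows "\<exists>n0. \<forall>n\<ge>n0. \<exists>k0. \<forall>k\<ge>k0. \<forall>\<^sub>F m in sequentially. \<bar>st.weighted_trace m (b m) \<epsilon> f - st.soft_trace m (b m) \<epsilon> f n k\<bar> \<le> e"
proof -
  define B' where "B' = \<bar>B\<bar> + 1"
  have B': "0 < B'" "\<And>F. F \<in> closed_unit_sets \<Longrightarrow> \<bar>f F\<bar> \<le> B'" using B by (force simp: B'_def)+
  have "0 \<le> 2 * \<bar>\<epsilon>\<bar>" by simp
  then obtain r V where r: "0 < r" and V: "\<forall>\<^sub>F m in sequentially. exp (2 * \<bar>\<epsilon>\<bar> / b m) * st.lap m r < 1 \<and> st.visit_moment m 2 (2 * \<bar>\<epsilon>\<bar> / b m) \<le> V"
    by (rule moments)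
  define V' where "V' = \<bar>V\<bar> + 1"
  have V': "0 < V'" "V \<le> V'" by (auto simp: V'_def)
  define \<eta> where "\<eta> = e / (8 * V')"
  define T where "T = 16 * B' * V' / e"
  define p where "p = e / (8 * B' * T)"
  have pos': "0 < \<eta>" "0 < T" "0 < p" using e V' B' by (auto simp: \<eta>_def T_def p_def)
  obtain d1 where d1: "0 < d1" "\<And>F G. F \<in> closed_unit_sets \<Longrightarrow> G \<in> closed_unit_sets \<Longrightarrow> close_sets d1 F G \<Longrightarrow> \<bar>f F - f G\<bar> < \<eta>"
    using matheron_uniformly_continuous[OF f pos'(1)] by blast
  obtain d2 where d2: "0 < d2" "\<forall>\<^sub>F m in sequentially. st.P.prob m {\<omega>\<in>space (Pi\<^sub>M UNIV (\<lambda>_. \<mu> m)). \<exists>j. pos j \<omega> \<in> {1 - d2..1 + d2}} \<le> p"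
    by (rule prob_hit_near_one[OF pos'(3)])
  define n0 where "n0 = max 4 (nat \<lceil>3 / min d1 d2\<rceil>)"
  have "\<exists>k0. \<forall>k\<ge>k0. \<forall>\<^sub>F m in sequentially. \<bar>st.weighted_trace m (b m) \<epsilon> f - st.soft_trace m (b m) \<epsilon> f n k\<bar> \<le> e" if "n0 \<le> n" for n
  proof -
    have n: "3 < n" "0 < n" using that by (auto simp: n0_def)
    have "3 / min d1 d2 \<le> real n" using that by (simp add: n0_def)
    then have "3 / n \<le> min d1 d2" using n d1(1) d2(1) by (simp add: field_simps min_def split: if_splits)
    then have nd: "3 / n \<le> d1" "3 / n \<le> d2" by auto
    have h: "0 < 1 / real n" and pn: "0 < p / n" using n pos' by auto
    obtain q where q: "0 < q" "\<forall>\<^sub>F m in sequentially. st.P.prob m {\<omega>\<in>space (Pi\<^sub>M UNIV (\<lambda>_. \<mu> m)). real (visits (1 / n) \<omega>) < q * b m} \<le> p / n"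
      by (rule prob_few_visits_eventually[OF h pn])
    define c where "c = e / (16 * B' * V' * 2 ^ n)"
    have c: "0 < c" using e B' V' by (simp add: c_def)
    define k0 where "k0 = max 0 (- ln c / q)"
    have "\<forall>\<^sub>F m in sequentially. \<bar>st.weighted_trace m (b m) \<epsilon> f - st.soft_trace m (b m) \<epsilon> f n k\<bar> \<le> e" if "k0 \<le> k" for k
    proof -
      have k: "0 \<le> k" "- ln c / q \<le> k" using that by (auto simp: k0_def)
      have "- k * q \<le> ln c" using k(2) q(1) by (simp add: field_simps)
      then have ec: "exp (- k * q) \<le> c" using c by (metis exp_le_cancel_iff exp_ln)
      have "0 \<le> \<bar>\<epsilon>\<bar> + k * n" using k by simp
      then obtain r' V2 where r': "0 < r'" and V2: "\<forall>\<^sub>F m in sequentially. exp ((\<bar>\<epsilon>\<bar> + k * n) / b m) * st.lap m r' < 1 \<and> st.visit_moment m 2 ((\<bar>\<epsilon>\<bar> + k * n) / b m) \<le> V2"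
        by (rule moments)
      from V d2(2) q(2) V2 show ?thesis
      proof eventually_elim
        case (elim m)
        let ?bad = "st.P.prob m (st.bad_set m (b m) q n)"
        have "?bad \<le> st.P.prob m {\<omega>\<in>space (Pi\<^sub>M UNIV (\<lambda>_. \<mu> m)). \<exists>j. pos j \<omega> \<in> {1 - 3 / n..1 + 3 / n}} + n * st.P.prob m {\<omega>\<in>space (Pi\<^sub>M UNIV (\<lambda>_. \<mu> m)). real (visits (1 / n) \<omega>) < q * b m}"
          by (rule st.prob_bad_set)
        also have "st.P.prob m {\<omega>\<in>space (Pi\<^sub>M UNIV (\<lambda>_. \<mu> m)). \<exists>j. pos j \<omega> \<in> {1 - 3 / n..1 + 3 / n}} \<le> st.P.prob m {\<omega>\<in>space (Pi\<^sub>M UNIV (\<lambda>_. \<mu> m)). \<exists>j. pos j \<omega> \<in> {1 - d2..1 + d2}}"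
        proof (rule st.P.finite_measure_mono)
          show "{\<omega>\<in>space (Pi\<^sub>M UNIV (\<lambda>_. \<mu> m)). \<exists>j. pos j \<omega> \<in> {1 - d2..1 + d2}} \<in> sets (Pi\<^sub>M UNIV (\<lambda>_. \<mu> m))"
            by measurable
          show "{\<omega>\<in>space (Pi\<^sub>M UNIV (\<lambda>_. \<mu> m)). \<exists>j. pos j \<omega> \<in> {1 - 3 / n..1 + 3 / n}} \<subseteq> {\<omega>\<in>space (Pi\<^sub>M UNIV (\<lambda>_. \<mu> m)). \<exists>j. pos j \<omega> \<in> {1 - d2..1 + d2}}"
          proof (rule Collect_mono, intro impI, elim conjE exE, intro conjI exI)
            fix \<omega> j assume "pos j \<omega> \<in> {1 - 3 / real n..1 + 3 / real n}"
            then show "pos j \<omega> \<in> {1 - d2..1 + d2}" using nd(2) unfolding atLeastAtMost_iff by linarith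
          qed
        qed
        also have "\<dots> \<le> p" by (rule elim(2))
        also have "n * st.P.prob m {\<omega>\<in>space (Pi\<^sub>M UNIV (\<lambda>_. \<mu> m)). real (visits (1 / n) \<omega>) < q * b m} \<le> n * (p / n)"
          using elim(3) by (intro mult_left_mono) auto
        also have "n * (p / n) = p" using n by simp
        finally have bad: "?bad \<le> p + p" by simp
        have "\<bar>st.weighted_trace m (b m) \<epsilon> f - st.soft_trace m (b m) \<epsilon> f n k\<bar> \<le>
            V' * (\<eta> + 2 * B' * 2 ^ n * exp (- k * q) + 2 * B' / T) + 2 * B' * T * ?bad"
        proof (rule st.soft_trace_near[OF b_pos n(1) k(1) q(1) f B'(2) _ r _ r' _ _ pos'(2)])
          show "\<bar>f F - f G\<bar> < \<eta>" if "F \<in> closed_unit_sets" "G \<in> closed_unit_sets" "close_sets (3 / n) F G" for F G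
            using d1(2)[OF that(1,2) close_sets_mono[OF that(3) nd(1)]] .
        qed (use elim V' in auto)
        also have "\<dots> \<le> V' * (\<eta> + 2 * B' * 2 ^ n * c + 2 * B' / T) + 2 * B' * T * (p + p)"
          using V' B' pos' ec bad by (intro add_mono mult_left_mono) auto
        also have "\<dots> = e / 8 + e / 8 + e / 8 + e / 2"
        proof -
          have "V' * \<eta> = e / 8" using V' by (simp add: \<eta>_def)
          moreover have "V' * (2 * B' * 2 ^ n * c) = e / 8" using V' B' by (simp add: c_def field_simps)
          moreover have "V' * (2 * B' / T) = e / 8" using V' B' e by (simp add: T_def field_simps)
          moreover have "2 * B' * T * (p + p) = e / 2" using B' pos'(2) by (simp add: p_def field_simps)
          ultimately show ?thesis by (simp only: distrib_left)
        qed
        also have "\<dots> \<le> e" using e by simp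
        finally show ?case .
      qed
    qed
    then show ?thesis by blast
  qed
  then show ?thesis by blast
qed

end

theorem weighted_trace_universal:
  assumes A: "stable_array \<alpha> \<mu> b" and A': "stable_array \<alpha> \<mu>' b'"
    and f: "continuous_map matheron euclideanreal f" and B: "\<And>F. F \<in> closed_unit_sets \<Longrightarrow> \<bar>f F\<bar> \<le> B"
  shows "(\<lambda>n. iid_steps.weighted_trace (\<mu> n) (b n) \<epsilon> f - iid_steps.weighted_trace (\<mu>' n) (b' n) \<epsilon> f) \<longlonglongrightarrow> 0"
proof (rule tendstoI)
  interpret A: stable_array \<alpha> \<mu> b by fact
  interpret A': stable_array \<alpha> \<mu>' b' by fact
  fix e :: real assume e: "0 < e"
  have e3: "0 < e / 4" using e by simp
  obtain n1 where n1: "\<And>n. n1 \<le> n \<Longrightarrow> \<exists>k0. \<forall>k\<ge>k0. \<forall>\<^sub>F m in sequentially. \<bar>A.st.weighted_trace m (b m) \<epsilon> f - A.st.soft_trace m (b m) \<epsilon> f n k\<bar> \<le> e / 4"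
    using A.soft_trace_approximates[OF f B e3] by blast
  obtain n2 where n2: "\<And>n. n2 \<le> n \<Longrightarrow> \<exists>k0. \<forall>k\<ge>k0. \<forall>\<^sub>F m in sequentially. \<bar>A'.st.weighted_trace m (b' m) \<epsilon> f - A'.st.soft_trace m (b' m) \<epsilon> f n k\<bar> \<le> e / 4"
    using A'.soft_trace_approximates[OF f B e3] by blast
  define n where "n = max 4 (max n1 n2)"
  have n: "3 < n" "n1 \<le> n" "n2 \<le> n" by (auto simp: n_def)
  obtain k1 where k1: "\<And>k. k1 \<le> k \<Longrightarrow> \<forall>\<^sub>F m in sequentially. \<bar>A.st.weighted_trace m (b m) \<epsilon> f - A.st.soft_trace m (b m) \<epsilon> f n k\<bar> \<le> e / 4"
    using n1[OF n(2)] by blast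
  obtain k2 where k2: "\<And>k. k2 \<le> k \<Longrightarrow> \<forall>\<^sub>F m in sequentially. \<bar>A'.st.weighted_trace m (b' m) \<epsilon> f - A'.st.soft_trace m (b' m) \<epsilon> f n k\<bar> \<le> e / 4"
    using n2[OF n(3)] by blast
  define k where "k = max 0 (max k1 k2)"
  have k: "0 \<le> k" "k1 \<le> k" "k2 \<le> k" by (auto simp: k_def)
  have "(\<lambda>m. \<Sum>I\<in>Pow {..<n}. \<Sum>X\<in>Pow I. f (grid_points n I) * (- 1) ^ card X *
      (A.st.fk m 2 (b m) (soft_exponent n k \<epsilon> (X \<union> ({..<n} - I))) 0 - A'.st.fk m 2 (b' m) (soft_exponent n k \<epsilon> (X \<union> ({..<n} - I))) 0))
    \<longlonglongrightarrow> (\<Sum>I\<in>Pow {..<n}. \<Sum>X\<in>Pow I. f (grid_points n I) * (- 1) ^ card X * 0)"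
  proof (intro tendsto_sum tendsto_mult tendsto_const)
    fix I X assume "I \<in> Pow {..<n}" "X \<in> Pow I"
    then have J: "X \<union> ({..<n} - I) \<subseteq> {..<n}" by auto
    note se = soft_exponent[OF n(1) k(1) J, where \<epsilon>=\<epsilon>]
    show "(\<lambda>m. A.st.fk m 2 (b m) (soft_exponent n k \<epsilon> (X \<union> ({..<n} - I))) 0 - A'.st.fk m 2 (b' m) (soft_exponent n k \<epsilon> (X \<union> ({..<n} - I))) 0) \<longlonglongrightarrow> 0"
      by (rule fk_universal[OF A A' se(1) se(2) _ se(3)]) simp_all
  qed
  then have "(\<lambda>m. A.st.soft_trace m (b m) \<epsilon> f n k - A'.st.soft_trace m (b' m) \<epsilon> f n k) \<longlonglongrightarrow> 0"
    by (simp add: A.st.soft_trace_def A'.st.soft_trace_def right_diff_distrib sum_subtractf)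
  from tendstoD[OF this e3] k1[OF k(2)] k2[OF k(3)]
  show "\<forall>\<^sub>F m in sequentially. dist (A.st.weighted_trace m (b m) \<epsilon> f - A'.st.weighted_trace m (b' m) \<epsilon> f) 0 < e"
  proof eventually_elim
    case (elim m)
    have "\<bar>x - y\<bar> < e" if "\<bar>s - s'\<bar> < e / 4" "\<bar>x - s\<bar> \<le> e / 4" "\<bar>y - s'\<bar> \<le> e / 4" for x y s s' :: real
      using that by linarith
    from this[OF _ elim(2,3)] elim(1) show ?case unfolding dist_real_def diff_0_right .
  qed
qed

section \<open>The stable subordinator\<close>

lemma (in prob_space) indep_vars_UNIV:
  fixes X :: "nat \<Rightarrow> 'a \<Rightarrow> 'b"
  assumes "\<And>n. indep_vars N X {..<n}"
  shows "indep_vars N X UNIV"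
proof -
  have rv: "random_variable (N i) (X i)" for i
    using assms[of "Suc i"] by (auto simp: indep_vars_def2)
  have "indep_sets (\<lambda>i. {X i -` A \<inter> space M | A. A \<in> sets (N i)}) UNIV"
  proof (subst indep_sets_finite_index_sets, intro allI impI)
    fix J :: "nat set" assume "finite J"
    then obtain n where n: "J \<subseteq> {..<n}" using finite_nat_iff_bounded by blast
    have "indep_sets (\<lambda>i. {X i -` A \<inter> space M | A. A \<in> sets (N i)}) {..<n}"
      using assms[of n] by (simp add: indep_vars_def2)
    then show "indep_sets (\<lambda>i. {X i -` A \<inter> space M | A. A \<in> sets (N i)}) J"
      by (rule indep_sets_mono_index[OF n])
  qed
  then show ?thesis using rv by (simp add: indep_vars_def2)
qed

lemma (in prob_space) distr_iid_sequence:
  fixes X :: "nat \<Rightarrow> 'a \<Rightarrow> real"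
  assumes "indep_vars (\<lambda>_. borel) X UNIV" "\<And>i. distr M borel (X i) = \<mu>"
  shows "distr M (Pi\<^sub>M UNIV (\<lambda>_. \<mu>)) (\<lambda>\<omega> i. X i \<omega>) = Pi\<^sub>M UNIV (\<lambda>_. \<mu>)"
    and "(\<lambda>\<omega> i. X i \<omega>) \<in> measurable M (Pi\<^sub>M UNIV (\<lambda>_. \<mu>))"
proof -
  have rv: "random_variable borel (X i)" for i
    using assms(1) by (auto simp: indep_vars_def2)
  have sets: "sets \<mu> = sets borel" using assms(2)[of 0] by (metis sets_distr)
  have sP: "sets (Pi\<^sub>M UNIV (\<lambda>_::nat. \<mu>)) = sets (Pi\<^sub>M UNIV (\<lambda>_::nat. borel))"
    by (rule sets_PiM_cong) (auto simp: sets)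
  have "distr M (Pi\<^sub>M UNIV (\<lambda>_. borel)) (\<lambda>\<omega>. \<lambda>i\<in>UNIV. X i \<omega>) = Pi\<^sub>M UNIV (\<lambda>i. distr M borel (X i))"
    using indep_vars_iff_distr_eq_PiM'[of UNIV X "\<lambda>_. borel"] rv assms(1) by simp
  then show "distr M (Pi\<^sub>M UNIV (\<lambda>_. \<mu>)) (\<lambda>\<omega> i. X i \<omega>) = Pi\<^sub>M UNIV (\<lambda>_. \<mu>)"
    unfolding distr_cong[OF refl sP refl] by (simp add: assms(2) restrict_def)
  show "(\<lambda>\<omega> i. X i \<omega>) \<in> measurable M (Pi\<^sub>M UNIV (\<lambda>_. \<mu>))"
    unfolding measurable_cong_sets[OF refl sP] using rv by (intro measurable_PiM_single') (auto simp: space_PiM)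
qed

locale subordinator =
  fixes \<alpha> :: real and M :: "'b measure" and \<sigma> :: "real \<Rightarrow> 'b \<Rightarrow> real"
  assumes \<alpha>: "0 < \<alpha>" "\<alpha> < 1" and stable: "stable_subordinator \<alpha> M \<sigma>"
begin

lemma levy: "levy_process M \<sigma>"
  using stable by (simp add: stable_subordinator_def)

sublocale prob_space M
  using levy by (simp add: levy_process_def)

lemma \<sigma>_measurable: "0 \<le> s \<Longrightarrow> \<sigma> s \<in> borel_measurable M"
  using levy by (simp add: levy_process_def)

lemma \<sigma>_zero: "\<omega> \<in> space M \<Longrightarrow> \<sigma> 0 \<omega> = 0"
  using levy by (simp add: levy_process_def)

lemma \<sigma>_mono: "\<omega> \<in> space M \<Longrightarrow> 0 \<le> s \<Longrightarrow> s \<le> t \<Longrightarrow> \<sigma> s \<omega> \<le> \<sigma> t \<omega>"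
  using stable unfolding stable_subordinator_def mono_on_def by auto

lemma \<sigma>_nonneg: "\<omega> \<in> space M \<Longrightarrow> 0 \<le> s \<Longrightarrow> 0 \<le> \<sigma> s \<omega>"
  using \<sigma>_mono[of \<omega> 0 s] \<sigma>_zero by simp

lemma \<sigma>_right_continuous:
  assumes "\<omega> \<in> space M" "0 \<le> s" "open G" "\<sigma> s \<omega> \<in> G"
  shows "\<exists>d>0. \<forall>u. s \<le> u \<and> u < s + d \<longrightarrow> \<sigma> u \<omega> \<in> G"
proof -
  have "continuous (at_right s) (\<lambda>u. \<sigma> u \<omega>)"
    using levy assms(1,2) by (simp add: levy_process_def)
  then have "((\<lambda>u. \<sigma> u \<omega>) \<longlongrightarrow> \<sigma> s \<omega>) (at_right s)"
    by (simp add: continuous_within)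
  then have "\<forall>\<^sub>F u in at_right s. \<sigma> u \<omega> \<in> G"
    using assms(3,4) by (rule topological_tendstoD)
  then obtain t where t: "s < t" "\<And>u. s < u \<Longrightarrow> u < t \<Longrightarrow> \<sigma> u \<omega> \<in> G"
    by (auto simp: eventually_at_right_field)
  show ?thesis
    using t assms(4) by (intro exI[of _ "t - s"]) (auto simp: le_less)
qed

definition rate :: "nat \<Rightarrow> real" where "rate n = real n + 1"

definition step_law :: "nat \<Rightarrow> real measure" where "step_law n = distr M borel (\<sigma> (1 / rate n))"

definition increments :: "nat \<Rightarrow> 'b \<Rightarrow> nat \<Rightarrow> real" where
  "increments n \<omega> i = \<sigma> (real (Suc i) / rate n) \<omega> - \<sigma> (real i / rate n) \<omega>"

lemma rate_pos [simp]: "0 < rate n" "0 \<le> rate n" "rate n \<noteq> 0"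
  by (auto simp: rate_def)

lemma iid_step_law: "iid_steps (step_law n)"
proof -
  have "prob_space (step_law n)"
    unfolding step_law_def by (rule prob_space_distr) (simp add: \<sigma>_measurable)
  then interpret S: prob_space "step_law n" .
  show ?thesis
    by unfold_locales (simp add: step_law_def)
qed

lemma lap_step_law: "0 < r \<Longrightarrow> iid_steps.lap (step_law n) r = exp (- (r powr \<alpha>) / rate n)"
proof -
  assume r: "0 < r"
  have [measurable]: "\<sigma> (1 / rate n) \<in> borel_measurable M" by (simp add: \<sigma>_measurable)
  have "iid_steps.lap (step_law n) r = (\<integral>x. exp (- r * \<bar>x\<bar>) \<partial>step_law n)"
    by (rule iid_steps.lap_def[OF iid_step_law])
  also have "\<dots> = (\<integral>\<omega>. exp (- r * \<bar>\<sigma> (1 / rate n) \<omega>\<bar>) \<partial>M)"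
    unfolding step_law_def by (rule integral_distr) measurable
  also have "\<dots> = (\<integral>\<omega>. exp (- r * \<sigma> (1 / rate n) \<omega>) \<partial>M)"
    by (intro Bochner_Integration.integral_cong refl) (simp add: \<sigma>_nonneg)
  also have "\<dots> = exp (- (1 / rate n) * r powr \<alpha>)"
    using stable r by (simp add: stable_subordinator_def)
  finally show ?thesis by simp
qed

lemma rate_top: "filterlim rate at_top sequentially"
  unfolding filterlim_at_top eventually_sequentially
proof
  fix Z :: real
  have "Z \<le> rate n" if "nat \<lceil>Z\<rceil> \<le> n" for n
    unfolding rate_def using that by linarith
  then show "\<exists>N. \<forall>n\<ge>N. Z \<le> rate n" by blast
qed

sublocale grid: stable_array \<alpha> step_law rate
proof (rule stable_array.intro)
  show "(\<lambda>n. rate n * (1 - iid_steps.lap (step_law n) r)) \<longlonglongrightarrow> r powr \<alpha>" if "0 < r" for r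
  proof -
    have "(\<lambda>n. - (rate n * (exp (- (r powr \<alpha>) / rate n) - 1))) \<longlonglongrightarrow> - (- (r powr \<alpha>))"
      by (intro tendsto_minus scaled_exp_limit rate_top) simp
    then show ?thesis using that by (simp add: lap_step_law right_diff_distrib)
  qed
qed (fact \<alpha> iid_step_law rate_pos rate_top)+

lemma increments_indep: "indep_vars (\<lambda>_. borel) (\<lambda>i \<omega>. increments n \<omega> i) UNIV"
proof (rule indep_vars_UNIV)
  fix m
  let ?t = "\<lambda>i. real i / rate n"
  have t: "0 \<le> ?t 0 \<and> mono ?t"
    by (auto simp: mono_def intro!: divide_right_mono)
  have "\<forall>(t::nat \<Rightarrow> real) n. 0 \<le> t 0 \<and> mono t \<longrightarrow>
        indep_vars (\<lambda>_. borel) (\<lambda>i \<omega>. \<sigma> (t (Suc i)) \<omega> - \<sigma> (t i) \<omega>) {..<n}"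
    using levy unfolding levy_process_def by (elim conjE)
  from this[THEN spec, THEN spec, THEN mp, OF t, of m]
  show "indep_vars (\<lambda>_. borel) (\<lambda>i \<omega>. increments n \<omega> i) {..<m}"
    unfolding increments_def .
qed

lemma increments_distr: "distr M borel (\<lambda>\<omega>. increments n \<omega> i) = step_law n"
proof -
  have "distr M borel (\<lambda>\<omega>. \<sigma> (real i / rate n + 1 / rate n) \<omega> - \<sigma> (real i / rate n) \<omega>) = distr M borel (\<sigma> (1 / rate n))"
  proof -
    have "\<forall>s\<ge>0. \<forall>h\<ge>0. distr M borel (\<lambda>\<omega>. \<sigma> (s + h) \<omega> - \<sigma> s \<omega>) = distr M borel (\<sigma> h)"
      using levy unfolding levy_process_def by (elim conjE)
    then show ?thesis by (elim allE impE) simp_all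
  qed
  moreover have "real i / rate n + 1 / rate n = real (Suc i) / rate n"
    by (simp add: add_divide_distrib add.commute)
  ultimately show ?thesis by (simp only: increments_def step_law_def)
qed

lemma distr_increments: "distr M (Pi\<^sub>M UNIV (\<lambda>_. step_law n)) (increments n) = Pi\<^sub>M UNIV (\<lambda>_. step_law n)"
  by (rule distr_iid_sequence(1)[OF increments_indep increments_distr])

lemma measurable_increments: "increments n \<in> measurable M (Pi\<^sub>M UNIV (\<lambda>_. step_law n))"
  by (rule distr_iid_sequence(2)[OF increments_indep increments_distr])

lemma pos_increments:
  assumes "\<omega> \<in> space M"
  shows "pos j (increments n \<omega>) = \<sigma> (real j / rate n) \<omega>"
proof -
  have "\<bar>increments n \<omega> i\<bar> = increments n \<omega> i" for i
    using \<sigma>_mono[OF assms, of "real i / rate n" "real (Suc i) / rate n"]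
    by (simp add: increments_def divide_right_mono)
  then have "pos j (increments n \<omega>) = (\<Sum>i<j. \<sigma> (real (Suc i) / rate n) \<omega> - \<sigma> (real i / rate n) \<omega>)"
    by (simp add: pos_def increments_def)
  also have "\<dots> = \<sigma> (real j / rate n) \<omega> - \<sigma> (real 0 / rate n) \<omega>"
    by (rule sum_lessThan_telescope)
  finally show ?thesis using \<sigma>_zero[OF assms] by simp
qed

lemma AE_unbounded: "AE \<omega> in M. \<forall>R. \<exists>s\<ge>0. R < \<sigma> s \<omega>"
proof -
  have "grid.st.lap 0 1 < 1" by (simp add: lap_step_law)
  from grid.st.AE_finite_visits[OF _ this]
  have "AE w in distr M (Pi\<^sub>M UNIV (\<lambda>_. step_law 0)) (increments 0). \<forall>R. finite {j. pos j w \<le> R}"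
    by (simp only: distr_increments)
  from AE_distrD[OF measurable_increments this] AE_space
  show ?thesis
  proof eventually_elim
    case (elim \<omega>)
    show ?case
    proof
      fix R
      have "finite {j. pos j (increments 0 \<omega>) \<le> R}" using elim(1) by blast
      then obtain j where "j \<notin> {j. pos j (increments 0 \<omega>) \<le> R}"
        using ex_new_if_finite infinite_UNIV_nat by blast
      then have "R < \<sigma> (real j / rate 0) \<omega>" using pos_increments[OF elim(2), of j 0] by simp
      then show "\<exists>s\<ge>0. R < \<sigma> s \<omega>" by (intro exI[of _ "real j / rate 0"]) simp
    qed
  qed
qed

lemma grid_approximates:
  assumes \<omega>: "\<omega> \<in> space M" and s: "0 \<le> s" and G: "open G" "\<sigma> s \<omega> \<in> G"
  shows "\<forall>\<^sub>F n in sequentially. \<exists>j. \<sigma> (real j / rate n) \<omega> \<in> G"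
proof -
  obtain d where d: "0 < d" "\<And>u. s \<le> u \<Longrightarrow> u < s + d \<Longrightarrow> \<sigma> u \<omega> \<in> G"
    using \<sigma>_right_continuous[OF \<omega> s G] by blast
  have "\<forall>\<^sub>F n in sequentially. 1 / d < rate n"
    using rate_top by (simp add: filterlim_at_top_dense)
  then show ?thesis
  proof eventually_elim
    case (elim n)
    define j where "j = nat \<lceil>s * rate n\<rceil>"
    have j: "s * rate n \<le> real j" "real j < s * rate n + 1" using s by (auto simp: j_def) linarith+
    have "1 / rate n < d" using elim d(1) by (simp add: field_simps)
    have "s \<le> real j / rate n" using j(1) by (simp add: field_simps)
    moreover have "real j / rate n < s + d"
    proof -
      have "real j / rate n < (s * rate n + 1) / rate n" using j(2) by (intro divide_strict_right_mono) auto
      also have "\<dots> = s + 1 / rate n" by (simp add: add_divide_distrib)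
      finally show ?thesis using \<open>1 / rate n < d\<close> by linarith
    qed
    ultimately show ?case using d(2) by blast
  qed
qed

definition unit_set :: "'b \<Rightarrow> real set" where
  "unit_set \<omega> = regenerative_set \<sigma> \<omega> \<inter> {0..1}"

lemma unit_set_closed: "unit_set \<omega> \<in> closed_unit_sets"
  unfolding unit_set_def regenerative_set_def by (rule closure_Int_unit_in_closed_unit_sets)

lemma measurable_unit_set: "unit_set \<in> measurable M (borel_of_topology matheron)"
proof -
  have eq: "regenerative_set \<sigma> \<omega> = closure (range (\<lambda>q::rat. \<sigma> \<bar>of_rat q\<bar> \<omega>))" if \<omega>: "\<omega> \<in> space M" for \<omega>
  proof
    show "closure (range (\<lambda>q::rat. \<sigma> \<bar>of_rat q\<bar> \<omega>)) \<subseteq> regenerative_set \<sigma> \<omega>"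
      unfolding regenerative_set_def by (rule closure_mono) force
    show "regenerative_set \<sigma> \<omega> \<subseteq> closure (range (\<lambda>q::rat. \<sigma> \<bar>of_rat q\<bar> \<omega>))"
      unfolding regenerative_set_def
    proof (rule closure_minimal)
      show "{\<sigma> s \<omega> |s. 0 \<le> s} \<subseteq> closure (range (\<lambda>q::rat. \<sigma> \<bar>of_rat q\<bar> \<omega>))"
      proof
        fix x assume "x \<in> {\<sigma> s \<omega> |s. 0 \<le> s}"
        then obtain s where s: "x = \<sigma> s \<omega>" "0 \<le> s" by blast
        show "x \<in> closure (range (\<lambda>q::rat. \<sigma> \<bar>of_rat q\<bar> \<omega>))"
          unfolding closure_approachable
        proof (intro allI impI)
          fix e :: real assume "0 < e"
          obtain d where d: "0 < d" "\<And>u. s \<le> u \<Longrightarrow> u < s + d \<Longrightarrow> \<sigma> u \<omega> \<in> ball x e"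
            using \<sigma>_right_continuous[OF \<omega> s(2), of "ball x e"] \<open>0 < e\<close> s(1) by auto
          obtain q where q: "s < of_rat q" "of_rat q < s + d" using of_rat_dense[of s "s + d"] d(1) by auto
          then have "0 \<le> (of_rat q :: real)" using s(2) by linarith
          then have "\<bar>of_rat q\<bar> = (of_rat q :: real)" by (rule abs_of_nonneg)
          then have "dist (\<sigma> \<bar>of_rat q\<bar> \<omega>) x < e" using d(2)[of "of_rat q"] q by (simp add: dist_commute)
          then show "\<exists>y\<in>range (\<lambda>q::rat. \<sigma> \<bar>of_rat q\<bar> \<omega>). dist y x < e" by blast
        qed
      qed
    qed simp
  qed
  have "(\<lambda>\<omega>. closure (range (\<lambda>q::rat. \<sigma> \<bar>of_rat q\<bar> \<omega>)) \<inter> {0..1}) \<in> measurable M (borel_of_topology matheron)"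
    by (rule measurable_closure_Int_unit) (simp add: \<sigma>_measurable)
  then show ?thesis
    by (subst measurable_cong[where g="\<lambda>\<omega>. closure (range (\<lambda>q::rat. \<sigma> \<bar>of_rat q\<bar> \<omega>)) \<inter> {0..1}"]) (auto simp: unit_set_def eq)
qed

lemma AE_one_notin: "AE \<omega> in M. 1 \<notin> regenerative_set \<sigma> \<omega>"
proof -
  let ?N = "{\<omega>\<in>space M. 1 \<in> regenerative_set \<sigma> \<omega>}"
  have "{F \<in> closed_unit_sets. F \<inter> {1} = {}} \<in> sets (borel_of_topology matheron)"
    using openin_matheron_miss[of "{1}"] by (simp add: sets_borel_of_topology)
  from measurable_sets[OF measurable_unit_set this]
  have "space M - (unit_set -` {F \<in> closed_unit_sets. F \<inter> {1} = {}} \<inter> space M) \<in> sets M" by blast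
  moreover have "space M - (unit_set -` {F \<in> closed_unit_sets. F \<inter> {1} = {}} \<inter> space M) = ?N"
    using unit_set_closed by (auto simp: unit_set_def)
  ultimately have N: "?N \<in> sets M" by simp
  have "prob ?N \<le> e" if e: "0 < e" for e
  proof -
    obtain d where d: "0 < d" "\<forall>\<^sub>F n in sequentially. grid.st.P.prob n {w\<in>space (Pi\<^sub>M UNIV (\<lambda>_. step_law n)). \<exists>j. pos j w \<in> {1 - d..1 + d}} \<le> e"
      by (rule grid.prob_hit_near_one[OF e])
    define H where "H n = {\<omega>\<in>space M. \<exists>j. \<sigma> (real j / rate n) \<omega> \<in> {1 - d..1 + d}}" for n
    have [measurable]: "\<sigma> (real j / rate n) \<in> borel_measurable M" for j n by (simp add: \<sigma>_measurable)
    have Hs: "H n \<in> sets M" for n unfolding H_def by measurable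
    have HP: "prob (H n) = grid.st.P.prob n {w\<in>space (Pi\<^sub>M UNIV (\<lambda>_. step_law n)). \<exists>j. pos j w \<in> {1 - d..1 + d}}" for n
    proof -
      have "grid.st.P.prob n {w\<in>space (Pi\<^sub>M UNIV (\<lambda>_. step_law n)). \<exists>j. pos j w \<in> {1 - d..1 + d}} =
        measure (distr M (Pi\<^sub>M UNIV (\<lambda>_. step_law n)) (increments n)) {w\<in>space (Pi\<^sub>M UNIV (\<lambda>_. step_law n)). \<exists>j. pos j w \<in> {1 - d..1 + d}}"
        by (simp only: distr_increments)
      also have "\<dots> = prob ((increments n) -` {w\<in>space (Pi\<^sub>M UNIV (\<lambda>_. step_law n)). \<exists>j. pos j w \<in> {1 - d..1 + d}} \<inter> space M)"
        by (rule measure_distr[OF measurable_increments]) measurable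
      also have "(increments n) -` {w\<in>space (Pi\<^sub>M UNIV (\<lambda>_. step_law n)). \<exists>j. pos j w \<in> {1 - d..1 + d}} \<inter> space M = H n"
        using measurable_space[OF measurable_increments] pos_increments unfolding H_def by auto
      finally show ?thesis by simp
    qed
    obtain n0 where n0: "\<And>n. n0 \<le> n \<Longrightarrow> prob (H n) \<le> e"
      using d(2) unfolding eventually_sequentially HP[symmetric] by blast
    define G where "G k = (\<Inter>n\<in>{k..}. H n)" for k
    have Gs: "G k \<in> sets M" for k unfolding G_def using Hs by (intro sets.countable_INT') auto
    have Ge: "prob (G k) \<le> e" for k
    proof -
      have "G k \<subseteq> H (max k n0)" by (auto simp: G_def)
      then have "prob (G k) \<le> prob (H (max k n0))" by (rule finite_measure_mono) (rule Hs)
      then show ?thesis using n0[of "max k n0"] by simp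
    qed
    have "incseq G" by (auto simp: incseq_def G_def)
    then have "(\<lambda>k. prob (G k)) \<longlonglongrightarrow> prob (\<Union>k. G k)"
      using Gs by (intro finite_Lim_measure_incseq) auto
    then have "prob (\<Union>k. G k) \<le> e"
      by (rule LIMSEQ_le_const2) (use Ge in auto)
    moreover have "?N \<subseteq> (\<Union>k. G k)"
    proof
      fix \<omega> assume "\<omega> \<in> ?N"
      then have \<omega>: "\<omega> \<in> space M" "1 \<in> closure {\<sigma> s \<omega> |s. 0 \<le> s}" by (auto simp: regenerative_set_def)
      obtain s where s: "0 \<le> s" "dist (\<sigma> s \<omega>) 1 < d" using \<omega>(2) d(1) unfolding closure_approachable by blast
      have "\<forall>\<^sub>F n in sequentially. \<exists>j. \<sigma> (real j / rate n) \<omega> \<in> ball 1 d"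
        by (rule grid_approximates[OF \<omega>(1) s(1)]) (use s(2) in \<open>auto simp: dist_commute\<close>)
      then obtain k where k: "\<And>n. k \<le> n \<Longrightarrow> \<exists>j. \<sigma> (real j / rate n) \<omega> \<in> ball 1 d"
        by (auto simp: eventually_sequentially)
      have "\<omega> \<in> H n" if kn: "k \<le> n" for n
      proof -
        obtain j where "\<sigma> (real j / rate n) \<omega> \<in> ball 1 d" using k[OF kn] by blast
        then have "\<sigma> (real j / rate n) \<omega> \<in> {1 - d..1 + d}" unfolding ball_eq_greaterThanLessThan by simp
        then show ?thesis using \<omega>(1) unfolding H_def by blast
      qed
      then show "\<omega> \<in> (\<Union>k. G k)" by (auto simp: G_def)
    qed
    ultimately show ?thesis
      using finite_measure_mono[of ?N "\<Union>k. G k"] Gs by (meson order_trans sets.countable_UN image_subsetI)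
  qed
  then have "prob ?N = 0" by (meson dense_ge measure_le_0_iff measure_nonneg order_antisym)
  then show ?thesis using N by (subst AE_iff_measurable[OF _ refl]) (auto simp: emeasure_eq_measure)
qed


end

context subordinator
begin

abbreviation loc_time :: "'b \<Rightarrow> real" where "loc_time \<equiv> local_time \<sigma> 1"

lemma level_set_bdd: "bdd_below {s. 0 \<le> s \<and> 1 \<le> \<sigma> s \<omega>}"
  by (rule bdd_belowI[of _ 0]) auto

lemma local_time_le_iff:
  assumes \<omega>: "\<omega> \<in> space M" and hit: "\<exists>s\<ge>0. 1 \<le> \<sigma> s \<omega>"
  shows "loc_time \<omega> \<le> a \<longleftrightarrow> 0 \<le> a \<and> 1 \<le> \<sigma> a \<omega>"
proof
  let ?S = "{s. 0 \<le> s \<and> 1 \<le> \<sigma> s \<omega>}"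
  have ne: "?S \<noteq> {}" using hit by auto
  assume a: "loc_time \<omega> \<le> a"
  have L0: "0 \<le> loc_time \<omega>" unfolding local_time_def by (rule cInf_greatest[OF ne]) auto
  have "1 \<le> \<sigma> a \<omega>"
  proof (rule ccontr)
    assume "\<not> 1 \<le> \<sigma> a \<omega>"
    then have "\<sigma> a \<omega> \<in> {..<1}" by simp
    from \<sigma>_right_continuous[OF \<omega> _ open_lessThan this] obtain d where d: "0 < d" "\<And>u. a \<le> u \<Longrightarrow> u < a + d \<Longrightarrow> \<sigma> u \<omega> < 1"
      using a L0 by auto
    have "Inf ?S < a + d" using a d(1) by (simp add: local_time_def)
    then obtain s where s: "0 \<le> s" "1 \<le> \<sigma> s \<omega>" "s < a + d" using cInf_lessD[OF ne] by auto
    have "\<sigma> s \<omega> \<le> \<sigma> (max s a) \<omega>" by (rule \<sigma>_mono[OF \<omega> s(1)]) simp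
    moreover have "\<sigma> (max s a) \<omega> < 1" by (rule d(2)) (use s d(1) in auto)
    ultimately show False using s(2) by linarith
  qed
  then show "0 \<le> a \<and> 1 \<le> \<sigma> a \<omega>" using a L0 by simp
next
  assume "0 \<le> a \<and> 1 \<le> \<sigma> a \<omega>"
  then show "loc_time \<omega> \<le> a" unfolding local_time_def by (intro cInf_lower level_set_bdd) auto
qed

lemma measurable_local_time [measurable]: "loc_time \<in> borel_measurable M"
proof (rule borel_measurable_iff_le[THEN iffD2], rule allI)
  fix a :: real
  have [measurable]: "\<sigma> (real n) \<in> borel_measurable M" for n by (simp add: \<sigma>_measurable)
  let ?N = "{\<omega>\<in>space M. \<exists>n::nat. 1 \<le> \<sigma> (real n) \<omega>}"
  have N: "?N \<in> sets M" by measurable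
  have N_iff: "\<omega> \<in> ?N \<longleftrightarrow> (\<exists>s\<ge>0. 1 \<le> \<sigma> s \<omega>)" if \<omega>: "\<omega> \<in> space M" for \<omega>
  proof
    assume "\<exists>s\<ge>0. 1 \<le> \<sigma> s \<omega>"
    then obtain s where s: "0 \<le> s" "1 \<le> \<sigma> s \<omega>" by blast
    have "\<sigma> s \<omega> \<le> \<sigma> (real (nat \<lceil>s\<rceil>)) \<omega>" by (rule \<sigma>_mono[OF \<omega> s(1)]) linarith
    then show "\<omega> \<in> ?N" using s(2) \<omega> by (auto intro!: exI[of _ "nat \<lceil>s\<rceil>"])
  qed (auto intro: of_nat_0_le_iff)
  have eq: "{\<omega>\<in>space M. loc_time \<omega> \<le> a} =
      (?N \<inter> {\<omega>\<in>space M. 0 \<le> a \<and> 1 \<le> \<sigma> (max 0 a) \<omega>}) \<union> ((space M - ?N) \<inter> {\<omega>\<in>space M. Inf {} \<le> a})"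
  proof -
    have "loc_time \<omega> \<le> a \<longleftrightarrow> (if \<omega> \<in> ?N then 0 \<le> a \<and> 1 \<le> \<sigma> (max 0 a) \<omega> else Inf {} \<le> a)" if \<omega>: "\<omega> \<in> space M" for \<omega>
    proof (cases "\<omega> \<in> ?N")
      case True
      then show ?thesis using local_time_le_iff[OF \<omega>, of a] N_iff[OF \<omega>] by (auto simp: max_def)
    next
      case False
      have e: "{s. 0 \<le> s \<and> 1 \<le> \<sigma> s \<omega>} = {}" using N_iff[OF \<omega>] False by blast
      show ?thesis by (simp only: local_time_def e False if_False)
    qed
    then show ?thesis by (auto split: if_splits)
  qed
  have [measurable]: "\<sigma> (max 0 a) \<in> borel_measurable M" by (simp add: \<sigma>_measurable)
  have 1: "{\<omega>\<in>space M. 0 \<le> a \<and> 1 \<le> \<sigma> (max 0 a) \<omega>} \<in> sets M" by measurable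
  have 2: "{\<omega>\<in>space M. (Inf {} :: real) \<le> a} \<in> sets M" by measurable
  show "{\<omega>\<in>space M. loc_time \<omega> \<le> a} \<in> sets M"
    unfolding eq by (intro sets.Un sets.Int sets.Diff sets.top N 1 2)
qed

lemma visits_increments:
  assumes \<omega>: "\<omega> \<in> space M" and unb: "\<And>R. \<exists>s\<ge>0. R < \<sigma> s \<omega>" and one: "1 \<notin> regenerative_set \<sigma> \<omega>"
  shows "loc_time \<omega> \<le> visits 1 (increments n \<omega>) / rate n" "visits 1 (increments n \<omega>) / rate n \<le> loc_time \<omega> + 1 / rate n"
proof -
  have hit: "\<exists>s\<ge>0. 1 \<le> \<sigma> s \<omega>"
  proof -
    obtain s where "0 \<le> s" "1 < \<sigma> s \<omega>" using unb[of 1] by blast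
    then show ?thesis by (intro exI[of _ s]) simp
  qed
  note iff = local_time_le_iff[OF \<omega> hit]
  let ?L = "loc_time \<omega>"
  have L0: "0 \<le> ?L" using iff[of ?L] by simp
  have ne1: "\<sigma> s \<omega> \<noteq> 1" if "0 \<le> s" for s
  proof
    assume "\<sigma> s \<omega> = 1"
    then have "1 \<in> {\<sigma> s \<omega> |s. 0 \<le> s}" using that by (intro CollectI exI[of _ s]) simp
    from one subsetD[OF closure_subset this] show False
      unfolding regenerative_set_def by (rule notE)
  qed
  let ?J = "{j. pos j (increments n \<omega>) \<le> 1}"
  have J: "j \<in> ?J \<longleftrightarrow> real j / rate n < ?L" if "real j / rate n \<noteq> ?L" for j
  proof -
    let ?x = "real j / rate n"
    have x: "0 \<le> ?x" by simp
    have "j \<in> ?J \<longleftrightarrow> \<sigma> ?x \<omega> \<le> 1" unfolding mem_Collect_eq pos_increments[OF \<omega>] ..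
    also have "\<dots> \<longleftrightarrow> \<not> 1 \<le> \<sigma> ?x \<omega>" using ne1[OF x] by linarith
    also have "\<dots> \<longleftrightarrow> \<not> ?L \<le> ?x" unfolding iff using x by (simp only: simp_thms)
    finally show ?thesis by (simp only: not_le)
  qed
  have lower: "{..<nat \<lceil>?L * rate n\<rceil>} \<subseteq> ?J"
  proof
    fix j assume "j \<in> {..<nat \<lceil>?L * rate n\<rceil>}"
    then have "real j < ?L * rate n" by (simp add: zless_nat_eq_int_zless less_ceiling_iff)
    then have "real j / rate n < ?L" by (simp add: field_simps)
    then show "j \<in> ?J" using J[of j] by simp
  qed
  have upper: "?J \<subseteq> {..nat \<lfloor>?L * rate n\<rfloor>}"
  proof
    fix j assume j: "j \<in> ?J"
    have "real j / rate n \<le> ?L"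
      using J[of j] j by (cases "real j / rate n = ?L") auto
    then have "real j \<le> ?L * rate n" by (simp add: field_simps)
    then show "j \<in> {..nat \<lfloor>?L * rate n\<rfloor>}" by (simp add: le_nat_floor)
  qed
  have "real (nat \<lceil>?L * rate n\<rceil>) \<le> visits 1 (increments n \<omega>)"
    using card_mono[OF finite_subset[OF upper finite_atMost] lower] by (simp add: visits_def)
  then have "?L * rate n \<le> visits 1 (increments n \<omega>)" by linarith
  then show "?L \<le> visits 1 (increments n \<omega>) / rate n" by (simp add: field_simps)
  have "real (visits 1 (increments n \<omega>)) \<le> real (nat \<lfloor>?L * rate n\<rfloor>) + 1"
    using card_mono[OF finite_atMost upper] by (simp add: visits_def)
  also have "\<dots> \<le> ?L * rate n + 1" using L0 by (simp add: of_nat_nat)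
  finally show "visits 1 (increments n \<omega>) / rate n \<le> ?L + 1 / rate n" by (simp add: field_simps)
qed

lemma integrable_exp_local_time: "integrable M (\<lambda>\<omega>. exp (C * loc_time \<omega>))"
proof -
  have "0 \<le> \<bar>C\<bar>" by simp
  then obtain r V where r: "0 < r" and V: "\<forall>\<^sub>F n in sequentially. exp (\<bar>C\<bar> / rate n) * grid.st.lap n r < 1 \<and> grid.st.visit_moment n 1 (\<bar>C\<bar> / rate n) \<le> V"
    by (rule grid.moments)
  then obtain n where n: "exp (\<bar>C\<bar> / rate n) * grid.st.lap n r < 1"
    using eventually_happens[OF V] by auto
  have "integrable (Pi\<^sub>M UNIV (\<lambda>_. step_law n)) (\<lambda>w. exp (\<bar>C\<bar> / rate n * visits 1 w))"
    by (rule grid.st.integrable_exp_visits(1)[OF _ _ n]) (use r in auto)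
  then have "integrable (distr M (Pi\<^sub>M UNIV (\<lambda>_. step_law n)) (increments n)) (\<lambda>w. exp (\<bar>C\<bar> / rate n * visits 1 w))"
    by (simp only: distr_increments)
  then have i: "integrable M (\<lambda>\<omega>. exp (\<bar>C\<bar> / rate n * visits 1 (increments n \<omega>)))"
    by (rule integrable_distr[OF measurable_increments])
  show ?thesis
  proof (rule Bochner_Integration.integrable_bound[OF i])
    show "AE \<omega> in M. norm (exp (C * loc_time \<omega>)) \<le> norm (exp (\<bar>C\<bar> / rate n * visits 1 (increments n \<omega>)))"
      using AE_unbounded AE_one_notin AE_space
    proof eventually_elim
      case (elim \<omega>)
      then have unb: "\<And>R. \<exists>s\<ge>0. R < \<sigma> s \<omega>" by blast
      note v = visits_increments(1)[OF elim(3) unb elim(2), of n]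
      obtain s where s: "0 \<le> s" "1 < \<sigma> s \<omega>" using unb[of 1] by blast
      have "\<exists>s\<ge>0. 1 \<le> \<sigma> s \<omega>" by (intro exI[of _ s]) (use s in simp)
      then have "0 \<le> loc_time \<omega>" using local_time_le_iff[OF elim(3), of "loc_time \<omega>"] by simp
      then have "C * loc_time \<omega> \<le> \<bar>C\<bar> * (visits 1 (increments n \<omega>) / rate n)"
        using v by (intro mult_mono) auto
      then show ?case by simp
    qed
  qed measurable
qed

lemma walk_trace_increments:
  "\<omega> \<in> space M \<Longrightarrow> walk_trace (increments n \<omega>) = closure (range (\<lambda>j. \<sigma> (real j / rate n) \<omega>)) \<inter> {0..1}"
  by (simp add: walk_trace_def pos_increments)

lemma weighted_trace_grid_limit:
  assumes f: "continuous_map matheron euclideanreal f" and B: "\<And>F. F \<in> closed_unit_sets \<Longrightarrow> \<bar>f F\<bar> \<le> B"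
  shows "(\<lambda>n. grid.st.weighted_trace n (rate n) \<epsilon> f) \<longlonglongrightarrow> (\<integral>\<omega>. f (unit_set \<omega>) * exp (\<epsilon> * loc_time \<omega>) \<partial>M)"
proof -
  have [measurable]: "f \<in> borel_measurable (borel_of_topology matheron)" by (rule measurable_continuous_map[OF f])
  have [measurable]: "increments n \<in> measurable M (Pi\<^sub>M UNIV (\<lambda>_. step_law n))" for n by (rule measurable_increments)
  have [measurable]: "unit_set \<in> measurable M (borel_of_topology matheron)" by (rule measurable_unit_set)
  have B0: "0 \<le> B" using B[OF unit_set_closed[of undefined]] by linarith
  have mh: "(\<lambda>w. f (walk_trace w) * exp (\<epsilon> * (visits 1 w / rate n))) \<in> borel_measurable (Pi\<^sub>M UNIV (\<lambda>_. step_law n))" for n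
  proof (rule borel_measurable_times)
    show "(\<lambda>w. f (walk_trace w)) \<in> borel_measurable (Pi\<^sub>M UNIV (\<lambda>_. step_law n))"
      by (rule measurable_compose[OF grid.st.measurable_walk_trace measurable_continuous_map[OF f]])
    show "(\<lambda>w. exp (\<epsilon> * (visits 1 w / rate n))) \<in> borel_measurable (Pi\<^sub>M UNIV (\<lambda>_. step_law n))"
      by (rule measurable_compose[OF grid.st.measurable_visits, where g="\<lambda>m. exp (\<epsilon> * (real m / rate n))"]) simp
  qed
  have eq: "grid.st.weighted_trace n (rate n) \<epsilon> f = (\<integral>\<omega>. f (walk_trace (increments n \<omega>)) * exp (\<epsilon> * (visits 1 (increments n \<omega>) / rate n)) \<partial>M)" for n
  proof -
    have "grid.st.weighted_trace n (rate n) \<epsilon> f =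
        (\<integral>w. f (walk_trace w) * exp (\<epsilon> * (visits 1 w / rate n)) \<partial>distr M (Pi\<^sub>M UNIV (\<lambda>_. step_law n)) (increments n))"
      unfolding grid.st.weighted_trace_def by (simp only: distr_increments)
    then show ?thesis unfolding integral_distr[OF measurable_increments mh] .
  qed
  show ?thesis
    unfolding eq
  proof (rule integral_dominated_convergence)
    show "(\<lambda>\<omega>. f (unit_set \<omega>) * exp (\<epsilon> * loc_time \<omega>)) \<in> borel_measurable M" by measurable
    show "(\<lambda>\<omega>. f (walk_trace (increments n \<omega>)) * exp (\<epsilon> * (visits 1 (increments n \<omega>) / rate n))) \<in> borel_measurable M" for n
      using measurable_compose[OF measurable_increments mh, of n] by simp
    show "integrable M (\<lambda>\<omega>. B * exp \<bar>\<epsilon>\<bar> * exp (\<bar>\<epsilon>\<bar> * loc_time \<omega>))"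
      by (intro integrable_mult_right integrable_exp_local_time)
    show "AE \<omega> in M. (\<lambda>n. f (walk_trace (increments n \<omega>)) * exp (\<epsilon> * (visits 1 (increments n \<omega>) / rate n))) \<longlonglongrightarrow> f (unit_set \<omega>) * exp (\<epsilon> * loc_time \<omega>)"
      using AE_unbounded AE_one_notin AE_space
    proof eventually_elim
      case (elim \<omega>)
      then have unb: "\<And>R. \<exists>s\<ge>0. R < \<sigma> s \<omega>" by blast
      note v = visits_increments[OF elim(3) unb elim(2)]
      have "(\<lambda>n. loc_time \<omega> + 1 / rate n) \<longlonglongrightarrow> loc_time \<omega> + 0"
        by (intro tendsto_intros grid.inverse_b)
      then have up: "(\<lambda>n. loc_time \<omega> + 1 / rate n) \<longlonglongrightarrow> loc_time \<omega>"
        by (simp only: add_0_right)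
      have vc: "(\<lambda>n. visits 1 (increments n \<omega>) / rate n) \<longlonglongrightarrow> loc_time \<omega>"
      proof (rule tendsto_sandwich[OF _ _ tendsto_const up])
        show "\<forall>\<^sub>F n in sequentially. loc_time \<omega> \<le> visits 1 (increments n \<omega>) / rate n"
          by (intro always_eventually allI v(1))
        show "\<forall>\<^sub>F n in sequentially. visits 1 (increments n \<omega>) / rate n \<le> loc_time \<omega> + 1 / rate n"
          by (intro always_eventually allI v(2))
      qed
      have "(\<lambda>n. f (walk_trace (increments n \<omega>))) \<longlonglongrightarrow> f (unit_set \<omega>)"
      proof (rule matheron_tendsto[OF f unit_set_closed walk_trace_closed])
        fix G :: "real set" assume G: "open G" "unit_set \<omega> \<inter> G \<noteq> {}"
        then obtain x where x: "x \<in> closure {\<sigma> s \<omega> |s. 0 \<le> s}" "0 \<le> x" "x \<le> 1" "x \<in> G"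
          by (auto simp: unit_set_def regenerative_set_def)
        have "x \<noteq> 1" using elim(2) x(1) by (auto simp: regenerative_set_def)
        then have "x \<in> G \<inter> {..<1}" using x by simp
        moreover have "open (G \<inter> {..<1})" using G(1) by (intro open_Int open_lessThan)
        ultimately have "G \<inter> {..<1} \<inter> {\<sigma> s \<omega> |s. 0 \<le> s} \<noteq> {}"
          using open_Int_closure_eq_empty[of "G \<inter> {..<1}" "{\<sigma> s \<omega> |s. 0 \<le> s}"] x(1) by blast
        then obtain s where s: "0 \<le> s" "\<sigma> s \<omega> \<in> G \<inter> {..<1}" by blast
        have "\<forall>\<^sub>F n in sequentially. \<exists>j. \<sigma> (real j / rate n) \<omega> \<in> G \<inter> {..<1}"
          by (rule grid_approximates[OF elim(3) s(1) _ s(2)]) (use G(1) in \<open>auto intro: open_Int\<close>)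
        then show "\<forall>\<^sub>F n in sequentially. walk_trace (increments n \<omega>) \<inter> G \<noteq> {}"
        proof eventually_elim
          case (elim n)
          then obtain j where j: "\<sigma> (real j / rate n) \<omega> \<in> G" "\<sigma> (real j / rate n) \<omega> < 1" by auto
          have "\<sigma> (real j / rate n) \<omega> \<in> closure (range (\<lambda>j. \<sigma> (real j / rate n) \<omega>))"
            by (rule closure_subset[THEN subsetD]) simp
          then show ?case
            using j \<sigma>_nonneg[OF \<open>\<omega> \<in> space M\<close>, of "real j / rate n"] walk_trace_increments[OF \<open>\<omega> \<in> space M\<close>, of n] by auto
        qed
      next
        fix C :: "real set" assume C: "compact C" "unit_set \<omega> \<inter> C = {}"
        have "walk_trace (increments n \<omega>) \<subseteq> unit_set \<omega>" for n
          unfolding walk_trace_increments[OF elim(3)] unit_set_def regenerative_set_def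
          by (intro Int_mono closure_mono) force+
        then show "\<forall>\<^sub>F n in sequentially. walk_trace (increments n \<omega>) \<inter> C = {}"
          using C(2) by (intro always_eventually) blast
      qed
      then show ?case by (intro tendsto_intros vc)
    qed
    show "AE \<omega> in M. norm (f (walk_trace (increments n \<omega>)) * exp (\<epsilon> * (visits 1 (increments n \<omega>) / rate n))) \<le> B * exp \<bar>\<epsilon>\<bar> * exp (\<bar>\<epsilon>\<bar> * loc_time \<omega>)" for n
      using AE_unbounded AE_one_notin AE_space
    proof eventually_elim
      case (elim \<omega>)
      then have unb: "\<And>R. \<exists>s\<ge>0. R < \<sigma> s \<omega>" by blast
      have "visits 1 (increments n \<omega>) / rate n \<le> loc_time \<omega> + 1 / rate n"
        by (rule visits_increments(2)[OF elim(3) unb elim(2)])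
      also have "\<dots> \<le> loc_time \<omega> + 1" by (simp add: rate_def)
      finally have "\<epsilon> * (visits 1 (increments n \<omega>) / rate n) \<le> \<bar>\<epsilon>\<bar> * (loc_time \<omega> + 1)"
        by (intro mult_mono) auto
      then have "exp (\<epsilon> * (visits 1 (increments n \<omega>) / rate n)) \<le> exp \<bar>\<epsilon>\<bar> * exp (\<bar>\<epsilon>\<bar> * loc_time \<omega>)"
        by (simp add: mult_exp_exp distrib_left add.commute)
      then show ?case
        using B[OF walk_trace_closed[of "increments n \<omega>"]] B0 by (simp add: abs_mult mult.assoc mult_mono)
    qed
  qed
qed

theorem weighted_trace_limit:
  assumes A: "stable_array \<alpha> \<mu> b"
    and f: "continuous_map matheron euclideanreal f" and B: "\<And>F. F \<in> closed_unit_sets \<Longrightarrow> \<bar>f F\<bar> \<le> B"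
  shows "(\<lambda>n. iid_steps.weighted_trace (\<mu> n) (b n) \<epsilon> f) \<longlonglongrightarrow> (\<integral>\<omega>. f (unit_set \<omega>) * exp (\<epsilon> * loc_time \<omega>) \<partial>M)"
proof -
  have "(\<lambda>n. (iid_steps.weighted_trace (\<mu> n) (b n) \<epsilon> f - grid.st.weighted_trace n (rate n) \<epsilon> f) + grid.st.weighted_trace n (rate n) \<epsilon> f)
     \<longlonglongrightarrow> 0 + (\<integral>\<omega>. f (unit_set \<omega>) * exp (\<epsilon> * loc_time \<omega>) \<partial>M)"
    by (intro tendsto_add weighted_trace_universal[OF A grid.stable_array_axioms f B] weighted_trace_grid_limit[OF f B])
  then show ?thesis by simp
qed

end

section \<open>Regular variation\<close>

definition log_slow :: "(real \<Rightarrow> real) \<Rightarrow> real \<Rightarrow> real" where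
  "log_slow L x = ln (L (exp x))"

context
  fixes L :: "real \<Rightarrow> real"
  assumes slow: "slowly_varying L"
begin

lemma slow_pos: "0 < x \<Longrightarrow> 0 < L x"
  using slow by (simp add: slowly_varying_def)

lemma measurable_log_slow [measurable]: "log_slow L \<in> borel_measurable borel"
proof -
  have "L \<in> borel_measurable (restrict_space borel {0<..})" using slow by (simp add: slowly_varying_def)
  moreover have "exp \<in> measurable (borel :: real measure) (restrict_space borel {0<..})"
    by (rule measurable_restrict_space2) auto
  ultimately have "(\<lambda>x. L (exp x)) \<in> borel_measurable borel" by (rule measurable_compose[rotated])
  then show ?thesis unfolding log_slow_def[abs_def] by measurable
qed

lemma log_slow_shift: "((\<lambda>x. log_slow L (x + u) - log_slow L x) \<longlongrightarrow> 0) at_top"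
proof -
  have "((\<lambda>x. L (exp u * x) / L x) \<longlongrightarrow> 1) at_top" using slow by (simp add: slowly_varying_def)
  then have "((\<lambda>x. ln (L (exp u * exp x) / L (exp x))) \<longlongrightarrow> ln 1) at_top"
    by (intro tendsto_ln filterlim_compose[OF _ exp_at_top]) auto
  moreover have "ln (L (exp u * exp x) / L (exp x)) = log_slow L (x + u) - log_slow L x" for x
    using slow_pos[of "exp x"] slow_pos[of "exp x * exp u"]
    by (simp add: log_slow_def ln_div exp_add mult.commute)
  ultimately show ?thesis by simp
qed

text \<open>The uniform convergence theorem, by the measure-theoretic argument of Csiszar and Erdos: two
  sets of measure almost \<open>2\<close> inside an interval of length \<open>3\<close> must meet.\<close>

lemma log_slow_uniform:
  assumes "0 < d"
  shows "\<exists>X. \<forall>x\<ge>X. \<forall>u\<in>{0..1}. \<bar>log_slow L (x + u) - log_slow L x\<bar> < d"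
proof (rule ccontr)
  let ?h = "log_slow L"
  assume "\<not> (\<exists>X. \<forall>x\<ge>X. \<forall>u\<in>{0..1}. \<bar>?h (x + u) - ?h x\<bar> < d)"
  then have "\<forall>n::nat. \<exists>x u. real n \<le> x \<and> u \<in> {0..1} \<and> d \<le> \<bar>?h (x + u) - ?h x\<bar>"
    by (meson not_le)
  then obtain x u where xu: "\<And>n::nat. real n \<le> x n" "\<And>n. u n \<in> {0..1}" "\<And>n. d \<le> \<bar>?h (x n + u n) - ?h (x n)\<bar>"
    by metis
  have large: "\<exists>n. 3 / 2 < measure lborel {y\<in>{0..2}. \<forall>m\<ge>n. \<bar>?h (z m + y) - ?h (z m)\<bar> < d / 2} \<and> n0 \<le> n"
    if z: "filterlim z at_top sequentially" for z :: "nat \<Rightarrow> real" and n0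
  proof -
    define V where "V n = {y\<in>{0..2::real}. \<forall>m\<ge>n. \<bar>?h (z m + y) - ?h (z m)\<bar> < d / 2}" for n
    have Vs: "V n \<in> sets lborel" for n
    proof -
      have "{y\<in>space borel. y \<in> {0..2::real} \<and> (\<forall>m. n \<le> m \<longrightarrow> \<bar>?h (z m + y) - ?h (z m)\<bar> < d / 2)} \<in> sets borel" by measurable
      then show ?thesis by (simp add: V_def)
    qed
    have inc: "incseq V" by (auto simp: incseq_def V_def)
    have "(\<Union>n. V n) = {0..2}"
    proof (intro equalityI subsetI)
      fix y :: real assume y: "y \<in> {0..2}"
      have "(\<lambda>m. ?h (z m + y) - ?h (z m)) \<longlonglongrightarrow> 0"
        by (rule filterlim_compose[OF log_slow_shift z])
      then have "\<forall>\<^sub>F m in sequentially. \<bar>?h (z m + y) - ?h (z m)\<bar> < d / 2"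
        using tendstoD[of "\<lambda>m. ?h (z m + y) - ?h (z m)" 0 sequentially "d / 2"] assms by (simp add: dist_real_def)
      then obtain n where "\<forall>m\<ge>n. \<bar>?h (z m + y) - ?h (z m)\<bar> < d / 2" by (auto simp: eventually_sequentially)
      then have "y \<in> V n" using y by (simp add: V_def)
      then show "y \<in> (\<Union>n. V n)" by blast
    qed (auto simp: V_def)
    moreover have "(\<lambda>n. measure lborel (V n)) \<longlonglongrightarrow> measure lborel (\<Union>n. V n)"
    proof (rule Lim_measure_incseq[OF _ inc])
      show "range V \<subseteq> sets lborel" using Vs by auto
      show "emeasure lborel (\<Union>n. V n) \<noteq> \<infinity>" using \<open>(\<Union>n. V n) = {0..2}\<close> by simp
    qed
    ultimately have "(\<lambda>n. measure lborel (V n)) \<longlonglongrightarrow> 2" by simp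
    then have "\<forall>\<^sub>F n in sequentially. 3 / 2 < measure lborel (V n)" by (rule order_tendstoD) simp
    then have "\<forall>\<^sub>F n in sequentially. 3 / 2 < measure lborel (V n) \<and> n0 \<le> n"
      using eventually_ge_at_top[of n0] by eventually_elim simp
    then show ?thesis unfolding V_def by (rule eventually_happens'[rotated]) simp
  qed
  have xt: "filterlim x at_top sequentially"
    by (rule filterlim_at_top_mono[OF filterlim_real_sequentially]) (use xu(1) in simp)
  have xut: "filterlim (\<lambda>n. x n + u n) at_top sequentially"
    by (rule filterlim_at_top_mono[OF xt]) (use xu(2) in auto)
  define V where "V n = {y\<in>{0..2::real}. \<forall>m\<ge>n. \<bar>?h (x m + y) - ?h (x m)\<bar> < d / 2}" for n
  define W where "W n = {y\<in>{0..2::real}. \<forall>m\<ge>n. \<bar>?h (x m + u m + y) - ?h (x m + u m)\<bar> < d / 2}" for n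
  have sets: "V n \<in> sets borel" "W n \<in> sets borel" for n
  proof -
    have "{y\<in>space borel. y \<in> {0..2::real} \<and> (\<forall>m. n \<le> m \<longrightarrow> \<bar>?h (x m + y) - ?h (x m)\<bar> < d / 2)} \<in> sets borel"
      "{y\<in>space borel. y \<in> {0..2::real} \<and> (\<forall>m. n \<le> m \<longrightarrow> \<bar>?h (x m + u m + y) - ?h (x m + u m)\<bar> < d / 2)} \<in> sets borel"
      by measurable
    then show "V n \<in> sets borel" "W n \<in> sets borel" by (simp_all add: V_def W_def)
  qed
  obtain n1 where n1: "3 / 2 < measure lborel (V n1)" using large[OF xt] unfolding V_def by blast
  obtain n where n: "3 / 2 < measure lborel (W n)" "n1 \<le> n" using large[OF xut] unfolding W_def by blast
  have fin: "emeasure lborel A \<noteq> \<infinity>" if "A \<subseteq> {0..3}" "A \<in> sets borel" for A :: "real set"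
    using emeasure_mono[OF that(1), of lborel] by (auto simp: top_unique)
  have V: "3 / 2 < measure lborel (V n)"
  proof -
    have "measure lborel (V n1) \<le> measure lborel (V n)"
    proof (rule measure_mono_fmeasurable)
      show "V n1 \<subseteq> V n" using n(2) by (auto simp: V_def)
      show "V n1 \<in> sets lborel" using sets by simp
      have "V n \<subseteq> {0..3}" by (auto simp: V_def)
      then show "V n \<in> fmeasurable lborel" using fin[of "V n"] sets(1) by (simp add: fmeasurable_def less_top)
    qed
    then show ?thesis using n1 by linarith
  qed
  define W' where "W' = {y. y - u n \<in> W n}"
  have W's: "W' \<in> sets borel"
  proof -
    have "(\<lambda>y. y - u n) -` W n \<inter> space borel \<in> sets borel" by (rule measurable_sets[OF _ sets(2)]) measurable
    then show ?thesis by (simp add: W'_def vimage_def)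
  qed
  have "emeasure lborel W' = emeasure lborel (W n)"
  proof -
    have "emeasure lborel (W n) = emeasure (distr lborel borel ((+) (- u n))) (W n)"
      by (simp add: lborel_distr_plus)
    also have "\<dots> = emeasure lborel ((+) (- u n) -` W n \<inter> space lborel)"
      by (rule emeasure_distr) (use sets in auto)
    also have "(+) (- u n) -` W n \<inter> space lborel = W'" by (auto simp: W'_def)
    finally show ?thesis by simp
  qed
  then have W': "3 / 2 < measure lborel W'" using n(1) by (simp add: measure_def)
  have sub: "V n \<subseteq> {0..3}" "W' \<subseteq> {0..3}"
    using xu(2)[of n] by (auto simp: V_def W'_def W_def)
  have "V n \<inter> W' \<noteq> {}"
  proof
    assume dis: "V n \<inter> W' = {}"
    have fm: "V n \<in> fmeasurable lborel" "W' \<in> fmeasurable lborel" "{0..3::real} \<in> fmeasurable lborel"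
      using fin[OF sub(1) sets(1)] fin[OF sub(2) W's] sets W's by (auto simp: fmeasurable_def less_top)
    have "measure lborel (V n \<union> W') = measure lborel (V n) + measure lborel W'"
      by (rule measure_Un2[OF fm(1,2), THEN trans]) (use dis in \<open>simp add: Diff_triv Int_commute\<close>)
    moreover have "measure lborel (V n \<union> W') \<le> measure lborel {0..3::real}"
      by (rule measure_mono_fmeasurable) (use sub sets W's fm in auto)
    ultimately show False using V W' by simp
  qed
  then obtain y where y: "y \<in> V n" "y - u n \<in> W n" by (auto simp: W'_def)
  have "\<bar>?h (x n + y) - ?h (x n)\<bar> < d / 2" using y(1) by (simp add: V_def)
  moreover have "\<bar>?h (x n + y) - ?h (x n + u n)\<bar> < d / 2"
  proof -
    have "\<bar>?h (x n + u n + (y - u n)) - ?h (x n + u n)\<bar> < d / 2" using y(2) unfolding W_def by blast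
    then show ?thesis by simp
  qed
  ultimately show False using xu(3)[of n] by linarith
qed

lemma log_slow_growth:
  assumes "0 < d"
  shows "\<exists>X. \<forall>x\<ge>X. \<forall>u\<ge>0. \<bar>log_slow L (x + u) - log_slow L x\<bar> \<le> d * (u + 1)"
proof -
  let ?h = "log_slow L"
  obtain X where X: "\<And>x u. X \<le> x \<Longrightarrow> u \<in> {0..1} \<Longrightarrow> \<bar>?h (x + u) - ?h x\<bar> < d"
    using log_slow_uniform[OF assms] by blast
  have step: "\<bar>?h (x + real k) - ?h x\<bar> \<le> d * real k" if x: "X \<le> x" for x k
  proof (induction k)
    case (Suc k)
    have "\<bar>?h (x + real k + 1) - ?h (x + real k)\<bar> < d" using X[of "x + real k" 1] x by simp
    moreover have "d * real (Suc k) = d * real k + d" by (simp add: distrib_left)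
    ultimately have "\<bar>?h (x + real k + 1) - ?h x\<bar> \<le> d * real (Suc k)" using Suc by linarith
    then show ?case by (simp add: add.assoc add.commute[of 1])
  qed simp
  have "\<bar>?h (x + u) - ?h x\<bar> \<le> d * (u + 1)" if x: "X \<le> x" and u: "0 \<le> u" for x u
  proof -
    define k where "k = nat \<lfloor>u\<rfloor>"
    have k: "real k \<le> u" "u < real k + 1" using u unfolding k_def by linarith+
    have "\<bar>?h (x + real k + (u - real k)) - ?h (x + real k)\<bar> < d" using X[of "x + real k" "u - real k"] x k by simp
    moreover have "d * real k \<le> d * u" using k(1) assms by simp
    moreover have "d * (u + 1) = d * u + d" by (simp add: distrib_left)
    ultimately show ?thesis using step[OF x, of k] by simp
  qed
  then show ?thesis by blast
qed

lemma slow_ratio_tendsto: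
  assumes y: "filterlim y at_top sequentially" and z: "\<And>n. 0 < z n" and lim: "(\<lambda>n. z n / y n) \<longlonglongrightarrow> c" and c: "0 < c"
  shows "(\<lambda>n. L (z n) / L (y n)) \<longlonglongrightarrow> 1"
proof -
  let ?h = "log_slow L"
  have ypos: "\<forall>\<^sub>F n in sequentially. 0 < y n" using y by (simp add: filterlim_at_top_dense)
  have lny: "filterlim (\<lambda>n. ln (y n)) at_top sequentially" by (rule filterlim_compose[OF ln_at_top y])
  have l: "(\<lambda>n. ln (z n / y n)) \<longlonglongrightarrow> ln c" by (rule tendsto_ln[OF lim]) (use c in simp)
  have "(\<lambda>n. ?h (ln (z n)) - ?h (ln (y n))) \<longlonglongrightarrow> 0"
  proof (rule tendstoI)
    fix e :: real assume e: "0 < e"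
    obtain X where X: "\<And>x u. X \<le> x \<Longrightarrow> u \<in> {0..1} \<Longrightarrow> \<bar>?h (x + u) - ?h x\<bar> < e / 2"
      using log_slow_uniform[OF half_gt_zero[OF e]] by blast
    have 1: "\<forall>\<^sub>F n in sequentially. \<bar>?h (ln (y n) + ln c) - ?h (ln (y n))\<bar> < e / 2"
      using tendstoD[OF filterlim_compose[OF log_slow_shift lny], of "e / 2" "ln c"] e by (simp add: dist_real_def)
    have 2: "\<forall>\<^sub>F n in sequentially. X - ln c + 1 \<le> ln (y n)" using lny by (simp add: filterlim_at_top)
    have 3: "\<forall>\<^sub>F n in sequentially. \<bar>ln (z n / y n) - ln c\<bar> < 1"
      using tendstoD[OF l, of 1] by (simp add: dist_real_def)
    from 1 2 3 ypos show "\<forall>\<^sub>F n in sequentially. dist (?h (ln (z n)) - ?h (ln (y n))) 0 < e"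
    proof eventually_elim
      case (elim n)
      define a b where "a = ln (y n) + ln c" and "b = ln (z n)"
      have "b = ln (y n) + ln (z n / y n)" using z[of n] elim(4) by (simp add: b_def ln_div)
      then have ab: "\<bar>b - a\<bar> < 1" "X \<le> a" "X \<le> b" using elim(2,3) by (auto simp: a_def)
      have "\<bar>?h b - ?h a\<bar> < e / 2"
      proof (cases "a \<le> b")
        case True
        then show ?thesis using X[of a "b - a"] ab by auto
      next
        case False
        then show ?thesis using X[of b "a - b"] ab by (auto simp: abs_minus_commute)
      qed
      then have "\<bar>?h b - ?h (ln (y n))\<bar> < e" using elim(1) unfolding a_def[symmetric] by linarith
      then show ?case by (simp add: b_def dist_real_def)
    qed
  qed
  then have "(\<lambda>n. exp (?h (ln (z n)) - ?h (ln (y n)))) \<longlonglongrightarrow> exp 0" by (intro tendsto_intros)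
  then have "(\<lambda>n. exp (?h (ln (z n)) - ?h (ln (y n)))) \<longlonglongrightarrow> 1" by simp
  then show ?thesis
  proof (rule Lim_transform_eventually)
    show "\<forall>\<^sub>F n in sequentially. exp (?h (ln (z n)) - ?h (ln (y n))) = L (z n) / L (y n)"
      using ypos by eventually_elim (use z slow_pos in \<open>simp add: log_slow_def exp_diff\<close>)
  qed
qed

lemma potter_nat:
  assumes d: "0 < d"
  shows "\<exists>C>0. \<exists>N0\<ge>1. \<forall>N\<ge>N0. \<forall>n\<ge>1. L (real n) / L (real N) \<le> C * ((real n / N) powr d + (real n / N) powr (- d))"
proof -
  let ?h = "log_slow L"
  obtain X where X: "\<And>x u. X \<le> x \<Longrightarrow> 0 \<le> u \<Longrightarrow> \<bar>?h (x + u) - ?h x\<bar> \<le> d * (u + 1)"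
    using log_slow_growth[OF d] by blast
  define N0 where "N0 = max 1 (nat \<lceil>exp X\<rceil>)"
  have N0: "1 \<le> N0" by (simp add: N0_def)
  have lnX: "X \<le> ln (real N)" if "N0 \<le> N" for N
  proof -
    have "exp X \<le> real N" using that by (simp add: N0_def)
    then show ?thesis using N0 that by (simp add: ln_ge_iff)
  qed
  have main: "L (real n) / L (real N) \<le> exp d * ((real n / N) powr d + (real n / N) powr (- d))"
    if n: "N0 \<le> n" and N: "N0 \<le> N" for n N
  proof -
    have pos: "0 < real n" "0 < real N" using n N N0 by auto
    have eq: "L (real n) / L (real N) = exp (?h (ln n) - ?h (ln N))"
      using pos slow_pos by (simp add: log_slow_def exp_diff)
    define w where "w = ln (real n / N)"
    have w: "ln (real n) = ln (real N) + w" using pos by (simp add: w_def ln_div)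
    have "?h (ln n) - ?h (ln N) \<le> d * (\<bar>w\<bar> + 1)"
    proof (cases "0 \<le> w")
      case True
      then show ?thesis using X[OF lnX[OF N] True] by (simp add: w)
    next
      case False
      then show ?thesis using X[OF lnX[OF n], of "- w"] by (simp add: w)
    qed
    then have "L (real n) / L (real N) \<le> exp (d * (\<bar>w\<bar> + 1))" unfolding eq by simp
    also have "\<dots> = exp d * exp (d * \<bar>w\<bar>)" by (simp add: distrib_left mult_exp_exp add.commute)
    also have "exp (d * \<bar>w\<bar>) \<le> exp (d * w) + exp (- d * w)" by (cases "0 \<le> w") auto
    also have "exp (d * w) = (real n / N) powr d" using pos by (simp add: w_def powr_def)
    also have "exp (- d * w) = (real n / N) powr (- d)" using pos by (simp add: w_def powr_def)
    finally show ?thesis by (simp add: mult_left_mono)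
  qed
  define C1 where "C1 = (\<Sum>n\<in>{1..N0}. L (real n) / L (real N0))"
  define C where "C = exp d * (1 + 2 * C1)"
  have C1: "0 \<le> C1" unfolding C1_def using N0 slow_pos by (intro sum_nonneg divide_nonneg_nonneg) (auto simp: less_imp_le)
  have C: "exp d \<le> C" "0 < C" using C1 by (auto simp: C_def intro: add_pos_nonneg)
  have "L (real n) / L (real N) \<le> C * ((real n / N) powr d + (real n / N) powr (- d))" if N: "N0 \<le> N" and n: "1 \<le> n" for n N
  proof (cases "N0 \<le> n")
    case True
    have "exp d * ((real n / N) powr d + (real n / N) powr (- d)) \<le> C * ((real n / N) powr d + (real n / N) powr (- d))"
      using C by (intro mult_right_mono) auto
    then show ?thesis using main[OF True N] by linarith
  next
    case False
    have pos: "0 < real n" "0 < real N" "0 < real N0" using n N N0 by auto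
    have a: "L (real n) / L (real N0) \<le> C1"
      unfolding C1_def using False n slow_pos N0 by (intro member_le_sum) (auto simp: less_imp_le)
    have b: "L (real N0) / L (real N) \<le> exp d * (2 * (real n / N) powr (- d))"
    proof -
      have "real N0 / N \<le> 1" using N pos by simp
      then have "(real N0 / N) powr d \<le> 1 powr d" using d pos by (intro powr_mono2) auto
      moreover have "1 \<le> (real N0 / N) powr (- d)"
        using powr_mono2'[of "- d" "real N0 / N" 1] d pos \<open>real N0 / N \<le> 1\<close> by simp
      moreover have "(real N0 / N) powr (- d) \<le> (real n / N) powr (- d)"
        using d pos False by (intro powr_mono2') (auto intro: divide_right_mono)
      ultimately have "(real N0 / N) powr d + (real N0 / N) powr (- d) \<le> 2 * (real n / N) powr (- d)" by simp
      then show ?thesis using main[OF order_refl N] by (meson exp_ge_zero mult_left_mono order_trans)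
    qed
    have "L (real n) / L (real N) = (L (real n) / L (real N0)) * (L (real N0) / L (real N))"
      using slow_pos[OF pos(3)] by simp
    also have "\<dots> \<le> C1 * (exp d * (2 * (real n / N) powr (- d)))"
      using a b C1 slow_pos pos by (intro mult_mono) (auto simp: less_imp_le)
    also have "\<dots> \<le> C * (real n / N) powr (- d)"
      using C1 by (simp add: C_def algebra_simps)
    also have "\<dots> \<le> C * ((real n / N) powr d + (real n / N) powr (- d))"
      using C by (intro mult_left_mono) auto
    finally show ?thesis .
  qed
  then show ?thesis using C(2) N0 by blast
qed

end

lemma nat_ceiling_cell: "0 < N \<Longrightarrow> 0 < x \<Longrightarrow> nat \<lceil>x * real N\<rceil> = Suc n \<longleftrightarrow> x \<in> {real n / N<..real (Suc n) / N}"
proof -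
  assume N: "0 < N" and x: "0 < x"
  have "nat \<lceil>x * real N\<rceil> = Suc n \<longleftrightarrow> \<lceil>x * real N\<rceil> = int (Suc n)"
    using N x by (auto simp: nat_eq_iff2)
  also have "\<dots> \<longleftrightarrow> real n < x * N \<and> x * N \<le> real (Suc n)"
    by (auto simp: ceiling_eq_iff)
  also have "\<dots> \<longleftrightarrow> x \<in> {real n / N<..real (Suc n) / N}"
    using N by (auto simp: field_simps)
  finally show ?thesis .
qed

lemma integrable_powr_unit: "a < 1 \<Longrightarrow> integrable lborel (\<lambda>x. indicator {0<..1} x * x powr (- a) :: real)"
proof -
  assume a: "a < 1"
  have "((\<lambda>x. x powr (- a)) has_integral (1 powr (- a + 1) / (- a + 1))) {0..1}"
    by (rule has_integral_powr_from_0) (use a in auto)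
  then have "((\<lambda>x. x powr (- a)) has_integral (1 powr (- a + 1) / (- a + 1))) {0<..1}"
    by (subst (asm) has_integral_spike_set_eq[where T="{0<..1}"])
      (auto intro: negligible_subset[of "{0}"] simp: negligible_sing)
  then have H: "((\<lambda>x. indicator {0<..1} x * x powr (- a)) has_integral (1 powr (- a + 1) / (- a + 1))) UNIV"
    by (subst (asm) has_integral_restrict_UNIV[symmetric], elim has_integral_eq[rotated]) auto
  have "(\<integral>\<^sup>+x. ennreal (indicator {0<..1} x * x powr (- a)) \<partial>lborel) = ennreal (1 powr (- a + 1) / (- a + 1))"
    by (rule nn_integral_has_integral_lborel[OF _ _ H]) auto
  then have "has_bochner_integral lborel (\<lambda>x. indicator {0<..1} x * x powr (- a)) (1 powr (- a + 1) / (- a + 1))"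
    by (intro has_bochner_integral_nn_integral) (use a in auto)
  then show ?thesis by (simp add: has_bochner_integral_iff)
qed

lemma has_bochner_integral_powr_tail:
  assumes a: "1 < a" and c: "0 < c"
  shows "has_bochner_integral lborel (\<lambda>x. indicator {c<..} x * x powr (- a) :: real) (c powr (1 - a) / (a - 1))"
proof -
  have "((\<lambda>x. x powr (- a)) has_integral (- (c powr (- a + 1)) / (- a + 1))) {c..}"
    by (rule has_integral_powr_to_inf) (use a c in auto)
  then have "((\<lambda>x. x powr (- a)) has_integral (- (c powr (- a + 1)) / (- a + 1))) {c<..}"
    by (subst (asm) has_integral_spike_set_eq[where T="{c<..}"])
      (auto intro: negligible_subset[of "{c}"] simp: negligible_sing)
  then have H: "((\<lambda>x. indicator {c<..} x * x powr (- a)) has_integral (- (c powr (- a + 1)) / (- a + 1))) UNIV"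
    by (subst (asm) has_integral_restrict_UNIV[symmetric], elim has_integral_eq[rotated]) auto
  moreover have e: "- (c powr (- a + 1)) / (- a + 1) = c powr (1 - a) / (a - 1)"
    using a by (simp add: field_simps)
  ultimately show ?thesis
    using a by (intro has_bochner_integral_nn_integral) (auto intro!: nn_integral_has_integral_lborel)
qed

text \<open>Sums against a regularly varying sequence are Riemann sums; Potter's bounds dominate them.\<close>

lemma regularly_varying_sum:
  fixes L K h :: "_ \<Rightarrow> real"
  assumes slow: "slowly_varying L" and \<alpha>: "0 < \<alpha>" "\<alpha> < 1"
    and K: "\<And>n. 1 \<le> n \<Longrightarrow> K n = L (real n) / real n powr (1 + \<alpha>)" and sumK: "summable (\<lambda>n. K (Suc n))"
    and h [measurable]: "h \<in> borel_measurable borel" and H: "\<And>x. 0 < x \<Longrightarrow> \<bar>h x\<bar> \<le> H * min x 1"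
    and cont: "finite E" "\<And>x. 0 < x \<Longrightarrow> x \<notin> E \<Longrightarrow> isCont h x"
  shows "(\<lambda>N. real N powr \<alpha> / L (real N) * (\<Sum>n. K (Suc n) * h (real (Suc n) / N)))
    \<longlonglongrightarrow> (\<integral>x. indicator {0<..} x * (x powr (- 1 - \<alpha>) * h x) \<partial>lborel)"
proof -
  have Lpos: "0 < L x" if "0 < x" for x using slow_pos[OF slow that] .
  have H0: "0 \<le> H" using H[of 1] by simp
  define d where "d = min \<alpha> (1 - \<alpha>) / 2"
  have "d \<le> \<alpha> / 2" "d \<le> (1 - \<alpha>) / 2" "0 < d" using \<alpha> by (auto simp: d_def)
  then have d: "0 < d" "\<alpha> + d < 1" "d < \<alpha>" using \<alpha> by (auto simp: field_simps)
  obtain C N0 where C: "0 < C" "1 \<le> N0" "\<And>N n. N0 \<le> N \<Longrightarrow> 1 \<le> n \<Longrightarrow> L (real n) / L (real N) \<le> C * ((real n / N) powr d + (real n / N) powr (- d))"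
    using potter_nat[OF slow d(1)] by blast
  define y where "y N x = real (nat \<lceil>x * real N\<rceil>) / N" for N x
  define g where "g N x = indicator {0<..} x * (L (real (nat \<lceil>x * real N\<rceil>)) / L (real N) * (y N x powr (- 1 - \<alpha>) * h (y N x)))" for N x
  define D where "D x = 2 * C * H * (indicator {0<..1} x * x powr (- (\<alpha> + d)) + indicator {1<..} x * x powr (- (1 + \<alpha> - d)))" for x
  have y_ge: "x \<le> y N x" "0 < y N x" "0 < nat \<lceil>x * real N\<rceil>" if "0 < N" "0 < x" for N x
  proof -
    have "x * N \<le> real (nat \<lceil>x * real N\<rceil>)" by linarith
    then show 1: "x \<le> y N x" using that by (simp add: y_def field_simps)
    then show "0 < y N x" using that by linarith
    then show "0 < nat \<lceil>x * real N\<rceil>" by (auto simp: y_def zero_less_divide_iff)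
  qed
  have g_sums: "(\<lambda>n. real N powr \<alpha> / L (real N) * (K (Suc n) * h (real (Suc n) / N))) sums (\<integral>x. g N x \<partial>lborel)" if N: "0 < N" for N
  proof -
    define c where "c n = real N powr \<alpha> / L (real N) * (K (Suc n) * h (real (Suc n) / N))" for n
    define f where "f n x = indicator {real n / N<..real (Suc n) / N} x * (real N * c n)" for n x
    have LN: "0 < L (real N)" using Lpos N by simp
    have fg: "(\<Sum>n. f n x) = g N x" "summable (\<lambda>n. norm (f n x))" for x
    proof -
      define k where "k = nat \<lceil>x * real N\<rceil> - 1"
      have z: "f n x = 0" if "n \<noteq> k \<or> \<not> 0 < x" for n
      proof (cases "0 < x")
        case True
        have "x \<notin> {real n / N<..real (Suc n) / N}"
        proof
          assume "x \<in> {real n / N<..real (Suc n) / N}"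
          from nat_ceiling_cell[OF N True, THEN iffD2, OF this] show False using that True by (simp add: k_def)
        qed
        then show ?thesis by (simp only: f_def indicator_simps mult_zero_left simp_thms)
      next
        case False
        then have "x \<le> real n / N" using order_trans[of x 0 "real n / N"] by simp
        then have "x \<notin> {real n / N<..real (Suc n) / N}" by simp
        then show ?thesis by (simp only: f_def indicator_simps mult_zero_left simp_thms)
      qed
      have s: "(\<Sum>n. f n x) = f k x" using suminf_finite[of "{k}" "\<lambda>n. f n x"] z by simp
      have "summable (\<lambda>n. norm (f n x))" by (rule summable_finite[of "{k}"]) (use z in auto)
      then show "summable (\<lambda>n. norm (f n x))" .
      show "(\<Sum>n. f n x) = g N x"
      proof (cases "0 < x")
        case True
        note yg = y_ge[OF N True]
        have k: "nat \<lceil>x * real N\<rceil> = Suc k" using yg(3) by (simp add: k_def)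
        have "f k x = real N * c k"
          using nat_ceiling_cell[OF N True, THEN iffD1, OF k] by (simp only: f_def indicator_simps mult_1)
        also have "\<dots> = L (real (Suc k)) / L (real N) * ((real (Suc k) / N) powr (- 1 - \<alpha>) * h (real (Suc k) / N))"
        proof -
          have Kk: "K (Suc k) = L (real (Suc k)) / real (Suc k) powr (1 + \<alpha>)" using K[of "Suc k"] by simp
          have pw: "real N * real N powr \<alpha> / real (Suc k) powr (1 + \<alpha>) = (real (Suc k) / N) powr (- 1 - \<alpha>)"
          proof -
            have "(real (Suc k) / N) powr (- 1 - \<alpha>) = (real (Suc k) / N) powr (- (1 + \<alpha>))" by (simp add: algebra_simps)
            also have "\<dots> = real N powr (1 + \<alpha>) / real (Suc k) powr (1 + \<alpha>)"
            proof -
              have aux: "(p / q) powr (- s) = q powr s / p powr s" if "0 < p" "0 < q" for p q s :: real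
                using that by (simp add: powr_minus_divide powr_divide)
              show ?thesis by (rule aux) (use N in auto)
            qed
            also have "real N powr (1 + \<alpha>) = real N * real N powr \<alpha>" using N by (simp add: powr_add)
            finally show ?thesis by simp
          qed
          show ?thesis unfolding c_def Kk pw[symmetric] by (simp only: divide_inverse mult_ac)
        qed
        finally show ?thesis unfolding s g_def y_def k using True by simp
      next
        case False
        then show ?thesis unfolding s using z[of k] by (simp add: g_def)
      qed
    qed
    have fint: "integrable lborel (f n)" for n
      unfolding f_def[abs_def] by (intro integrable_mult_left integrable_real_indicator) (auto simp: emeasure_lborel_Ioc divide_right_mono)
    have len: "measure lborel {real n / N<..real (Suc n) / N} = 1 / N" for n
      using N by (simp add: measure_lborel_Ioc divide_right_mono diff_divide_distrib[symmetric])
    have fI: "(\<integral>x. f n x \<partial>lborel) = c n" "(\<integral>x. norm (f n x) \<partial>lborel) = \<bar>c n\<bar>" for n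
    proof -
      have "(\<integral>x. f n x \<partial>lborel) = measure lborel {real n / N<..real (Suc n) / N} * (real N * c n)"
        unfolding f_def by (subst integral_mult_left_zero) simp
      then show "(\<integral>x. f n x \<partial>lborel) = c n" using N unfolding len by simp
      have "(\<integral>x. norm (f n x) \<partial>lborel) = (\<integral>x. indicator {real n / N<..real (Suc n) / N} x * (real N * \<bar>c n\<bar>) \<partial>lborel)"
        unfolding f_def by (intro Bochner_Integration.integral_cong refl) (simp add: abs_mult)
      also have "\<dots> = measure lborel {real n / N<..real (Suc n) / N} * (real N * \<bar>c n\<bar>)"
        by (subst integral_mult_left_zero) simp
      finally show "(\<integral>x. norm (f n x) \<partial>lborel) = \<bar>c n\<bar>" using N unfolding len by simp
    qed
    have Kpos: "0 \<le> K (Suc n)" for n using K[of "Suc n"] Lpos[of "real (Suc n)"] by simp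
    have "summable (\<lambda>n. real N powr \<alpha> / L (real N) * (K (Suc n) * H))"
      by (intro summable_mult summable_mult2 sumK)
    then have csum: "summable (\<lambda>n. \<bar>c n\<bar>)"
    proof (rule summable_comparison_test'[where N=0])
      fix n :: nat
      have "\<bar>h (real (Suc n) / N)\<bar> \<le> H"
        using H[of "real (Suc n) / N"] N mult_left_mono[OF min.cobounded2 H0, of "real (Suc n) / N" 1] by simp
      then have "real N powr \<alpha> / L (real N) * (K (Suc n) * \<bar>h (real (Suc n) / N)\<bar>) \<le> real N powr \<alpha> / L (real N) * (K (Suc n) * H)"
        using Kpos[of n] LN by (intro mult_left_mono) auto
      then show "norm \<bar>c n\<bar> \<le> real N powr \<alpha> / L (real N) * (K (Suc n) * H)"
        using Kpos[of n] LN by (simp add: c_def abs_mult)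
    qed
    have "(\<lambda>n. \<integral>x. f n x \<partial>lborel) sums (\<integral>x. (\<Sum>n. f n x) \<partial>lborel)"
    proof (rule sums_integral[OF fint])
      show "AE x in lborel. summable (\<lambda>n. norm (f n x))" by (intro AE_I2 fg(2))
      show "summable (\<lambda>n. \<integral>x. norm (f n x) \<partial>lborel)" unfolding fI(2) by (rule csum)
    qed
    then show ?thesis unfolding fI(1) fg(1) c_def .
  qed
  have lim: "(\<lambda>N. \<integral>x. g N x \<partial>lborel) \<longlonglongrightarrow> (\<integral>x. indicator {0<..} x * (x powr (- 1 - \<alpha>) * h x) \<partial>lborel)"
  proof -
    have [measurable]: "y N \<in> borel_measurable borel" for N unfolding y_def[abs_def] by measurable
    have Lm: "(\<lambda>x. L (real (nat \<lceil>x * real N\<rceil>))) \<in> borel_measurable borel" for N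
      by (rule measurable_compose[where g="\<lambda>k. L (real k)" and N="count_space UNIV"]) measurable
    have gm: "g N \<in> borel_measurable lborel" for N
      unfolding g_def[abs_def] using Lm[of N] by measurable
    have "(\<lambda>N. \<integral>x. g (N + N0) x \<partial>lborel) \<longlonglongrightarrow> (\<integral>x. indicator {0<..} x * (x powr (- 1 - \<alpha>) * h x) \<partial>lborel)"
    proof (rule integral_dominated_convergence[where w=D])
      show "integrable lborel D"
        unfolding D_def[abs_def] using d has_bochner_integral_powr_tail[of "1 + \<alpha> - d" 1]
        by (intro integrable_mult_right Bochner_Integration.integrable_add integrable_powr_unit) (auto simp: has_bochner_integral_iff)
      show "AE x in lborel. (\<lambda>N. g (N + N0) x) \<longlonglongrightarrow> indicator {0<..} x * (x powr (- 1 - \<alpha>) * h x)"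
      proof (rule AE_mp[OF AE_not_in[of E]])
        show "E \<in> null_sets lborel" by (rule finite_imp_null_set_lborel[OF cont(1)])
        show "AE x in lborel. x \<notin> E \<longrightarrow> (\<lambda>N. g (N + N0) x) \<longlonglongrightarrow> indicator {0<..} x * (x powr (- 1 - \<alpha>) * h x)"
        proof (intro AE_I2 impI)
          fix x assume xE: "x \<notin> E"
          show "(\<lambda>N. g (N + N0) x) \<longlonglongrightarrow> indicator {0<..} x * (x powr (- 1 - \<alpha>) * h x)"
          proof (cases "0 < x")
            case False
            then show ?thesis by (simp add: g_def)
          next
            case True
            let ?M = "\<lambda>N. N + N0"
            have Mpos: "0 < ?M N" for N using C(2) by simp
            have Mt: "filterlim (\<lambda>N. real (?M N)) at_top sequentially"
              by (rule filterlim_at_top_mono[OF filterlim_real_sequentially]) simp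
            have yl: "(\<lambda>N. y (?M N) x) \<longlonglongrightarrow> x"
            proof (rule tendsto_sandwich)
              show "(\<lambda>N. x) \<longlonglongrightarrow> x" by simp
              have "(\<lambda>N. x + 1 / real (?M N)) \<longlonglongrightarrow> x + 0"
                by (intro tendsto_intros tendsto_divide_0[OF tendsto_const] filterlim_at_top_imp_at_infinity Mt)
              then show "(\<lambda>N. x + 1 / real (?M N)) \<longlonglongrightarrow> x" by simp
              show "\<forall>\<^sub>F N in sequentially. x \<le> y (?M N) x" using y_ge(1)[OF Mpos True] by simp
              show "\<forall>\<^sub>F N in sequentially. y (?M N) x \<le> x + 1 / real (?M N)"
              proof (intro always_eventually allI)
                fix N
                have "real (nat \<lceil>x * real (?M N)\<rceil>) \<le> x * real (?M N) + 1" using True by (simp add: of_nat_nat)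
                then have "y (?M N) x \<le> (x * real (?M N) + 1) / real (?M N)" unfolding y_def by (rule divide_right_mono) simp
                also have "\<dots> = x + 1 / real (?M N)"
                proof -
                  have "real (?M N) \<noteq> 0" using Mpos[of N] by (simp only: of_nat_eq_0_iff)
                  then show ?thesis by (simp only: add_divide_distrib nonzero_mult_div_cancel_right simp_thms not_False_eq_True)
                qed
                finally show "y (?M N) x \<le> x + 1 / real (?M N)" .
              qed
            qed
            have Ll: "(\<lambda>N. L (real (nat \<lceil>x * real (?M N)\<rceil>)) / L (real (?M N))) \<longlonglongrightarrow> 1"
            proof (rule slow_ratio_tendsto[OF slow Mt _ _ True])
              show "0 < real (nat \<lceil>x * real (?M N)\<rceil>)" for N using y_ge(3)[OF Mpos True, of N] by simp
              show "(\<lambda>N. real (nat \<lceil>x * real (?M N)\<rceil>) / real (?M N)) \<longlonglongrightarrow> x" using yl by (simp only: y_def)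
            qed
            have hl: "(\<lambda>N. h (y (?M N) x)) \<longlonglongrightarrow> h x"
              by (rule isCont_tendsto_compose[OF cont(2)[OF True xE] yl])
            have pl: "(\<lambda>N. y (?M N) x powr (- 1 - \<alpha>)) \<longlonglongrightarrow> x powr (- 1 - \<alpha>)"
              using True by (intro tendsto_intros yl) simp
            have "(\<lambda>N. indicator {0<..} x * (L (real (nat \<lceil>x * real (?M N)\<rceil>)) / L (real (?M N)) * (y (?M N) x powr (- 1 - \<alpha>) * h (y (?M N) x)))) \<longlonglongrightarrow> indicator {0<..} x * (1 * (x powr (- 1 - \<alpha>) * h x))"
              by (intro tendsto_mult tendsto_const Ll pl hl)
            then show ?thesis by (simp only: g_def mult_1)
          qed
        qed
      qed
      show "AE x in lborel. norm (g (N + N0) x) \<le> D x" for N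
      proof (rule AE_I2)
        fix x
        show "norm (g (N + N0) x) \<le> D x"
        proof (cases "0 < x")
          case False
          then show ?thesis by (simp add: g_def D_def)
        next
          case True
          let ?M = "N + N0"
          have Mpos: "0 < ?M" using C(2) by simp
          define z where "z = y ?M x"
          have z: "x \<le> z" "0 < z" and n: "0 < nat \<lceil>x * real ?M\<rceil>" using y_ge[OF Mpos True] by (auto simp: z_def)
          have r: "L (real (nat \<lceil>x * real ?M\<rceil>)) / L (real ?M) \<le> C * (z powr d + z powr (- d))"
            unfolding z_def y_def using n by (intro C(3)) (simp_all only: Suc_le_eq One_nat_def le_add2)
          have r0: "0 \<le> L (real (nat \<lceil>x * real ?M\<rceil>)) / L (real ?M)"
            using Lpos[of "real ?M"] Lpos[of "real (nat \<lceil>x * real ?M\<rceil>)"] n Mpos by simp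
          have "norm (g ?M x) = L (real (nat \<lceil>x * real ?M\<rceil>)) / L (real ?M) * (z powr (- 1 - \<alpha>) * \<bar>h z\<bar>)"
            using True abs_of_nonneg[OF r0] by (simp only: g_def z_def[symmetric] abs_mult real_norm_def abs_of_nonneg[OF powr_ge_zero] indicator_simps greaterThan_iff mult_1 abs_one simp_thms if_True)
          also have "\<dots> \<le> C * (z powr d + z powr (- d)) * (z powr (- 1 - \<alpha>) * (H * min z 1))"
            using r r0 H[OF z(2)] C(1) by (intro mult_mono mult_left_mono) auto
          also have "\<dots> = C * H * ((z powr d + z powr (- d)) * (z powr (- 1 - \<alpha>) * min z 1))"
            by (simp only: mult_ac)
          also have "\<dots> \<le> C * H * (2 * (indicator {0<..1} x * x powr (- (\<alpha> + d)) + indicator {1<..} x * x powr (- (1 + \<alpha> - d))))"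
          proof (rule mult_left_mono)
            show "(z powr d + z powr (- d)) * (z powr (- 1 - \<alpha>) * min z 1) \<le> 2 * (indicator {0<..1} x * x powr (- (\<alpha> + d)) + indicator {1<..} x * x powr (- (1 + \<alpha> - d)))"
            proof (cases "z \<le> 1")
              case z1: True
              have "z powr d \<le> z powr (- d)" using powr_mono'[of "- d" d z] z z1 d by simp
              then have "(z powr d + z powr (- d)) * (z powr (- 1 - \<alpha>) * z) \<le> (2 * z powr (- d)) * (z powr (- 1 - \<alpha>) * z)"
                using z by (intro mult_right_mono) auto
              also have "\<dots> = 2 * z powr (- (\<alpha> + d))"
              proof -
                have "z powr (- d) * (z powr (- 1 - \<alpha>) * z powr 1) = z powr (- d + (- 1 - \<alpha> + 1))" by (simp only: powr_add)
                then show ?thesis using z by (simp add: add.commute)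
              qed
              also have "\<dots> \<le> 2 * x powr (- (\<alpha> + d))"
                using z True d \<alpha> by (intro mult_left_mono powr_mono2') auto
              finally show ?thesis using z z1 True by (simp add: min_absorb1)
            next
              case z1: False
              have "z powr (- d) \<le> z powr d" using z1 d by (intro powr_mono) auto
              then have "(z powr d + z powr (- d)) * (z powr (- 1 - \<alpha>) * 1) \<le> (2 * z powr d) * (z powr (- 1 - \<alpha>) * 1)"
                by (intro mult_right_mono) auto
              also have "\<dots> = 2 * z powr (- (1 + \<alpha> - d))"
              proof -
                have "d + (- 1 - \<alpha>) = - (1 + \<alpha> - d)" by simp
                then have "z powr d * z powr (- 1 - \<alpha>) = z powr (- (1 + \<alpha> - d))" by (simp only: powr_add[symmetric])
                then show ?thesis by simp
              qed
              also have "\<dots> \<le> 2 * (indicator {0<..1} x * x powr (- (\<alpha> + d)) + indicator {1<..} x * x powr (- (1 + \<alpha> - d)))"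
              proof (cases "x \<le> 1")
                case x1: True
                have "z powr (- (1 + \<alpha> - d)) \<le> 1 powr (- (1 + \<alpha> - d))" using z1 d \<alpha> by (intro powr_mono2') auto
                moreover have "1 powr (- (\<alpha> + d)) \<le> x powr (- (\<alpha> + d))" using x1 True d \<alpha> by (intro powr_mono2') auto
                ultimately show ?thesis using x1 True by simp
              next
                case False
                have "z powr (- (1 + \<alpha> - d)) \<le> x powr (- (1 + \<alpha> - d))" using z True d \<alpha> by (intro powr_mono2') auto
                then show ?thesis using False by simp
              qed
              finally show ?thesis using z1 by (simp add: min_absorb2)
            qed
          qed (use C(1) H0 in simp)
          also have "\<dots> = D x" by (simp only: D_def mult_ac)
          finally show ?thesis .
        qed
      qed
    qed (use gm in measurable)
    then show ?thesis by (rule LIMSEQ_offset)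
  qed
  show ?thesis
  proof (rule Lim_transform_eventually[OF lim])
    show "\<forall>\<^sub>F N in sequentially. (\<integral>x. g N x \<partial>lborel) = real N powr \<alpha> / L (real N) * (\<Sum>n. K (Suc n) * h (real (Suc n) / N))"
    proof (rule eventually_mono[OF eventually_gt_at_top[of 0]])
      fix N :: nat assume N: "0 < N"
      have LN: "0 < real N powr \<alpha> / L (real N)" using Lpos[of "real N"] N by simp
      let ?c = "real N powr \<alpha> / L (real N)"
      have "(\<lambda>n. inverse ?c * (?c * (K (Suc n) * h (real (Suc n) / N)))) sums (inverse ?c * (\<integral>x. g N x \<partial>lborel))"
        by (intro sums_mult g_sums[OF N])
      then have "(\<lambda>n. K (Suc n) * h (real (Suc n) / N)) sums (inverse ?c * (\<integral>x. g N x \<partial>lborel))"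
        using LN by (simp only: mult.assoc[symmetric] left_inverse[OF less_imp_neq[OF LN, symmetric]] mult_1)
      then have "(\<Sum>n. K (Suc n) * h (real (Suc n) / N)) = inverse ?c * (\<integral>x. g N x \<partial>lborel)" by (rule sums_unique[symmetric])
      then show "(\<integral>x. g N x \<partial>lborel) = ?c * (\<Sum>n. K (Suc n) * h (real (Suc n) / N))"
        by (simp only: mult.assoc[symmetric] right_inverse[OF less_imp_neq[OF LN, symmetric]] mult_1)
    qed
  qed
qed

lemma laplace_powr_integral:
  fixes \<alpha> r :: real
  assumes \<alpha>: "0 < \<alpha>" "\<alpha> < 1" and r: "0 < r"
  shows "(\<integral>x. indicator {0<..} x * (x powr (- 1 - \<alpha>) * (1 - exp (- r * x))) \<partial>lborel) = Gamma (1 - \<alpha>) / \<alpha> * r powr \<alpha>"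
proof -
  define F :: "real \<Rightarrow> real \<Rightarrow> ennreal" where "F x u = ennreal (r * exp (- r * u)) * (ennreal (x powr (- 1 - \<alpha>)) * (if 0 < x \<and> 0 \<le> u \<and> u \<le> x then 1 else 0))" for x u
  have [measurable]: "(\<lambda>(x, u). F x u) \<in> borel_measurable (borel \<Otimes>\<^sub>M borel)" unfolding F_def by measurable
  have inner_u: "(\<integral>\<^sup>+u. F x u \<partial>lborel) = ennreal (indicator {0<..} x * (x powr (- 1 - \<alpha>) * (1 - exp (- r * x))))" for x
  proof (cases "0 < x")
    case True
    have "(\<integral>\<^sup>+u. ennreal (r * exp (- r * u)) * indicator {0..x} u \<partial>lborel) = ennreal (- exp (- r * x) - - exp (- r * 0))"
      by (rule nn_integral_FTC_Icc) (use True r in \<open>auto intro!: derivative_eq_intros\<close>)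
    moreover have "(\<integral>\<^sup>+u. F x u \<partial>lborel) = (\<integral>\<^sup>+u. ennreal (x powr (- 1 - \<alpha>)) * (ennreal (r * exp (- r * u)) * indicator {0..x} u) \<partial>lborel)"
      by (intro nn_integral_cong) (use True in \<open>simp add: F_def indicator_def mult_ac\<close>)
    ultimately show ?thesis
      using True r by (simp add: nn_integral_cmult ennreal_mult[symmetric])
  next
    case False
    then show ?thesis by (simp add: F_def)
  qed
  have inner_x: "(\<integral>\<^sup>+x. F x u \<partial>lborel) = ennreal (r * Gamma (1 - \<alpha>) / \<alpha> * (stable_density (1 - \<alpha>) u * exp (- r * u)))" if "u \<noteq> 0" for u
  proof (cases "0 < u")
    case True
    have "(\<integral>\<^sup>+x. ennreal (x powr (- 1 - \<alpha>)) * indicator {u..} x \<partial>lborel) = ennreal (0 - (- (u powr (- \<alpha>)) / \<alpha>))"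
    proof (rule nn_integral_FTC_atLeast)
      show "((\<lambda>x. - (x powr (- \<alpha>)) / \<alpha>) \<longlongrightarrow> 0) at_top"
      proof -
        have "((\<lambda>x. x powr (- \<alpha>)) \<longlongrightarrow> 0) at_top" using \<alpha> by (intro tendsto_neg_powr filterlim_ident) auto
        then have "((\<lambda>x. - (x powr (- \<alpha>)) / \<alpha>) \<longlongrightarrow> - 0 / \<alpha>) at_top" by (intro tendsto_intros) (use \<alpha> in auto)
        then show ?thesis by simp
      qed
      show "((\<lambda>x. - (x powr (- \<alpha>)) / \<alpha>) has_real_derivative x powr (- 1 - \<alpha>)) (at x)" if "u \<le> x" for x
      proof -
        have "0 < x" using that True by linarith
        from has_real_derivative_powr[OF this, of "- \<alpha>"]
        have "((\<lambda>x. - (x powr (- \<alpha>)) / \<alpha>) has_real_derivative - (- \<alpha> * x powr (- \<alpha> - 1)) / \<alpha>) (at x)"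
          by (rule DERIV_cdivide[OF DERIV_minus])
        moreover have "- \<alpha> - 1 = - 1 - \<alpha>" by simp
        moreover have "- (- \<alpha> * y) / \<alpha> = y" for y using \<alpha> by simp
        ultimately show ?thesis by (simp only:)
      qed
    qed simp_all
    moreover have "(\<integral>\<^sup>+x. F x u \<partial>lborel) = (\<integral>\<^sup>+x. ennreal (r * exp (- r * u)) * (ennreal (x powr (- 1 - \<alpha>)) * indicator {u..} x) \<partial>lborel)"
      by (intro nn_integral_cong) (use True in \<open>auto simp: F_def indicator_def\<close>)
    moreover have "r * exp (- r * u) * (0 - (- (u powr (- \<alpha>)) / \<alpha>)) = r * Gamma (1 - \<alpha>) / \<alpha> * (stable_density (1 - \<alpha>) u * exp (- r * u))"
    proof -
      have "Gamma (1 - \<alpha>) \<noteq> 0" using Gamma_real_pos[of "1 - \<alpha>"] \<alpha> by linarith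
      then show ?thesis using True by (simp add: stable_density_def)
    qed
    ultimately show ?thesis
      using r \<alpha> by (simp add: nn_integral_cmult ennreal_mult[symmetric]) (simp only: mult_ac times_divide_eq_right)
  next
    case False
    have "F x u = 0" for x using False that by (simp add: F_def)
    then show ?thesis using False by (simp add: stable_density_def)
  qed
  have sd: "integrable lborel (\<lambda>u. stable_density (1 - \<alpha>) u * exp (- r * u))" "(\<integral>u. stable_density (1 - \<alpha>) u * exp (- r * u) \<partial>lborel) = r powr (- (1 - \<alpha>))"
    using stable_density_laplace[of "1 - \<alpha>" r] \<alpha> r by auto
  have G: "0 < Gamma (1 - \<alpha>)" using \<alpha> by (intro Gamma_real_pos) simp
  have "(\<integral>\<^sup>+x. ennreal (indicator {0<..} x * (x powr (- 1 - \<alpha>) * (1 - exp (- r * x)))) \<partial>lborel) = (\<integral>\<^sup>+x. \<integral>\<^sup>+u. F x u \<partial>lborel \<partial>lborel)"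
    by (simp only: inner_u)
  also have "\<dots> = (\<integral>\<^sup>+u. \<integral>\<^sup>+x. F x u \<partial>lborel \<partial>lborel)"
    by (rule lborel_pair.Fubini'[symmetric]) measurable
  also have "\<dots> = (\<integral>\<^sup>+u. ennreal (r * Gamma (1 - \<alpha>) / \<alpha> * (stable_density (1 - \<alpha>) u * exp (- r * u))) \<partial>lborel)"
    by (rule nn_integral_cong_AE, rule AE_mp[OF AE_lborel_singleton[of 0]]) (simp add: inner_x)
  also have "\<dots> = ennreal (\<integral>u. r * Gamma (1 - \<alpha>) / \<alpha> * (stable_density (1 - \<alpha>) u * exp (- r * u)) \<partial>lborel)"
    using sd(1) G r \<alpha> by (intro nn_integral_eq_integral integrable_mult_right AE_I2) (auto intro!: mult_nonneg_nonneg divide_nonneg_pos stable_density_nonneg)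
  also have "(\<integral>u. r * Gamma (1 - \<alpha>) / \<alpha> * (stable_density (1 - \<alpha>) u * exp (- r * u)) \<partial>lborel) = r * Gamma (1 - \<alpha>) / \<alpha> * r powr (- (1 - \<alpha>))"
    by (subst integral_mult_right_zero) (simp only: sd(2))
  also have "r * Gamma (1 - \<alpha>) / \<alpha> * r powr (- (1 - \<alpha>)) = Gamma (1 - \<alpha>) / \<alpha> * r powr \<alpha>"
  proof -
    have "r powr 1 * r powr (- (1 - \<alpha>)) = r powr \<alpha>" by (simp only: powr_add[symmetric]) simp
    then show ?thesis using r by (simp add: field_simps)
  qed
  finally have nn: "(\<integral>\<^sup>+x. ennreal (indicator {0<..} x * (x powr (- 1 - \<alpha>) * (1 - exp (- r * x)))) \<partial>lborel) = ennreal (Gamma (1 - \<alpha>) / \<alpha> * r powr \<alpha>)" .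
  have "has_bochner_integral lborel (\<lambda>x. indicator {0<..} x * (x powr (- 1 - \<alpha>) * (1 - exp (- r * x)))) (Gamma (1 - \<alpha>) / \<alpha> * r powr \<alpha>)"
  proof (rule has_bochner_integral_nn_integral[OF _ _ _ nn])
    show "AE x in lborel. 0 \<le> indicator {0<..} x * (x powr (- 1 - \<alpha>) * (1 - exp (- r * x)))"
      using r by (intro AE_I2) (auto simp: indicator_def)
    show "0 \<le> Gamma (1 - \<alpha>) / \<alpha> * r powr \<alpha>" using G \<alpha> by simp
  qed measurable
  then show ?thesis by (simp add: has_bochner_integral_iff)
qed

lemma asymptotic_inverse_scale:
  assumes slow: "slowly_varying L" and \<alpha>: "0 < \<alpha>" "\<alpha> < 1"
    and a: "normalizing_seq \<alpha> L a" and ab: "asymptotic_inverse a b"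
  shows "(\<lambda>N. b N * (Gamma (1 - \<alpha>) * L (real N) / (\<alpha> * real N powr \<alpha>))) \<longlonglongrightarrow> 1" "filterlim b at_top sequentially"
proof -
  define m where "m N = nat \<lfloor>b N\<rfloor>" for N
  have bpos: "0 < b N" if "1 \<le> N" for N using ab that by (simp add: asymptotic_inverse_def)
  have apos: "0 < a n" if "1 \<le> n" for n using a that by (simp add: normalizing_seq_def)
  have "(\<lambda>N. a (m N)) \<sim>[sequentially] real" using ab by (simp add: asymptotic_inverse_def m_def)
  then have am: "(\<lambda>N. a (m N) / real N) \<longlonglongrightarrow> 1"
    by (rule asymp_equivD_strong) (auto simp: eventually_sequentially intro!: exI[of _ 1])
  have amt: "filterlim (\<lambda>N. a (m N)) at_top sequentially"
  proof -
    have "filterlim (\<lambda>N. (a (m N) / real N) * real N) at_top sequentially"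
      by (rule filterlim_tendsto_pos_mult_at_top[OF am _ filterlim_real_sequentially]) simp
    moreover have "\<forall>\<^sub>F N in sequentially. (a (m N) / real N) * real N = a (m N)"
      using eventually_gt_at_top[of 0] by eventually_elim simp
    ultimately show ?thesis by (rule filterlim_cong[OF refl refl, THEN iffD1, rotated])
  qed
  have mt: "filterlim m at_top sequentially"
    unfolding filterlim_at_top
  proof
    fix Z
    define A where "A = Max (a ` {..Z})"
    have "\<forall>\<^sub>F N in sequentially. A < a (m N)" using amt by (simp add: filterlim_at_top_dense)
    then show "\<forall>\<^sub>F N in sequentially. Z \<le> m N"
    proof eventually_elim
      case (elim N)
      show ?case
      proof (rule ccontr)
        assume "\<not> Z \<le> m N"
        then have "a (m N) \<le> A" unfolding A_def by (intro Max_ge) auto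
        then show False using elim by simp
      qed
    qed
  qed
  have mreal: "filterlim (\<lambda>N. real (m N)) at_top sequentially"
    by (rule filterlim_compose[OF filterlim_real_sequentially mt])
  have m_le: "\<forall>\<^sub>F N in sequentially. real (m N) \<le> b N \<and> b N \<le> real (m N) + 1 \<and> 0 < real (m N) \<and> 1 \<le> N \<and> 1 \<le> m N"
    using eventually_ge_at_top[of 1] filterlim_at_top[THEN iffD1, OF mt, THEN spec, of 1]
  proof eventually_elim
    case (elim N)
    then show ?case using bpos[of N] unfolding m_def by (auto simp: of_nat_nat) linarith+
  qed
  then have "\<forall>\<^sub>F N in sequentially. real (m N) \<le> b N" by (rule eventually_mono) simp
  from filterlim_at_top_mono[OF mreal this] show bt: "filterlim b at_top sequentially" .
  have bm: "(\<lambda>N. b N / real (m N)) \<longlonglongrightarrow> 1"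
  proof (rule tendsto_sandwich)
    show "\<forall>\<^sub>F N in sequentially. 1 \<le> b N / real (m N)" using m_le by eventually_elim simp
    show "\<forall>\<^sub>F N in sequentially. b N / real (m N) \<le> 1 + 1 / real (m N)" using m_le by eventually_elim (simp add: field_simps)
    have "(\<lambda>N. 1 + 1 / real (m N)) \<longlonglongrightarrow> 1 + 0"
      by (intro tendsto_add tendsto_const tendsto_divide_0[OF tendsto_const] filterlim_at_top_imp_at_infinity mreal)
    then show "(\<lambda>N. 1 + 1 / real (m N)) \<longlonglongrightarrow> 1" by simp
  qed simp
  have na: "(\<lambda>N. real (m N) * Gamma (1 - \<alpha>) * L (a (m N)) / (\<alpha> * a (m N) powr \<alpha>)) \<longlonglongrightarrow> 1"
  proof -
    have "(\<lambda>n. real n * Gamma (1 - \<alpha>) * L (a n) / (\<alpha> * a n powr \<alpha>)) \<longlonglongrightarrow> 1" using a by (simp add: normalizing_seq_def)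
    from filterlim_compose[OF this mt] show ?thesis .
  qed
  have "(\<lambda>N. inverse (a (m N) / real N)) \<longlonglongrightarrow> inverse 1" by (rule tendsto_inverse[OF am]) simp
  then have na1: "(\<lambda>N. real N / a (m N)) \<longlonglongrightarrow> 1" by simp
  have z1: "(\<lambda>N. real (max 1 N) / a (m N)) \<longlonglongrightarrow> 1"
    by (rule Lim_transform_eventually[OF na1]) (use eventually_ge_at_top[of 1] in eventually_elim, simp add: max_def)
  have "(\<lambda>N. L (real (max 1 N)) / L (a (m N))) \<longlonglongrightarrow> 1"
    by (rule slow_ratio_tendsto[OF slow amt _ z1]) simp_all
  then have La: "(\<lambda>N. L (real N) / L (a (m N))) \<longlonglongrightarrow> 1"
    by (rule Lim_transform_eventually) (use eventually_ge_at_top[of 1] in eventually_elim, simp add: max_def)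
  have pw: "(\<lambda>N. (a (m N) / real N) powr \<alpha>) \<longlonglongrightarrow> 1 powr \<alpha>"
    by (intro tendsto_intros am) simp
  have "(\<lambda>N. (real (m N) * Gamma (1 - \<alpha>) * L (a (m N)) / (\<alpha> * a (m N) powr \<alpha>)) * (b N / real (m N)) * (L (real N) / L (a (m N))) * (a (m N) / real N) powr \<alpha>) \<longlonglongrightarrow> 1 * 1 * 1 * 1 powr \<alpha>"
    by (intro tendsto_mult na bm La pw)
  then have "(\<lambda>N. (real (m N) * Gamma (1 - \<alpha>) * L (a (m N)) / (\<alpha> * a (m N) powr \<alpha>)) * (b N / real (m N)) * (L (real N) / L (a (m N))) * (a (m N) / real N) powr \<alpha>) \<longlonglongrightarrow> 1"
    by simp
  then show "(\<lambda>N. b N * (Gamma (1 - \<alpha>) * L (real N) / (\<alpha> * real N powr \<alpha>))) \<longlonglongrightarrow> 1"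
  proof (rule Lim_transform_eventually)
    show "\<forall>\<^sub>F N in sequentially. (real (m N) * Gamma (1 - \<alpha>) * L (a (m N)) / (\<alpha> * a (m N) powr \<alpha>)) * (b N / real (m N)) * (L (real N) / L (a (m N))) * (a (m N) / real N) powr \<alpha>
        = b N * (Gamma (1 - \<alpha>) * L (real N) / (\<alpha> * real N powr \<alpha>))"
      using m_le
    proof eventually_elim
      case (elim N)
      have p: "0 < a (m N)" using apos elim by simp
      have "0 < L (a (m N))" using slow_pos[OF slow p] .
      then have nz: "L (a (m N)) \<noteq> 0" "a (m N) powr \<alpha> \<noteq> 0" "real (m N) \<noteq> 0" "\<alpha> \<noteq> 0" "real N powr \<alpha> \<noteq> 0"
        using p elim \<alpha> by auto
      have "(a (m N) / real N) powr \<alpha> = a (m N) powr \<alpha> / real N powr \<alpha>" using p elim by (simp add: powr_divide)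
      then show ?case using nz by (simp add: field_simps)
    qed
  qed
qed

lemma kernel_sum_limit:
  fixes L K h :: "_ \<Rightarrow> real"
  assumes slow: "slowly_varying L" and \<alpha>: "0 < \<alpha>" "\<alpha> < 1"
    and K: "\<And>n. 1 \<le> n \<Longrightarrow> K n = L (real n) / real n powr (1 + \<alpha>)" and sumK: "summable (\<lambda>n. K (Suc n))"
    and b: "(\<lambda>N. b N * (Gamma (1 - \<alpha>) * L (real N) / (\<alpha> * real N powr \<alpha>))) \<longlonglongrightarrow> 1"
    and h: "h \<in> borel_measurable borel" and H: "\<And>x. 0 < x \<Longrightarrow> \<bar>h x\<bar> \<le> H * min x 1"
    and cont: "finite E" "\<And>x. 0 < x \<Longrightarrow> x \<notin> E \<Longrightarrow> isCont h x"
    and I: "(\<integral>x. indicator {0<..} x * (x powr (- 1 - \<alpha>) * h x) \<partial>lborel) = Gamma (1 - \<alpha>) / \<alpha> * c"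
  shows "(\<lambda>N. b N * (\<Sum>n. K (Suc n) * h (real (Suc n) / N))) \<longlonglongrightarrow> c"
proof -
  let ?G = "Gamma (1 - \<alpha>)" and ?S = "\<lambda>N. \<Sum>n. K (Suc n) * h (real (Suc n) / real N)"
  have G: "0 < ?G" using \<alpha> by (intro Gamma_real_pos) simp
  have "(\<lambda>N. (b N * (?G * L (real N) / (\<alpha> * real N powr \<alpha>))) * (\<alpha> / ?G * (real N powr \<alpha> / L (real N) * ?S N))) \<longlonglongrightarrow> 1 * (\<alpha> / ?G * (?G / \<alpha> * c))"
    unfolding I[symmetric]
    by (intro tendsto_mult tendsto_const b regularly_varying_sum[OF slow \<alpha> K sumK h H cont])
  then have "(\<lambda>N. (b N * (?G * L (real N) / (\<alpha> * real N powr \<alpha>))) * (\<alpha> / ?G * (real N powr \<alpha> / L (real N) * ?S N))) \<longlonglongrightarrow> c"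
    using G \<alpha> by simp
  then show ?thesis
  proof (rule Lim_transform_eventually)
    show "\<forall>\<^sub>F N in sequentially. (b N * (?G * L (real N) / (\<alpha> * real N powr \<alpha>))) * (\<alpha> / ?G * (real N powr \<alpha> / L (real N) * ?S N)) = b N * ?S N"
      using eventually_gt_at_top[of 0]
    proof eventually_elim
      case (elim N)
      have nz: "?G \<noteq> 0" "L (real N) \<noteq> 0" "real N powr \<alpha> \<noteq> 0" "\<alpha> \<noteq> 0"
        using less_imp_neq[OF G] \<alpha> elim slow_pos[OF slow, of "real N"] by auto
      have "b * (g * l / (\<alpha> * p)) * (\<alpha> / g * (p / l * s)) = b * s"
        if "g \<noteq> 0" "l \<noteq> 0" "p \<noteq> 0" "\<alpha> \<noteq> 0" for b g l p s :: real using that by simp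
      from this[OF nz] show ?case .
    qed
  qed
qed

lemma kernel_laplace_limit:
  fixes L K :: "_ \<Rightarrow> real"
  assumes slow: "slowly_varying L" and \<alpha>: "0 < \<alpha>" "\<alpha> < 1"
    and K: "\<And>n. 1 \<le> n \<Longrightarrow> K n = L (real n) / real n powr (1 + \<alpha>)" and sumK: "summable (\<lambda>n. K (Suc n))"
    and b: "(\<lambda>N. b N * (Gamma (1 - \<alpha>) * L (real N) / (\<alpha> * real N powr \<alpha>))) \<longlonglongrightarrow> 1"
    and r: "0 < r"
  shows "(\<lambda>N. b N * (\<Sum>n. K (Suc n) * (1 - exp (- r * (real (Suc n) / N))))) \<longlonglongrightarrow> r powr \<alpha>"
proof (rule kernel_sum_limit[OF slow \<alpha> K sumK b, where H = "max r 1" and E = "{}" and h = "\<lambda>x. 1 - exp (- r * x)"])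
  show "\<bar>1 - exp (- r * x)\<bar> \<le> max r 1 * min x 1" if "0 < x" for x
  proof -
    have "0 \<le> 1 - exp (- r * x)" using that r by simp
    moreover have "1 - exp (- r * x) \<le> r * x" using exp_ge_add_one_self[of "- r * x"] by simp
    moreover have "r * x \<le> max r 1 * x" using that by (intro mult_right_mono) auto
    moreover have "1 - exp (- r * x) < 1" by simp
    moreover have "1 \<le> max r 1" by simp
    ultimately show ?thesis unfolding min_def abs_le_iff by (cases "x \<le> 1") (simp_all only: if_True if_False mult_1_right, linarith+)
  qed
  show "(\<integral>x. indicator {0<..} x * (x powr (- 1 - \<alpha>) * (1 - exp (- r * x))) \<partial>lborel) = Gamma (1 - \<alpha>) / \<alpha> * r powr \<alpha>"
    by (rule laplace_powr_integral[OF \<alpha> r])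
qed auto

lemma kernel_tail_limit:
  fixes L K :: "_ \<Rightarrow> real"
  assumes slow: "slowly_varying L" and \<alpha>: "0 < \<alpha>" "\<alpha> < 1"
    and K: "\<And>n. 1 \<le> n \<Longrightarrow> K n = L (real n) / real n powr (1 + \<alpha>)" and sumK: "summable (\<lambda>n. K (Suc n))"
    and b: "(\<lambda>N. b N * (Gamma (1 - \<alpha>) * L (real N) / (\<alpha> * real N powr \<alpha>))) \<longlonglongrightarrow> 1"
    and y: "0 < y"
  shows "(\<lambda>N. b N * (\<Sum>n. K (Suc n) * indicator {y<..} (real (Suc n) / N))) \<longlonglongrightarrow> y powr (- \<alpha>) / Gamma (1 - \<alpha>)"
proof (rule kernel_sum_limit[OF slow \<alpha> K sumK b, where H = "max 1 (1 / y)" and E = "{y}" and h = "indicator {y<..}"])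
  show "\<bar>indicator {y<..} x\<bar> \<le> max 1 (1 / y) * min x 1" if "0 < x" for x
  proof (cases "y < x")
    case True
    have "1 \<le> max 1 (1 / y) * min y 1" using y by (cases "y \<le> 1") (auto simp: max_def min_def)
    also have "\<dots> \<le> max 1 (1 / y) * min x 1" using True by (intro mult_left_mono) auto
    finally show ?thesis using True by simp
  qed (use that in simp)
  show "isCont (indicator {y<..} :: real \<Rightarrow> real) x" if "0 < x" "x \<notin> {y}" for x
    by (rule isCont_indicator[THEN iffD2]) (use that in \<open>simp add: frontier_def interior_open\<close>)
  have "(\<integral>x. indicator {0<..} x * (x powr (- 1 - \<alpha>) * indicator {y<..} x) \<partial>lborel) = (\<integral>x. indicator {y<..} x * x powr - (1 + \<alpha>) \<partial>lborel)"
    by (intro Bochner_Integration.integral_cong refl) (use y in \<open>simp add: indicator_def\<close>)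
  also have "\<dots> = y powr (1 - (1 + \<alpha>)) / (1 + \<alpha> - 1)"
    using has_bochner_integral_powr_tail[of "1 + \<alpha>" y] \<alpha> y by (simp add: has_bochner_integral_iff)
  also have "\<dots> = Gamma (1 - \<alpha>) / \<alpha> * (y powr (- \<alpha>) / Gamma (1 - \<alpha>))"
  proof -
    have "Gamma (1 - \<alpha>) \<noteq> 0" using less_imp_neq[OF Gamma_real_pos[of "1 - \<alpha>"]] \<alpha> by simp
    then show ?thesis by simp
  qed
  finally show "(\<integral>x. indicator {0<..} x * (x powr (- 1 - \<alpha>) * indicator {y<..} x) \<partial>lborel) = Gamma (1 - \<alpha>) / \<alpha> * (y powr (- \<alpha>) / Gamma (1 - \<alpha>))" .
qed auto

lemma uniform_limit_mono_unit:
  fixes g :: "nat \<Rightarrow> real \<Rightarrow> real"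
  assumes mono: "\<And>N. mono_on {0..1} (g N)" and cont: "continuous_on {0..1} G"
    and lim: "\<And>y. y \<in> {0..1} \<Longrightarrow> (\<lambda>N. g N y) \<longlonglongrightarrow> G y"
  shows "uniform_limit {0..1} g G sequentially"
proof (rule uniform_limitI)
  fix e :: real assume e: "0 < e"
  have "uniformly_continuous_on {0..1} G" by (rule compact_uniformly_continuous[OF cont]) simp
  then obtain d where d: "0 < d" "\<And>x y. x \<in> {0..1} \<Longrightarrow> y \<in> {0..1} \<Longrightarrow> dist y x < d \<Longrightarrow> dist (G y) (G x) < e / 2"
    using e unfolding uniformly_continuous_on_def by (metis half_gt_zero)
  obtain k :: nat where k: "0 < k" "1 / real k < d"
    using real_arch_inverse[of d] d(1) by (auto simp: inverse_eq_divide)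
  have "\<forall>\<^sub>F N in sequentially. \<forall>i\<in>{..k}. dist (g N (real i / k)) (G (real i / k)) < e / 2"
    by (intro eventually_ball_finite ballI tendstoD lim) (use e k in auto)
  then show "\<forall>\<^sub>F N in sequentially. \<forall>y\<in>{0..1}. dist (g N y) (G y) < e"
  proof eventually_elim
    case (elim N)
    show ?case
    proof
      fix y :: real assume y: "y \<in> {0..1}"
      obtain i where i: "i < k" "real i / k \<le> y" "y \<le> real (Suc i) / k"
      proof (cases "y = 1")
        case True
        show ?thesis by (rule that[of "k - 1"]) (use k True in \<open>simp_all add: field_simps\<close>)
      next
        case False
        let ?i = "nat \<lfloor>y * k\<rfloor>"
        have yk: "0 \<le> y * k" "y * k < k" using y False k by auto
        have 1: "real ?i \<le> y * k" "y * k \<le> real (Suc ?i)" using yk(1) by linarith+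
        have "real ?i < real k" using 1 yk by linarith
        then show ?thesis using 1 k by (intro that[of ?i]) (simp_all only: of_nat_less_iff divide_le_eq le_divide_eq of_nat_0_less_iff if_True simp_thms)
      qed
      have Suc_eq: "real (Suc i) / k = real i / k + 1 / k" by (simp add: add_divide_distrib)
      have in01: "real i / k \<in> {0..1}" "real (Suc i) / k \<in> {0..1}" using i k by (auto simp: field_simps)
      have "g N (real i / k) \<le> g N y" "g N y \<le> g N (real (Suc i) / k)"
        using mono_onD[OF mono in01(1) y i(2)] mono_onD[OF mono y in01(2) i(3)] by auto
      moreover have "\<bar>g N (real i / k) - G (real i / k)\<bar> < e / 2" "\<bar>g N (real (Suc i) / k) - G (real (Suc i) / k)\<bar> < e / 2"
        using elim[THEN bspec, of i] elim[THEN bspec, of "Suc i"] i by (simp_all only: dist_real_def atMost_iff less_imp_le Suc_leI)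
      moreover have "\<bar>G (real i / k) - G y\<bar> < e / 2"
        using d(2)[OF y in01(1)] i k(2) Suc_eq by (simp add: dist_real_def)
      moreover have "\<bar>G (real (Suc i) / k) - G y\<bar> < e / 2"
        using d(2)[OF y in01(2)] i k(2) Suc_eq by (simp add: dist_real_def del: of_nat_Suc)
      ultimately show "dist (g N y) (G y) < e" unfolding dist_real_def by linarith
    qed
  qed
qed

text \<open>The tail \<open>1 - \<Sum>j\<le>m. K j\<close> of a kernel, extended to real arguments so that the rescaled
  ratio is monotone in \<open>y \<in> {0..1}\<close>.\<close>

definition kernel_tail :: "(nat \<Rightarrow> real) \<Rightarrow> real \<Rightarrow> real" where
  "kernel_tail K x = (\<Sum>n. K (Suc n) * indicator {x<..} (real (Suc n)))"

lemma summable_kernel_tail: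
  fixes K :: "nat \<Rightarrow> real"
  assumes pos: "\<And>n. 1 \<le> n \<Longrightarrow> 0 < K n" and sumK: "summable (\<lambda>n. K (Suc n))"
  shows "summable (\<lambda>n. K (Suc n) * indicator {x<..} (real (Suc n)))"
  using sumK by (rule summable_comparison_test') (use pos[of "Suc _"] in \<open>auto simp: indicator_def less_imp_le\<close>)

lemma kernel_tail_nat:
  assumes pos: "\<And>n. 1 \<le> n \<Longrightarrow> 0 < K n" and sumK: "summable (\<lambda>n. K (Suc n))"
  shows "kernel_tail K (real m) = kernel_mass K - (\<Sum>j<m. K (Suc j))"
proof -
  have "kernel_mass K = (\<Sum>n. K (Suc (n + m))) + (\<Sum>j<m. K (Suc j))"
    unfolding kernel_mass_def by (rule suminf_split_initial_segment[OF sumK])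
  moreover have "kernel_tail K (real m) = (\<Sum>n. K (Suc (n + m)))"
  proof -
    have "kernel_tail K (real m) = (\<Sum>n. K (Suc (n + m)) * indicator {real m<..} (real (Suc (n + m)))) + (\<Sum>j<m. K (Suc j) * indicator {real m<..} (real (Suc j)))"
      unfolding kernel_tail_def by (rule suminf_split_initial_segment[OF summable_kernel_tail[OF pos sumK]])
    moreover have "(\<Sum>j<m. K (Suc j) * indicator {real m<..} (real (Suc j))) = 0"
      by (rule sum.neutral) (simp add: indicator_def)
    ultimately show ?thesis by (simp add: indicator_def)
  qed
  ultimately show ?thesis by simp
qed

lemma kernel_tail_pos:
  assumes pos: "\<And>n. 1 \<le> n \<Longrightarrow> 0 < K n" and sumK: "summable (\<lambda>n. K (Suc n))"
  shows "0 < kernel_tail K x"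
proof -
  obtain m :: nat where m: "x < real m" using reals_Archimedean2 by blast
  show ?thesis unfolding kernel_tail_def
  proof (rule suminf_pos2[OF summable_kernel_tail[OF pos sumK], where i = m])
    show "0 < K (Suc m) * indicator {x<..} (real (Suc m))" using m pos[of "Suc m"] by simp
  qed (use pos[of "Suc _"] in \<open>auto simp: indicator_def less_imp_le\<close>)
qed

lemma kernel_tail_antimono:
  assumes pos: "\<And>n. 1 \<le> n \<Longrightarrow> 0 < K n" and sumK: "summable (\<lambda>n. K (Suc n))" and xy: "x \<le> y"
  shows "kernel_tail K y \<le> kernel_tail K x"
  unfolding kernel_tail_def
proof (rule suminf_le[OF _ summable_kernel_tail[OF pos sumK] summable_kernel_tail[OF pos sumK]])
  show "K (Suc n) * indicator {y<..} (real (Suc n)) \<le> K (Suc n) * indicator {x<..} (real (Suc n))" for n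
    using pos[of "Suc n"] xy by (intro mult_left_mono) (auto simp: indicator_def)
qed

lemma kernel_tail_tendsto_0:
  assumes pos: "\<And>n. 1 \<le> n \<Longrightarrow> 0 < K n" and sumK: "summable (\<lambda>n. K (Suc n))"
  shows "(\<lambda>m. kernel_tail K (real m)) \<longlonglongrightarrow> 0"
proof -
  have "(\<lambda>m. kernel_mass K - (\<Sum>j<m. K (Suc j))) \<longlonglongrightarrow> kernel_mass K - kernel_mass K"
    unfolding kernel_mass_def by (intro tendsto_diff tendsto_const summable_LIMSEQ[OF sumK])
  moreover have "kernel_tail K (real m) = kernel_mass K - (\<Sum>j<m. K (Suc j))" for m by (rule kernel_tail_nat[OF pos sumK])
  ultimately show ?thesis by simp
qed

lemma kernel_tail_ratio_limit:
  fixes L K :: "_ \<Rightarrow> real"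
  assumes slow: "slowly_varying L" and \<alpha>: "0 < \<alpha>" "\<alpha> < 1"
    and K: "\<And>n. 1 \<le> n \<Longrightarrow> K n = L (real n) / real n powr (1 + \<alpha>)" and sumK: "summable (\<lambda>n. K (Suc n))"
    and b: "(\<lambda>N. b N * (Gamma (1 - \<alpha>) * L (real N) / (\<alpha> * real N powr \<alpha>))) \<longlonglongrightarrow> 1"
  shows "uniform_limit {0..1} (\<lambda>N y. kernel_tail K (real N) / kernel_tail K (y * real N)) (\<lambda>y. y powr \<alpha>) sequentially"
proof (rule uniform_limit_mono_unit)
  have pos: "0 < K n" if "1 \<le> n" for n using K[OF that] slow_pos[OF slow, of "real n"] that by simp
  have tail_pos: "0 < kernel_tail K x" for x by (rule kernel_tail_pos[OF pos sumK])
  have tail_0: "kernel_tail K x \<noteq> 0" for x using less_imp_neq[OF tail_pos[of x]] by simp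
  have tail_lim: "(\<lambda>m. kernel_tail K (real m)) \<longlonglongrightarrow> 0" by (rule kernel_tail_tendsto_0[OF pos sumK])
  show "mono_on {0..1} (\<lambda>y. kernel_tail K (real N) / kernel_tail K (y * real N))" for N
    by (intro mono_onI divide_left_mono kernel_tail_antimono[OF pos sumK] mult_right_mono mult_pos_pos tail_pos) (auto intro: less_imp_le tail_pos)
  show "continuous_on {0..1} (\<lambda>y. y powr \<alpha> :: real)" using \<alpha> by (intro continuous_on_powr' continuous_intros) auto
  show "(\<lambda>N. kernel_tail K (real N) / kernel_tail K (y * real N)) \<longlonglongrightarrow> y powr \<alpha>" if y: "y \<in> {0..1}" for y
  proof (cases "y = 0")
    case True
    have "(\<lambda>N. kernel_tail K (real N) / kernel_tail K 0) \<longlonglongrightarrow> 0 / kernel_tail K 0"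
      by (rule tendsto_divide[OF tail_lim tendsto_const tail_0])
    then show ?thesis using True by simp
  next
    case False
    have G: "0 < Gamma (1 - \<alpha>)" using \<alpha> by (intro Gamma_real_pos) simp
    have tl: "(\<lambda>N. b N * kernel_tail K (z * real N)) \<longlonglongrightarrow> z powr (- \<alpha>) / Gamma (1 - \<alpha>)" if z: "0 < z" for z
    proof (rule Lim_transform_eventually[OF kernel_tail_limit[OF slow \<alpha> K sumK b z]])
      show "\<forall>\<^sub>F N in sequentially. b N * (\<Sum>n. K (Suc n) * indicator {z<..} (real (Suc n) / N)) = b N * kernel_tail K (z * real N)"
        using eventually_gt_at_top[of 0]
      proof eventually_elim
        case (elim N)
        have "indicator {z<..} (real (Suc n) / N) = (indicator {z * real N<..} (real (Suc n)) :: real)" for n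
          using elim by (simp add: indicator_def less_divide_eq)
        then show ?case by (simp only: kernel_tail_def)
      qed
    qed
    have "(\<lambda>N. (b N * kernel_tail K (1 * real N)) / (b N * kernel_tail K (y * real N))) \<longlonglongrightarrow> (1 powr (- \<alpha>) / Gamma (1 - \<alpha>)) / (y powr (- \<alpha>) / Gamma (1 - \<alpha>))"
      by (intro tendsto_divide tl) (use False y G in auto)
    also have "(1 powr (- \<alpha>) / Gamma (1 - \<alpha>)) / (y powr (- \<alpha>) / Gamma (1 - \<alpha>)) = y powr \<alpha>"
      using G False y by (simp add: powr_minus field_simps)
    finally show ?thesis
    proof (rule Lim_transform_eventually)
      have "\<forall>\<^sub>F N in sequentially. b N * (Gamma (1 - \<alpha>) * L (real N) / (\<alpha> * real N powr \<alpha>)) > 0"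
        using order_tendstoD(1)[OF b, of 0] by simp
      then show "\<forall>\<^sub>F N in sequentially. (b N * kernel_tail K (1 * real N)) / (b N * kernel_tail K (y * real N)) = kernel_tail K (real N) / kernel_tail K (y * real N)"
        by eventually_elim auto
    qed
  qed
qed

section \<open>Renewal processes and the pinning law\<close>

definition interarrivals :: "nat \<Rightarrow> nat list set" where
  "interarrivals N = {v. (\<forall>x\<in>set v. 1 \<le> x) \<and> sum_list v \<le> N}"

definition renewal_points :: "nat list \<Rightarrow> nat set" where
  "renewal_points v = (\<lambda>j. sum_list (take j v)) ` {..length v}"

definition starts_with :: "nat \<Rightarrow> (nat \<Rightarrow> enat) \<Rightarrow> nat list \<Rightarrow> bool" where
  "starts_with N x v \<longleftrightarrow> (\<forall>i<length v. x (Suc i) = enat (v ! i)) \<and> enat (N - sum_list v) < x (Suc (length v))"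

lemma finite_interarrivals: "finite (interarrivals N)"
proof (rule finite_subset)
  have len: "length v \<le> sum_list v" if "\<forall>x\<in>set v. 1 \<le> x" for v :: "nat list"
    using that by (induction v) auto
  show "interarrivals N \<subseteq> {v. set v \<subseteq> {..N} \<and> length v \<le> N}"
  proof
    fix v assume v: "v \<in> interarrivals N"
    have "x \<le> N" if "x \<in> set v" for x
      using member_le_sum_list[OF that] v by (simp add: interarrivals_def)
    moreover have "length v \<le> sum_list v" by (rule len) (use v in \<open>simp add: interarrivals_def\<close>)
    moreover have "sum_list v \<le> N" using v by (simp add: interarrivals_def)
    ultimately show "v \<in> {v. set v \<subseteq> {..N} \<and> length v \<le> N}" by (simp add: subset_iff)
  qed
  show "finite {v. set v \<subseteq> {..N} \<and> length v \<le> N}" by (rule finite_lists_length_le) simp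
qed

lemma sum_list_take_Suc: "j < length v \<Longrightarrow> sum_list (take (Suc j) v) = sum_list (take j v) + (v ! j :: nat)"
  by (simp add: take_Suc_conv_app_nth)

lemma sum_list_take_less:
  assumes v: "v \<in> interarrivals N" and "i < j" "j \<le> length v"
  shows "sum_list (take i v) < sum_list (take j v)"
  using assms(2,3)
proof (induction j)
  case (Suc j)
  have "1 \<le> v ! j" using v Suc.prems by (auto simp: interarrivals_def)
  then have step: "sum_list (take j v) < sum_list (take (Suc j) v)" using Suc.prems by (simp add: sum_list_take_Suc)
  show ?case
  proof (cases "i = j")
    case False
    then have "sum_list (take i v) < sum_list (take j v)" by (intro Suc.IH) (use Suc.prems in linarith)+
    then show ?thesis using step by (rule less_trans)
  next
    case True
    then show ?thesis using step by (simp only:)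
  qed
qed simp

lemma renewal_points:
  assumes v: "v \<in> interarrivals N"
  shows card_renewal_points: "card (renewal_points v) = Suc (length v)"
    and Max_renewal_points: "Max (renewal_points v) = sum_list v"
    and renewal_points_le: "renewal_points v \<subseteq> {..N}"
proof -
  have "inj_on (\<lambda>j. sum_list (take j v)) {..length v}"
  proof (rule inj_onI)
    fix i j assume ij: "i \<in> {..length v}" "j \<in> {..length v}" and eq: "sum_list (take i v) = sum_list (take j v)"
    show "i = j"
      using sum_list_take_less[OF v, of i j] sum_list_take_less[OF v, of j i] ij eq by (cases i j rule: linorder_cases) auto
  qed
  then show "card (renewal_points v) = Suc (length v)"
    unfolding renewal_points_def by (subst card_image) auto
  have le: "sum_list (take j v) \<le> sum_list v" for j
    using append_take_drop_id[of j v] by (metis le_add1 sum_list_append)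
  show "Max (renewal_points v) = sum_list v"
    by (rule Max_eqI) (auto simp: renewal_points_def le intro: image_eqI[of _ _ "length v"])
  show "renewal_points v \<subseteq> {..N}"
    using le v by (auto simp: renewal_points_def interarrivals_def intro: order_trans)
qed

lemma partial_sum_eq:
  fixes x :: "nat \<Rightarrow> enat"
  assumes "\<And>i. i < length v \<Longrightarrow> x (Suc i) = enat (v ! i)" "j \<le> length v"
  shows "(\<Sum>i=1..j. x i) = enat (sum_list (take j v))"
  using assms(2)
proof (induction j)
  case 0
  then show ?case by (simp add: zero_enat_def)
next
  case (Suc j)
  then have "(\<Sum>i=1..Suc j. x i) = enat (sum_list (take j v)) + enat (v ! j)" using assms(1)[of j] by simp
  then show ?case using Suc.prems by (simp add: sum_list_take_Suc)
qed

lemma starts_with_renewals: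
  fixes x :: "nat \<Rightarrow> enat"
  assumes v: "v \<in> interarrivals N" and m: "starts_with N x v"
  shows "renewals_upto N (range (\<lambda>k. \<Sum>i=1..k. x i)) = renewal_points v"
proof -
  have ps: "(\<Sum>i=1..j. x i) = enat (sum_list (take j v))" if "j \<le> length v" for j
    by (rule partial_sum_eq[OF _ that]) (use m in \<open>simp add: starts_with_def\<close>)
  have big: "enat N < (\<Sum>i=1..j. x i)" if "length v < j" for j
  proof -
    have "enat (N - sum_list v) < x (Suc (length v))" using m by (simp add: starts_with_def)
    moreover have "sum_list v \<le> N" using v by (simp add: interarrivals_def)
    ultimately have "enat N < enat (sum_list v) + x (Suc (length v))"
      by (cases "x (Suc (length v))") auto
    also have "\<dots> = (\<Sum>i=1..Suc (length v). x i)" using ps[of "length v"] by simp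
    also have "\<dots> \<le> (\<Sum>i=1..j. x i)" using that by (intro sum_mono2) auto
    finally show ?thesis .
  qed
  show ?thesis
  proof (rule set_eqI)
    fix n
    have "n \<in> renewals_upto N (range (\<lambda>k. \<Sum>i=1..k. x i)) \<longleftrightarrow> n \<le> N \<and> (\<exists>j. enat n = (\<Sum>i=1..j. x i))"
      by (simp add: renewals_upto_def image_iff)
    also have "\<dots> \<longleftrightarrow> (\<exists>j\<le>length v. n = sum_list (take j v))"
    proof
      assume L: "n \<le> N \<and> (\<exists>j. enat n = (\<Sum>i=1..j. x i))"
      then obtain j where j: "enat n = (\<Sum>i=1..j. x i)" by blast
      have jl: "j \<le> length v"
      proof (rule ccontr)
        assume "\<not> j \<le> length v"
        then have "enat N < enat n" unfolding j by (intro big) simp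
        then show False using L by simp
      qed
      then show "\<exists>j\<le>length v. n = sum_list (take j v)" using ps[OF jl] j by auto
    next
      assume "\<exists>j\<le>length v. n = sum_list (take j v)"
      then obtain j where j: "j \<le> length v" "n = sum_list (take j v)" by blast
      then have "n \<in> renewal_points v" by (auto simp: renewal_points_def)
      then have "n \<le> N" using renewal_points_le[OF v] by auto
      then show "n \<le> N \<and> (\<exists>j. enat n = (\<Sum>i=1..j. x i))" using ps[OF j(1)] j(2) by metis
    qed
    also have "\<dots> \<longleftrightarrow> n \<in> renewal_points v" by (auto simp: renewal_points_def)
    finally show "n \<in> renewals_upto N (range (\<lambda>k. \<Sum>i=1..k. x i)) \<longleftrightarrow> n \<in> renewal_points v" .
  qed
qed

lemma starts_with_exists:
  fixes x :: "nat \<Rightarrow> enat"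
  assumes x: "\<And>i. 1 \<le> i \<Longrightarrow> x i \<noteq> 0"
  shows "\<exists>v\<in>interarrivals N. starts_with N x v"
proof -
  define J where "J = {k. (\<Sum>i=1..k. x i) \<le> enat N}"
  have lower: "enat k \<le> (\<Sum>i=1..k. x i)" for k
  proof -
    have "1 \<le> x i" if "i \<in> {1..k}" for i using x[of i] that by (simp add: ileI1 one_eSuc)
    then have "(\<Sum>i=1..k. 1) \<le> (\<Sum>i=1..k. x i)" by (intro sum_mono)
    then show ?thesis by (simp add: of_nat_eq_enat)
  qed
  have "J \<subseteq> {..N}"
  proof
    fix k assume "k \<in> J"
    then have "(\<Sum>i=1..k. x i) \<le> enat N" by (simp add: J_def)
    from order_trans[OF lower this] show "k \<in> {..N}" by simp
  qed
  then have fin: "finite J" by (rule finite_subset) simp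
  have "0 \<in> J" by (simp add: J_def)
  define k where "k = Max J"
  have kJ: "k \<in> J" unfolding k_def using fin \<open>0 \<in> J\<close> by (intro Max_in) auto
  have kS: "Suc k \<notin> J" using Max_ge[OF fin, of "Suc k"] by (auto simp: k_def)
  define v where "v = map (\<lambda>i. the_enat (x (Suc i))) [0..<k]"
  have len: "length v = k" by (simp add: v_def)
  have xi: "x (Suc i) = enat (v ! i)" "1 \<le> v ! i" if "i < k" for i
  proof -
    have "x (Suc i) \<le> (\<Sum>i=1..k. x i)" by (rule member_le_sum) (use that in auto)
    also have "\<dots> \<le> enat N" using kJ by (simp add: J_def)
    finally obtain n where n: "x (Suc i) = enat n" by (cases "x (Suc i)") auto
    then show 1: "x (Suc i) = enat (v ! i)" using that by (simp add: v_def)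
    show "1 \<le> v ! i" using x[of "Suc i"] 1 by (cases "v ! i") (auto simp: zero_enat_def)
  qed
  have sv: "(\<Sum>i=1..k. x i) = enat (sum_list v)"
    using partial_sum_eq[of v x k] xi(1) len by simp
  then have svN: "sum_list v \<le> N" using kJ by (simp add: J_def)
  have "v \<in> interarrivals N"
    using svN xi(2) by (auto simp: interarrivals_def in_set_conv_nth len)
  moreover have "starts_with N x v"
  proof -
    have "\<not> enat (sum_list v) + x (Suc k) \<le> enat N" using kS sv by (simp add: J_def)
    then have "enat (N - sum_list v) < x (Suc k)" using svN by (cases "x (Suc k)") auto
    then show ?thesis using xi(1) by (simp add: starts_with_def len)
  qed
  ultimately show ?thesis by blast
qed

lemma starts_with_unique:
  fixes x :: "nat \<Rightarrow> enat"
  assumes "v \<in> interarrivals N" "starts_with N x v" "w \<in> interarrivals N" "starts_with N x w"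
  shows "v = w"
proof -
  have le: "\<not> length v < length w" if v: "v \<in> interarrivals N" "starts_with N x v" and w: "w \<in> interarrivals N" "starts_with N x w" for v w
  proof
    assume l: "length v < length w"
    have "take (length v) w = v"
    proof (rule nth_equalityI)
      show "take (length v) w ! i = v ! i" if "i < length (take (length v) w)" for i
      proof -
        have i: "i < length v" "i < length w" using that l by auto
        have "x (Suc i) = enat (v ! i)" using v(2) i unfolding starts_with_def by blast
        moreover have "x (Suc i) = enat (w ! i)" using w(2) i unfolding starts_with_def by blast
        ultimately show ?thesis using i by simp
      qed
    qed (use l in simp)
    then have "sum_list v + w ! length v = sum_list (take (Suc (length v)) w)"
      using sum_list_take_Suc[OF l] by simp
    also have "\<dots> \<le> sum_list w" using append_take_drop_id[of "Suc (length v)" w] by (metis le_add1 sum_list_append)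
    also have "\<dots> \<le> N" using w by (simp add: interarrivals_def)
    finally have "w ! length v \<le> N - sum_list v" by simp
    moreover have "x (Suc (length v)) = enat (w ! length v)" using w(2) l by (simp add: starts_with_def)
    ultimately show False using v(2) by (simp add: starts_with_def)
  qed
  have len: "length v = length w" using le[OF assms] le[OF assms(3,4,1,2)] by simp
  show ?thesis
  proof (rule nth_equalityI[OF len])
    show "v ! i = w ! i" if "i < length v" for i
    proof -
      have i: "i < length v" "i < length w" using that len by auto
      have "x (Suc i) = enat (v ! i)" using assms(2) i unfolding starts_with_def by blast
      moreover have "x (Suc i) = enat (w ! i)" using assms(4) i unfolding starts_with_def by blast
      ultimately show ?thesis by simp
    qed
  qed
qed

locale renewal =
  fixes P :: "'a measure" and l :: "nat \<Rightarrow> 'a \<Rightarrow> enat" and K :: "nat \<Rightarrow> real"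
  assumes incr: "renewal_increments P l K"
begin

sublocale prob_space P
  using incr by (simp add: renewal_increments_def)

abbreviation renewals :: "nat \<Rightarrow> 'a \<Rightarrow> nat set" where
  "renewals N \<omega> \<equiv> renewals_upto N (renewal_set l \<omega>)"

definition start_event :: "nat \<Rightarrow> nat list \<Rightarrow> 'a set" where
  "start_event N v = {\<omega>\<in>space P. starts_with N (\<lambda>i. l i \<omega>) v}"

lemma increments_nonzero: "1 \<le> i \<Longrightarrow> \<omega> \<in> space P \<Longrightarrow> l i \<omega> \<noteq> 0"
  using incr by (simp add: renewal_increments_def)

lemma increments_indep: "indep_vars (\<lambda>_. count_space UNIV) l {1..}"
  using incr by (simp add: renewal_increments_def)

lemma increments_measurable: "1 \<le> i \<Longrightarrow> l i \<in> measurable P (count_space UNIV)"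
  using increments_indep by (simp add: indep_vars_def2)

lemma prob_increment_eq: "1 \<le> i \<Longrightarrow> 1 \<le> n \<Longrightarrow> prob (l i -` {enat n} \<inter> space P) = K n"
  using incr by (simp add: renewal_increments_def vimage_def Int_def conj_commute)

lemma prob_increment_gt:
  assumes i: "1 \<le> i"
  shows "prob (l i -` {enat m<..} \<inter> space P) = 1 - (\<Sum>j<m. K (Suc j))"
proof -
  note meas = measurable_sets[OF increments_measurable[OF i]]
  have eq: "l i -` {enat m<..} \<inter> space P = space P - (\<Union>j<m. l i -` {enat (Suc j)} \<inter> space P)"
  proof -
    have "enat m < l i \<omega> \<longleftrightarrow> (\<forall>j<m. l i \<omega> \<noteq> enat (Suc j))" if "\<omega> \<in> space P" for \<omega>
    proof (cases "l i \<omega>")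
      case (enat n)
      then have "n \<noteq> 0" using increments_nonzero[OF i that] by (auto simp: zero_enat_def)
      then obtain n' where n': "n = Suc n'" by (cases n) auto
      have "m < Suc n' \<longleftrightarrow> (\<forall>j<m. n' \<noteq> j)" using le_less_linear[of m n'] by (auto simp: less_Suc_eq_le)
      then show ?thesis unfolding enat n' by simp
    qed simp
    then show ?thesis by auto
  qed
  have "prob (\<Union>j<m. l i -` {enat (Suc j)} \<inter> space P) = (\<Sum>j<m. prob (l i -` {enat (Suc j)} \<inter> space P))"
    by (rule finite_measure_finite_Union) (auto simp: disjoint_family_on_def intro!: meas)
  also have "\<dots> = (\<Sum>j<m. K (Suc j))" using i by (intro sum.cong refl prob_increment_eq) auto
  finally have pU: "prob (\<Union>j<m. l i -` {enat (Suc j)} \<inter> space P) = (\<Sum>j<m. K (Suc j))" .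
  have "(\<Union>j<m. l i -` {enat (Suc j)} \<inter> space P) \<in> events" by (intro sets.finite_UN meas) auto
  from prob_compl[OF this] show ?thesis unfolding eq pU .
qed

lemma start_event:
  assumes v: "v \<in> interarrivals N"
  shows sets_start_event: "start_event N v \<in> events"
    and prob_start_event: "prob (start_event N v) = (\<Prod>i<length v. K (v ! i)) * (1 - (\<Sum>j<N - sum_list v. K (Suc j)))"
proof -
  let ?k = "length v"
  define A where "A i = (if i \<le> ?k then {enat (v ! (i - 1))} else {enat (N - sum_list v)<..})" for i
  have eq: "start_event N v = (\<Inter>i\<in>{1..Suc ?k}. l i -` A i \<inter> space P)"
  proof (rule set_eqI)
    fix \<omega>
    have "(\<forall>i\<in>{1..Suc ?k}. l i \<omega> \<in> A i) \<longleftrightarrow> (\<forall>i\<in>{..<Suc ?k}. l (Suc i) \<omega> \<in> A (Suc i))"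
      by (subst image_Suc_lessThan[symmetric]) blast
    then show "\<omega> \<in> start_event N v \<longleftrightarrow> \<omega> \<in> (\<Inter>i\<in>{1..Suc ?k}. l i -` A i \<inter> space P)"
      by (auto simp: start_event_def starts_with_def A_def lessThan_Suc simp del: atLeastAtMost_iff)
  qed
  show "start_event N v \<in> events"
    unfolding eq by (intro sets.finite_INT measurable_sets[OF increments_measurable]) auto
  have "prob (start_event N v) = (\<Prod>i\<in>{1..Suc ?k}. prob (l i -` A i \<inter> space P))"
    unfolding eq by (rule indep_varsD[OF increments_indep]) auto
  also have "\<dots> = (\<Prod>i<?k. prob (l (Suc i) -` A (Suc i) \<inter> space P)) * prob (l (Suc ?k) -` A (Suc ?k) \<inter> space P)"
    by (simp add: prod.atLeast1_atMost_eq lessThan_Suc mult.commute)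
  also have "(\<Prod>i<?k. prob (l (Suc i) -` A (Suc i) \<inter> space P)) = (\<Prod>i<?k. K (v ! i))"
  proof (rule prod.cong[OF refl])
    fix i assume "i \<in> {..<?k}"
    moreover from this have "1 \<le> v ! i" using v by (auto simp: interarrivals_def)
    ultimately show "prob (l (Suc i) -` A (Suc i) \<inter> space P) = K (v ! i)"
      using prob_increment_eq[of "Suc i" "v ! i"] by (simp add: A_def)
  qed
  also have "prob (l (Suc ?k) -` A (Suc ?k) \<inter> space P) = 1 - (\<Sum>j<N - sum_list v. K (Suc j))"
    using prob_increment_gt[of "Suc ?k" "N - sum_list v"] by (simp add: A_def)
  finally show "prob (start_event N v) = (\<Prod>i<?k. K (v ! i)) * (1 - (\<Sum>j<N - sum_list v. K (Suc j)))" .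
qed

lemma renewals_start_event:
  assumes "v \<in> interarrivals N" "\<omega> \<in> start_event N v"
  shows "renewals N \<omega> = renewal_points v"
  unfolding renewal_set_def
  by (rule starts_with_renewals) (use assms in \<open>auto simp: start_event_def\<close>)

lemma start_event_exists:
  assumes "\<omega> \<in> space P"
  shows "\<exists>!v. v \<in> interarrivals N \<and> \<omega> \<in> start_event N v"
proof -
  obtain v where v: "v \<in> interarrivals N" "starts_with N (\<lambda>i. l i \<omega>) v"
    using starts_with_exists[of "\<lambda>i. l i \<omega>" N] increments_nonzero assms by blast
  show ?thesis
    by (rule ex1I[of _ v]) (use v assms starts_with_unique[of _ N "\<lambda>i. l i \<omega>"] in \<open>auto simp: start_event_def\<close>)
qed

lemma renewals_in: "\<omega> \<in> space P \<Longrightarrow> renewals N \<omega> \<in> Pow {..N}"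
  by (auto simp: renewals_upto_def)

lemma measurable_renewals: "renewals N \<in> measurable P (count_space (Pow {..N}))"
proof (subst measurable_count_space_eq2, simp, intro conjI ballI)
  show "renewals N \<in> space P \<rightarrow> Pow {..N}" using renewals_in by auto
  fix A assume "A \<in> Pow {..N}"
  have "renewals N -` {A} \<inter> space P = (\<Union>v\<in>{v\<in>interarrivals N. renewal_points v = A}. start_event N v)"
  proof (rule set_eqI)
    fix \<omega>
    show "\<omega> \<in> renewals N -` {A} \<inter> space P \<longleftrightarrow> \<omega> \<in> (\<Union>v\<in>{v\<in>interarrivals N. renewal_points v = A}. start_event N v)"
    proof
      assume \<omega>: "\<omega> \<in> renewals N -` {A} \<inter> space P"
      then obtain v where "v \<in> interarrivals N" "\<omega> \<in> start_event N v" using start_event_exists[of \<omega> N] by blast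
      then show "\<omega> \<in> (\<Union>v\<in>{v\<in>interarrivals N. renewal_points v = A}. start_event N v)"
        using \<omega> renewals_start_event[of v N \<omega>] by auto
    next
      assume "\<omega> \<in> (\<Union>v\<in>{v\<in>interarrivals N. renewal_points v = A}. start_event N v)"
      then show "\<omega> \<in> renewals N -` {A} \<inter> space P"
        using renewals_start_event by (auto simp: start_event_def)
    qed
  qed
  also have "\<dots> \<in> events"
    using finite_interarrivals by (intro sets.finite_UN sets_start_event) auto
  finally show "renewals N -` {A} \<inter> space P \<in> events" .
qed

lemma integral_renewals:
  fixes G :: "nat set \<Rightarrow> real"
  shows "(\<integral>\<omega>. G (renewals N \<omega>) \<partial>P) =
    (\<Sum>v\<in>interarrivals N. G (renewal_points v) * ((\<Prod>i<length v. K (v ! i)) * (1 - (\<Sum>j<N - sum_list v. K (Suc j)))))"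
proof -
  have "(\<integral>\<omega>. G (renewals N \<omega>) \<partial>P) = (\<integral>\<omega>. (\<Sum>v\<in>interarrivals N. G (renewal_points v) * indicator (start_event N v) \<omega>) \<partial>P)"
  proof (rule Bochner_Integration.integral_cong[OF refl])
    fix \<omega> assume "\<omega> \<in> space P"
    then obtain w where w: "w \<in> interarrivals N" "\<omega> \<in> start_event N w"
      and uniq: "\<And>v. v \<in> interarrivals N \<Longrightarrow> \<omega> \<in> start_event N v \<Longrightarrow> v = w"
      using start_event_exists[of \<omega> N] by blast
    have "(\<Sum>v\<in>interarrivals N. G (renewal_points v) * indicator (start_event N v) \<omega>) = (\<Sum>v\<in>interarrivals N. if v = w then G (renewal_points v) else 0)"
    proof (rule sum.cong[OF refl])
      fix v assume v: "v \<in> interarrivals N"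
      show "G (renewal_points v) * indicator (start_event N v) \<omega> = (if v = w then G (renewal_points v) else 0)"
      proof (cases "v = w")
        case True
        then show ?thesis using w(2) by simp
      next
        case False
        then have "\<omega> \<notin> start_event N v" using uniq[OF v] by blast
        then show ?thesis using False by simp
      qed
    qed
    also have "\<dots> = G (renewal_points w)" using w finite_interarrivals by simp
    also have "\<dots> = G (renewals N \<omega>)" using renewals_start_event[OF w] by simp
    finally show "G (renewals N \<omega>) = (\<Sum>v\<in>interarrivals N. G (renewal_points v) * indicator (start_event N v) \<omega>)" ..
  qed
  also have "\<dots> = (\<Sum>v\<in>interarrivals N. \<integral>\<omega>. G (renewal_points v) * indicator (start_event N v) \<omega> \<partial>P)"
    by (intro Bochner_Integration.integral_sum integrable_mult_right integrable_real_indicator sets_start_event)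
      (simp_all only: infinity_ennreal_def less_top[symmetric] emeasure_finite simp_thms not_False_eq_True)
  also have "\<dots> = (\<Sum>v\<in>interarrivals N. G (renewal_points v) * prob (start_event N v))"
  proof (intro sum.cong refl)
    fix v
    have "start_event N v \<inter> space P = start_event N v" by (auto simp: start_event_def)
    then show "(\<integral>\<omega>. G (renewal_points v) * indicator (start_event N v) \<omega> \<partial>P) = G (renewal_points v) * prob (start_event N v)"
      by (simp only: integral_mult_right_zero Bochner_Integration.integral_indicator)
  qed
  finally show ?thesis by (simp add: prob_start_event)
qed

end

lemma change_of_kernel:
  fixes F :: "nat set \<Rightarrow> real"
  assumes "renewal P l K" "renewal P' l' K'" and s: "0 < kernel_mass K"
    and K': "\<And>n. 1 \<le> n \<Longrightarrow> K' n = K n / kernel_mass K" and tail: "\<And>m. kernel_tail K' (real m) = 1 - (\<Sum>j<m. K' (Suc j))"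
    and tail_pos: "\<And>x. 0 < kernel_tail K' x"
  shows "(\<integral>\<omega>. F (renewals_upto N (renewal_set l \<omega>)) * exp ((critical_beta K + c) * card (renewals_upto N (renewal_set l \<omega>))) \<partial>P)
    = exp (critical_beta K) * (\<integral>\<omega>. F (renewals_upto N (renewal_set l' \<omega>)) * exp (c * card (renewals_upto N (renewal_set l' \<omega>)))
        * ((1 - kernel_mass K) / kernel_tail K' (real (N - Max (renewals_upto N (renewal_set l' \<omega>)))) + kernel_mass K) \<partial>P')"
proof -
  interpret A: renewal P l K by (rule assms(1))
  interpret B: renewal P' l' K' by (rule assms(2))
  let ?s = "kernel_mass K" and ?T = "\<lambda>m. kernel_tail K' (real m)"
  have es: "exp (critical_beta K) = 1 / ?s" using s by (simp add: critical_beta_def exp_minus inverse_eq_divide)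
  show ?thesis
    unfolding A.integral_renewals[where G = "\<lambda>R. F R * exp ((critical_beta K + c) * card R)"]
      B.integral_renewals[where G = "\<lambda>R. F R * exp (c * card R) * ((1 - ?s) / ?T (N - Max R) + ?s)"]
      sum_distrib_left
  proof (rule sum.cong[OF refl])
    fix v assume v: "v \<in> interarrivals N"
    let ?k = "length v" and ?m = "N - sum_list v"
    have "(\<Prod>i<?k. K (v ! i)) = (\<Prod>i<?k. ?s * K' (v ! i))"
    proof (rule prod.cong[OF refl])
      fix i assume "i \<in> {..<?k}"
      then have "1 \<le> v ! i" using v by (auto simp: interarrivals_def)
      then show "K (v ! i) = ?s * K' (v ! i)" using K' s by simp
    qed
    then have pK: "(\<Prod>i<?k. K (v ! i)) = ?s ^ ?k * (\<Prod>i<?k. K' (v ! i))" by (simp add: prod.distrib)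
    have sK: "(\<Sum>j<?m. K (Suc j)) = ?s * (\<Sum>j<?m. K' (Suc j))" using K' s by (simp add: sum_distrib_left)
    have Q: "1 - (\<Sum>j<?m. K (Suc j)) = ((1 - ?s) / ?T ?m + ?s) * ?T ?m"
    proof -
      have nz: "?T ?m \<noteq> 0" using tail_pos[of "real ?m"] by simp
      have "(\<Sum>j<?m. K' (Suc j)) = 1 - ?T ?m" using tail[of ?m] by simp
      moreover have "((1 - ?s) / ?T ?m + ?s) * ?T ?m = (1 - ?s) + ?s * ?T ?m"
        by (simp only: distrib_right nonzero_eq_divide_eq[OF nz, THEN iffD1, OF refl])
      ultimately show ?thesis unfolding sK by (simp add: right_diff_distrib)
    qed
    have "exp ((critical_beta K + c) * real (Suc ?k)) = exp (critical_beta K * real (Suc ?k)) * exp (c * real (Suc ?k))"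
      by (simp only: distrib_right exp_add)
    also have "exp (critical_beta K * real (Suc ?k)) = (1 / ?s) ^ Suc ?k"
      by (simp only: es[symmetric] exp_of_nat2_mult[symmetric])
    finally have e: "exp ((critical_beta K + c) * real (Suc ?k)) * ?s ^ ?k = exp (critical_beta K) * exp (c * real (Suc ?k))"
      using s by (simp add: es power_divide)
    have "F (renewal_points v) * exp ((critical_beta K + c) * card (renewal_points v)) * ((\<Prod>i<?k. K (v ! i)) * (1 - (\<Sum>j<?m. K (Suc j))))
      = F (renewal_points v) * (exp ((critical_beta K + c) * real (Suc ?k)) * ?s ^ ?k) * (\<Prod>i<?k. K' (v ! i)) * (((1 - ?s) / ?T ?m + ?s) * ?T ?m)"
      unfolding pK Q card_renewal_points[OF v] by (simp only: mult_ac)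
    also have "\<dots> = exp (critical_beta K) * (F (renewal_points v) * exp (c * real (Suc ?k)) * ((1 - ?s) / ?T ?m + ?s) * ((\<Prod>i<?k. K' (v ! i)) * ?T ?m))"
      unfolding e by (simp only: mult_ac)
    finally show "F (renewal_points v) * exp ((critical_beta K + c) * card (renewal_points v)) * ((\<Prod>i<?k. K (v ! i)) * (1 - (\<Sum>j<?m. K (Suc j))))
      = exp (critical_beta K) * (F (renewal_points v) * exp (c * card (renewal_points v)) * ((1 - ?s) / ?T (N - Max (renewal_points v)) + ?s)
        * ((\<Prod>i<?k. K' (v ! i)) * (1 - (\<Sum>j<?m. K' (Suc j)))))"
      by (simp only: tail[symmetric] card_renewal_points[OF v] Max_renewal_points[OF v])
  qed
qed

lemma indep_vars_coordinates:
  fixes M :: "'a measure" and f :: "nat \<Rightarrow> nat"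
  assumes M: "prob_space M" and f: "inj f"
  shows "prob_space.indep_vars (Pi\<^sub>M UNIV (\<lambda>_::nat. M)) (\<lambda>_. M) (\<lambda>i \<omega>. \<omega> (f i)) UNIV"
proof -
  have ps: "prob_space (Pi\<^sub>M UNIV (\<lambda>_::nat. M))" by (rule prob_space_PiM) (rule M)
  have comp: "distr (Pi\<^sub>M UNIV (\<lambda>_::nat. M)) M (\<lambda>\<omega>. \<omega> j) = M" for j
    using distr_PiM_component[of UNIV "\<lambda>_::nat. M" j] M by simp
  have "distr (Pi\<^sub>M UNIV (\<lambda>_::nat. M)) (Pi\<^sub>M UNIV (\<lambda>_::nat. M)) (\<lambda>\<omega>. \<lambda>i\<in>UNIV. \<omega> (f i)) = Pi\<^sub>M UNIV (\<lambda>_. M)"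
    using distr_PiM_reindex[of UNIV "\<lambda>_::nat. M" f UNIV] M f by simp
  then show ?thesis
    by (subst prob_space.indep_vars_iff_distr_eq_PiM'[OF ps]) (simp_all add: comp)
qed

locale kernel_walk =
  fixes K :: "nat \<Rightarrow> real"
  assumes pos: "\<And>n. 1 \<le> n \<Longrightarrow> 0 < K n" and sumK: "summable (\<lambda>n. K (Suc n))" and mass: "kernel_mass K = 1"
begin

definition gap_pmf :: "nat pmf" where "gap_pmf = embed_pmf (\<lambda>n. K (Suc n))"

definition Q :: "(nat \<Rightarrow> nat) measure" where "Q = Pi\<^sub>M UNIV (\<lambda>_. measure_pmf gap_pmf)"

definition gap :: "nat \<Rightarrow> (nat \<Rightarrow> nat) \<Rightarrow> enat" where "gap i \<omega> = enat (Suc (\<omega> i))"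

definition walk :: "real \<Rightarrow> (nat \<Rightarrow> nat) \<Rightarrow> nat \<Rightarrow> real" where "walk c \<omega> i = real (Suc (\<omega> (Suc i))) / c"

definition step :: "real \<Rightarrow> real measure" where "step c = distr (measure_pmf gap_pmf) borel (\<lambda>n. real (Suc n) / c)"

lemma K_nonneg: "0 \<le> K (Suc n)"
  using pos[of "Suc n"] by simp

lemma pmf_gap: "pmf gap_pmf n = K (Suc n)"
proof -
  have "(\<integral>\<^sup>+n. ennreal (K (Suc n)) \<partial>count_space UNIV) = ennreal (\<Sum>n. K (Suc n))"
    unfolding nn_integral_count_space_nat by (rule suminf_ennreal2[OF K_nonneg sumK])
  then show ?thesis
    unfolding gap_pmf_def using mass by (intro pmf_embed_pmf K_nonneg) (simp add: kernel_mass_def)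
qed

lemma prob_space_Q: "prob_space Q"
  unfolding Q_def by (rule prob_space_PiM) (rule measure_pmf.prob_space_axioms)

lemma indep_coordinates:
  fixes f :: "nat \<Rightarrow> nat"
  assumes "inj f"
  shows "prob_space.indep_vars Q (\<lambda>_. measure_pmf gap_pmf) (\<lambda>i \<omega>. \<omega> (f i)) UNIV"
  unfolding Q_def by (rule indep_vars_coordinates[OF measure_pmf.prob_space_axioms assms])

lemma distr_coordinate: "distr Q (measure_pmf gap_pmf) (\<lambda>\<omega>. \<omega> i) = measure_pmf gap_pmf"
  unfolding Q_def by (rule distr_PiM_component) (simp_all add: measure_pmf.prob_space_axioms)

lemma measurable_coordinate: "(\<lambda>\<omega>. \<omega> i) \<in> measurable Q (measure_pmf gap_pmf)"
  unfolding Q_def by measurable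

lemma renewal_gap: "renewal Q gap K"
  unfolding renewal_def renewal_increments_def
proof (intro conjI allI impI ballI)
  have "prob_space.indep_vars Q (\<lambda>_. count_space UNIV) (\<lambda>i \<omega>. enat (Suc (\<omega> (id i)))) UNIV"
    by (rule prob_space.indep_vars_compose2[OF prob_space_Q indep_coordinates]) simp_all
  then have "prob_space.indep_vars Q (\<lambda>_. count_space UNIV) gap UNIV"
    unfolding gap_def[abs_def] by (simp only: id_apply)
  then show "prob_space.indep_vars Q (\<lambda>_. count_space UNIV) gap {1..}"
    by (rule prob_space.indep_vars_subset[OF prob_space_Q]) simp
  show "gap i \<omega> \<noteq> 0" for i \<omega> by (simp add: gap_def zero_enat_def)
  show "measure Q {\<omega> \<in> space Q. gap i \<omega> = enat n} = K n" if n: "1 \<le> n" for i n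
  proof -
    have "{\<omega> \<in> space Q. gap i \<omega> = enat n} = (\<lambda>\<omega>. \<omega> i) -` {n - 1} \<inter> space Q"
      using n by (auto simp: gap_def)
    then have "measure Q {\<omega> \<in> space Q. gap i \<omega> = enat n} = measure (distr Q (measure_pmf gap_pmf) (\<lambda>\<omega>. \<omega> i)) {n - 1}"
      by (subst measure_distr[OF measurable_coordinate]) simp_all
    also have "\<dots> = pmf gap_pmf (n - 1)" unfolding distr_coordinate by (simp add: measure_pmf_single)
    also have "\<dots> = K n" using n by (simp add: pmf_gap)
    finally show ?thesis .
  qed
  show "measure Q {\<omega> \<in> space Q. gap i \<omega> = \<infinity>} = 1 - kernel_mass K" for i
    by (simp add: gap_def mass)
qed (rule prob_space_Q)

lemma iid_step: "iid_steps (step c)"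
proof -
  have "prob_space (step c)"
    unfolding step_def by (rule prob_space.prob_space_distr[OF measure_pmf.prob_space_axioms]) simp
  then interpret prob_space "step c" .
  show ?thesis by unfold_locales (simp add: step_def)
qed

lemma one_minus_lap_step:
  assumes c: "0 < c" and r: "0 < r"
  shows "1 - iid_steps.lap (step c) r = (\<Sum>n. K (Suc n) * (1 - exp (- r * (real (Suc n) / c))))"
proof -
  let ?e = "\<lambda>n. exp (- r * (real (Suc n) / c))"
  have e: "0 \<le> ?e n" "?e n \<le> 1" for n using c r by (auto intro!: mult_nonneg_nonneg divide_nonneg_pos)
  have sm: "summable (\<lambda>n. K (Suc n) * ?e n)"
  proof (rule summable_comparison_test'[OF sumK])
    show "norm (K (Suc n) * ?e n) \<le> K (Suc n)" for n
      using mult_left_mono[OF e(2)[of n] K_nonneg[of n]] K_nonneg[of n] e(1)[of n] by (simp only: real_norm_def abs_mult abs_of_nonneg mult_1_right)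
  qed
  have "iid_steps.lap (step c) r = (\<integral>x. exp (- r * \<bar>x\<bar>) \<partial>step c)"
    by (rule iid_steps.lap_def[OF iid_step])
  also have "\<dots> = (\<integral>n. exp (- r * \<bar>real (Suc n) / c\<bar>) \<partial>measure_pmf gap_pmf)"
    unfolding step_def by (rule integral_distr) measurable
  also have "\<dots> = (\<integral>n. ?e n \<partial>measure_pmf gap_pmf)"
    by (intro Bochner_Integration.integral_cong refl) (use c in simp)
  also have "\<dots> = (\<integral>n. pmf gap_pmf n *\<^sub>R ?e n \<partial>count_space UNIV)"
    unfolding measure_pmf_eq_density by (rule integral_density) simp_all
  also have "\<dots> = (\<integral>n. K (Suc n) * ?e n \<partial>count_space UNIV)"
    by (simp only: pmf_gap real_scaleR_def)
  also have "\<dots> = (\<Sum>n. K (Suc n) * ?e n)"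
  proof (rule integral_count_space_nat)
    have "summable (\<lambda>n. norm (K (Suc n) * ?e n))"
      using sm K_nonneg by (simp add: abs_mult)
    then show "integrable (count_space UNIV) (\<lambda>n. K (Suc n) * ?e n)"
      by (simp only: integrable_count_space_nat_iff)
  qed
  finally have "1 - iid_steps.lap (step c) r = (\<Sum>n. K (Suc n)) - (\<Sum>n. K (Suc n) * ?e n)"
    using mass by (simp only: kernel_mass_def)
  also have "\<dots> = (\<Sum>n. K (Suc n) - K (Suc n) * ?e n)" by (rule suminf_diff[OF sumK sm])
  finally show ?thesis by (simp only: right_diff_distrib mult_1_right)
qed

lemma walk_law:
  shows distr_walk: "distr Q (Pi\<^sub>M UNIV (\<lambda>_. step c)) (walk c) = Pi\<^sub>M UNIV (\<lambda>_. step c)"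
    and measurable_walk: "walk c \<in> measurable Q (Pi\<^sub>M UNIV (\<lambda>_. step c))"
proof -
  have "prob_space.indep_vars Q (\<lambda>_. borel) (\<lambda>i \<omega>. real (Suc (\<omega> (Suc i))) / c) UNIV"
    by (rule prob_space.indep_vars_compose2[OF prob_space_Q indep_coordinates]) simp_all
  then have ind: "prob_space.indep_vars Q (\<lambda>_. borel) (\<lambda>i \<omega>. walk c \<omega> i) UNIV"
    by (simp only: walk_def)
  have dist: "distr Q borel (\<lambda>\<omega>. walk c \<omega> i) = step c" for i
  proof -
    have "distr (distr Q (measure_pmf gap_pmf) (\<lambda>\<omega>. \<omega> (Suc i))) borel (\<lambda>n. real (Suc n) / c) = distr Q borel ((\<lambda>n. real (Suc n) / c) \<circ> (\<lambda>\<omega>. \<omega> (Suc i)))"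
      by (rule distr_distr[OF _ measurable_coordinate]) simp
    then show ?thesis unfolding distr_coordinate step_def[symmetric] by (simp add: walk_def comp_def)
  qed
  show "distr Q (Pi\<^sub>M UNIV (\<lambda>_. step c)) (walk c) = Pi\<^sub>M UNIV (\<lambda>_. step c)" "walk c \<in> measurable Q (Pi\<^sub>M UNIV (\<lambda>_. step c))"
    using prob_space.distr_iid_sequence[OF prob_space_Q ind dist] by simp_all
qed

lemma walk_pathwise:
  assumes N: "0 < N"
  shows walk_trace_walk: "walk_trace (walk (real N) \<omega>) = rescaled_set N (renewal_set gap \<omega>)"
    and visits_walk: "visits 1 (walk (real N) \<omega>) = card (renewals_upto N (renewal_set gap \<omega>))"
proof -
  define s where "s j = (\<Sum>i<j. Suc (\<omega> (Suc i)))" for j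
  have s_ge: "j \<le> s j" for j unfolding s_def by (induction j) auto
  have "strict_mono s" by (rule strict_mono_Suc_iff[THEN iffD2]) (simp add: s_def)
  then have inj: "inj s" by (rule strict_mono_imp_inj_on)
  have pos_eq: "pos j (walk (real N) \<omega>) = real (s j) / real N" for j
    by (simp only: pos_def walk_def s_def of_nat_sum sum_divide_distrib abs_divide abs_of_nat)
  have sum_gap: "(\<Sum>i=1..k. gap i \<omega>) = enat (s k)" for k
    by (induction k) (simp_all add: s_def gap_def zero_enat_def)
  have ren: "renewals_upto N (renewal_set gap \<omega>) = s ` {k. s k \<le> N}"
    unfolding renewals_upto_def renewal_set_def sum_gap by auto
  have le: "real (s j) / real N \<le> 1 \<longleftrightarrow> s j \<le> N" for j using N by (simp add: divide_le_eq)
  show "visits 1 (walk (real N) \<omega>) = card (renewals_upto N (renewal_set gap \<omega>))"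
    unfolding visits_def pos_eq le ren by (rule card_image[symmetric]) (rule inj_on_subset[OF inj subset_UNIV])
  have "{j. pos j (walk (real N) \<omega>) \<le> 2} \<subseteq> {..2 * N}"
  proof
    fix j assume "j \<in> {j. pos j (walk (real N) \<omega>) \<le> 2}"
    then have "real (s j) \<le> 2 * real N" using N by (simp add: pos_eq divide_le_eq)
    then have "s j \<le> 2 * N" by linarith
    then show "j \<in> {..2 * N}" using s_ge[of j] by simp
  qed
  then have "finite {j. pos j (walk (real N) \<omega>) \<le> 2}" by (rule finite_subset) simp
  then have "walk_trace (walk (real N) \<omega>) = range (\<lambda>j. pos j (walk (real N) \<omega>)) \<inter> {0..1}"
    unfolding walk_trace_def by (rule closure_range_pos) simp
  also have "\<dots> = (\<lambda>n. real n / real N) ` (s ` {k. s k \<le> N})"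
    unfolding pos_eq by (auto simp: le)
  finally show "walk_trace (walk (real N) \<omega>) = rescaled_set N (renewal_set gap \<omega>)"
    by (simp only: rescaled_set_def ren)
qed

lemma weighted_trace_step:
  assumes N: "0 < N" and f: "continuous_map matheron euclideanreal f"
  shows "iid_steps.weighted_trace (step (real N)) b \<epsilon> f =
    (\<integral>\<omega>. f (rescaled_set N (renewal_set gap \<omega>)) * exp (\<epsilon> * (card (renewals_upto N (renewal_set gap \<omega>)) / b)) \<partial>Q)"
proof -
  interpret S: iid_steps "step (real N)" by (rule iid_step)
  have [measurable]: "f \<in> borel_measurable (borel_of_topology matheron)" by (rule measurable_continuous_map[OF f])
  have "S.weighted_trace b \<epsilon> f = (\<integral>\<omega>. f (walk_trace \<omega>) * exp (\<epsilon> * (visits 1 \<omega> / b)) \<partial>distr Q (Pi\<^sub>M UNIV (\<lambda>_. step (real N))) (walk (real N)))"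
    unfolding distr_walk by (rule S.weighted_trace_def)
  also have "\<dots> = (\<integral>\<omega>. f (walk_trace (walk (real N) \<omega>)) * exp (\<epsilon> * (visits 1 (walk (real N) \<omega>) / b)) \<partial>Q)"
    by (rule integral_distr[OF measurable_walk]) measurable
  finally show ?thesis by (simp only: walk_trace_walk[OF N] visits_walk[OF N])
qed

end

text \<open>The value at \<open>{}\<close> only has to be isolated from the values of the supremum on non-empty sets,
  so that the function is continuous on the whole space.\<close>

definition max_point :: "real set \<Rightarrow> real" where
  "max_point F = (if F = {} then - 1 else Sup F)"

lemma Sup_closed_unit:
  assumes "F \<in> closed_unit_sets" "F \<noteq> {}"
  shows "Sup F \<in> F" "Sup F \<in> {0..1}" "x \<in> F \<Longrightarrow> x \<le> Sup F"
proof -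
  have bdd: "bdd_above F" using assms by (intro bdd_aboveI[of _ 1]) (auto simp: closed_unit_sets_def)
  show "Sup F \<in> F" using assms bdd by (intro closed_contains_Sup) (auto simp: closed_unit_sets_def)
  then show "Sup F \<in> {0..1}" using assms by (auto simp: closed_unit_sets_def)
  show "x \<in> F \<Longrightarrow> x \<le> Sup F" by (rule cSup_upper[OF _ bdd])
qed

lemma max_point_bounds: "F \<in> closed_unit_sets \<Longrightarrow> max_point F \<in> {- 1..1}"
proof (cases "F = {}")
  case False
  assume "F \<in> closed_unit_sets"
  from Sup_closed_unit(2)[OF this False] show ?thesis using False by (simp add: max_point_def)
qed (simp add: max_point_def)

lemma continuous_max_point: "continuous_map matheron euclideanreal max_point"
  unfolding continuous_map_upper_lower_semicontinuous_lt topspace_matheron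
proof (intro conjI allI)
  fix a :: real
  show "openin matheron {F \<in> closed_unit_sets. a < max_point F}"
  proof (cases "a < - 1")
    case True
    then have "{F \<in> closed_unit_sets. a < max_point F} = topspace matheron"
      using max_point_bounds by (force simp: topspace_matheron)
    then show ?thesis by simp
  next
    case False
    have "{F \<in> closed_unit_sets. a < max_point F} = {F \<in> closed_unit_sets. F \<inter> {a<..} \<noteq> {}}"
    proof (rule Collect_cong, rule conj_cong[OF refl])
      fix F assume F: "F \<in> closed_unit_sets"
      show "a < max_point F \<longleftrightarrow> F \<inter> {a<..} \<noteq> {}"
      proof (cases "F = {}")
        case True
        then show ?thesis using False by (simp add: max_point_def)
      next
        case ne: False
        show ?thesis using Sup_closed_unit(1,3)[OF F ne] ne by (auto simp: max_point_def intro: less_le_trans)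
      qed
    qed
    then show ?thesis by (simp only: openin_matheron_hit[OF open_greaterThan])
  qed
  show "openin matheron {F \<in> closed_unit_sets. max_point F < a}"
  proof (cases "- 1 < a")
    case False
    then have "{F \<in> closed_unit_sets. max_point F < a} = {}"
      using max_point_bounds by force
    then show ?thesis by (simp only: openin_empty)
  next
    case True
    have "{F \<in> closed_unit_sets. max_point F < a} = {F \<in> closed_unit_sets. F \<inter> {a..1} = {}}"
    proof (rule Collect_cong, rule conj_cong[OF refl])
      fix F assume F: "F \<in> closed_unit_sets"
      show "max_point F < a \<longleftrightarrow> F \<inter> {a..1} = {}"
      proof (cases "F = {}")
        case True
        then show ?thesis using \<open>- 1 < a\<close> by (simp add: max_point_def)
      next
        case ne: False
        have "max_point F < a \<longleftrightarrow> (\<forall>x\<in>F. x < a)"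
          using Sup_closed_unit(1,3)[OF F ne] ne by (auto simp: max_point_def intro: le_less_trans)
        moreover have "x < a \<longleftrightarrow> x \<notin> {a..1}" if "x \<in> F" for x
        proof -
          have "x \<le> 1" using F that by (auto simp: closed_unit_sets_def)
          then show ?thesis unfolding atLeastAtMost_iff by linarith
        qed
        ultimately show ?thesis by blast
      qed
    qed
    then show ?thesis by (simp only: openin_matheron_miss[OF compact_Icc])
  qed
qed

context renewal
begin

lemma zero_in_renewals: "0 \<in> renewals N \<omega>"
  by (auto simp: renewals_upto_def renewal_set_def zero_enat_def intro!: image_eqI[of _ _ 0])

lemma integrable_renewals:
  fixes G :: "nat set \<Rightarrow> real"
  shows "integrable P (\<lambda>\<omega>. G (renewals N \<omega>))"
proof (rule integrable_const_bound)
  show "AE \<omega> in P. norm (G (renewals N \<omega>)) \<le> Max ((\<lambda>R. norm (G R)) ` Pow {..N})"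
    by (intro AE_I2 Max_ge imageI renewals_in) auto
  show "(\<lambda>\<omega>. G (renewals N \<omega>)) \<in> borel_measurable P"
    by (rule measurable_compose[OF measurable_renewals]) simp
qed

lemma measurable_rescaled: "(\<lambda>\<omega>. rescaled_set N (renewal_set l \<omega>)) \<in> measurable P (borel_of_topology matheron)"
  unfolding rescaled_set_def
proof (rule measurable_compose[OF measurable_renewals])
  show "image (\<lambda>n. real n / real N) \<in> measurable (count_space (Pow {..N})) (borel_of_topology matheron)"
  proof -
    have "(\<lambda>n. real n / real N) ` R \<in> closed_unit_sets" if R: "R \<subseteq> {..N}" for R
    proof -
      have "finite ((\<lambda>n. real n / real N) ` R)" using finite_subset[OF R] by simp
      moreover have "real n / real N \<in> {0..1}" if "n \<in> R" for n
        using R that by (cases "N = 0") (auto simp: divide_le_eq)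
      ultimately show ?thesis by (auto simp: closed_unit_sets_def intro: finite_imp_closed)
    qed
    then show ?thesis by (simp add: topspace_matheron)
  qed
qed

context
  fixes N :: nat and \<beta> :: real
begin

lemma partition_function_pos: "0 < partition_function P (renewal_set l) N \<beta>"
proof -
  let ?e = "\<lambda>\<omega>. exp (\<beta> * real (card (renewals N \<omega>)))"
  have int: "integrable P ?e" by (rule integrable_renewals[where G = "\<lambda>R. exp (\<beta> * real (card R))"])
  have "\<not> (AE \<omega> in P. ?e \<omega> = 0)" by simp
  then have "(\<integral>\<omega>. ?e \<omega> \<partial>P) \<noteq> 0" using integral_nonneg_eq_0_iff_AE[OF int] by simp
  moreover have "0 \<le> (\<integral>\<omega>. ?e \<omega> \<partial>P)" by (intro integral_nonneg_AE) simp
  ultimately show ?thesis unfolding partition_function_def by linarith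
qed

lemma measurable_pinning_weight: "(\<lambda>\<omega>. exp (\<beta> * real (card (renewals N \<omega>))) / partition_function P (renewal_set l) N \<beta>) \<in> borel_measurable P"
  by (rule measurable_compose[OF measurable_renewals]) simp

lemma prob_space_pinning_law: "prob_space (pinning_law P (renewal_set l) N \<beta>)"
proof (rule prob_spaceI)
  let ?Z = "partition_function P (renewal_set l) N \<beta>"
  let ?w = "\<lambda>\<omega>. exp (\<beta> * real (card (renewals N \<omega>))) / ?Z"
  have int: "integrable P ?w" by (rule integrable_renewals[where G = "\<lambda>R. exp (\<beta> * real (card R)) / ?Z"])
  have "emeasure (pinning_law P (renewal_set l) N \<beta>) (space P) = (\<integral>\<^sup>+\<omega>. ennreal (?w \<omega>) \<partial>P)"
    unfolding pinning_law_def using measurable_pinning_weight by (subst emeasure_density) (auto intro!: nn_integral_cong)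
  also have "\<dots> = ennreal (\<integral>\<omega>. ?w \<omega> \<partial>P)"
    using partition_function_pos by (intro nn_integral_eq_integral int AE_I2) (simp add: less_imp_le)
  also have "(\<integral>\<omega>. ?w \<omega> \<partial>P) = 1"
    using partition_function_pos by (simp add: partition_function_def)
  finally show "emeasure (pinning_law P (renewal_set l) N \<beta>) (space (pinning_law P (renewal_set l) N \<beta>)) = 1"
    by (simp add: pinning_law_def)
qed

lemma rescaled_pinning_law:
  shows prob_space_rescaled_pinning_law: "prob_space (rescaled_pinning_law P (renewal_set l) N \<beta>)"
    and sets_rescaled_pinning_law: "sets (rescaled_pinning_law P (renewal_set l) N \<beta>) = sets (borel_of_topology matheron)"
    and integral_rescaled_pinning_law: "f \<in> borel_measurable (borel_of_topology matheron) \<Longrightarrow>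
      (\<integral>F. f F \<partial>rescaled_pinning_law P (renewal_set l) N \<beta>) =
      (\<integral>\<omega>. f (rescaled_set N (renewal_set l \<omega>)) * exp (\<beta> * real (card (renewals N \<omega>))) \<partial>P) / partition_function P (renewal_set l) N \<beta>"
proof -
  let ?Z = "partition_function P (renewal_set l) N \<beta>"
  let ?w = "\<lambda>\<omega>. exp (\<beta> * real (card (renewals N \<omega>))) / ?Z"
  have meas: "(\<lambda>\<omega>. rescaled_set N (renewal_set l \<omega>)) \<in> measurable (pinning_law P (renewal_set l) N \<beta>) (borel_of_topology matheron)"
    unfolding pinning_law_def using measurable_rescaled by simp
  show "prob_space (rescaled_pinning_law P (renewal_set l) N \<beta>)"
    unfolding rescaled_pinning_law_def by (rule prob_space.prob_space_distr[OF prob_space_pinning_law meas])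
  show "sets (rescaled_pinning_law P (renewal_set l) N \<beta>) = sets (borel_of_topology matheron)"
    by (simp add: rescaled_pinning_law_def)
  assume f: "f \<in> borel_measurable (borel_of_topology matheron)"
  have "(\<integral>F. f F \<partial>rescaled_pinning_law P (renewal_set l) N \<beta>) = (\<integral>\<omega>. f (rescaled_set N (renewal_set l \<omega>)) \<partial>pinning_law P (renewal_set l) N \<beta>)"
    unfolding rescaled_pinning_law_def by (rule integral_distr[OF meas f])
  also have "\<dots> = (\<integral>\<omega>. ?w \<omega> *\<^sub>R f (rescaled_set N (renewal_set l \<omega>)) \<partial>P)"
    unfolding pinning_law_def
    by (rule integral_density[OF measurable_compose[OF measurable_rescaled f] measurable_pinning_weight])
      (use partition_function_pos in \<open>simp add: less_imp_le\<close>)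
  also have "\<dots> = (\<integral>\<omega>. f (rescaled_set N (renewal_set l \<omega>)) * exp (\<beta> * real (card (renewals N \<omega>))) / ?Z \<partial>P)"
    by (intro Bochner_Integration.integral_cong refl) simp
  finally show "(\<integral>F. f F \<partial>rescaled_pinning_law P (renewal_set l) N \<beta>) =
      (\<integral>\<omega>. f (rescaled_set N (renewal_set l \<omega>)) * exp (\<beta> * real (card (renewals N \<omega>))) \<partial>P) / ?Z"
    by simp
qed

end

end

context subordinator
begin

lemma last_point_eq: "\<omega> \<in> space M \<Longrightarrow> last_point \<sigma> \<omega> = max_point (unit_set \<omega>)"
proof -
  assume "\<omega> \<in> space M"
  then have "0 \<in> {\<sigma> s \<omega> | s. s \<ge> 0}" using \<sigma>_zero[of \<omega>] by force
  then have "0 \<in> unit_set \<omega>"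
    unfolding unit_set_def regenerative_set_def using closure_subset[of "{\<sigma> s \<omega> | s. s \<ge> 0}"] by auto
  then show ?thesis by (auto simp: max_point_def last_point_def unit_set_def)
qed

lemma last_point_bounds:
  assumes "\<omega> \<in> space M"
  shows "last_point \<sigma> \<omega> \<le> 1" "1 \<notin> regenerative_set \<sigma> \<omega> \<Longrightarrow> last_point \<sigma> \<omega> < 1"
proof -
  show le: "last_point \<sigma> \<omega> \<le> 1"
    using max_point_bounds[OF unit_set_closed, of \<omega>] by (simp add: last_point_eq[OF assms])
  assume "1 \<notin> regenerative_set \<sigma> \<omega>"
  then have 1: "1 \<notin> unit_set \<omega>" by (simp add: unit_set_def)
  have "last_point \<sigma> \<omega> \<noteq> 1"
  proof
    assume eq: "last_point \<sigma> \<omega> = 1"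
    then have ne: "unit_set \<omega> \<noteq> {}" using last_point_eq[OF assms] by (auto simp: max_point_def)
    then have "Sup (unit_set \<omega>) = 1" using eq last_point_eq[OF assms] by (simp add: max_point_def)
    then show False using Sup_closed_unit(1)[OF unit_set_closed ne] 1 by simp
  qed
  then show "last_point \<sigma> \<omega> < 1" using le by simp
qed

text \<open>The pinned walk is a reweighting of the critical one: \<open>c N\<close> times the weight \<open>W\<close> coming from the
  last, incomplete inter-arrival interval converges uniformly to \<open>\<phi>\<close> of the rescaled last renewal.\<close>

lemma pinned_functional_limit:
  fixes L K K' b c :: "_ \<Rightarrow> real" and \<phi> :: "real \<Rightarrow> real"
  assumes slow: "slowly_varying L"
    and K'_eq: "\<And>n. 1 \<le> n \<Longrightarrow> K' n = L (real n) / real n powr (1 + \<alpha>)"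
    and K': "\<And>n. 1 \<le> n \<Longrightarrow> K' n = K n / kernel_mass K"
    and sumK': "summable (\<lambda>n. K' (Suc n))" and mass: "kernel_mass K' = 1" and s: "0 < kernel_mass K"
    and b: "(\<lambda>N. b N * (Gamma (1 - \<alpha>) * L (real N) / (\<alpha> * real N powr \<alpha>))) \<longlonglongrightarrow> 1"
    and b_top: "filterlim b at_top sequentially" and b_pos: "\<And>N. 1 \<le> N \<Longrightarrow> 0 < b N"
    and P: "renewal P l K"
    and \<phi>: "continuous_on UNIV \<phi>"
    and W: "\<And>e. 0 < e \<Longrightarrow> \<forall>\<^sub>F N in sequentially. \<forall>n\<le>N.
      \<bar>c N * ((1 - kernel_mass K) / kernel_tail K' (real (N - n)) + kernel_mass K) - \<phi> (real n / N)\<bar> \<le> e"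
    and f: "continuous_map matheron euclideanreal f" and B: "\<And>F. F \<in> closed_unit_sets \<Longrightarrow> \<bar>f F\<bar> \<le> B"
  shows "(\<lambda>N. c N * exp (- critical_beta K) * (\<integral>\<omega>. f (rescaled_set N (renewal_set l \<omega>))
      * exp ((critical_beta K + \<epsilon> / b N) * real (card (renewals_upto N (renewal_set l \<omega>)))) \<partial>P))
    \<longlonglongrightarrow> (\<integral>\<omega>. f (unit_set \<omega>) * \<phi> (last_point \<sigma> \<omega>) * exp (\<epsilon> * loc_time \<omega>) \<partial>M)"
proof -
  have pos: "0 < K' n" if "1 \<le> n" for n
    unfolding K'_eq[OF that] using that slow_pos[OF slow, of "real n"] by simp
  interpret W: kernel_walk K' by unfold_locales (rule pos, assumption, rule sumK', rule mass)
  interpret R: renewal W.Q W.gap K' by (rule W.renewal_gap)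
  let ?s = "kernel_mass K" and ?T = "kernel_tail K'"
  let ?R = "\<lambda>N \<omega>. renewals_upto N (renewal_set W.gap \<omega>)" and ?rs = "\<lambda>N \<omega>. rescaled_set N (renewal_set W.gap \<omega>)"
  have tail: "?T (real m) = 1 - (\<Sum>j<m. K' (Suc j))" for m
    using kernel_tail_nat[OF W.pos sumK', of m] mass by simp
  have tail_pos: "0 < ?T x" for x by (rule kernel_tail_pos[OF W.pos sumK'])
  have array: "stable_array \<alpha> (\<lambda>n. W.step (real (Suc n))) (\<lambda>n. b (Suc n))"
  proof (rule stable_array.intro)
    show "filterlim (\<lambda>n. b (Suc n)) at_top sequentially" using b_top by (simp only: filterlim_sequentially_Suc)
    show "0 < b (Suc n)" for n by (rule b_pos) simp
    fix r :: real assume r: "0 < r"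
    have "(\<lambda>N. b N * (\<Sum>n. K' (Suc n) * (1 - exp (- r * (real (Suc n) / N))))) \<longlonglongrightarrow> r powr \<alpha>"
      by (rule kernel_laplace_limit[OF slow \<alpha> K'_eq sumK' b r])
    then have "(\<lambda>N. b (Suc N) * (\<Sum>n. K' (Suc n) * (1 - exp (- r * (real (Suc n) / real (Suc N)))))) \<longlonglongrightarrow> r powr \<alpha>"
      by (rule LIMSEQ_Suc)
    then show "(\<lambda>n. b (Suc n) * (1 - iid_steps.lap (W.step (real (Suc n))) r)) \<longlonglongrightarrow> r powr \<alpha>"
      by (simp only: W.one_minus_lap_step[OF of_nat_0_less_iff[THEN iffD2, OF zero_less_Suc] r])
  qed (rule \<alpha> W.iid_step)+
  have lim: "(\<lambda>N. \<integral>\<omega>. h (?rs N \<omega>) * exp (\<epsilon> * (card (?R N \<omega>) / b N)) \<partial>W.Q) \<longlonglongrightarrow> (\<integral>\<omega>. h (unit_set \<omega>) * exp (\<epsilon> * loc_time \<omega>) \<partial>M)"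
    if h: "continuous_map matheron euclideanreal h" and C: "\<And>F. F \<in> closed_unit_sets \<Longrightarrow> \<bar>h F\<bar> \<le> C" for h C
  proof -
    have "(\<lambda>n. iid_steps.weighted_trace (W.step (real (Suc n))) (b (Suc n)) \<epsilon> h) \<longlonglongrightarrow> (\<integral>\<omega>. h (unit_set \<omega>) * exp (\<epsilon> * loc_time \<omega>) \<partial>M)"
      by (rule weighted_trace_limit[OF array h C])
    then show ?thesis by (simp only: W.weighted_trace_step[OF zero_less_Suc h] filterlim_sequentially_Suc[of "\<lambda>N. \<integral>\<omega>. h (?rs N \<omega>) * exp (\<epsilon> * (card (?R N \<omega>) / b N)) \<partial>W.Q"])
  qed
  have "compact (\<phi> ` {- 1..1})" by (rule compact_continuous_image[OF continuous_on_subset[OF \<phi>]]) auto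
  from compact_imp_bounded[OF this] obtain C where "\<forall>x\<in>{- 1..1}. \<bar>\<phi> x\<bar> \<le> C" by (auto simp: bounded_iff)
  then have C: "\<bar>\<phi> x\<bar> \<le> C" if "x \<in> {- 1..1}" for x using that by blast
  let ?h = "\<lambda>F. f F * \<phi> (max_point F)"
  have hc: "continuous_map matheron euclideanreal ?h"
  proof (rule continuous_map_real_mult[OF f])
    have "continuous_map euclideanreal euclideanreal \<phi>" using \<phi> by simp
    from continuous_map_compose[OF continuous_max_point this]
    show "continuous_map matheron euclideanreal (\<lambda>F. \<phi> (max_point F))" by (simp only: comp_def)
  qed
  have hB: "\<bar>?h F\<bar> \<le> B * C" if F: "F \<in> closed_unit_sets" for F
    unfolding abs_mult using B[OF F] C[OF max_point_bounds[OF F]] by (intro mult_mono) auto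
  let ?X = "\<lambda>N. \<integral>\<omega>. f (?rs N \<omega>) * exp (\<epsilon> / b N * card (?R N \<omega>)) * (c N * ((1 - ?s) / ?T (real (N - Max (?R N \<omega>))) + ?s)) \<partial>W.Q"
  let ?Y = "\<lambda>N. \<integral>\<omega>. ?h (?rs N \<omega>) * exp (\<epsilon> * (card (?R N \<omega>) / b N)) \<partial>W.Q"
  let ?E = "\<lambda>N. \<integral>\<omega>. 1 * exp (\<epsilon> * (card (?R N \<omega>) / b N)) \<partial>W.Q"
  have X: "c N * exp (- critical_beta K) * (\<integral>\<omega>. f (rescaled_set N (renewal_set l \<omega>))
      * exp ((critical_beta K + \<epsilon> / b N) * real (card (renewals_upto N (renewal_set l \<omega>)))) \<partial>P) = ?X N" for N
  proof -
    have "exp (- critical_beta K) * exp (critical_beta K) = 1" by (simp add: exp_minus)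
    then have cancel: "c N * exp (- critical_beta K) * (exp (critical_beta K) * z) = c N * z" for z
      by (simp only: mult.assoc[symmetric]) simp
    have ck: "(\<integral>\<omega>. f ((\<lambda>n. real n / real N) ` renewals_upto N (renewal_set l \<omega>)) * exp ((critical_beta K + \<epsilon> / b N) * real (card (renewals_upto N (renewal_set l \<omega>)))) \<partial>P)
      = exp (critical_beta K) * (\<integral>\<omega>. f ((\<lambda>n. real n / real N) ` ?R N \<omega>) * exp (\<epsilon> / b N * card (?R N \<omega>)) * ((1 - ?s) / ?T (real (N - Max (?R N \<omega>))) + ?s) \<partial>W.Q)"
      by (rule change_of_kernel[OF P W.renewal_gap s K' tail tail_pos])
    show ?thesis
      unfolding rescaled_set_def ck cancel
      by (subst integral_mult_right_zero[symmetric]) (intro Bochner_Integration.integral_cong refl, simp only: mult_ac)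
  qed
  have "0 \<le> B" using B[of "{}"] by (simp add: closed_unit_sets_def)
  have XY: "\<forall>\<^sub>F N in sequentially. \<bar>?X N - ?Y N\<bar> \<le> B * e * ?E N" if e: "0 < e" for e
    using W[OF e] eventually_gt_at_top[of 0]
  proof eventually_elim
    case (elim N)
    let ?w = "\<lambda>R. c N * ((1 - ?s) / ?T (real (N - Max R)) + ?s)"
    let ?g = "\<lambda>R. f ((\<lambda>n. real n / real N) ` R)" and ?x = "\<lambda>R. exp (\<epsilon> * (card R / b N))"
    have intX: "integrable W.Q (\<lambda>\<omega>. f (?rs N \<omega>) * exp (\<epsilon> / b N * card (?R N \<omega>)) * ?w (?R N \<omega>))"
      unfolding rescaled_set_def by (rule R.integrable_renewals[where G = "\<lambda>R. ?g R * exp (\<epsilon> / b N * card R) * ?w R"])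
    have intY: "integrable W.Q (\<lambda>\<omega>. ?h (?rs N \<omega>) * ?x (?R N \<omega>))"
      unfolding rescaled_set_def by (rule R.integrable_renewals[where G = "\<lambda>R. ?g R * \<phi> (max_point ((\<lambda>n. real n / real N) ` R)) * ?x R"])
    have intE: "integrable W.Q (\<lambda>\<omega>. B * e * (1 * ?x (?R N \<omega>)))"
      by (rule R.integrable_renewals[where G = "\<lambda>R. B * e * (1 * ?x R)"])
    have pt: "\<bar>f (?rs N \<omega>) * exp (\<epsilon> / b N * card (?R N \<omega>)) * ?w (?R N \<omega>) - ?h (?rs N \<omega>) * ?x (?R N \<omega>)\<bar> \<le> B * e * (1 * ?x (?R N \<omega>))" for \<omega>
    proof -
      let ?r = "?R N \<omega>"
      have r: "finite ?r" "?r \<noteq> {}" "?r \<subseteq> {..N}"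
        using R.zero_in_renewals[of N \<omega>] by (auto simp: renewals_upto_def intro: finite_subset[of _ "{..N}"])
      have Mx: "Max ?r \<in> ?r" "\<And>n. n \<in> ?r \<Longrightarrow> n \<le> Max ?r" using Max_in[OF r(1,2)] Max_ge[OF r(1)] by auto
      have "Sup (?rs N \<omega>) = real (Max ?r) / N"
        unfolding rescaled_set_def by (rule cSup_eq_maximum) (use Mx in \<open>auto intro!: divide_right_mono\<close>)
      then have mp: "max_point (?rs N \<omega>) = real (Max ?r) / N"
        using r(2) by (simp add: max_point_def rescaled_set_def)
      have rsc: "?rs N \<omega> \<in> closed_unit_sets"
        unfolding closed_unit_sets_def rescaled_set_def using r elim(2) by (auto intro!: finite_imp_closed simp: divide_le_eq)
      have "Max ?r \<le> N" using Mx(1) r(3) by auto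
      then have we: "\<bar>?w ?r - \<phi> (max_point (?rs N \<omega>))\<bar> \<le> e" using elim(1) unfolding mp by blast
      have "\<epsilon> / b N * card ?r = \<epsilon> * (card ?r / b N)" by simp
      then have "f (?rs N \<omega>) * exp (\<epsilon> / b N * card ?r) * ?w ?r - ?h (?rs N \<omega>) * ?x ?r = f (?rs N \<omega>) * (?w ?r - \<phi> (max_point (?rs N \<omega>))) * ?x ?r"
        by (simp only: left_diff_distrib right_diff_distrib mult_ac)
      also have "\<bar>\<dots>\<bar> \<le> B * e * (1 * ?x ?r)"
        unfolding abs_mult using B[OF rsc] we \<open>0 \<le> B\<close> e by (intro mult_mono) auto
      finally show ?thesis .
    qed
    have "\<bar>?X N - ?Y N\<bar> = \<bar>\<integral>\<omega>. f (?rs N \<omega>) * exp (\<epsilon> / b N * card (?R N \<omega>)) * ?w (?R N \<omega>) - ?h (?rs N \<omega>) * ?x (?R N \<omega>) \<partial>W.Q\<bar>"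
      by (simp only: Bochner_Integration.integral_diff[OF intX intY])
    also have "\<dots> \<le> (\<integral>\<omega>. \<bar>f (?rs N \<omega>) * exp (\<epsilon> / b N * card (?R N \<omega>)) * ?w (?R N \<omega>) - ?h (?rs N \<omega>) * ?x (?R N \<omega>)\<bar> \<partial>W.Q)"
      by (rule integral_abs_bound)
    also have "\<dots> \<le> (\<integral>\<omega>. B * e * (1 * ?x (?R N \<omega>)) \<partial>W.Q)"
      by (intro integral_mono integrable_abs Bochner_Integration.integrable_diff intX intY intE pt)
    also have "\<dots> = B * e * ?E N" by (rule integral_mult_right_zero)
    finally show ?case .
  qed
  let ?Einf = "\<integral>\<omega>. 1 * exp (\<epsilon> * loc_time \<omega>) \<partial>M"
  have const: "continuous_map matheron euclideanreal (\<lambda>_. 1)" by simp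
  have E: "?E \<longlonglongrightarrow> ?Einf" by (rule lim[OF const order_refl])
  have diff: "(\<lambda>N. ?X N - ?Y N) \<longlonglongrightarrow> 0"
  proof (rule LIMSEQ_I)
    fix r :: real assume r: "0 < r"
    define D where "D = (B + 1) * (\<bar>?Einf\<bar> + 1)"
    have D: "0 < D" unfolding D_def using \<open>0 \<le> B\<close> by (intro mult_pos_pos add_nonneg_pos abs_ge_zero zero_less_one)
    define e where "e = r / (2 * D)"
    have e: "0 < e" using r D by (simp add: e_def)
    have "\<forall>\<^sub>F N in sequentially. ?E N < \<bar>?Einf\<bar> + 1" by (rule order_tendstoD(2)[OF E]) simp
    then have "\<forall>\<^sub>F N in sequentially. norm (?X N - ?Y N - 0) < r"
      using XY[OF e]
    proof eventually_elim
      case (elim N)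
      have "0 \<le> ?E N" by (intro integral_nonneg_AE) simp
      have "B * e * ?E N \<le> (B + 1) * e * (\<bar>?Einf\<bar> + 1)"
      proof (rule mult_mono)
        show "B * e \<le> (B + 1) * e" using e by simp
        show "?E N \<le> \<bar>?Einf\<bar> + 1" by (rule less_imp_le[OF elim(1)])
        show "0 \<le> (B + 1) * e" using e \<open>0 \<le> B\<close> by simp
      qed fact
      also have "\<dots> = D * e" by (simp only: D_def mult_ac)
      also have "\<dots> < r" using D r by (simp add: e_def)
      finally show ?case unfolding diff_0_right real_norm_def by (rule le_less_trans[OF elim(2)])
    qed
    then show "\<exists>no. \<forall>n\<ge>no. norm (?X n - ?Y n - 0) < r" by (simp only: eventually_sequentially)
  qed
  have "?Y \<longlonglongrightarrow> (\<integral>\<omega>. ?h (unit_set \<omega>) * exp (\<epsilon> * loc_time \<omega>) \<partial>M)" by (rule lim[OF hc hB])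
  from tendsto_add[OF diff this]
  have "?X \<longlonglongrightarrow> (\<integral>\<omega>. ?h (unit_set \<omega>) * exp (\<epsilon> * loc_time \<omega>) \<partial>M)" by simp
  also have "(\<integral>\<omega>. ?h (unit_set \<omega>) * exp (\<epsilon> * loc_time \<omega>) \<partial>M) = (\<integral>\<omega>. f (unit_set \<omega>) * \<phi> (last_point \<sigma> \<omega>) * exp (\<epsilon> * loc_time \<omega>) \<partial>M)"
    by (intro Bochner_Integration.integral_cong refl) (simp only: last_point_eq)
  finally show ?thesis unfolding X .
qed

end

context subordinator
begin

lemma weak_limit_of_functionals:
  fixes \<beta> k :: "nat \<Rightarrow> real" and \<phi> :: "real \<Rightarrow> real"
  assumes P: "renewal P l K" and k: "\<And>N. 0 < k N"
    and \<phi>: "continuous_on UNIV \<phi>" "\<And>x. 0 \<le> \<phi> x" "AE \<omega> in M. 0 < \<phi> (last_point \<sigma> \<omega>)"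
    and lim: "\<And>f B. continuous_map matheron euclideanreal f \<Longrightarrow> (\<And>F. F \<in> closed_unit_sets \<Longrightarrow> \<bar>f F\<bar> \<le> B) \<Longrightarrow>
      (\<lambda>N. k N * (\<integral>\<omega>. f (rescaled_set N (renewal_set l \<omega>)) * exp (\<beta> N * real (card (renewals_upto N (renewal_set l \<omega>)))) \<partial>P))
      \<longlonglongrightarrow> (\<integral>\<omega>. f (unit_set \<omega>) * \<phi> (last_point \<sigma> \<omega>) * exp (\<epsilon> * loc_time \<omega>) \<partial>M)"
    and D: "\<And>\<omega>. \<omega> \<in> space M \<Longrightarrow> D \<omega> = exp (\<epsilon> * loc_time \<omega>) * \<phi> (last_point \<sigma> \<omega>) / (\<integral>\<omega>. exp (\<epsilon> * loc_time \<omega>) * \<phi> (last_point \<sigma> \<omega>) \<partial>M)"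
  shows "\<exists>\<B>. law_with_density M unit_set D \<B> \<and>
    weakly_converges matheron (\<lambda>N. rescaled_pinning_law P (renewal_set l) N (\<beta> N)) \<B>"
proof -
  interpret R: renewal P l K by (rule P)
  let ?H = "\<lambda>\<omega>. exp (\<epsilon> * loc_time \<omega>) * \<phi> (last_point \<sigma> \<omega>)"
  define D0 where "D0 = (\<integral>\<omega>. ?H \<omega> \<partial>M)"
  have "compact (\<phi> ` {- 1..1})" by (rule compact_continuous_image[OF continuous_on_subset[OF \<phi>(1)]]) auto
  from compact_imp_bounded[OF this] obtain C where "\<forall>x\<in>{- 1..1}. \<bar>\<phi> x\<bar> \<le> C" by (auto simp: bounded_iff)
  then have C: "\<bar>\<phi> (last_point \<sigma> \<omega>)\<bar> \<le> C" if "\<omega> \<in> space M" for \<omega>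
    using that max_point_bounds[OF unit_set_closed, of \<omega>] by (simp only: last_point_eq)
  have lp: "(\<lambda>\<omega>. \<phi> (last_point \<sigma> \<omega>)) \<in> borel_measurable M"
  proof (subst measurable_cong)
    show "\<phi> (last_point \<sigma> \<omega>) = \<phi> (max_point (unit_set \<omega>))" if "\<omega> \<in> space M" for \<omega>
      using that by (simp only: last_point_eq)
    show "(\<lambda>\<omega>. \<phi> (max_point (unit_set \<omega>))) \<in> borel_measurable M"
      by (rule measurable_compose[OF measurable_compose[OF measurable_unit_set measurable_continuous_map[OF continuous_max_point]] borel_measurable_continuous_onI[OF \<phi>(1)]])
  qed
  have intH: "integrable M ?H"
  proof (rule Bochner_Integration.integrable_bound)
    show "integrable M (\<lambda>\<omega>. C * exp (\<epsilon> * loc_time \<omega>))" by (intro integrable_mult_right integrable_exp_local_time)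
    show "?H \<in> borel_measurable M" using lp by measurable
    show "AE \<omega> in M. norm (?H \<omega>) \<le> norm (C * exp (\<epsilon> * loc_time \<omega>))"
    proof (rule AE_I2)
      fix \<omega> assume "\<omega> \<in> space M"
      then have "\<bar>\<phi> (last_point \<sigma> \<omega>)\<bar> \<le> \<bar>C\<bar>" using C[of \<omega>] by linarith
      then have "exp (\<epsilon> * loc_time \<omega>) * \<bar>\<phi> (last_point \<sigma> \<omega>)\<bar> \<le> exp (\<epsilon> * loc_time \<omega>) * \<bar>C\<bar>" by (intro mult_left_mono) simp_all
      then show "norm (?H \<omega>) \<le> norm (C * exp (\<epsilon> * loc_time \<omega>))" by (simp add: abs_mult mult.commute)
    qed
  qed
  have D0: "0 < D0"
  proof -
    have "\<not> (AE \<omega> in M. ?H \<omega> = 0)"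
    proof
      assume "AE \<omega> in M. ?H \<omega> = 0"
      with \<phi>(3) have "AE \<omega> in M. False" by eventually_elim simp
      then show False by simp
    qed
    then have "D0 \<noteq> 0" unfolding D0_def using integral_nonneg_eq_0_iff_AE[OF intH] \<phi>(2) by simp
    moreover have "0 \<le> D0" unfolding D0_def using \<phi>(2) by (intro integral_nonneg_AE) simp
    ultimately show ?thesis by linarith
  qed
  have D_eq: "D \<omega> = ?H \<omega> / D0" if "\<omega> \<in> space M" for \<omega> using D[OF that] by (simp only: D0_def)
  have D_meas: "D \<in> borel_measurable M"
    by (subst measurable_cong[OF D_eq]) (use borel_measurable_integrable[OF intH] in measurable)
  have D_nonneg: "0 \<le> D \<omega>" if "\<omega> \<in> space M" for \<omega> using D_eq[OF that] \<phi>(2) D0 by simp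
  have D_int: "integrable M D"
    by (subst Bochner_Integration.integrable_cong[OF refl D_eq]) (assumption, rule integrable_divide[OF intH])
  have D_one: "(\<integral>\<omega>. D \<omega> \<partial>M) = 1"
  proof -
    have "(\<integral>\<omega>. D \<omega> \<partial>M) = (\<integral>\<omega>. ?H \<omega> / D0 \<partial>M)" by (rule Bochner_Integration.integral_cong[OF refl D_eq])
    also have "\<dots> = (\<integral>\<omega>. ?H \<omega> \<partial>M) / D0" by (rule integral_divide_zero)
    also have "\<dots> = 1" using D0 by (simp only: D0_def[symmetric]) simp
    finally show ?thesis .
  qed
  define \<B> where "\<B> = distr (density M (\<lambda>\<omega>. ennreal (D \<omega>))) (borel_of_topology matheron) unit_set"
  have unit_meas: "unit_set \<in> measurable (density M (\<lambda>\<omega>. ennreal (D \<omega>))) (borel_of_topology matheron)"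
    using measurable_unit_set by simp
  have "prob_space (density M (\<lambda>\<omega>. ennreal (D \<omega>)))"
  proof (rule prob_spaceI)
    have "emeasure (density M (\<lambda>\<omega>. ennreal (D \<omega>))) (space M) = (\<integral>\<^sup>+\<omega>. ennreal (D \<omega>) \<partial>M)"
      using D_meas by (subst emeasure_density) (auto intro!: nn_integral_cong)
    also have "\<dots> = ennreal (\<integral>\<omega>. D \<omega> \<partial>M)" by (intro nn_integral_eq_integral D_int AE_I2 D_nonneg)
    finally show "emeasure (density M (\<lambda>\<omega>. ennreal (D \<omega>))) (space (density M (\<lambda>\<omega>. ennreal (D \<omega>)))) = 1"
      by (simp add: D_one)
  qed
  then have prob_B: "prob_space \<B>" unfolding \<B>_def by (rule prob_space.prob_space_distr[OF _ unit_meas])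
  have sets_B: "sets \<B> = sets (borel_of_topology matheron)" by (simp add: \<B>_def)
  have int_B: "(\<integral>F. f F \<partial>\<B>) = (\<integral>\<omega>. f (unit_set \<omega>) * D \<omega> \<partial>M)" if f: "f \<in> borel_measurable (borel_of_topology matheron)" for f :: "real set \<Rightarrow> real"
  proof -
    have "(\<integral>F. f F \<partial>\<B>) = (\<integral>\<omega>. f (unit_set \<omega>) \<partial>density M (\<lambda>\<omega>. ennreal (D \<omega>)))"
      unfolding \<B>_def by (rule integral_distr[OF unit_meas f])
    also have "\<dots> = (\<integral>\<omega>. D \<omega> *\<^sub>R f (unit_set \<omega>) \<partial>M)"
      by (rule integral_density[OF measurable_compose[OF measurable_unit_set f] D_meas]) (rule AE_I2, rule D_nonneg)
    finally show ?thesis by (simp only: real_scaleR_def mult.commute)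
  qed
  have conv: "(\<lambda>N. \<integral>F. f F \<partial>rescaled_pinning_law P (renewal_set l) N (\<beta> N)) \<longlonglongrightarrow> (\<integral>F. f F \<partial>\<B>)"
    if f: "continuous_map matheron euclideanreal f" and bd: "bounded (f ` topspace matheron)" for f
  proof -
    obtain B where "\<forall>F\<in>closed_unit_sets. \<bar>f F\<bar> \<le> B" using bd by (auto simp: bounded_iff topspace_matheron)
    then have B: "\<bar>f F\<bar> \<le> B" if "F \<in> closed_unit_sets" for F using that by blast
    have fm: "f \<in> borel_measurable (borel_of_topology matheron)" by (rule measurable_continuous_map[OF f])
    let ?J = "\<lambda>f N. \<integral>\<omega>. f (rescaled_set N (renewal_set l \<omega>)) * exp (\<beta> N * real (card (renewals_upto N (renewal_set l \<omega>)))) \<partial>P"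
    have num: "(\<lambda>N. k N * ?J f N) \<longlonglongrightarrow> (\<integral>\<omega>. f (unit_set \<omega>) * \<phi> (last_point \<sigma> \<omega>) * exp (\<epsilon> * loc_time \<omega>) \<partial>M)"
      by (rule lim[OF f B])
    have "(\<lambda>N. k N * ?J (\<lambda>_. 1) N) \<longlonglongrightarrow> (\<integral>\<omega>. 1 * \<phi> (last_point \<sigma> \<omega>) * exp (\<epsilon> * loc_time \<omega>) \<partial>M)"
      using lim[of "\<lambda>_. 1" 1] by simp
    also have "(\<integral>\<omega>. 1 * \<phi> (last_point \<sigma> \<omega>) * exp (\<epsilon> * loc_time \<omega>) \<partial>M) = D0"
      by (simp only: D0_def mult_1 mult.commute)
    finally have den: "(\<lambda>N. k N * ?J (\<lambda>_. 1) N) \<longlonglongrightarrow> D0" .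
    have "(\<lambda>N. (k N * ?J f N) / (k N * ?J (\<lambda>_. 1) N)) \<longlonglongrightarrow> (\<integral>\<omega>. f (unit_set \<omega>) * \<phi> (last_point \<sigma> \<omega>) * exp (\<epsilon> * loc_time \<omega>) \<partial>M) / D0"
      by (rule tendsto_divide[OF num den]) (use D0 in simp)
    moreover have "(k N * ?J f N) / (k N * ?J (\<lambda>_. 1) N) = (\<integral>F. f F \<partial>rescaled_pinning_law P (renewal_set l) N (\<beta> N))" for N
      unfolding R.integral_rescaled_pinning_law[OF fm] partition_function_def using k[of N] by simp
    moreover have "(\<integral>\<omega>. f (unit_set \<omega>) * \<phi> (last_point \<sigma> \<omega>) * exp (\<epsilon> * loc_time \<omega>) \<partial>M) / D0 = (\<integral>F. f F \<partial>\<B>)"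
    proof -
      have "(\<integral>F. f F \<partial>\<B>) = (\<integral>\<omega>. f (unit_set \<omega>) * \<phi> (last_point \<sigma> \<omega>) * exp (\<epsilon> * loc_time \<omega>) / D0 \<partial>M)"
        unfolding int_B[OF fm] by (intro Bochner_Integration.integral_cong refl) (simp only: D_eq times_divide_eq_right mult_ac)
      then show ?thesis by simp
    qed
    ultimately show ?thesis by (simp only:)
  qed
  have "law_with_density M unit_set D \<B>"
    unfolding law_with_density_def
    using measurable_unit_set D_meas D_nonneg D_int D_one prob_B sets_B int_B by blast
  moreover have "weakly_converges matheron (\<lambda>N. rescaled_pinning_law P (renewal_set l) N (\<beta> N)) \<B>"
    unfolding weakly_converges_def
    using R.prob_space_rescaled_pinning_law R.sets_rescaled_pinning_law prob_B sets_B conv by blast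
  ultimately show ?thesis by blast
qed

end

lemma slowly_varying_divide:
  assumes "slowly_varying L" "0 < s"
  shows "slowly_varying (\<lambda>x. L x / s)"
  using assms by (simp add: slowly_varying_def borel_measurable_divide)

theorem theorem3p1:
  fixes \<alpha> \<epsilon> :: real
    and L :: "real \<Rightarrow> real"
    and K :: "nat \<Rightarrow> real"
    and P :: "'a measure" and l :: "nat \<Rightarrow> 'a \<Rightarrow> enat"
    and M :: "'b measure" and \<sigma> :: "real \<Rightarrow> 'b \<Rightarrow> real"
  assumes "0 < \<alpha>" and "\<alpha> < 1"
    and "slowly_varying L"
    and "\<And>n. n \<ge> 1 \<Longrightarrow> K n = L (real n) / real n powr (1 + \<alpha>)"
    and "summable (\<lambda>n. K (Suc n))" and "kernel_mass K \<le> 1"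
    and "renewal_increments P l K"
    and "stable_subordinator \<alpha> M \<sigma>"
  shows "(1 - kernel_mass K = 0 \<longrightarrow>
           (\<forall>a b. normalizing_seq \<alpha> L a \<and> asymptotic_inverse a b \<longrightarrow>
             (\<exists>\<B>. law_with_density M (\<lambda>\<omega>. regenerative_set \<sigma> \<omega> \<inter> {0..1})
                     (\<lambda>\<omega>. exp (\<epsilon> * local_time \<sigma> 1 \<omega>) /
                           (\<integral>\<omega>'. exp (\<epsilon> * local_time \<sigma> 1 \<omega>') \<partial>M)) \<B> \<and>
                  weakly_converges matheron
                    (\<lambda>N. rescaled_pinning_law P (renewal_set l) N (critical_beta K + \<epsilon> / b N)) \<B>)))
       \<and> (1 - kernel_mass K > 0 \<longrightarrow>
           (\<forall>a b. normalizing_seq \<alpha> (\<lambda>x. L x / kernel_mass K) a \<and> asymptotic_inverse a b \<longrightarrow>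
             (\<exists>\<B>. law_with_density M (\<lambda>\<omega>. regenerative_set \<sigma> \<omega> \<inter> {0..1})
                     (\<lambda>\<omega>. exp (\<epsilon> * local_time \<sigma> 1 \<omega>) * (1 - last_point \<sigma> \<omega>) powr \<alpha> /
                           (\<integral>\<omega>'. exp (\<epsilon> * local_time \<sigma> 1 \<omega>') * (1 - last_point \<sigma> \<omega>') powr \<alpha> \<partial>M)) \<B> \<and>
                  weakly_converges matheron
                    (\<lambda>N. rescaled_pinning_law P (renewal_set l) N (critical_beta K + \<epsilon> / b N)) \<B>)))"
proof -
  interpret subordinator \<alpha> M \<sigma> by unfold_locales (rule assms)+
  have P: "renewal P l K" by (rule renewal.intro) (rule assms)
  let ?s = "kernel_mass K"
  define K' where "K' n = K n / ?s" for n
  define L' where "L' x = L x / ?s" for x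
  have K_pos: "0 < K n" if "1 \<le> n" for n
    using assms(4)[OF that] slow_pos[OF assms(3), of "real n"] that by simp
  have s: "0 < ?s" unfolding kernel_mass_def by (rule suminf_pos[OF assms(5)]) (rule K_pos, simp)
  have slow': "slowly_varying L'" unfolding L'_def by (rule slowly_varying_divide[OF assms(3) s])
  have K'_eq: "\<And>n. 1 \<le> n \<Longrightarrow> K' n = L' (real n) / real n powr (1 + \<alpha>)"
    unfolding K'_def L'_def using assms(4) by simp
  have K': "\<And>n. 1 \<le> n \<Longrightarrow> K' n = K n / ?s" by (simp add: K'_def)
  have sumK': "summable (\<lambda>n. K' (Suc n))" unfolding K'_def by (rule summable_divide[OF assms(5)])
  have mass: "kernel_mass K' = 1"
  proof -
    have "kernel_mass K' = (\<Sum>n. K (Suc n)) / ?s" unfolding kernel_mass_def K'_def by (rule suminf_divide[OF assms(5)])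
    then show ?thesis using s by (simp add: kernel_mass_def)
  qed
  have K'_pos: "\<And>n. 1 \<le> n \<Longrightarrow> 0 < K' n" using K_pos s by (simp add: K'_def)
  have T_pos: "0 < kernel_tail K' x" for x by (rule kernel_tail_pos[OF K'_pos sumK'])
  have T_lim: "(\<lambda>m. kernel_tail K' (real m)) \<longlonglongrightarrow> 0" by (rule kernel_tail_tendsto_0[OF K'_pos sumK'])
  have main: "\<exists>\<B>. law_with_density M unit_set D \<B> \<and>
      weakly_converges matheron (\<lambda>N. rescaled_pinning_law P (renewal_set l) N (critical_beta K + \<epsilon> / b N)) \<B>"
    if a: "normalizing_seq \<alpha> L' a" and b: "asymptotic_inverse a b" and c: "\<And>N. 0 < c N"
      and \<phi>: "continuous_on UNIV \<phi>" "\<And>x. 0 \<le> \<phi> x" "AE \<omega> in M. 0 < \<phi> (last_point \<sigma> \<omega>)"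
      and W: "(\<lambda>N. b N * (Gamma (1 - \<alpha>) * L' (real N) / (\<alpha> * real N powr \<alpha>))) \<longlonglongrightarrow> 1 \<Longrightarrow> \<forall>e>0. \<forall>\<^sub>F N in sequentially. \<forall>n\<le>N.
        \<bar>c N * ((1 - ?s) / kernel_tail K' (real (N - n)) + ?s) - \<phi> (real n / N)\<bar> \<le> e"
      and D: "\<And>\<omega>. \<omega> \<in> space M \<Longrightarrow> D \<omega> = exp (\<epsilon> * loc_time \<omega>) * \<phi> (last_point \<sigma> \<omega>) / (\<integral>\<omega>. exp (\<epsilon> * loc_time \<omega>) * \<phi> (last_point \<sigma> \<omega>) \<partial>M)"
    for a b c :: "nat \<Rightarrow> real" and \<phi> D
  proof (rule weak_limit_of_functionals[OF P _ \<phi> _ D, where k = "\<lambda>N. c N * exp (- critical_beta K)"])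
    note scale = asymptotic_inverse_scale[OF slow' assms(1,2) a b]
    have W': "\<And>e. 0 < e \<Longrightarrow> \<forall>\<^sub>F N in sequentially. \<forall>n\<le>N.
        \<bar>c N * ((1 - ?s) / kernel_tail K' (real (N - n)) + ?s) - \<phi> (real n / N)\<bar> \<le> e"
      using W[OF scale(1)] by blast
    have b_pos: "\<And>N. 1 \<le> N \<Longrightarrow> 0 < b N" using b by (simp add: asymptotic_inverse_def)
    show "(\<lambda>N. c N * exp (- critical_beta K) * (\<integral>\<omega>. f (rescaled_set N (renewal_set l \<omega>)) * exp ((critical_beta K + \<epsilon> / b N) * real (card (renewals_upto N (renewal_set l \<omega>)))) \<partial>P))
      \<longlonglongrightarrow> (\<integral>\<omega>. f (unit_set \<omega>) * \<phi> (last_point \<sigma> \<omega>) * exp (\<epsilon> * loc_time \<omega>) \<partial>M)"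
      if "continuous_map matheron euclideanreal f" "\<And>F. F \<in> closed_unit_sets \<Longrightarrow> \<bar>f F\<bar> \<le> B" for f B
      by (rule pinned_functional_limit[OF slow' K'_eq K' sumK' mass s scale b_pos P \<phi>(1) W' that])
    show "0 < c N * exp (- critical_beta K)" for N using c by simp
  qed
  have "\<exists>\<B>. law_with_density M (\<lambda>\<omega>. regenerative_set \<sigma> \<omega> \<inter> {0..1})
         (\<lambda>\<omega>. exp (\<epsilon> * local_time \<sigma> 1 \<omega>) / (\<integral>\<omega>'. exp (\<epsilon> * local_time \<sigma> 1 \<omega>') \<partial>M)) \<B> \<and>
       weakly_converges matheron (\<lambda>N. rescaled_pinning_law P (renewal_set l) N (critical_beta K + \<epsilon> / b N)) \<B>"
    if s1: "1 - ?s = 0" and a: "normalizing_seq \<alpha> L a" and b: "asymptotic_inverse a b" for a b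
    unfolding unit_set_def[symmetric]
  proof (rule main[of a b "\<lambda>_. 1" "\<lambda>_. 1", OF _ b])
    show "normalizing_seq \<alpha> L' a" using a s1 by (simp add: L'_def[abs_def])
    show "\<forall>e>0. \<forall>\<^sub>F N in sequentially. \<forall>n\<le>N. \<bar>1 * ((1 - ?s) / kernel_tail K' (real (N - n)) + ?s) - 1\<bar> \<le> e"
      using s1 by simp
  qed simp_all
  moreover have "\<exists>\<B>. law_with_density M (\<lambda>\<omega>. regenerative_set \<sigma> \<omega> \<inter> {0..1})
         (\<lambda>\<omega>. exp (\<epsilon> * local_time \<sigma> 1 \<omega>) * (1 - last_point \<sigma> \<omega>) powr \<alpha> /
           (\<integral>\<omega>'. exp (\<epsilon> * local_time \<sigma> 1 \<omega>') * (1 - last_point \<sigma> \<omega>') powr \<alpha> \<partial>M)) \<B> \<and>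
       weakly_converges matheron (\<lambda>N. rescaled_pinning_law P (renewal_set l) N (critical_beta K + \<epsilon> / b N)) \<B>"
    if s1: "1 - ?s > 0" and a: "normalizing_seq \<alpha> (\<lambda>x. L x / ?s) a" and b: "asymptotic_inverse a b" for a b
    unfolding unit_set_def[symmetric]
  proof (rule main[of a b "\<lambda>N. kernel_tail K' (real N) / (1 - ?s)" "\<lambda>x. max 0 (1 - x) powr \<alpha>", OF _ b])
    let ?\<phi> = "\<lambda>x. max 0 (1 - x) powr \<alpha> :: real"
    show "normalizing_seq \<alpha> L' a" using a by (simp add: L'_def[abs_def])
    show "0 < kernel_tail K' (real N) / (1 - ?s)" for N using T_pos s1 by simp
    show "continuous_on UNIV ?\<phi>" using assms(1) by (intro continuous_on_powr' continuous_intros) auto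
    show "0 \<le> ?\<phi> x" for x by simp
    show "AE \<omega> in M. 0 < ?\<phi> (last_point \<sigma> \<omega>)"
      using AE_one_notin AE_space
    proof eventually_elim
      case (elim \<omega>)
      then have "last_point \<sigma> \<omega> < 1" by (intro last_point_bounds(2))
      then show ?case by simp
    qed
    have \<phi>_eq: "(1 - last_point \<sigma> \<omega>) powr \<alpha> = ?\<phi> (last_point \<sigma> \<omega>)" if "\<omega> \<in> space M" for \<omega>
      using last_point_bounds(1)[OF that] by (simp add: max_def)
    have "(\<integral>\<omega>'. exp (\<epsilon> * local_time \<sigma> 1 \<omega>') * (1 - last_point \<sigma> \<omega>') powr \<alpha> \<partial>M) = (\<integral>\<omega>'. exp (\<epsilon> * local_time \<sigma> 1 \<omega>') * ?\<phi> (last_point \<sigma> \<omega>') \<partial>M)"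
      by (intro Bochner_Integration.integral_cong refl) (simp only: \<phi>_eq)
    then show "exp (\<epsilon> * local_time \<sigma> 1 \<omega>) * (1 - last_point \<sigma> \<omega>) powr \<alpha> / (\<integral>\<omega>'. exp (\<epsilon> * local_time \<sigma> 1 \<omega>') * (1 - last_point \<sigma> \<omega>') powr \<alpha> \<partial>M)
      = exp (\<epsilon> * local_time \<sigma> 1 \<omega>) * ?\<phi> (last_point \<sigma> \<omega>) / (\<integral>\<omega>'. exp (\<epsilon> * local_time \<sigma> 1 \<omega>') * ?\<phi> (last_point \<sigma> \<omega>') \<partial>M)"
      if "\<omega> \<in> space M" for \<omega>
      by (simp only: \<phi>_eq[OF that])
    assume scale: "(\<lambda>N. b N * (Gamma (1 - \<alpha>) * L' (real N) / (\<alpha> * real N powr \<alpha>))) \<longlonglongrightarrow> 1"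
    show "\<forall>e>0. \<forall>\<^sub>F N in sequentially. \<forall>n\<le>N.
        \<bar>kernel_tail K' (real N) / (1 - ?s) * ((1 - ?s) / kernel_tail K' (real (N - n)) + ?s) - ?\<phi> (real n / real N)\<bar> \<le> e"
    proof (intro allI impI)
      fix e :: real assume e: "0 < e"
      have "(\<lambda>N. ?s / (1 - ?s) * kernel_tail K' (real N)) \<longlonglongrightarrow> ?s / (1 - ?s) * 0" by (intro tendsto_mult tendsto_const T_lim)
      then have "\<forall>\<^sub>F N in sequentially. ?s / (1 - ?s) * kernel_tail K' (real N) < e / 2" by (rule order_tendstoD(2)) (use e in simp)
      moreover have "\<forall>\<^sub>F N in sequentially. \<forall>y\<in>{0..1}. dist (kernel_tail K' (real N) / kernel_tail K' (y * real N)) (y powr \<alpha>) < e / 2"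
        by (rule uniform_limitD[OF kernel_tail_ratio_limit[OF slow' assms(1,2) K'_eq sumK' scale]]) (use e in simp_all)
      ultimately show "\<forall>\<^sub>F N in sequentially. \<forall>n\<le>N.
        \<bar>kernel_tail K' (real N) / (1 - ?s) * ((1 - ?s) / kernel_tail K' (real (N - n)) + ?s) - ?\<phi> (real n / real N)\<bar> \<le> e"
        using eventually_gt_at_top[of 0]
      proof eventually_elim
        case (elim N)
        show ?case
        proof (intro allI impI)
          fix n assume n: "n \<le> N"
          let ?y = "1 - real n / real N" and ?T = "kernel_tail K'"
          have y: "?y \<in> {0..1}" using n elim(3) by (simp add: divide_le_eq)
          have yN: "?y * real N = real (N - n)" using n elim(3) by (simp add: left_diff_distrib of_nat_diff)
          have "?T (real N) / (1 - ?s) * ((1 - ?s) / ?T (real (N - n)) + ?s) = ?T (real N) / ?T (real (N - n)) + ?s / (1 - ?s) * ?T (real N)"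
            using s1 by (simp add: distrib_left)
          moreover have "?\<phi> (real n / real N) = ?y powr \<alpha>" using y by (simp add: max_def)
          moreover have "\<bar>?T (real N) / ?T (real (N - n)) - ?y powr \<alpha>\<bar> < e / 2"
            using elim(2)[rule_format, OF y] unfolding yN dist_real_def .
          moreover have "0 \<le> ?s / (1 - ?s) * ?T (real N)" using s s1 T_pos[of "real N"] by simp
          ultimately show "\<bar>?T (real N) / (1 - ?s) * ((1 - ?s) / ?T (real (N - n)) + ?s) - ?\<phi> (real n / real N)\<bar> \<le> e"
            using elim(1) by linarith
        qed
      qed
    qed
  qed
  ultimately show ?thesis by blast
qed

end
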